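(* Let $(M,J,\langle\cdot,\cdot\rangle)$ be a Hermite surface, let $\beta\neq-1$ be real, and let $\Sigma$ be a $\beta$-symplectic critical surface in $M$ with Kähler angle $\alpha$. Suppose that along $\Sigma$ the complex structure $J$ satisfies, for all tangent vector fields $X,Y$ of $\Sigma$ and all normal vector fields $\xi$ of $\Sigma$ in $M$, $$\langle(\bar\nabla_{\xi}J)X,Y\rangle+\langle(\bar\nabla_{X}J)Y,\xi\rangle+\langle(\bar\nabla_{Y}J)\xi,X\rangle=0$$ and $$\bigl((\bar\nabla_XJ)Y+(\bar\nabla_YJ)X\bigr)^\bot=0 .$$ Then at every point $p\in\Sigma$ with $\sin\alpha\neq0$ and $\cos^2\alpha+\beta\sin^2\alpha\neq0$, with respect to an adapted frame $\{e_1,e_2,e_3,e_4\}$ at $p$, $\cos\alpha$ satisfies $$\begin{aligned}\triangle\cos\alpha={}&\frac{2\beta\sin^{2}\alpha}{\cos\alpha(\cos^{2}\alpha+\beta\sin^{2}\alpha)}|\nabla\alpha|^{2}-2\cos\alpha|\nabla\alpha|^{2}-\frac{\sin\alpha\cos^{2}\alpha}{\cos^{2}\alpha+\beta\sin^{2}\alpha}(K_{1213}-K_{1224})+\Theta\\&-\frac{\beta\sin\alpha}{\cos^{2}\alpha+\beta\sin^{2}\alpha}\bigl(\partial_{1}\cos\alpha\,J_{14,2}+3\,\partial_{2}\cos\alpha\,J_{13,2}\bigr),\end{aligned}$$ where $$\begin{aligned}\Theta={}&\frac{2\cos\alpha}{\sin^{2}\alpha}\Bigl(1+\frac{\cos^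{2}\alpha}{\cos^{2}\alpha+\beta\sin^{2}\alpha}\Bigr)\bigl(\partial_{1}\cos\alpha\,J_{12,1}+\partial_{2}\cos\alpha\,J_{12,2}\bigr)\\&+\frac{\cos^{2}\alpha}{\cos^{2}\alpha+\beta\sin^{2}\alpha}J_{12,kk}-\frac{2\cos^{3}\alpha}{\sin^{2}\alpha(\cos^{2}\alpha+\beta\sin^{2}\alpha)}\bigl((J_{12,1})^{2}+(J_{12,2})^{2}\bigr).\end{aligned}$$
   Context: A Hermite surface $(M,J,\langle\cdot,\cdot\rangle)$ is a complex surface (real dimension 4) with complex structure $J$ and Riemannian metric $\langle\cdot,\cdot\rangle$ such that $\langle JU,JV\rangle=\langle U,V\rangle$; its Kähler form is $\omega(U,V)=\langle JU,V\rangle$ (not assumed closed). $\bar\nabla$ is the Levi-Civita connection of $M$. For a closed oriented surface $\Sigma$ smoothly immersed in $M$, with induced metric $g$, area element $d\mu_\Sigma$ and Levi-Civita connection $\nabla$, the Kähler angle $\alpha$ is defined by $\omega|_\Sigma=\cos\alpha\,d\mu_\Sigma$; $\Sigma$ is symplectic if $\cos\alpha>0$. $(\cdot)^\top$ and $(\cdot)^\bot$ are the tangential and normal projections along $\Sigma$, $B(X,Y)=(\bar\nabla_XY)^\bot$, and $\mathbf{H}$ is the trace of $B$. A $\beta$-symplectic critical surface is a closed symplectic surface $\Sigma$ which is a critical point of $L_\beta=\int_\Sigma\cos^{-\beta}\alpha\,d\mu$ in the class of symplectic surfaces; under the first displayed condition on $J$ its Euler–Lagrange equation is $\cos^3\alpha\,\mathbf{H}-\beta(J(J\nabla\cos\alpha)^\top)^\bot=0$.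 Adapted frame at $p$: an orthonormal basis $e_1,e_2,e_3,e_4$ of $T_pM$ with $e_1,e_2$ an oriented basis of $T_p\Sigma$, $e_3,e_4$ normal to $\Sigma$, and $Je_1=\cos\alpha\,e_2+\sin\alpha\,e_3$, $Je_2=-\cos\alpha\,e_1-\sin\alpha\,e_4$, $Je_3=-\sin\alpha\,e_1+\cos\alpha\,e_4$, $Je_4=\sin\alpha\,e_2-\cos\alpha\,e_3$. Notation at $p$: $\partial_i\cos\alpha=e_i(\cos\alpha)$; $J_{AB,k}=\langle(\bar\nabla_{e_k}J)e_A,e_B\rangle$ for $A,B\in\{1,2,3,4\}$, $k\in\{1,2\}$; $J_{12,kk}=\sum_{k=1}^2\langle(\bar\nabla_{e_k}(\bar\nabla_{e_k}J))e_1,e_2\rangle$, the iterated derivative along $\Sigma$, where $e_1,e_2$ are extended near $p$ to tangent fields of $\Sigma$ with $\nabla_{e_i}e_j(p)=0$. $K$ is the Riemannian curvature tensor of $M$ with $K_{ABCD}=\langle R(e_A,e_B)e_D,e_C\rangle$, $R(U,V)W=\bar\nabla_U\bar\nabla_VW-\bar\nabla_V\bar\nabla_UW-\bar\nabla_{[U,V]}W$, so that $K_{1212}$ is the sectional curvature of the plane spanned by $e_1,e_2$. $\triangle$ and $\nabla$ acting on functions are the Laplacian (trace of the Hessian) and gradient on $(\Sigma,g)$, and $|\nabla\alpha|^2=|\nabla\cos\alpha|^2/\sin^2\alpha$ where $\sin\alpha\neq0$. *)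

theory Defs
  imports "HOL-Analysis.Analysis"
begin

section \<open>Smooth maps and manifolds\<close>

abbreviation D :: "('a::real_normed_vector \<Rightarrow> 'b::real_normed_vector) \<Rightarrow> 'a \<Rightarrow> 'a \<Rightarrow> 'b" where
  "D f x v \<equiv> frechet_derivative f (at x) v"

text \<open>Only meant for open sets in finite dimension, where continuity of all iterated directional
  derivatives is the usual notion of being \<open>k\<close> times continuously differentiable.\<close>

fun Ck_on :: "nat \<Rightarrow> 'a::euclidean_space set \<Rightarrow> ('a \<Rightarrow> 'b::real_normed_vector) \<Rightarrow> bool" where
  "Ck_on 0 S f \<longleftrightarrow> continuous_on S f"
| "Ck_on (Suc k) S f \<longleftrightarrow> (\<forall>x\<in>S. f differentiable (at x)) \<and> (\<forall>v. Ck_on k S (\<lambda>x. D f x v))"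

definition smooth_on :: "'a::euclidean_space set \<Rightarrow> ('a \<Rightarrow> 'b::real_normed_vector) \<Rightarrow> bool" where
  "smooth_on S f \<longleftrightarrow> (\<forall>k. Ck_on k S f)"

text \<open>A manifold is a topological type together with an atlas; a chart is a pair of its domain
  and its coordinate map, the latter being relevant on the domain only.\<close>

type_synonym ('m, 'e) chart = "'m set \<times> ('m \<Rightarrow> 'e)"

abbreviation cdom :: "('m, 'e) chart \<Rightarrow> 'm set" where "cdom c \<equiv> fst c"
abbreviation cmap :: "('m, 'e) chart \<Rightarrow> 'm \<Rightarrow> 'e" where "cmap c \<equiv> snd c"

definition cinv :: "('m, 'e) chart \<Rightarrow> 'e \<Rightarrow> 'm" where
  "cinv c = inv_into (cdom c) (cmap c)"

definition is_chart :: "('m::topological_space, 'e::euclidean_space) chart \<Rightarrow> bool" where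
  "is_chart c \<longleftrightarrow> open (cdom c) \<and> open (cmap c ` cdom c)
     \<and> homeomorphism (cdom c) (cmap c ` cdom c) (cmap c) (cinv c)"

definition transition :: "('m, 'e) chart \<Rightarrow> ('m, 'e) chart \<Rightarrow> 'e \<Rightarrow> 'e" where
  "transition c d = cmap d \<circ> cinv c"

definition overlap :: "('m, 'e) chart \<Rightarrow> ('m, 'e) chart \<Rightarrow> 'e set" where
  "overlap c d = cmap c ` (cdom c \<inter> cdom d)"

definition smooth_atlas :: "('m::topological_space, 'e::euclidean_space) chart set \<Rightarrow> bool" where
  "smooth_atlas A \<longleftrightarrow> (\<forall>c\<in>A. is_chart c) \<and> (\<Union>c\<in>A. cdom c) = UNIV
     \<and> (\<forall>c\<in>A. \<forall>d\<in>A. smooth_on (overlap c d) (transition c d))"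


section \<open>Hermite surfaces\<close>

text \<open>In every holomorphic chart the complex structure is the constant field \<open>J\<close>.\<close>

definition J :: "complex^2 \<Rightarrow> complex^2" where
  "J v = \<i> *s v"

definition complex_surface :: "('m::topological_space, complex^2) chart set \<Rightarrow> bool" where
  "complex_surface A \<longleftrightarrow> smooth_atlas A
     \<and> (\<forall>c\<in>A. \<forall>d\<in>A. \<forall>x\<in>overlap c d. \<forall>v. D (transition c d) x (J v) = J (D (transition c d) x v))"

definition inner_product :: "('a::real_vector \<Rightarrow> 'a \<Rightarrow> real) \<Rightarrow> bool" where
  "inner_product b \<longleftrightarrow> bilinear b \<and> (\<forall>u v. b u v = b v u) \<and> (\<forall>u. u \<noteq> 0 \<longrightarrow> b u u > 0)"

type_synonym 'a metric = "'a \<Rightarrow> 'a \<Rightarrow> 'a \<Rightarrow> real"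

text \<open>\<open>h c x u v\<close> is the scalar product, at the point with coordinate \<open>x\<close> in the chart \<open>c\<close>, of the
  tangent vectors with components \<open>u\<close> and \<open>v\<close>.\<close>

definition riemannian_metric ::
    "('m::topological_space, 'e::euclidean_space) chart set \<Rightarrow> (('m, 'e) chart \<Rightarrow> 'e metric) \<Rightarrow> bool" where
  "riemannian_metric A h \<longleftrightarrow>
     (\<forall>c\<in>A. (\<forall>x\<in>cmap c ` cdom c. inner_product (h c x))
        \<and> (\<forall>u v. smooth_on (cmap c ` cdom c) (\<lambda>x. h c x u v)))
     \<and> (\<forall>c\<in>A. \<forall>d\<in>A. \<forall>x\<in>overlap c d. \<forall>u v.
          h d (transition c d x) (D (transition c d) x u) (D (transition c d) x v) = h c x u v)"

definition hermite_surface ::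
    "('m::topological_space, complex^2) chart set \<Rightarrow> (('m, complex^2) chart \<Rightarrow> (complex^2) metric) \<Rightarrow> bool" where
  "hermite_surface A h \<longleftrightarrow> complex_surface A \<and> riemannian_metric A h
     \<and> (\<forall>c\<in>A. \<forall>x\<in>cmap c ` cdom c. \<forall>u v. h c x (J u) (J v) = h c x u v)"


section \<open>Riemannian geometry in a chart\<close>

definition sharp :: "('a::real_vector \<Rightarrow> 'a \<Rightarrow> real) \<Rightarrow> ('a \<Rightarrow> real) \<Rightarrow> 'a" where
  "sharp b \<phi> = (THE z. \<forall>w. b z w = \<phi> w)"

text \<open>\<open>\<Gamma>(u, v)\<close>, by the Koszul formula for constant vector fields.\<close>

definition christoffel :: "('a::euclidean_space) metric \<Rightarrow> 'a \<Rightarrow> 'a \<Rightarrow> 'a \<Rightarrow> 'a" where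
  "christoffel G x u v = sharp (G x)
     (\<lambda>w. (D (\<lambda>y. G y v w) x u + D (\<lambda>y. G y u w) x v - D (\<lambda>y. G y u v) x w) / 2)"

text \<open>The Levi-Civita connection \<open>(\<nabla>\<^sub>U W)(x)\<close>.\<close>

definition cov :: "('a::euclidean_space) metric \<Rightarrow> ('a \<Rightarrow> 'a) \<Rightarrow> ('a \<Rightarrow> 'a) \<Rightarrow> 'a \<Rightarrow> 'a" where
  "cov G U W x = D W x (U x) + christoffel G x (U x) (W x)"

definition lie_bracket :: "('a::euclidean_space \<Rightarrow> 'a) \<Rightarrow> ('a \<Rightarrow> 'a) \<Rightarrow> 'a \<Rightarrow> 'a" where
  "lie_bracket U V x = D V x (U x) - D U x (V x)"

text \<open>\<open>R(u, v)w\<close> at \<open>x\<close>; being tensorial, it may be computed with the constant extensions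
  of \<open>u\<close>, \<open>v\<close> and \<open>w\<close>.\<close>

definition curvature :: "('a::euclidean_space) metric \<Rightarrow> 'a \<Rightarrow> 'a \<Rightarrow> 'a \<Rightarrow> 'a \<Rightarrow> 'a" where
  "curvature G x u v w =
     (let U = (\<lambda>_. u); V = (\<lambda>_. v); W = (\<lambda>_. w)
      in cov G U (cov G V W) x - cov G V (cov G U W) x - cov G (lie_bracket U V) W x)"

text \<open>\<open>(\<nabla>\<^sub>a T)v = \<nabla>\<^sub>a(Tv) - T(\<nabla>\<^sub>a v)\<close> for a field \<open>T\<close> of endomorphisms along the map \<open>f\<close>, where \<open>a\<close> is
  tangent to the source of \<open>f\<close>.\<close>

definition cov_end_along ::
    "('e::euclidean_space) metric \<Rightarrow> ('a::euclidean_space \<Rightarrow> 'e) \<Rightarrow> ('a \<Rightarrow> 'e \<Rightarrow> 'e) \<Rightarrow> 'a \<Rightarrow> 'a \<Rightarrow> 'e \<Rightarrow> 'e" where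
  "cov_end_along G f T x a v =
     D (\<lambda>y. T y v) x a + christoffel G (f x) (D f x a) (T x v) - T x (christoffel G (f x) (D f x a) v)"

definition nabla_J :: "(complex^2) metric \<Rightarrow> complex^2 \<Rightarrow> complex^2 \<Rightarrow> complex^2 \<Rightarrow> complex^2" where
  "nabla_J G x u v = cov_end_along G (\<lambda>y. y) (\<lambda>_. J) x u v"

definition grad :: "('a::euclidean_space) metric \<Rightarrow> ('a \<Rightarrow> real) \<Rightarrow> 'a \<Rightarrow> 'a" where
  "grad G u x = sharp (G x) (D u x)"

definition hessian :: "('a::euclidean_space) metric \<Rightarrow> ('a \<Rightarrow> real) \<Rightarrow> 'a \<Rightarrow> 'a \<Rightarrow> 'a \<Rightarrow> real" where
  "hessian G u x a b = D (\<lambda>y. D u y b) x a - D u x (christoffel G x a b)"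

text \<open>\<open>sharp (G x) (\<lambda>w. w \<bullet> i)\<close> is \<open>\<Sum>\<^sub>j g\<^sup>i\<^sup>j \<partial>\<^sub>j\<close>, so this is \<open>g\<^sup>i\<^sup>j (Hess u)\<^sub>i\<^sub>j\<close>.\<close>

definition laplacian :: "('a::euclidean_space) metric \<Rightarrow> ('a \<Rightarrow> real) \<Rightarrow> 'a \<Rightarrow> real" where
  "laplacian G u x = (\<Sum>i\<in>Basis. hessian G u x (sharp (G x) (\<lambda>w. w \<bullet> i)) i)"


section \<open>Immersed surfaces\<close>

definition closed_oriented_surface :: "('s::topological_space, real^2) chart set \<Rightarrow> bool" where
  "closed_oriented_surface B \<longleftrightarrow> compact (UNIV :: 's set) \<and> smooth_atlas B
     \<and> (\<forall>c\<in>B. \<forall>d\<in>B. \<forall>x\<in>overlap c d. det (matrix (D (transition c d) x)) > 0)"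

definition local_rep :: "('s, 'a) chart \<Rightarrow> ('m, 'e) chart \<Rightarrow> ('s \<Rightarrow> 'm) \<Rightarrow> 'a \<Rightarrow> 'e" where
  "local_rep c d F = cmap d \<circ> F \<circ> cinv c"

definition local_dom :: "('s, 'a) chart \<Rightarrow> ('m, 'e) chart \<Rightarrow> ('s \<Rightarrow> 'm) \<Rightarrow> 'a set" where
  "local_dom c d F = cmap c ` (cdom c \<inter> F -` cdom d)"

definition immersion ::
    "('s::topological_space, 'a::euclidean_space) chart set \<Rightarrow> ('m::topological_space, 'e::euclidean_space) chart set
       \<Rightarrow> ('s \<Rightarrow> 'm) \<Rightarrow> bool" where
  "immersion B A F \<longleftrightarrow> continuous_on UNIV F
     \<and> (\<forall>c\<in>B. \<forall>d\<in>A. smooth_on (local_dom c d F) (local_rep c d F)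
          \<and> (\<forall>x\<in>local_dom c d F. inj (D (local_rep c d F) x)))"

definition induced_metric :: "'e metric \<Rightarrow> ('a::euclidean_space \<Rightarrow> 'e::euclidean_space) \<Rightarrow> 'a metric" where
  "induced_metric G f x a b = G (f x) (D f x a) (D f x b)"

definition tangential ::
    "'e metric \<Rightarrow> ('a::euclidean_space \<Rightarrow> 'e::euclidean_space) \<Rightarrow> 'a \<Rightarrow> 'e \<Rightarrow> 'e" where
  "tangential G f x v = D f x (sharp (induced_metric G f x) (\<lambda>b. G (f x) v (D f x b)))"

definition normal_part ::
    "'e metric \<Rightarrow> ('a::euclidean_space \<Rightarrow> 'e::euclidean_space) \<Rightarrow> 'a \<Rightarrow> 'e \<Rightarrow> 'e" where
  "normal_part G f x v = v - tangential G f x v"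

definition is_normal ::
    "'e metric \<Rightarrow> ('a::euclidean_space \<Rightarrow> 'e::euclidean_space) \<Rightarrow> 'a \<Rightarrow> 'e \<Rightarrow> bool" where
  "is_normal G f x \<xi> \<longleftrightarrow> (\<forall>a. G (f x) \<xi> (D f x a) = 0)"

text \<open>The coefficient of \<open>dx\<^sup>1 \<and> dx\<^sup>2\<close> in the area element of a metric on a domain of the plane.\<close>

definition area_density :: "(real^2) metric \<Rightarrow> real^2 \<Rightarrow> real" where
  "area_density g x = sqrt (g x (axis 1 1) (axis 1 1) * g x (axis 2 1) (axis 2 1) - (g x (axis 1 1) (axis 2 1))\<^sup>2)"

definition kahler_form :: "(complex^2) metric \<Rightarrow> complex^2 \<Rightarrow> complex^2 \<Rightarrow> complex^2 \<Rightarrow> real" where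
  "kahler_form G x u v = G x (J u) v"

definition area_measure ::
    "('m, complex^2) chart set \<Rightarrow> (('m, complex^2) chart \<Rightarrow> (complex^2) metric)
       \<Rightarrow> ('s::topological_space, real^2) chart set \<Rightarrow> ('s \<Rightarrow> 'm) \<Rightarrow> 's measure" where
  "area_measure A h B F = (THE \<mu>. sets \<mu> = sets borel
     \<and> (\<forall>c\<in>B. \<forall>d\<in>A. \<forall>X\<in>sets borel. X \<subseteq> cdom c \<inter> F -` cdom d \<longrightarrow>
          emeasure \<mu> X
            = (\<integral>\<^sup>+ x \<in> cmap c ` X. ennreal (area_density (induced_metric (h d) (local_rep c d F)) x) \<partial>lborel)))"

text \<open>The Kaehler angle, normalised to \<open>[0, \<pi>]\<close>: in every oriented chart,
  \<open>\<omega>(\<partial>\<^sub>1 f, \<partial>\<^sub>2 f) = cos \<alpha> \<cdot> \<surd>det g\<close>.\<close>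

definition kahler_angle ::
    "('m, complex^2) chart set \<Rightarrow> (('m, complex^2) chart \<Rightarrow> (complex^2) metric)
       \<Rightarrow> ('s, real^2) chart set \<Rightarrow> ('s \<Rightarrow> 'm) \<Rightarrow> 's \<Rightarrow> real" where
  "kahler_angle A h B F p = (THE \<alpha>. 0 \<le> \<alpha> \<and> \<alpha> \<le> pi
     \<and> (\<forall>c\<in>B. \<forall>d\<in>A. p \<in> cdom c \<and> F p \<in> cdom d \<longrightarrow>
          (let f = local_rep c d F; x = cmap c p
           in kahler_form (h d) (f x) (D f x (axis 1 1)) (D f x (axis 2 1))
                = cos \<alpha> * area_density (induced_metric (h d) f) x)))"

definition symplectic_surface ::
    "('m::topological_space, complex^2) chart set \<Rightarrow> (('m, complex^2) chart \<Rightarrow> (complex^2) metric)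
       \<Rightarrow> ('s::topological_space, real^2) chart set \<Rightarrow> ('s \<Rightarrow> 'm) \<Rightarrow> bool" where
  "symplectic_surface A h B F \<longleftrightarrow> immersion B A F \<and> (\<forall>p. cos (kahler_angle A h B F p) > 0)"

definition L_functional ::
    "real \<Rightarrow> ('m, complex^2) chart set \<Rightarrow> (('m, complex^2) chart \<Rightarrow> (complex^2) metric)
       \<Rightarrow> ('s::topological_space, real^2) chart set \<Rightarrow> ('s \<Rightarrow> 'm) \<Rightarrow> real" where
  "L_functional \<beta> A h B F = (\<integral>p. cos (kahler_angle A h B F p) powr (-\<beta>) \<partial>(area_measure A h B F))"

definition symplectic_variation ::
    "('m::topological_space, complex^2) chart set \<Rightarrow> (('m, complex^2) chart \<Rightarrow> (complex^2) metric)
       \<Rightarrow> ('s::topological_space, real^2) chart set \<Rightarrow> ('s \<Rightarrow> 'm) \<Rightarrow> real \<Rightarrow> (real \<Rightarrow> 's \<Rightarrow> 'm) \<Rightarrow> bool" where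
  "symplectic_variation A h B F \<epsilon> \<Phi> \<longleftrightarrow> \<epsilon> > 0 \<and> \<Phi> 0 = F
     \<and> (\<forall>t\<in>{-\<epsilon><..<\<epsilon>}. symplectic_surface A h B (\<Phi> t))
     \<and> continuous_on ({-\<epsilon><..<\<epsilon>} \<times> UNIV) (\<lambda>(t, p). \<Phi> t p)
     \<and> (\<forall>c\<in>B. \<forall>d\<in>A. smooth_on {(t, x). t \<in> {-\<epsilon><..<\<epsilon>} \<and> x \<in> local_dom c d (\<Phi> t)}
          (\<lambda>(t, x). local_rep c d (\<Phi> t) x))"

definition symplectic_critical_surface ::
    "real \<Rightarrow> ('m::topological_space, complex^2) chart set \<Rightarrow> (('m, complex^2) chart \<Rightarrow> (complex^2) metric)
       \<Rightarrow> ('s::topological_space, real^2) chart set \<Rightarrow> ('s \<Rightarrow> 'm) \<Rightarrow> bool" where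
  "symplectic_critical_surface \<beta> A h B F \<longleftrightarrow>
     closed_oriented_surface B \<and> symplectic_surface A h B F
     \<and> (\<forall>\<epsilon> \<Phi>. symplectic_variation A h B F \<epsilon> \<Phi> \<longrightarrow>
          ((\<lambda>t. L_functional \<beta> A h B (\<Phi> t)) has_real_derivative 0) (at 0))"


section \<open>Conditions on the complex structure along the surface\<close>

text \<open>Both conditions are tensorial in the fields \<open>X\<close>, \<open>Y\<close>, \<open>\<xi>\<close>, hence pointwise conditions on
  vectors \<open>X = D f x a\<close>, \<open>Y = D f x b\<close> and on normal vectors \<open>\<xi>\<close>.\<close>

definition J_condition_cyclic ::
    "('m, complex^2) chart set \<Rightarrow> (('m, complex^2) chart \<Rightarrow> (complex^2) metric)
       \<Rightarrow> ('s, real^2) chart set \<Rightarrow> ('s \<Rightarrow> 'm) \<Rightarrow> bool" where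
  "J_condition_cyclic A h B F \<longleftrightarrow>
     (\<forall>c\<in>B. \<forall>d\<in>A. \<forall>x\<in>local_dom c d F.
        let f = local_rep c d F; G = h d; ip = G (f x); nJ = nabla_J G (f x)
        in \<forall>a b \<xi>. is_normal G f x \<xi> \<longrightarrow>
             (let X = D f x a; Y = D f x b
              in ip (nJ \<xi> X) Y + ip (nJ X Y) \<xi> + ip (nJ Y \<xi>) X = 0))"

definition J_condition_symmetric ::
    "('m, complex^2) chart set \<Rightarrow> (('m, complex^2) chart \<Rightarrow> (complex^2) metric)
       \<Rightarrow> ('s, real^2) chart set \<Rightarrow> ('s \<Rightarrow> 'm) \<Rightarrow> bool" where
  "J_condition_symmetric A h B F \<longleftrightarrow>
     (\<forall>c\<in>B. \<forall>d\<in>A. \<forall>x\<in>local_dom c d F.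
        let f = local_rep c d F; G = h d; nJ = nabla_J G (f x)
        in \<forall>a b. let X = D f x a; Y = D f x b
                 in normal_part G f x (nJ X Y + nJ Y X) = 0)"


section \<open>Adapted frames\<close>

text \<open>\<open>a 1\<close>, \<open>a 2\<close> are the components of \<open>e 1\<close>, \<open>e 2\<close> in a positively oriented chart of the surface.\<close>

definition adapted_frame ::
    "(complex^2) metric \<Rightarrow> (real^2 \<Rightarrow> complex^2) \<Rightarrow> real \<Rightarrow> real^2 \<Rightarrow> (nat \<Rightarrow> real^2) \<Rightarrow> (nat \<Rightarrow> complex^2) \<Rightarrow> bool" where
  "adapted_frame G f \<alpha> x a e \<longleftrightarrow>
     (\<forall>k\<in>{1,2}. e k = D f x (a k))
     \<and> a 1 $ 1 * a 2 $ 2 - a 1 $ 2 * a 2 $ 1 > 0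
     \<and> (\<forall>i\<in>{1..4}. \<forall>j\<in>{1..4}. G (f x) (e i) (e j) = (if i = j then 1 else 0))
     \<and> J (e 1) = cos \<alpha> *\<^sub>R e 2 + sin \<alpha> *\<^sub>R e 3
     \<and> J (e 2) = - cos \<alpha> *\<^sub>R e 1 - sin \<alpha> *\<^sub>R e 4
     \<and> J (e 3) = - sin \<alpha> *\<^sub>R e 1 + cos \<alpha> *\<^sub>R e 4
     \<and> J (e 4) = sin \<alpha> *\<^sub>R e 2 - cos \<alpha> *\<^sub>R e 3"

text \<open>Local tangent fields \<open>E 1\<close>, \<open>E 2\<close>, in coordinates of the surface, that extend \<open>a 1\<close>, \<open>a 2\<close> and
  satisfy \<open>\<nabla>\<^sub>E\<^sub>i E\<^sub>j = 0\<close> at the point \<open>x\<close>.\<close>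

definition normal_extension ::
    "(real^2) metric \<Rightarrow> (real^2) set \<Rightarrow> real^2 \<Rightarrow> (nat \<Rightarrow> real^2) \<Rightarrow> (nat \<Rightarrow> real^2 \<Rightarrow> real^2) \<Rightarrow> bool" where
  "normal_extension g N x a E \<longleftrightarrow> open N \<and> x \<in> N
     \<and> (\<forall>j\<in>{1,2}. smooth_on N (E j) \<and> E j x = a j)
     \<and> (\<forall>i\<in>{1,2}. \<forall>j\<in>{1,2}. cov g (E i) (E j) x = 0)"

end

theory Submission
  imports Defs
begin

text \<open>
  Write \<open>u = cos \<alpha>\<close>, \<open>\<omega>(X, Y) = \<langle>J X, Y\<rangle>\<close> and \<open>f\<close> for the immersion in coordinates. Three facts carry the proof.

  \<^item> \<^emph>\<open>Along the surface, \<open>J\<close> is parallel in tangent directions.\<close> For a tangent vector \<open>X\<close>, the endomorphism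
  \<open>P = \<nabla>\<^sub>X J\<close> is skew and anticommutes with \<open>J\<close>, so \<open>P X\<close> is orthogonal to \<open>X\<close> and to \<open>J X\<close>. The second
  condition, with \<open>Y = X\<close>, makes \<open>P X\<close> tangent; then \<open>\<omega>(X, P X) = 0\<close> and \<open>\<omega>\<close> does not vanish on the tangent
  plane, so \<open>P X\<close> is a multiple of \<open>X\<close>, hence zero. A skew \<open>J\<close>-antilinear endomorphism of a four-dimensional
  space that kills a vector is zero (\<open>nabla_J_tangent_eq_0\<close>). Hence all the \<open>J\<^sub>A\<^sub>B\<^sub>,\<^sub>k\<close> and \<open>J\<^sub>1\<^sub>2\<^sub>,\<^sub>k\<^sub>k\<close> are zero. The
  first condition then reduces to \<open>\<langle>(\<nabla>\<^sub>V J) X, Y\<rangle> = 0\<close> for tangent \<open>X\<close>, \<open>Y\<close> and arbitrary \<open>V\<close>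
  (\<open>nabla_J_area_component_eq_0\<close>).

  \<^item> \<^emph>\<open>The Euler-Lagrange equation.\<close> It is enough to vary the surface by \<open>f + t \<phi> V\<close> inside one coordinate patch,
  with a bump function \<open>\<phi>\<close> and a constant vector \<open>V\<close>: the functional splits into the contribution of the patch
  and a constant (\<open>L_functional_split\<close>, \<open>critical_local_variation\<close>). The two facts about \<open>\<nabla>J\<close> turn the
  first variation of the integrand into a divergence minus \<open>(\<beta> + 1) \<phi>\<close> times an expression without derivatives
  of \<open>\<phi>\<close> (\<open>lagrangian_dot_divergence\<close>), which therefore vanishes as \<open>\<beta> \<noteq> -1\<close> (\<open>euler_lagrange\<close>). Its normal part
  prescribes the mean curvature: \<open>\<langle>H, V\<rangle> = - \<beta> u\<^sup>-\<^sup>2 (E\<^sub>1(u) \<langle>J V, E\<^sub>2\<rangle> + E\<^sub>2(u) \<langle>J E\<^sub>1, V\<rangle>)\<close> in an oriented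
  orthonormal frame \<open>E\<^sub>1\<close>, \<open>E\<^sub>2\<close> of the surface.

  \<^item> \<^emph>\<open>The Laplacian as a curl.\<close> The equation of the mean curvature can be rewritten as
  \<open>(1 + \<beta> tan\<^sup>2 \<alpha>) \<star>du = \<theta>\<close> for the one-form
  \<open>\<theta>(k) = \<langle>\<nabla>\<^sub>k E\<^sub>1, J E\<^sub>1\<rangle> + \<langle>\<nabla>\<^sub>k E\<^sub>2, J E\<^sub>2\<rangle> - 2 u \<langle>\<nabla>\<^sub>k E\<^sub>1, E\<^sub>2\<rangle>\<close> (\<open>euler_lagrange_frame\<close>). The exterior derivative of
  the left-hand side gives the Laplacian of \<open>u\<close> and a multiple of the squared gradient. As \<open>J\<close> is parallel, that
  of \<open>\<theta>\<close> consists of curvature and of terms quadratic in the second fundamental form (\<open>curl_theta\<close>); by the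
  Euler-Lagrange equation the latter add up to a multiple of the squared gradient as well. Solving for the
  Laplacian gives the formula (\<open>laplacian_formula\<close>).
\<close>

section \<open>Smooth maps\<close>

lemma D_eqI: "(f has_derivative f') (at x) \<Longrightarrow> D f x v = f' v"
  by (metis frechet_derivative_at)

lemma Ck_on_imp_continuous_on: "Ck_on k S f \<Longrightarrow> continuous_on S f"
  by (cases k) (auto intro!: continuous_at_imp_continuous_on differentiable_imp_continuous_within)

lemma Ck_on_Suc_imp: "Ck_on (Suc k) S f \<Longrightarrow> Ck_on k S f"
proof (induction k arbitrary: f)
  case 0
  then show ?case using Ck_on_imp_continuous_on[OF 0] by simp
next
  case (Suc k)
  then show ?case by simp
qed

lemma Ck_on_subset: "Ck_on k S f \<Longrightarrow> T \<subseteq> S \<Longrightarrow> Ck_on k T f"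
  by (induction k arbitrary: f) (auto intro: continuous_on_subset)

lemma D_cong_open:
  assumes "open S" "x \<in> S" "\<And>y. y \<in> S \<Longrightarrow> f y = g y"
  shows "D f x = D g x"
proof (cases "f differentiable (at x)")
  case True
  then have "(f has_derivative D f x) (at x)" by (simp add: frechet_derivative_works)
  then have "(g has_derivative D f x) (at x)"
    using assms by (metis has_derivative_transform_within_open)
  then show ?thesis using frechet_derivative_at by blast
next
  case False
  have "(f has_derivative L) (at x) \<longleftrightarrow> (g has_derivative L) (at x)" for L
    using assms by (metis has_derivative_transform_within_open)
  then show ?thesis unfolding frechet_derivative_def by auto
qed

lemma differentiable_cong_open:
  assumes "open S" "x \<in> S" "\<And>y. y \<in> S \<Longrightarrow> f y = g y" "f differentiable (at x)"
  shows "g differentiable (at x)"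
  using assms by (metis differentiable_def has_derivative_transform_within_open)

lemma Ck_on_cong:
  assumes "open S" "\<And>y. y \<in> S \<Longrightarrow> f y = g y" "Ck_on k S f"
  shows "Ck_on k S g"
  using assms(2,3)
proof (induction k arbitrary: f g)
  case 0
  then show ?case by (simp cong: continuous_on_cong_simp add: continuous_on_cong[of S S f g])
next
  case (Suc k)
  have "D f y = D g y" if "y \<in> S" for y
    using D_cong_open[OF assms(1) that, of f g] Suc.prems(1) by blast
  then have "Ck_on k S (\<lambda>x. D g x v)" for v
    using Suc.IH[of "\<lambda>x. D f x v" "\<lambda>x. D g x v"] Suc.prems(2) by simp
  moreover have "g differentiable (at y)" if "y \<in> S" for y
    using differentiable_cong_open[OF assms(1) that, of f g] Suc.prems that by simp
  ultimately show ?case by simp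
qed

lemma Ck_on_local:
  assumes "\<And>x. x \<in> S \<Longrightarrow> \<exists>T. open T \<and> x \<in> T \<and> Ck_on k T f"
  shows "Ck_on k S f"
  using assms
proof (induction k arbitrary: f)
  case 0
  have "isCont f x" if "x \<in> S" for x
    using 0[OF that] continuous_on_eq_continuous_at by auto
  then show ?case by (simp add: continuous_at_imp_continuous_on)
next
  case (Suc k)
  show ?case
  proof (simp, intro conjI ballI allI)
    show "f differentiable at x" if "x \<in> S" for x
      using Suc.prems[OF that] by auto
    show "Ck_on k S (\<lambda>x. D f x v)" for v
      using Suc.prems by (intro Suc.IH) fastforce
  qed
qed

lemma Ck_on_const: "Ck_on k S (\<lambda>x. c)"
  by (induction k arbitrary: c) auto

lemma Ck_on_linear_image:
  assumes L: "bounded_linear L" and S: "open S"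
  shows "Ck_on k S f \<Longrightarrow> Ck_on k S (\<lambda>x. L (f x))"
proof (induction k arbitrary: f)
  case 0
  then show ?case using bounded_linear.continuous_on[OF L] by simp
next
  case (Suc k)
  have d: "((\<lambda>x. L (f x)) has_derivative (\<lambda>v. L (D f x v))) (at x)" if "x \<in> S" for x
    using Suc.prems that by (intro bounded_linear.has_derivative[OF L]) (simp add: frechet_derivative_works)
  have "Ck_on k S (\<lambda>x. D (\<lambda>x. L (f x)) x v)" for v
  proof (rule Ck_on_cong[OF S])
    show "Ck_on k S (\<lambda>x. L (D f x v))" using Suc by simp
  qed (use D_eqI[OF d] in auto)
  then show ?case using d by (auto simp: differentiable_def)
qed

lemma Ck_on_add:
  assumes S: "open S"
  shows "Ck_on k S f \<Longrightarrow> Ck_on k S g \<Longrightarrow> Ck_on k S (\<lambda>x. f x + g x)"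
proof (induction k arbitrary: f g)
  case 0
  then show ?case by (simp add: continuous_on_add)
next
  case (Suc k)
  have d: "((\<lambda>x. f x + g x) has_derivative (\<lambda>v. D f x v + D g x v)) (at x)" if "x \<in> S" for x
    using Suc.prems that by (intro has_derivative_add) (simp_all add: frechet_derivative_works)
  have "Ck_on k S (\<lambda>x. D (\<lambda>x. f x + g x) x v)" for v
  proof (rule Ck_on_cong[OF S])
    show "Ck_on k S (\<lambda>x. D f x v + D g x v)" using Suc by simp
  qed (use D_eqI[OF d] in auto)
  then show ?case using d by (auto simp: differentiable_def)
qed

lemma Ck_on_bilinear:
  assumes B: "bounded_bilinear B" and S: "open S"
  shows "Ck_on k S f \<Longrightarrow> Ck_on k S g \<Longrightarrow> Ck_on k S (\<lambda>x. B (f x) (g x))"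
proof (induction k arbitrary: f g)
  case 0
  then show ?case using bounded_bilinear.continuous_on[OF B] by simp
next
  case (Suc k)
  have d: "((\<lambda>x. B (f x) (g x)) has_derivative (\<lambda>v. B (f x) (D g x v) + B (D f x v) (g x))) (at x)"
    if "x \<in> S" for x
    using Suc.prems that by (intro bounded_bilinear.FDERIV[OF B]) (simp_all add: frechet_derivative_works)
  have fg: "Ck_on k S f" "Ck_on k S g"
    using Suc.prems Ck_on_Suc_imp by blast+
  have "Ck_on k S (\<lambda>x. D (\<lambda>x. B (f x) (g x)) x v)" for v
  proof (rule Ck_on_cong[OF S])
    show "Ck_on k S (\<lambda>x. B (f x) (D g x v) + B (D f x v) (g x))"
      using Suc fg by (intro Ck_on_add[OF S] Suc.IH) auto
  qed (use D_eqI[OF d] in auto)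
  then show ?case using d by (auto simp: differentiable_def)
qed

lemma Ck_on_sum:
  assumes S: "open S"
  shows "(\<And>i. i \<in> I \<Longrightarrow> Ck_on k S (f i)) \<Longrightarrow> Ck_on k S (\<lambda>x. \<Sum>i\<in>I. f i x)"
  by (induction I rule: infinite_finite_induct) (auto simp: Ck_on_const intro: Ck_on_add[OF S])

lemma linear_D: "f differentiable (at x) \<Longrightarrow> linear (D f x)"
  using frechet_derivative_works has_derivative_linear by blast

lemma D_basis_expansion:
  fixes f :: "'a::euclidean_space \<Rightarrow> 'b::real_normed_vector"
  assumes "f differentiable (at x)"
  shows "D f x v = (\<Sum>b\<in>Basis. (v \<bullet> b) *\<^sub>R D f x b)"
proof -
  interpret l: linear "D f x" by (rule linear_D[OF assms])
  have "D f x v = D f x (\<Sum>b\<in>Basis. (v \<bullet> b) *\<^sub>R b)" by (simp add: euclidean_representation)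
  then show ?thesis by (simp add: l.sum l.scaleR)
qed

text \<open>The derivative of the composition contains the derivative of \<open>g\<close> in a moving direction; expanding the direction in
  the standard basis leaves iterated derivatives of \<open>g\<close> in fixed directions, to which the induction applies.\<close>

lemma Ck_on_compose:
  fixes f :: "'a::euclidean_space \<Rightarrow> 'b::euclidean_space" and g :: "'b \<Rightarrow> 'c::real_normed_vector"
  assumes S: "open S" and sub: "\<And>x. x \<in> S \<Longrightarrow> f x \<in> T"
  shows "Ck_on k T g \<Longrightarrow> Ck_on k S f \<Longrightarrow> Ck_on k S (\<lambda>x. g (f x))"
proof (induction k arbitrary: g)
  case 0
  then show ?case using sub by (auto intro: continuous_on_compose2)
next
  case (Suc k)
  have dg: "g differentiable (at (f x))" and df: "f differentiable (at x)" if "x \<in> S" for x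
    using Suc.prems that sub by auto
  have d: "((\<lambda>x. g (f x)) has_derivative (\<lambda>v. D g (f x) (D f x v))) (at x)" if "x \<in> S" for x
    using has_derivative_compose[of f "D f x" x UNIV g "D g (f x)"] dg[OF that] df[OF that]
    by (simp add: frechet_derivative_works)
  have f: "Ck_on k S f" using Suc.prems Ck_on_Suc_imp by blast
  have "Ck_on k S (\<lambda>x. D (\<lambda>x. g (f x)) x v)" for v
  proof (rule Ck_on_cong[OF S])
    show "Ck_on k S (\<lambda>x. \<Sum>b\<in>Basis. (D f x v \<bullet> b) *\<^sub>R D g (f x) b)"
    proof (intro Ck_on_sum[OF S] Ck_on_bilinear[OF bounded_bilinear_scaleR S])
      fix b :: 'b
      show "Ck_on k S (\<lambda>x. D g (f x) b)" using Suc.IH[of "\<lambda>y. D g y b"] Suc.prems f by simp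
      show "Ck_on k S (\<lambda>x. D f x v \<bullet> b)"
        using Suc.prems by (intro Ck_on_linear_image[OF bounded_linear_inner_left S]) simp
    qed
    show "(\<Sum>b\<in>Basis. (D f y v \<bullet> b) *\<^sub>R D g (f y) b) = D (\<lambda>x. g (f x)) y v" if "y \<in> S" for y
      using D_basis_expansion[OF dg[OF that], of "D f y v"] D_eqI[OF d[OF that], of v] by simp
  qed
  then show ?case using d by (auto simp: differentiable_def)
qed

lemma smooth_on_D: "smooth_on S f \<Longrightarrow> smooth_on S (\<lambda>x. D f x v)"
  unfolding smooth_on_def by (metis Ck_on.simps(2))

lemma smooth_on_imp_differentiable: "smooth_on S f \<Longrightarrow> x \<in> S \<Longrightarrow> f differentiable (at x)"
  unfolding smooth_on_def by (metis Ck_on.simps(2))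

lemma smooth_on_has_derivative: "smooth_on S f \<Longrightarrow> x \<in> S \<Longrightarrow> (f has_derivative D f x) (at x)"
  using smooth_on_imp_differentiable frechet_derivative_works by blast

lemma smooth_on_imp_continuous_on: "smooth_on S f \<Longrightarrow> continuous_on S f"
  unfolding smooth_on_def using Ck_on_imp_continuous_on by blast

lemma smooth_on_subset: "smooth_on S f \<Longrightarrow> T \<subseteq> S \<Longrightarrow> smooth_on T f"
  unfolding smooth_on_def using Ck_on_subset by blast

lemma smooth_on_cong: "smooth_on S f \<Longrightarrow> open S \<Longrightarrow> (\<And>y. y \<in> S \<Longrightarrow> f y = g y) \<Longrightarrow> smooth_on S g"
  unfolding smooth_on_def using Ck_on_cong by blast

lemma smooth_on_local:
  "(\<And>x. x \<in> S \<Longrightarrow> \<exists>T. open T \<and> x \<in> T \<and> smooth_on T f) \<Longrightarrow> smooth_on S f"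
  unfolding smooth_on_def by (meson Ck_on_local)

named_theorems smooth_intros

lemma smooth_on_const [smooth_intros]: "smooth_on S (\<lambda>x. c)"
  unfolding smooth_on_def by (simp add: Ck_on_const)

lemma smooth_on_linear_image:
  "bounded_linear L \<Longrightarrow> smooth_on S f \<Longrightarrow> open S \<Longrightarrow> smooth_on S (\<lambda>x. L (f x))"
  unfolding smooth_on_def by (simp add: Ck_on_linear_image)

lemma smooth_on_bilinear:
  "bounded_bilinear L \<Longrightarrow> smooth_on S f \<Longrightarrow> smooth_on S g \<Longrightarrow> open S \<Longrightarrow> smooth_on S (\<lambda>x. L (f x) (g x))"
  unfolding smooth_on_def by (simp add: Ck_on_bilinear)

lemma smooth_on_add [smooth_intros]:
  "smooth_on S f \<Longrightarrow> smooth_on S g \<Longrightarrow> open S \<Longrightarrow> smooth_on S (\<lambda>x. f x + g x)"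
  unfolding smooth_on_def by (simp add: Ck_on_add)

lemma smooth_on_sum [smooth_intros]:
  "(\<And>i. i \<in> I \<Longrightarrow> smooth_on S (f i)) \<Longrightarrow> open S \<Longrightarrow> smooth_on S (\<lambda>x. \<Sum>i\<in>I. f i x)"
  unfolding smooth_on_def by (simp add: Ck_on_sum)

lemma smooth_on_compose:
  fixes f :: "'a::euclidean_space \<Rightarrow> 'b::euclidean_space" and g :: "'b \<Rightarrow> 'c::real_normed_vector"
  shows "smooth_on T g \<Longrightarrow> smooth_on S f \<Longrightarrow> open S \<Longrightarrow> (\<And>x. x \<in> S \<Longrightarrow> f x \<in> T) \<Longrightarrow> smooth_on S (\<lambda>x. g (f x))"
  unfolding smooth_on_def using Ck_on_compose[of S f T _ g] by blast

lemmas smooth_on_scaleR [smooth_intros] = smooth_on_bilinear[OF bounded_bilinear_scaleR]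
lemmas smooth_on_inner [smooth_intros] = smooth_on_bilinear[OF bounded_bilinear_inner]

lemma smooth_on_mult [smooth_intros]:
  fixes f g :: "'a::euclidean_space \<Rightarrow> real"
  shows "smooth_on S f \<Longrightarrow> smooth_on S g \<Longrightarrow> open S \<Longrightarrow> smooth_on S (\<lambda>x. f x * g x)"
  by (rule smooth_on_bilinear[OF bounded_bilinear_mult])

lemma smooth_on_minus [smooth_intros]: "smooth_on S f \<Longrightarrow> open S \<Longrightarrow> smooth_on S (\<lambda>x. - f x)"
  using smooth_on_linear_image[OF bounded_linear_minus[OF bounded_linear_ident]] .

lemma smooth_on_diff [smooth_intros]:
  "smooth_on S f \<Longrightarrow> smooth_on S g \<Longrightarrow> open S \<Longrightarrow> smooth_on S (\<lambda>x. f x - g x)"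
  using smooth_on_add[of S f "\<lambda>x. - g x"] smooth_on_minus[of S g] by simp

lemma smooth_on_power [smooth_intros]:
  fixes f :: "'a::euclidean_space \<Rightarrow> real"
  shows "smooth_on S f \<Longrightarrow> open S \<Longrightarrow> smooth_on S (\<lambda>x. f x ^ n)"
  by (induction n) (auto intro: smooth_intros)

lemma smooth_on_ident [smooth_intros]: "smooth_on S (\<lambda>x. x)"
proof -
  have "Ck_on k S (\<lambda>x. x)" for k
    by (cases k) (auto simp: Ck_on_const D_eqI[OF has_derivative_ident])
  then show ?thesis by (simp add: smooth_on_def)
qed

lemma smooth_on_bounded_linear: "bounded_linear L \<Longrightarrow> open S \<Longrightarrow> smooth_on S L"
  using smooth_on_linear_image[of L S "\<lambda>x. x"] smooth_on_ident[of S] by simp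

lemma smooth_on_Pair [smooth_intros]:
  assumes "smooth_on S f" "smooth_on S g" "open S"
  shows "smooth_on S (\<lambda>x. (f x, g x))"
proof -
  have "smooth_on S (\<lambda>x. (f x, 0) + (0, g x))"
    using assms by (intro smooth_on_add smooth_on_linear_image[where L="\<lambda>y. (y, 0)"]
        smooth_on_linear_image[where L="\<lambda>y. (0, y)"])
      (auto intro: bounded_linear_Pair bounded_linear_zero bounded_linear_ident)
  then show ?thesis by simp
qed

lemma smooth_on_powr_real: "smooth_on {0<..} (\<lambda>s::real. s powr r)"
proof -
  have d: "((\<lambda>s::real. s powr r) has_derivative (\<lambda>v. v * (r * s powr (r - 1)))) (at s)" if "s > 0" for r s
    using has_real_derivative_powr[OF that, of r] by (simp add: has_field_derivative_def mult.commute[of _ "r * s powr (r - 1)"])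
  have "Ck_on k {0<..} (\<lambda>s::real. s powr r)" for k
  proof (induction k arbitrary: r)
    case 0
    then show ?case by (auto intro!: continuous_intros)
  next
    case (Suc k)
    have "Ck_on k {0<..} (\<lambda>s. D (\<lambda>s::real. s powr r) s v)" for v
    proof (rule Ck_on_cong)
      show "Ck_on k {0<..} (\<lambda>s. v * (r * s powr (r - 1)))"
        by (intro Ck_on_bilinear[OF bounded_bilinear_mult] Ck_on_const Suc) auto
    qed (use D_eqI[OF d] in auto)
    then show ?case using d by (auto simp: differentiable_def)
  qed
  then show ?thesis by (simp add: smooth_on_def)
qed

lemma smooth_on_powr [smooth_intros]:
  fixes f :: "'a::euclidean_space \<Rightarrow> real"
  shows "smooth_on S f \<Longrightarrow> open S \<Longrightarrow> (\<And>x. x \<in> S \<Longrightarrow> f x > 0) \<Longrightarrow> smooth_on S (\<lambda>x. f x powr r)"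
  using smooth_on_compose[OF smooth_on_powr_real, of S f r] by auto

lemma smooth_on_divide [smooth_intros]:
  fixes f g :: "'a::euclidean_space \<Rightarrow> real"
  assumes "smooth_on S f" "smooth_on S g" "open S" "\<And>x. x \<in> S \<Longrightarrow> g x > 0"
  shows "smooth_on S (\<lambda>x. f x / g x)"
proof (rule smooth_on_cong[where f="\<lambda>x. f x * g x powr (-1)"])
  show "smooth_on S (\<lambda>x. f x * g x powr (-1))" using assms by (intro smooth_intros)
  show "f y * g y powr (-1) = f y / g y" if "y \<in> S" for y
    using assms(4)[OF that] by (simp add: powr_minus divide_inverse)
qed (fact assms(3))

lemma smooth_on_sqrt [smooth_intros]:
  fixes f :: "'a::euclidean_space \<Rightarrow> real"
  assumes "smooth_on S f" "open S" "\<And>x. x \<in> S \<Longrightarrow> f x > 0"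
  shows "smooth_on S (\<lambda>x. sqrt (f x))"
  by (rule smooth_on_cong[where f="\<lambda>x. f x powr (1/2)"])
    (use assms in \<open>auto intro!: smooth_intros simp: powr_half_sqrt less_imp_le\<close>)

subsection \<open>Symmetry of second derivatives\<close>

lemma D_line:
  assumes "f differentiable (at (x + s *\<^sub>R v))"
  shows "((\<lambda>s. f (x + s *\<^sub>R v)) has_vector_derivative D f (x + s *\<^sub>R v) v) (at s)"
proof -
  have "((\<lambda>s. x + s *\<^sub>R v) has_vector_derivative v) (at s)"
    by (auto intro!: derivative_eq_intros)
  moreover have "(f has_derivative D f (x + s *\<^sub>R v)) (at (x + s *\<^sub>R v))"
    using assms frechet_derivative_works by blast
  ultimately show ?thesis
    using vector_derivative_diff_chain_within[of "\<lambda>s. x + s *\<^sub>R v" v s UNIV f] 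
    by (simp add: has_derivative_at_withinI o_def)
qed

text \<open>Both mixed derivatives are the limit of the same second difference quotient; the mean value
  theorem, applied twice, exhibits the quotient as a mixed derivative at an intermediate point.\<close>

lemma second_difference_mean_value:
  fixes f :: "'a::euclidean_space \<Rightarrow> real"
  assumes f: "Ck_on 2 (ball x r) f" and t: "0 < t" and small: "t * (norm v + norm w) < r"
  shows "\<exists>y. dist x y \<le> t * (norm v + norm w) \<and>
    f (x + t *\<^sub>R v + t *\<^sub>R w) - f (x + t *\<^sub>R v) - f (x + t *\<^sub>R w) + f x = t * t * D (\<lambda>y. D f y v) y w"
proof -
  have inside: "x + s *\<^sub>R v + q *\<^sub>R w \<in> ball x r" and near: "dist x (x + s *\<^sub>R v + q *\<^sub>R w) \<le> t * (norm v + norm w)"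
    if "0 \<le> s" "s \<le> t" "0 \<le> q" "q \<le> t" for s q
  proof -
    have "norm (s *\<^sub>R v + q *\<^sub>R w) \<le> s * norm v + q * norm w"
      using norm_triangle_ineq[of "s *\<^sub>R v" "q *\<^sub>R w"] that by simp
    also have "\<dots> \<le> t * norm v + t * norm w"
      using that by (intro add_mono mult_right_mono) auto
    finally show "dist x (x + s *\<^sub>R v + q *\<^sub>R w) \<le> t * (norm v + norm w)"
      by (simp add: dist_norm algebra_simps norm_minus_commute add_diff_eq[symmetric] norm_minus_cancel[symmetric, of "s *\<^sub>R v + q *\<^sub>R w"])
    then show "x + s *\<^sub>R v + q *\<^sub>R w \<in> ball x r" using small by simp
  qed
  have f1: "f differentiable (at z)" if "z \<in> ball x r" for z
    using f that by (simp add: numeral_2_eq_2)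
  have f2: "(\<lambda>y. D f y v) differentiable (at z)" if "z \<in> ball x r" for z
    using f that by (simp add: numeral_2_eq_2)
  define \<phi> where "\<phi> s = f ((x + t *\<^sub>R w) + s *\<^sub>R v) - f (x + s *\<^sub>R v)" for s
  have "\<exists>z>0. z < t \<and> \<phi> t - \<phi> 0 = (t - 0) * (D f ((x + t *\<^sub>R w) + z *\<^sub>R v) v - D f (x + z *\<^sub>R v) v)"
  proof (rule MVT2[OF t])
    fix s :: real assume s: "0 \<le> s" "s \<le> t"
    have "((\<lambda>s. f ((x + t *\<^sub>R w) + s *\<^sub>R v)) has_real_derivative D f ((x + t *\<^sub>R w) + s *\<^sub>R v) v) (at s)"
      using D_line[of f "x + t *\<^sub>R w" s v] f1 inside[of s t] s t
      by (simp add: has_real_derivative_iff_has_vector_derivative algebra_simps)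
    moreover have "((\<lambda>s. f (x + s *\<^sub>R v)) has_real_derivative D f (x + s *\<^sub>R v) v) (at s)"
      using D_line[of f x s v] f1 inside[of s 0] s t
      by (simp add: has_real_derivative_iff_has_vector_derivative)
    ultimately show "DERIV \<phi> s :> D f ((x + t *\<^sub>R w) + s *\<^sub>R v) v - D f (x + s *\<^sub>R v) v"
      unfolding \<phi>_def by (rule DERIV_diff)
  qed
  then obtain s where s: "0 < s" "s < t"
    and eq1: "\<phi> t - \<phi> 0 = t * (D f (x + s *\<^sub>R v + t *\<^sub>R w) v - D f (x + s *\<^sub>R v) v)"
    by (auto simp: algebra_simps)
  have "\<exists>z>0. z < t \<and> D f (x + s *\<^sub>R v + t *\<^sub>R w) v - D f (x + s *\<^sub>R v + 0 *\<^sub>R w) v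
      = (t - 0) * D (\<lambda>y. D f y v) (x + s *\<^sub>R v + z *\<^sub>R w) w"
  proof (rule MVT2[OF t])
    fix q :: real assume q: "0 \<le> q" "q \<le> t"
    show "((\<lambda>q. D f (x + s *\<^sub>R v + q *\<^sub>R w) v) has_real_derivative
        D (\<lambda>y. D f y v) (x + s *\<^sub>R v + q *\<^sub>R w) w) (at q)"
      using D_line[of "\<lambda>y. D f y v" "x + s *\<^sub>R v" q w] f2 inside[of s q] s q
      by (simp add: has_real_derivative_iff_has_vector_derivative)
  qed
  then obtain q where q: "0 < q" "q < t" and eq2: "D f (x + s *\<^sub>R v + t *\<^sub>R w) v - D f (x + s *\<^sub>R v) v
      = t * D (\<lambda>y. D f y v) (x + s *\<^sub>R v + q *\<^sub>R w) w" by auto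
  show ?thesis
    using near[of s q] s q eq1 eq2
    by (intro exI[of _ "x + s *\<^sub>R v + q *\<^sub>R w"]) (simp add: \<phi>_def algebra_simps)
qed

lemma D2_commute_real:
  fixes f :: "'a::euclidean_space \<Rightarrow> real"
  assumes S: "open S" "x \<in> S" and f: "Ck_on 2 S f"
  shows "D (\<lambda>y. D f y v) x w = D (\<lambda>y. D f y w) x v"
proof -
  obtain r where r: "r > 0" "ball x r \<subseteq> S" using S openE by blast
  define b where "b = norm v + norm w"
  \<comment> \<open>step sizes tending to \<open>0\<close> for which the parallelogram stays inside the ball\<close>
  define t where "t n = r / (b + 1) / real (Suc (Suc n))" for n
  have b: "b \<ge> 0" by (simp add: b_def)
  have tpos: "t n > 0" for n using r b by (simp add: t_def)
  have tsmall: "t n * b < r" for n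
  proof -
    have "t n * b = r * (b / (b + 1) / real (Suc (Suc n)))" by (simp add: t_def)
    also have "\<dots> < r * 1"
    proof (rule mult_strict_left_mono)
      have "b / (b + 1) < 1" using b by simp
      moreover have "b / (b + 1) / real (Suc (Suc n)) \<le> b / (b + 1) / 1"
        using b by (intro divide_left_mono) auto
      ultimately show "b / (b + 1) / real (Suc (Suc n)) < 1" by linarith
    qed (use r in simp)
    finally show ?thesis by simp
  qed
  have t0: "(\<lambda>n. t n * b) \<longlonglongrightarrow> 0"
  proof -
    have "(\<lambda>n. inverse (real (Suc (Suc n)))) \<longlonglongrightarrow> 0"
      by (rule LIMSEQ_Suc[OF LIMSEQ_inverse_real_of_nat])
    then have "(\<lambda>n. (r / (b + 1) * b) * inverse (real (Suc (Suc n)))) \<longlonglongrightarrow> (r / (b + 1) * b) * 0"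
      by (intro tendsto_mult tendsto_const)
    then show ?thesis by (simp add: t_def divide_inverse ac_simps)
  qed
  have f': "Ck_on 2 (ball x r) f" using f r Ck_on_subset by blast
  define dq where "dq n = (f (x + t n *\<^sub>R v + t n *\<^sub>R w) - f (x + t n *\<^sub>R v) - f (x + t n *\<^sub>R w) + f x) / (t n * t n)" for n
  have lim: "(\<lambda>n. dq n) \<longlonglongrightarrow> D (\<lambda>y. D f y v') x w'"
    if vw: "(v', w') = (v, w) \<or> (v', w') = (w, v)" for v' w'
  proof -
    have "\<exists>y. dist x y \<le> t n * b \<and> dq n = D (\<lambda>y. D f y v') y w'" for n
    proof -
      have b': "norm v' + norm w' = b" using vw by (auto simp: b_def)
      obtain y where y: "dist x y \<le> t n * b" "f (x + t n *\<^sub>R v' + t n *\<^sub>R w') - f (x + t n *\<^sub>R v') - f (x + t n *\<^sub>R w') + f x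
          = t n * t n * D (\<lambda>y. D f y v') y w'"
        using second_difference_mean_value[OF f' tpos[of n], of v' w'] tsmall[of n] unfolding b' by blast
      have "f (x + t n *\<^sub>R v' + t n *\<^sub>R w') - f (x + t n *\<^sub>R v') - f (x + t n *\<^sub>R w') + f x
          = f (x + t n *\<^sub>R v + t n *\<^sub>R w) - f (x + t n *\<^sub>R v) - f (x + t n *\<^sub>R w) + f x"
        using vw by (auto simp: add_ac)
      then have "dq n = t n * t n * D (\<lambda>y. D f y v') y w' / (t n * t n)"
        unfolding dq_def using y(2) by metis
      then have "dq n = D (\<lambda>y. D f y v') y w'" using tpos[of n] by simp
      then show ?thesis using y(1) by blast
    qed
    then obtain y where y: "\<And>n. dist x (y n) \<le> t n * b" "\<And>n. dq n = D (\<lambda>y. D f y v') (y n) w'"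
      by metis
    have "y \<longlonglongrightarrow> x"
      using t0 y(1) by (intro metric_tendsto_imp_tendsto[OF t0]) (auto simp: dist_commute intro!: always_eventually order_trans[OF y(1)])
    moreover have "isCont (\<lambda>y. D (\<lambda>y. D f y v') y w') x"
      using f S continuous_on_eq_continuous_at[OF S(1), of "\<lambda>y. D (\<lambda>y. D f y v') y w'"]
      by (simp add: numeral_2_eq_2)
    ultimately show ?thesis
      unfolding y(2) by (rule isCont_tendsto_compose[rotated])
  qed
  show ?thesis using LIMSEQ_unique[OF lim[of v w] lim[of w v]] by simp
qed

lemma D2_commute:
  fixes f :: "'a::euclidean_space \<Rightarrow> 'b::euclidean_space"
  assumes S: "open S" "x \<in> S" and f: "smooth_on S f"
  shows "D (\<lambda>y. D f y v) x w = D (\<lambda>y. D f y w) x v"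
proof (rule euclidean_eqI)
  fix b :: 'b assume "b \<in> Basis"
  have d: "D (\<lambda>y. g y \<bullet> b) z u = D g z u \<bullet> b" if "smooth_on S g" "z \<in> S" for g :: "'a \<Rightarrow> 'b" and z u
    by (rule D_eqI) (rule bounded_linear.has_derivative[OF bounded_linear_inner_left smooth_on_has_derivative[OF that]])
  have "D (\<lambda>y. D f y v) x w \<bullet> b = D (\<lambda>y. D f y v \<bullet> b) x w" for v w
    using d[OF smooth_on_D[OF f] S(2)] by simp
  also have "D (\<lambda>y. D f y v \<bullet> b) x w = D (\<lambda>y. D (\<lambda>y. f y \<bullet> b) y v) x w" for v w
    using D_cong_open[OF S, of "\<lambda>y. D f y v \<bullet> b" "\<lambda>y. D (\<lambda>y. f y \<bullet> b) y v"] d[OF f] by simp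
  finally have "D (\<lambda>y. D f y v) x w \<bullet> b = D (\<lambda>y. D (\<lambda>y. f y \<bullet> b) y v) x w" for v w .
  moreover have "Ck_on 2 S (\<lambda>y. f y \<bullet> b)"
    using smooth_on_inner[OF f smooth_on_const S(1)] by (simp add: smooth_on_def)
  ultimately show "D (\<lambda>y. D f y v) x w \<bullet> b = D (\<lambda>y. D f y w) x v \<bullet> b"
    using D2_commute_real[OF S] by metis
qed

subsection \<open>Bump functions\<close>

text \<open>The derivative of \<open>s powr (-n) exp (-1/s)\<close>, extended by \<open>0\<close> to \<open>s \<le> 0\<close>, is a combination of
  functions of the same family, which is thus smooth altogether.\<close>

definition flat :: "nat \<Rightarrow> real \<Rightarrow> real" where
  "flat n s = (if s > 0 then inverse s ^ n * exp (- inverse s) else 0)"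

lemma flat_has_derivative: "(flat n has_real_derivative (flat (n + 2) s - of_nat n * flat (n + 1) s)) (at s)"
proof -
  consider "s > 0" | "s < 0" | "s = 0" by linarith
  then show ?thesis
  proof cases
    case 1
    have "((\<lambda>s. inverse s ^ n * exp (- inverse s)) has_real_derivative (flat (n + 2) s - of_nat n * flat (n + 1) s)) (at s)"
    proof (cases n)
      case 0
      then show ?thesis using 1 by (auto intro!: derivative_eq_intros simp: flat_def power2_eq_square)
    next
      case (Suc m)
      have "((\<lambda>s. inverse s ^ n * exp (- inverse s)) has_real_derivative
          inverse s ^ n * (exp (- inverse s) * (inverse s * inverse s))
          + (of_nat n * (inverse s ^ (n - 1)) * (- (inverse s * inverse s))) * exp (- inverse s)) (at s)"
        using 1 by (auto intro!: derivative_eq_intros simp: power2_eq_square)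
      then show ?thesis by (rule DERIV_cong) (use 1 in \<open>simp add: flat_def Suc algebra_simps\<close>)
    qed
    then show ?thesis
      by (rule has_field_derivative_transform_within_open[where S="{0<..}"]) (use 1 in \<open>auto simp: flat_def\<close>)
  next
    case 2
    have "((\<lambda>s. 0) has_real_derivative (flat (n + 2) s - of_nat n * flat (n + 1) s)) (at s)"
      using 2 by (simp add: flat_def)
    then show ?thesis
      by (rule has_field_derivative_transform_within_open[where S="{..<0}"]) (use 2 in \<open>auto simp: flat_def\<close>)
  next
    case 3
    have "((\<lambda>y. (flat n y - flat n 0) / (y - 0)) \<longlongrightarrow> 0) (at 0)"
    proof (rule filterlim_split_at)
      show "((\<lambda>y. (flat n y - flat n 0) / (y - 0)) \<longlongrightarrow> 0) (at_left 0)"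
        by (rule tendsto_eventually) (auto simp: flat_def eventually_at_left_field intro!: exI[of _ "-1"])
      have "((\<lambda>s::real. s ^ Suc n / exp s) \<longlongrightarrow> 0) at_top"
        by (rule tendsto_power_div_exp_0)
      then have "((\<lambda>s::real. inverse s ^ Suc n / exp (inverse s)) \<longlongrightarrow> 0) (at_right 0)"
        using filterlim_inverse_at_top_right filterlim_compose by blast
      moreover have "\<forall>\<^sub>F s in at_right 0. inverse s ^ Suc n / exp (inverse s) = (flat n s - flat n 0) / (s - 0)"
        by (auto simp: flat_def eventually_at_right_field exp_minus divide_inverse intro!: exI[of _ "1"])
      ultimately show "((\<lambda>y. (flat n y - flat n 0) / (y - 0)) \<longlongrightarrow> 0) (at_right 0)"
        by (rule Lim_transform_eventually)
    qed
    then show ?thesis using 3 by (simp add: has_field_derivative_iff flat_def)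
  qed
qed

lemma smooth_on_flat: "smooth_on UNIV (flat n)"
proof -
  have d: "(flat n has_derivative (\<lambda>v. v * (flat (n + 2) s + (- of_nat n) * flat (n + 1) s))) (at s)" for n s
    using flat_has_derivative[of n s] by (simp add: has_field_derivative_def mult.commute[of _ "_ - _"] mult_commute_abs)
  have "Ck_on k UNIV (flat n)" for k
  proof (induction k arbitrary: n)
    case 0
    show ?case using DERIV_isCont[OF flat_has_derivative]
      by (auto intro!: continuous_at_imp_continuous_on)
  next
    case (Suc k)
    have "(\<lambda>s. D (flat n) s v) = (\<lambda>s. v * (flat (n + 2) s + (- of_nat n) * flat (n + 1) s))" for v
      using D_eqI[OF d] by auto
    moreover have "Ck_on k UNIV (\<lambda>s. v * (flat (n + 2) s + (- of_nat n) * flat (n + 1) s))" for v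
      by (intro Ck_on_bilinear[OF bounded_bilinear_mult] Ck_on_add Ck_on_const Suc) auto
    moreover have "flat n differentiable (at s)" for s using d[of n s] unfolding differentiable_def by blast
    ultimately show ?case by simp
  qed
  then show ?thesis by (simp add: smooth_on_def)
qed

lemma exists_bump:
  fixes z :: "'a::euclidean_space"
  assumes "r > 0"
  shows "\<exists>\<phi>::'a \<Rightarrow> real. smooth_on UNIV \<phi> \<and> (\<forall>x. \<phi> x \<ge> 0) \<and> \<phi> z > 0 \<and> (\<forall>x. x \<notin> ball z r \<longrightarrow> \<phi> x = 0)"
proof (intro exI conjI allI impI)
  let ?\<phi> = "\<lambda>x. flat 0 (r\<^sup>2 - (x - z) \<bullet> (x - z))"
  show "smooth_on UNIV ?\<phi>"
    by (rule smooth_on_compose[OF smooth_on_flat]) (auto intro!: smooth_intros)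
  show "?\<phi> x \<ge> 0" for x by (simp add: flat_def)
  show "?\<phi> z > 0" using assms by (simp add: flat_def)
  show "?\<phi> x = 0" if "x \<notin> ball z r" for x
  proof -
    have "r \<le> norm (x - z)" using that by (simp add: dist_norm norm_minus_commute)
    then have "r\<^sup>2 \<le> (norm (x - z))\<^sup>2" using assms by (intro power_mono) auto
    then show ?thesis by (simp add: flat_def power2_norm_eq_inner)
  qed
qed

section \<open>Inner products and the Levi-Civita connection in a chart\<close>

lemma bilinear_expansion:
  fixes h :: "'a::euclidean_space \<Rightarrow> 'b::euclidean_space \<Rightarrow> 'c::real_vector"
  assumes "bilinear h"
  shows "h v w = (\<Sum>b\<in>Basis. \<Sum>c\<in>Basis. ((v \<bullet> b) * (w \<bullet> c)) *\<^sub>R h b c)"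
proof -
  have l: "linear (\<lambda>v. h v w)" "linear (h v)" for v w
    using assms by (auto simp: bilinear_def)
  have "h v w = h (\<Sum>b\<in>Basis. (v \<bullet> b) *\<^sub>R b) w" by (simp add: euclidean_representation)
  also have "\<dots> = (\<Sum>b\<in>Basis. (v \<bullet> b) *\<^sub>R h b w)"
    by (simp only: linear_sum[OF l(1)] linear_scale[OF l(1)])
  also have "\<dots> = (\<Sum>b\<in>Basis. (v \<bullet> b) *\<^sub>R h b (\<Sum>c\<in>Basis. (w \<bullet> c) *\<^sub>R c))" by (simp add: euclidean_representation)
  also have "\<dots> = (\<Sum>b\<in>Basis. \<Sum>c\<in>Basis. ((v \<bullet> b) * (w \<bullet> c)) *\<^sub>R h b c)"
    by (simp only: linear_sum[OF l(2)] linear_scale[OF l(2)] scaleR_sum_right scaleR_scaleR)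
  finally show ?thesis .
qed

lemma smooth_on_bilinear_family:
  fixes h :: "'e::euclidean_space \<Rightarrow> 'a::euclidean_space \<Rightarrow> 'b::euclidean_space \<Rightarrow> 'c::real_normed_vector"
    and f :: "'x::euclidean_space \<Rightarrow> 'e"
  assumes bil: "\<And>p. p \<in> S \<Longrightarrow> bilinear (h p)" and sm: "\<And>u v. smooth_on S (\<lambda>p. h p u v)"
    and "open U" "smooth_on U f" "\<And>x. x \<in> U \<Longrightarrow> f x \<in> S" "smooth_on U V" "smooth_on U W"
  shows "smooth_on U (\<lambda>x. h (f x) (V x) (W x))"
proof (rule smooth_on_cong[OF _ \<open>open U\<close>])
  show "smooth_on U (\<lambda>x. \<Sum>b\<in>Basis. \<Sum>c\<in>Basis. ((V x \<bullet> b) * (W x \<bullet> c)) *\<^sub>R h (f x) b c)"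
    using assms by (intro smooth_intros smooth_on_compose[OF sm]) auto
  show "(\<Sum>b\<in>Basis. \<Sum>c\<in>Basis. ((V x \<bullet> b) * (W x \<bullet> c)) *\<^sub>R h (f x) b c) = h (f x) (V x) (W x)"
    if "x \<in> U" for x
    by (rule bilinear_expansion[OF bil[OF assms(5)[OF that]], symmetric])
qed

text \<open>A product rule for a bilinear form that depends on the point: in the standard basis the moving arguments become
  real coefficients.\<close>

lemma has_derivative_bilinear_family:
  fixes h :: "'e::euclidean_space \<Rightarrow> 'a::euclidean_space \<Rightarrow> 'b::euclidean_space \<Rightarrow> 'c::real_normed_vector"
    and f :: "'x::euclidean_space \<Rightarrow> 'e"
  assumes S: "open S" "f y \<in> S" and bil: "\<And>p. p \<in> S \<Longrightarrow> bilinear (h p)"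
    and dh: "\<And>u v. (\<lambda>p. h p u v) differentiable (at (f y))"
    and d: "f differentiable (at y)" "V differentiable (at y)" "W differentiable (at y)"
  shows "((\<lambda>y. h (f y) (V y) (W y)) has_derivative
    (\<lambda>k. D (\<lambda>p. h p (V y) (W y)) (f y) (D f y k) + h (f y) (D V y k) (W y) + h (f y) (V y) (D W y k))) (at y)"
proof -
  let ?b = "\<lambda>v w p. \<Sum>b\<in>Basis. \<Sum>c\<in>Basis. ((v \<bullet> b) * (w \<bullet> c)) *\<^sub>R h p b c"
  have D: "(f has_derivative D f y) (at y)" "(V has_derivative D V y) (at y)" "(W has_derivative D W y) (at y)"
    using d by (simp_all add: frechet_derivative_works)
  have Dh: "((\<lambda>p. h p u v) has_derivative D (\<lambda>p. h p u v) (f y)) (at (f y))" for u v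
    using dh by (simp add: frechet_derivative_works)
  have eq: "?b v w p = h p v w" if "p \<in> S" for v w p
    using bilinear_expansion[OF bil[OF that]] by metis
  have Dhf: "((\<lambda>y. h (f y) b c) has_derivative (\<lambda>k. D (\<lambda>p. h p b c) (f y) (D f y k))) (at y)" for b c
    using has_derivative_compose[OF D(1) Dh] by simp
  have Dexp: "D (\<lambda>p. h p v w) (f y) k = (\<Sum>b\<in>Basis. \<Sum>c\<in>Basis. ((v \<bullet> b) * (w \<bullet> c)) *\<^sub>R D (\<lambda>p. h p b c) (f y) k)" for v w k
  proof (rule D_eqI[of _ "\<lambda>k. (\<Sum>b\<in>Basis. \<Sum>c\<in>Basis. ((v \<bullet> b) * (w \<bullet> c)) *\<^sub>R D (\<lambda>p. h p b c) (f y) k)"])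
    have "((\<lambda>p. ?b v w p) has_derivative (\<lambda>k. \<Sum>b\<in>Basis. \<Sum>c\<in>Basis. ((v \<bullet> b) * (w \<bullet> c)) *\<^sub>R D (\<lambda>p. h p b c) (f y) k)) (at (f y))"
      by (intro has_derivative_sum has_derivative_scaleR_right Dh)
    then show "((\<lambda>p. h p v w) has_derivative (\<lambda>k. \<Sum>b\<in>Basis. \<Sum>c\<in>Basis. ((v \<bullet> b) * (w \<bullet> c)) *\<^sub>R D (\<lambda>p. h p b c) (f y) k)) (at (f y))"
      by (rule has_derivative_transform_within_open[OF _ S]) (rule eq)
  qed
  have "((\<lambda>y. ?b (V y) (W y) (f y)) has_derivative (\<lambda>k. \<Sum>b\<in>Basis. \<Sum>c\<in>Basis.
      ((V y \<bullet> b) * (W y \<bullet> c)) *\<^sub>R D (\<lambda>p. h p b c) (f y) (D f y k) +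
      ((V y \<bullet> b) * (D W y k \<bullet> c) + (D V y k \<bullet> b) * (W y \<bullet> c)) *\<^sub>R h (f y) b c)) (at y)"
    by (intro has_derivative_sum has_derivative_scaleR Dhf has_derivative_mult
        bounded_linear.has_derivative[OF bounded_linear_inner_left] D)
  also have "(\<lambda>k. \<Sum>b\<in>Basis. \<Sum>c\<in>Basis.
      ((V y \<bullet> b) * (W y \<bullet> c)) *\<^sub>R D (\<lambda>p. h p b c) (f y) (D f y k) +
      ((V y \<bullet> b) * (D W y k \<bullet> c) + (D V y k \<bullet> b) * (W y \<bullet> c)) *\<^sub>R h (f y) b c)
    = (\<lambda>k. D (\<lambda>p. h p (V y) (W y)) (f y) (D f y k) + h (f y) (D V y k) (W y) + h (f y) (V y) (D W y k))"
  proof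
    fix k
    have e: "h (f y) (D V y k) (W y) = ?b (D V y k) (W y) (f y)" "h (f y) (V y) (D W y k) = ?b (V y) (D W y k) (f y)"
      using eq[OF S(2)] by metis+
    show "(\<Sum>b\<in>Basis. \<Sum>c\<in>Basis. ((V y \<bullet> b) * (W y \<bullet> c)) *\<^sub>R D (\<lambda>p. h p b c) (f y) (D f y k) +
      ((V y \<bullet> b) * (D W y k \<bullet> c) + (D V y k \<bullet> b) * (W y \<bullet> c)) *\<^sub>R h (f y) b c)
      = D (\<lambda>p. h p (V y) (W y)) (f y) (D f y k) + h (f y) (D V y k) (W y) + h (f y) (V y) (D W y k)"
      unfolding e Dexp[of "V y" "W y"] by (simp only: sum.distrib scaleR_add_left add.assoc) (simp only: ac_simps)
  qed
  finally have *: "((\<lambda>y. ?b (V y) (W y) (f y)) has_derivative (\<lambda>k. D (\<lambda>p. h p (V y) (W y)) (f y) (D f y k)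
      + h (f y) (D V y k) (W y) + h (f y) (V y) (D W y k))) (at y)" .
  have cont: "isCont f y" by (rule has_derivative_continuous[OF D(1)])
  obtain N where N: "open N" "y \<in> N" "\<And>z. z \<in> N \<Longrightarrow> f z \<in> S"
    using cont[unfolded continuous_at_open, rule_format, OF conjI[OF S]] by auto
  show ?thesis
    by (rule has_derivative_transform_within_open[OF * N(1,2)]) (rule eq[OF N(3)])
qed

lemma inner_productD:
  assumes "inner_product b"
  shows "bilinear b" "b u v = b v u" "u \<noteq> 0 \<Longrightarrow> b u u > 0" "linear (b u)" "linear (\<lambda>u. b u v)"
    "b (u + w) v = b u v + b w v" "b (u - w) v = b u v - b w v" "b (r *\<^sub>R u) v = r * b u v" "b (- u) v = - b u v" "b 0 v = 0"
    "b v (u + w) = b v u + b v w" "b v (u - w) = b v u - b v w" "b v (r *\<^sub>R u) = r * b v u" "b v (- u) = - b v u" "b v 0 = 0"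
    "b u u = 0 \<longleftrightarrow> u = 0" "b u u \<ge> 0"
proof -
  show B: "bilinear b" using assms by (simp add: inner_product_def)
  show "b u v = b v u" using assms by (simp add: inner_product_def)
  show p: "u \<noteq> 0 \<Longrightarrow> b u u > 0" for u using assms by (simp add: inner_product_def)
  show l1: "linear (b u)" for u using B by (simp add: bilinear_def)
  show l2: "linear (\<lambda>u. b u v)" for v using B by (simp add: bilinear_def)
  show "b (u + w) v = b u v + b w v" by (rule linear_add[OF l2])
  show "b (u - w) v = b u v - b w v" by (rule linear_diff[OF l2])
  show "b (r *\<^sub>R u) v = r * b u v" using linear_scale[OF l2, of r u v] by simp
  show "b (- u) v = - b u v" by (rule linear_neg[OF l2])
  show "b 0 v = 0" by (rule linear_0[OF l2])
  show "b v (u + w) = b v u + b v w" by (rule linear_add[OF l1])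
  show "b v (u - w) = b v u - b v w" by (rule linear_diff[OF l1])
  show "b v (r *\<^sub>R u) = r * b v u" using linear_scale[OF l1, of v r u] by simp
  show "b v (- u) = - b v u" by (rule linear_neg[OF l1])
  show z: "b v 0 = 0" for v by (rule linear_0[OF l1])
  show "b u u = 0 \<longleftrightarrow> u = 0" using p[of u] z[of 0] by (cases "u = 0") auto
  show "b u u \<ge> 0" using p[of u] z[of 0] by (cases "u = 0") auto
qed

lemmas ip_lin = inner_productD(6-15)

lemma inner_product_ext:
  assumes "inner_product b" "\<And>w. b z w = b z' w"
  shows "z = z'"
proof -
  have "b (z - z') (z - z') = 0" using assms(2)[of "z - z'"] by (simp add: ip_lin[OF assms(1)])
  then show ?thesis using inner_productD(16)[OF assms(1)] by simp
qed

lemma sharp_eqI: "inner_product b \<Longrightarrow> (\<And>w. b z w = \<phi> w) \<Longrightarrow> sharp b \<phi> = z"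
  unfolding sharp_def by (rule the_equality) (simp, rule inner_product_ext[of b], simp_all)

text \<open>Nondegeneracy makes the linear map \<open>z \<mapsto> b z\<close> injective, hence surjective onto the dual space, as the dimensions agree.\<close>

lemma sharp_works:
  fixes b :: "'a::euclidean_space \<Rightarrow> 'a \<Rightarrow> real"
  assumes b: "inner_product b" and \<phi>: "linear \<phi>"
  shows "b (sharp b \<phi>) w = \<phi> w"
proof -
  define T where "T z = (\<Sum>i\<in>Basis. b z i *\<^sub>R i)" for z
  have T: "linear T"
    unfolding T_def by (rule linearI) (simp_all add: ip_lin[OF b] sum.distrib scaleR_add_left scaleR_sum_right)
  have coef: "T z \<bullet> i = b z i" if "i \<in> Basis" for z i
    using that by (simp add: T_def inner_sum_left inner_Basis if_distrib cong: if_cong)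
  have lin_ext: "\<psi> = \<psi>'" if "linear \<psi>" "linear \<psi>'" "\<And>i. i \<in> Basis \<Longrightarrow> \<psi> i = \<psi>' i" for \<psi> \<psi>' :: "'a \<Rightarrow> real"
    using linear_eq_stdbasis[of \<psi> \<psi>'] that by blast
  have "inj T"
  proof (rule linear_injective_0[OF T, THEN iffD2], intro allI impI)
    fix z assume "T z = 0"
    then have "b z i = 0" if "i \<in> Basis" for i using coef[OF that, of z] by simp
    then have "b z = (\<lambda>_. 0)"
      using lin_ext[of "b z" "\<lambda>_. 0"] inner_productD(4)[OF b] by (simp add: linear_zero)
    then show "z = 0" using inner_productD(16)[OF b, of z] by simp
  qed
  then have "surj T" using T linear_inj_imp_surj by blast
  then obtain z where "T z = (\<Sum>i\<in>Basis. \<phi> i *\<^sub>R i)" by (metis surjD)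
  then have "b z i = \<phi> i" if "i \<in> Basis" for i
    using coef[OF that, of z] that by (simp add: inner_sum_left inner_Basis if_distrib cong: if_cong)
  then have "b z = \<phi>" by (intro lin_ext inner_productD(4)[OF b] \<phi>)
  then have "sharp b \<phi> = z" by (intro sharp_eqI[OF b]) simp
  then show ?thesis using \<open>b z = \<phi>\<close> by simp
qed

definition metric_on :: "'a::euclidean_space set \<Rightarrow> 'a metric \<Rightarrow> bool" where
  "metric_on S G \<longleftrightarrow> open S \<and> (\<forall>x\<in>S. inner_product (G x)) \<and> (\<forall>u v. smooth_on S (\<lambda>x. G x u v))"

lemma metric_onD:
  assumes "metric_on S G"
  shows "open S" "x \<in> S \<Longrightarrow> inner_product (G x)" "smooth_on S (\<lambda>x. G x u v)" "x \<in> S \<Longrightarrow> bilinear (G x)"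
    "x \<in> S \<Longrightarrow> (\<lambda>x. G x u v) differentiable (at x)"
proof -
  show "open S" "x \<in> S \<Longrightarrow> inner_product (G x)" and s: "smooth_on S (\<lambda>x. G x u v)"
    using assms by (auto simp: metric_on_def)
  then show "x \<in> S \<Longrightarrow> bilinear (G x)" by (simp add: inner_product_def)
  show "x \<in> S \<Longrightarrow> (\<lambda>x. G x u v) differentiable (at x)" by (rule smooth_on_imp_differentiable[OF s])
qed

text \<open>Gram-Schmidt orthonormalisation of the standard basis, carried out over all points at once; the norms that are
  divided by never vanish, so every step preserves smoothness.\<close>

lemma smooth_orthonormal_frame:
  fixes G :: "'a::euclidean_space metric"
  assumes m: "metric_on S G"
  shows "\<exists>w. (\<forall>i\<in>(Basis::'a set). smooth_on S (w i)) \<and>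
    (\<forall>x\<in>S. (\<forall>i\<in>Basis. \<forall>j\<in>Basis. G x (w i x) (w j x) = (if i = j then 1 else 0)) \<and> span ((\<lambda>i. w i x) ` Basis) = UNIV)"
proof -
  have "\<exists>w. (\<forall>i\<in>B. smooth_on S (w i)) \<and>
    (\<forall>x\<in>S. (\<forall>i\<in>B. \<forall>j\<in>B. G x (w i x) (w j x) = (if i = j then 1 else 0)) \<and> span ((\<lambda>i. w i x) ` B) = span B)"
    if "finite B" "independent B" for B :: "'a set"
    using that
  proof (induction B rule: finite_induct)
    case empty
    show ?case by simp
  next
    case (insert b B)
    then have "independent B" by (simp add: independent_insert)
    from insert.IH[OF this] obtain w where W: "(\<forall>i\<in>B. smooth_on S (w i)) \<and>
      (\<forall>x\<in>S. (\<forall>i\<in>B. \<forall>j\<in>B. G x (w i x) (w j x) = (if i = j then 1 else 0)) \<and> span ((\<lambda>i. w i x) ` B) = span B)"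
      by (elim exE)
    have w: "\<And>i. i \<in> B \<Longrightarrow> smooth_on S (w i)"
      and on: "\<And>x i j. x \<in> S \<Longrightarrow> i \<in> B \<Longrightarrow> j \<in> B \<Longrightarrow> G x (w i x) (w j x) = (if i = j then 1 else 0)"
      and sp: "\<And>x. x \<in> S \<Longrightarrow> span ((\<lambda>i. w i x) ` B) = span B"
      using W by blast+
    define v where "v x = b - (\<Sum>i\<in>B. G x b (w i x) *\<^sub>R w i x)" for x
    have bil: "\<And>x. x \<in> S \<Longrightarrow> bilinear (G x)" and sm: "\<And>u v. smooth_on S (\<lambda>x. G x u v)" and S: "open S"
      using metric_onD[OF m] by auto
    have smv: "smooth_on S v"
      unfolding v_def using S w
      by (intro smooth_intros smooth_on_bilinear_family[OF bil sm]) auto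
    have v0: "v x \<noteq> 0" if x: "x \<in> S" for x
    proof
      assume "v x = 0"
      then have "b = (\<Sum>i\<in>B. G x b (w i x) *\<^sub>R w i x)" by (simp add: v_def)
      also have "\<dots> \<in> span ((\<lambda>i. w i x) ` B)" by (intro span_sum span_scale span_base) auto
      finally have "b \<in> span B" using sp[OF x] by simp
      then show False using insert by (simp add: independent_insert)
    qed
    have vorth: "G x (v x) (w j x) = 0" if x: "x \<in> S" and "j \<in> B" for x j
    proof -
      note ip = metric_onD(2)[OF m x]
      have "G x (v x) (w j x) = G x b (w j x) - (\<Sum>i\<in>B. G x b (w i x) * G x (w i x) (w j x))"
        unfolding v_def by (simp add: linear_sum[OF inner_productD(5)[OF ip]] ip_lin[OF ip])
      also have "(\<Sum>i\<in>B. G x b (w i x) * G x (w i x) (w j x)) = (\<Sum>i\<in>B. if i = j then G x b (w i x) else 0)"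
        using on[OF x _ \<open>j \<in> B\<close>] by (intro sum.cong) auto
      finally show ?thesis using \<open>j \<in> B\<close> insert.hyps by simp
    qed
    have vpos: "G x (v x) (v x) > 0" if "x \<in> S" for x
      using inner_productD(3)[OF metric_onD(2)[OF m that]] v0[OF that] by blast
    define w' where "w' i x = (if i = b then (1 / sqrt (G x (v x) (v x))) *\<^sub>R v x else w i x)" for i x
    have w'b: "w' b = (\<lambda>x. (1 / sqrt (G x (v x) (v x))) *\<^sub>R v x)" and w'B: "\<And>i. i \<in> B \<Longrightarrow> w' i = w i"
      using insert.hyps by (auto simp: w'_def)
    show ?case
    proof (intro exI[of _ w'] conjI ballI)
      fix i assume "i \<in> insert b B"
      moreover have "smooth_on S (w' b)"
        unfolding w'b using S smv vpos
        by (intro smooth_intros smooth_on_bilinear_family[OF bil sm]) auto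
      ultimately show "smooth_on S (w' i)" using w w'B by auto
    next
      fix x i j assume x: "x \<in> S" and i: "i \<in> insert b B" and j: "j \<in> insert b B"
      note ip = metric_onD(2)[OF m x]
      have "G x (w' b x) (w' b x) = 1"
        using vpos[OF x] by (simp add: w'b ip_lin[OF ip] real_sqrt_mult_self flip: real_sqrt_mult power2_eq_square)
      moreover have "G x (w' b x) (w' j x) = 0 \<and> G x (w' j x) (w' b x) = 0" if "j \<in> B" for j
        using vorth[OF x that] that inner_productD(2)[OF ip, of "v x" "w j x"] by (simp add: w'b w'B ip_lin[OF ip])
      ultimately show "G x (w' i x) (w' j x) = (if i = j then 1 else 0)"
        using i j on[OF x] w'B insert.hyps by auto
    next
      fix x assume x: "x \<in> S"
      have "v x \<in> span (insert b B)"
      proof -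
        have "(\<Sum>i\<in>B. G x b (w i x) *\<^sub>R w i x) \<in> span ((\<lambda>i. w i x) ` B)" by (intro span_sum span_scale span_base) auto
        then have "(\<Sum>i\<in>B. G x b (w i x) *\<^sub>R w i x) \<in> span (insert b B)"
          using sp[OF x] span_mono[of B "insert b B"] by auto
        then show ?thesis unfolding v_def by (rule span_diff[OF span_base, rotated]) simp
      qed
      then have 1: "w' b x \<in> span (insert b B)" by (auto simp: w'b intro: span_scale)
      have imB: "(\<lambda>i. w' i x) ` B = (\<lambda>i. w i x) ` B" using w'B by auto
      have le: "span ((\<lambda>i. w' i x) ` insert b B) \<subseteq> span (insert b B)"
      proof (rule span_minimal[OF _ subspace_span])
        show "(\<lambda>i. w' i x) ` insert b B \<subseteq> span (insert b B)"
          using 1 imB sp[OF x] span_base[of _ "(\<lambda>i. w i x) ` B"] span_mono[of B "insert b B"] by fastforce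
      qed
      have wB: "span B \<subseteq> span ((\<lambda>i. w' i x) ` insert b B)"
        using sp[OF x] imB span_mono[of "(\<lambda>i. w' i x) ` B" "(\<lambda>i. w' i x) ` insert b B"] by auto
      have "v x = sqrt (G x (v x) (v x)) *\<^sub>R w' b x" using vpos[OF x] by (simp add: w'b)
      then have "v x \<in> span ((\<lambda>i. w' i x) ` insert b B)" by (metis image_eqI insertI1 span_base span_scale)
      moreover have "(\<Sum>i\<in>B. G x b (w i x) *\<^sub>R w i x) \<in> span ((\<lambda>i. w' i x) ` insert b B)"
        using w'B by (intro span_sum span_scale span_base) (auto simp: image_iff intro!: bexI)
      ultimately have "v x + (\<Sum>i\<in>B. G x b (w i x) *\<^sub>R w i x) \<in> span ((\<lambda>i. w' i x) ` insert b B)"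
        by (rule span_add)
      then have "b \<in> span ((\<lambda>i. w' i x) ` insert b B)" by (simp add: v_def)
      then have "span (insert b B) \<subseteq> span ((\<lambda>i. w' i x) ` insert b B)"
        using wB span_base[of _ B] by (intro span_minimal[OF _ subspace_span]) auto
      then show "span ((\<lambda>i. w' i x) ` insert b B) = span (insert b B)" using le by auto
    qed
  qed
  from this[OF finite_Basis independent_Basis] show ?thesis by (simp only: span_Basis)
qed

lemma orthonormal_expansion:
  assumes b: "inner_product b" and I: "finite I"
    and on: "\<And>i j. i \<in> I \<Longrightarrow> j \<in> I \<Longrightarrow> b (w i) (w j) = (if i = j then 1 else 0)"
    and sp: "span (w ` I) = UNIV"
  shows "z = (\<Sum>i\<in>I. b z (w i) *\<^sub>R w i)"
proof -
  have "b (z - (\<Sum>i\<in>I. b z (w i) *\<^sub>R w i)) v = 0" for v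
  proof -
    have "v \<in> span (w ` I)" using sp by simp
    then show ?thesis
    proof (induction rule: span_induct_alt)
      case base
      then show ?case by (simp add: ip_lin[OF b])
    next
      case (step c x y)
      then obtain j where j: "j \<in> I" "x = w j" by auto
      have "b (\<Sum>i\<in>I. b z (w i) *\<^sub>R w i) (w j) = (\<Sum>i\<in>I. b z (w i) * b (w i) (w j))"
        by (simp add: linear_sum[OF inner_productD(5)[OF b]] ip_lin[OF b])
      also have "\<dots> = (\<Sum>i\<in>I. if i = j then b z (w i) else 0)" using on j by (intro sum.cong) auto
      finally have "b (z - (\<Sum>i\<in>I. b z (w i) *\<^sub>R w i)) x = 0" using j I by (simp add: ip_lin[OF b])
      then show ?case using step by (simp add: ip_lin[OF b])
    qed
  qed
  from this[of "z - (\<Sum>i\<in>I. b z (w i) *\<^sub>R w i)"] show ?thesis using inner_productD(16)[OF b] by simp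
qed

text \<open>In an orthonormal frame \<open>w\<close>, the vector dual to \<open>\<phi>\<close> is \<open>\<Sum>\<^sub>i \<phi>(w\<^sub>i) w\<^sub>i\<close>.\<close>

lemma smooth_on_sharp:
  fixes G :: "'a::euclidean_space metric"
  assumes m: "metric_on S G" and lin: "\<And>x. x \<in> S \<Longrightarrow> linear (\<phi> x)" and sm: "\<And>w. smooth_on S (\<lambda>x. \<phi> x w)"
  shows "smooth_on S (\<lambda>x. sharp (G x) (\<phi> x))"
proof -
  obtain w :: "'a \<Rightarrow> 'a \<Rightarrow> 'a" where w: "\<And>i. i \<in> Basis \<Longrightarrow> smooth_on S (w i)"
    and on: "\<And>x i j. x \<in> S \<Longrightarrow> i \<in> Basis \<Longrightarrow> j \<in> Basis \<Longrightarrow> G x (w i x) (w j x) = (if i = j then 1 else 0)"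
    and sp: "\<And>x. x \<in> S \<Longrightarrow> span ((\<lambda>i. w i x) ` Basis) = UNIV"
    using smooth_orthonormal_frame[OF m] by blast
  note S = metric_onD(1)[OF m]
  have sm\<phi>: "smooth_on S (\<lambda>x. \<phi> x (w i x))" if "i \<in> Basis" for i
  proof (rule smooth_on_cong[OF _ S])
    show "smooth_on S (\<lambda>x. \<Sum>b\<in>Basis. (w i x \<bullet> b) *\<^sub>R \<phi> x b)"
      by (intro smooth_intros S w that sm)
    show "(\<Sum>b\<in>Basis. (w i y \<bullet> b) *\<^sub>R \<phi> y b) = \<phi> y (w i y)" if "y \<in> S" for y
      using linear_sum[OF lin[OF that]] linear_scale[OF lin[OF that]]
      by (metis (no_types, lifting) euclidean_representation sum.cong)
  qed
  show ?thesis
  proof (rule smooth_on_cong[OF _ S])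
    show "smooth_on S (\<lambda>x. \<Sum>i\<in>Basis. \<phi> x (w i x) *\<^sub>R w i x)"
      by (intro smooth_intros S w sm\<phi>)
    show "(\<Sum>i\<in>Basis. \<phi> x (w i x) *\<^sub>R w i x) = sharp (G x) (\<phi> x)" if x: "x \<in> S" for x
      using orthonormal_expansion[OF metric_onD(2)[OF m x] finite_Basis on[OF x] sp[OF x], of "sharp (G x) (\<phi> x)"]
      by (simp add: sharp_works[OF metric_onD(2)[OF m x] lin[OF x]])
  qed
qed

lemma trilinear_D_metric:
  assumes m: "metric_on S G" and x: "x \<in> S"
  shows "linear (\<lambda>w. D (\<lambda>y. G y v w) x u)" "linear (\<lambda>v. D (\<lambda>y. G y v w) x u)" "linear (D (\<lambda>y. G y v w) x)"
    "D (\<lambda>y. G y v w) x u = D (\<lambda>y. G y w v) x u"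
proof -
  note S = metric_onD(1)[OF m]
  have d: "((\<lambda>y. G y v w) has_derivative D (\<lambda>y. G y v w) x) (at x)" for v w
    using metric_onD(5)[OF m x] by (simp add: frechet_derivative_works)
  show sy: "D (\<lambda>y. G y v w) x u = D (\<lambda>y. G y w v) x u" for v w
  proof -
    have "D (\<lambda>y. G y v w) x = D (\<lambda>y. G y w v) x"
      by (rule D_cong_open[OF S x]) (rule inner_productD(2)[OF metric_onD(2)[OF m]])
    then show ?thesis by simp
  qed
  show "linear (D (\<lambda>y. G y v w) x)" using d has_derivative_linear by blast
  show *: "linear (\<lambda>w. D (\<lambda>y. G y v w) x u)" for v
  proof (rule linearI)
    fix w w' :: 'a and r :: real
    have "((\<lambda>y. G y v (w + w')) has_derivative (\<lambda>u. D (\<lambda>y. G y v w) x u + D (\<lambda>y. G y v w') x u)) (at x)"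
      by (rule has_derivative_transform_within_open[OF has_derivative_add[OF d d] S x])
        (simp add: ip_lin[OF metric_onD(2)[OF m]])
    then show "D (\<lambda>y. G y v (w + w')) x u = D (\<lambda>y. G y v w) x u + D (\<lambda>y. G y v w') x u"
      by (rule D_eqI)
    have "((\<lambda>y. G y v (r *\<^sub>R w)) has_derivative (\<lambda>u. r *\<^sub>R D (\<lambda>y. G y v w) x u)) (at x)"
      by (rule has_derivative_transform_within_open[OF has_derivative_scaleR_right[OF d] S x])
        (simp add: ip_lin[OF metric_onD(2)[OF m]])
    then show "D (\<lambda>y. G y v (r *\<^sub>R w)) x u = r *\<^sub>R D (\<lambda>y. G y v w) x u"
      by (rule D_eqI)
  qed
  show "linear (\<lambda>v. D (\<lambda>y. G y v w) x u)" using *[of w] by (simp add: sy[of _ w])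
qed

lemma christoffel_koszul:
  assumes m: "metric_on S G" and x: "x \<in> S"
  shows "G x (christoffel G x u v) w = (D (\<lambda>y. G y v w) x u + D (\<lambda>y. G y u w) x v - D (\<lambda>y. G y u v) x w) / 2"
  unfolding christoffel_def
proof (rule sharp_works[OF metric_onD(2)[OF m x]])
  have "linear (\<lambda>w. (1/2) *\<^sub>R (D (\<lambda>y. G y v w) x u + D (\<lambda>y. G y u w) x v - D (\<lambda>y. G y u v) x w))"
    using trilinear_D_metric(1,3)[OF m x] by (intro linear_compose_scale_right linear_compose_sub linear_compose_add) auto
  then show "linear (\<lambda>w. (D (\<lambda>y. G y v w) x u + D (\<lambda>y. G y u w) x v - D (\<lambda>y. G y u v) x w) / 2)" by simp
qed

lemma christoffel_sym:
  assumes m: "metric_on S G" and x: "x \<in> S"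
  shows "christoffel G x u v = christoffel G x v u"
  by (rule inner_product_ext[OF metric_onD(2)[OF m x]])
    (simp add: christoffel_koszul[OF m x] trilinear_D_metric(4)[OF m x, of u v])

lemma christoffel_bilinear:
  assumes m: "metric_on S G" and x: "x \<in> S"
  shows "bilinear (christoffel G x)"
proof -
  have l: "linear (christoffel G x u)" for u
  proof (rule linearI)
    note ip = metric_onD(2)[OF m x] and t = trilinear_D_metric[OF m x]
    show "christoffel G x u (v + v') = christoffel G x u v + christoffel G x u v'" for v v'
      by (rule inner_product_ext[OF ip])
        (simp add: ip_lin[OF ip] christoffel_koszul[OF m x] linear_add[OF t(1)] linear_add[OF t(2)] linear_add[OF t(3)] field_simps)
    show "christoffel G x u (r *\<^sub>R v) = r *\<^sub>R christoffel G x u v" for r v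
      by (rule inner_product_ext[OF ip])
        (simp add: ip_lin[OF ip] christoffel_koszul[OF m x] linear_scale[OF t(1)] linear_scale[OF t(2)] linear_scale[OF t(3)] field_simps)
  qed
  then show ?thesis unfolding bilinear_def using christoffel_sym[OF m x] by auto
qed

lemma christoffel_metric:
  assumes m: "metric_on S G" and x: "x \<in> S"
  shows "D (\<lambda>y. G y v w) x u = G x (christoffel G x u v) w + G x v (christoffel G x u w)"
  using inner_productD(2)[OF metric_onD(2)[OF m x], of v "christoffel G x u w"]
  by (simp add: christoffel_koszul[OF m x] trilinear_D_metric(4)[OF m x, of w v] field_simps)

lemma smooth_on_christoffel:
  assumes m: "metric_on S G"
  shows "smooth_on S (\<lambda>x. christoffel G x u v)"
  unfolding christoffel_def
proof (rule smooth_on_sharp[OF m])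
  fix x assume x: "x \<in> S"
  have "linear (\<lambda>w. (1/2) *\<^sub>R (D (\<lambda>y. G y v w) x u + D (\<lambda>y. G y u w) x v - D (\<lambda>y. G y u v) x w))"
    using trilinear_D_metric(1,3)[OF m x] by (intro linear_compose_scale_right linear_compose_sub linear_compose_add) auto
  then show "linear (\<lambda>w. (D (\<lambda>y. G y v w) x u + D (\<lambda>y. G y u w) x v - D (\<lambda>y. G y u v) x w) / 2)" by simp
next
  fix w
  show "smooth_on S (\<lambda>x. (D (\<lambda>y. G y v w) x u + D (\<lambda>y. G y u w) x v - D (\<lambda>y. G y u v) x w) / 2)"
    by (intro smooth_intros smooth_on_D metric_onD[OF m]) auto
qed

subsection \<open>Covariant differentiation along a map\<close>

text \<open>The covariant derivative of the pulled-back connection: \<open>W\<close> is a vector field along the map \<open>f\<close>, and \<open>a\<close> a constant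
  direction in the source of \<open>f\<close>.\<close>

definition cov_along :: "('e::euclidean_space) metric \<Rightarrow> ('a::euclidean_space \<Rightarrow> 'e) \<Rightarrow> 'a \<Rightarrow> ('a \<Rightarrow> 'e) \<Rightarrow> 'a \<Rightarrow> 'e" where
  "cov_along G f a W y = D W y a + christoffel G (f y) (D f y a) (W y)"

lemma smooth_on_cov_along:
  assumes m: "metric_on S G" and U: "open U" "\<And>y. y \<in> U \<Longrightarrow> f y \<in> S" and f: "smooth_on U f" "smooth_on U W"
  shows "smooth_on U (cov_along G f a W)"
  unfolding cov_along_def[abs_def]
  by (intro smooth_on_add smooth_on_D f U smooth_on_bilinear_family[where S=S and h="christoffel G" and f=f and V="\<lambda>y. D f y a" and W=W]
      christoffel_bilinear[OF m] smooth_on_christoffel[OF m])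

lemma cov_along_metric:
  assumes m: "metric_on S G" and y: "f y \<in> S" and d: "f differentiable (at y)" "V differentiable (at y)" "W differentiable (at y)"
  shows "((\<lambda>y. G (f y) (V y) (W y)) has_derivative (\<lambda>a. G (f y) (cov_along G f a V y) (W y) + G (f y) (V y) (cov_along G f a W y))) (at y)"
proof (rule has_derivative_eq_rhs[OF has_derivative_bilinear_family[where h=G and f=f, OF metric_onD(1)[OF m] y metric_onD(4)[OF m] metric_onD(5)[OF m y] d]])
  note ip = metric_onD(2)[OF m y]
  show "(\<lambda>k. D (\<lambda>p. G p (V y) (W y)) (f y) (D f y k) + G (f y) (D V y k) (W y) + G (f y) (V y) (D W y k)) =
    (\<lambda>a. G (f y) (cov_along G f a V y) (W y) + G (f y) (V y) (cov_along G f a W y))"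
    unfolding christoffel_metric[OF m y] cov_along_def ip_lin[OF ip] by (rule ext) simp
qed

lemma cov_along_torsion_free:
  assumes m: "metric_on S G" and U: "open U" "y \<in> U" "f y \<in> S" and f: "smooth_on U f"
  shows "cov_along G f a (\<lambda>y. D f y b) y = cov_along G f b (\<lambda>y. D f y a) y"
  unfolding cov_along_def by (rule arg_cong2[where f="(+)", OF D2_commute[OF U(1,2) f] christoffel_sym[OF m U(3)]])

lemma curvature_formula:
  assumes m: "metric_on S G" and x: "x \<in> S"
  shows "curvature G x u v w = D (\<lambda>y. christoffel G y v w) x u - D (\<lambda>y. christoffel G y u w) x v
    + christoffel G x u (christoffel G x v w) - christoffel G x v (christoffel G x u w)"
proof -
  have c: "D (\<lambda>_. w) y k = 0" for y k and w :: 'a by (simp add: D_eqI[OF has_derivative_const])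
  have "bilinear (christoffel G x)" by (rule christoffel_bilinear[OF m x])
  then have "christoffel G x 0 w = 0" by (rule bilinear_lzero)
  then show ?thesis unfolding curvature_def Let_def cov_def lie_bracket_def by (simp add: c)
qed

text \<open>The second derivatives of \<open>f\<close> and of \<open>W\<close> are symmetric and cancel; what is left are the derivatives and the products of
  Christoffel symbols that make up the curvature. As the directions \<open>a\<close>, \<open>b\<close> are constant, no bracket appears.\<close>

lemma cov_along_commutator:
  assumes m: "metric_on S G" and U: "open U" "y \<in> U" "\<And>y. y \<in> U \<Longrightarrow> f y \<in> S" and f: "smooth_on U f" and W: "smooth_on U W"
  shows "cov_along G f a (cov_along G f b W) y - cov_along G f b (cov_along G f a W) y = curvature G (f y) (D f y a) (D f y b) (W y)"
proof -
  let ?\<Gamma> = "christoffel G"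
  note y = U(3)[OF U(2)]
  note bil = christoffel_bilinear[OF m y]
  have eq: "cov_along G f a (cov_along G f b W) y = D (\<lambda>y. D W y b) y a
     + (D (\<lambda>p. ?\<Gamma> p (D f y b) (W y)) (f y) (D f y a) + ?\<Gamma> (f y) (D (\<lambda>y. D f y b) y a) (W y) + ?\<Gamma> (f y) (D f y b) (D W y a))
     + (?\<Gamma> (f y) (D f y a) (D W y b) + ?\<Gamma> (f y) (D f y a) (?\<Gamma> (f y) (D f y b) (W y)))" for a b
  proof -
    have "((\<lambda>y. ?\<Gamma> (f y) (D f y b) (W y)) has_derivative
      (\<lambda>a. D (\<lambda>p. ?\<Gamma> p (D f y b) (W y)) (f y) (D f y a) + ?\<Gamma> (f y) (D (\<lambda>y. D f y b) y a) (W y) + ?\<Gamma> (f y) (D f y b) (D W y a))) (at y)"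
      using U(2) by (intro has_derivative_bilinear_family[where h="christoffel G" and f=f and V="\<lambda>y. D f y b" and W=W, OF metric_onD(1)[OF m] y] christoffel_bilinear[OF m]
          smooth_on_imp_differentiable[OF smooth_on_christoffel[OF m] y]
          smooth_on_imp_differentiable[OF f] smooth_on_imp_differentiable[OF W] smooth_on_imp_differentiable[OF smooth_on_D[OF f]])
    then have "D (cov_along G f b W) y a = D (\<lambda>y. D W y b) y a +
      (D (\<lambda>p. ?\<Gamma> p (D f y b) (W y)) (f y) (D f y a) + ?\<Gamma> (f y) (D (\<lambda>y. D f y b) y a) (W y) + ?\<Gamma> (f y) (D f y b) (D W y a))"
      unfolding cov_along_def[abs_def]
      by (intro D_eqI[OF has_derivative_add] smooth_on_has_derivative[OF smooth_on_D[OF W] U(2)])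
    then show ?thesis by (simp add: cov_along_def bilinear_radd[OF bil])
  qed
  show ?thesis
    unfolding eq curvature_formula[OF m y]
    using D2_commute[OF U(1,2) W, of a b] D2_commute[OF U(1,2) f, of a b]
    by (simp add: algebra_simps)
qed

section \<open>Hermitian metrics\<close>

lemma J_alg: "J (u + v) = J u + J v" "J (r *\<^sub>R v) = r *\<^sub>R J v" "J (- v) = - J v" "J (u - v) = J u - J v"
    "J (J v) = - v" "J 0 = 0"
proof -
  show "J (u + v) = J u + J v" "J (u - v) = J u - J v" "J (- v) = - J v" "J 0 = 0"
    by (simp_all add: J_def vec_eq_iff distrib_left right_diff_distrib)
  show "J (r *\<^sub>R v) = r *\<^sub>R J v" by (simp add: J_def vec_eq_iff)
  show "J (J v) = - v" by (simp add: J_def vec_eq_iff mult.assoc[symmetric])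
qed

lemma linear_J: "linear J"
  by (rule linearI) (simp_all add: J_alg)

lemma bounded_linear_J: "bounded_linear J"
  using linear_J by (simp add: linear_conv_bounded_linear)

lemma smooth_on_J: "smooth_on S f \<Longrightarrow> open S \<Longrightarrow> smooth_on S (\<lambda>x. J (f x))"
  by (rule smooth_on_linear_image[OF bounded_linear_J])

definition hermitian_on :: "(complex^2) set \<Rightarrow> (complex^2) metric \<Rightarrow> bool" where
  "hermitian_on S G \<longleftrightarrow> metric_on S G \<and> (\<forall>x\<in>S. \<forall>u v. G x (J u) (J v) = G x u v)"

lemma hermitian_onD:
  assumes "hermitian_on S G"
  shows "metric_on S G" "x \<in> S \<Longrightarrow> G x (J u) (J v) = G x u v"
  using assms by (auto simp: hermitian_on_def)

lemma J_skew:
  assumes "inner_product b" "\<And>u v. b (J u) (J v) = b u v"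
  shows "b (J u) v = - b u (J v)" "b (J u) u = 0" "b u (J u) = 0"
proof -
  show *: "b (J u) v = - b u (J v)" for u v
    using assms(2)[of u "J v"] by (simp add: J_alg ip_lin[OF assms(1)])
  show "b (J u) u = 0" "b u (J u) = 0"
    using *[of u u] inner_productD(2)[OF assms(1), of "J u" u] by simp_all
qed

lemma nabla_J_christoffel:
  assumes "hermitian_on S G" "x \<in> S"
  shows "nabla_J G x u v = christoffel G x u (J v) - J (christoffel G x u v)"
proof -
  have "D (\<lambda>y. J v) x u = 0" by (simp add: D_eqI[OF has_derivative_const])
  moreover have "D (\<lambda>y. y) x u = u" by (simp add: D_eqI[OF has_derivative_ident])
  ultimately show ?thesis by (simp add: nabla_J_def cov_end_along_def)
qed

text \<open>Differentiate the skewness of \<open>J\<close>; the connection is metric.\<close>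

lemma nabla_J_skew:
  assumes h: "hermitian_on S G" and x: "x \<in> S"
  shows "G x (nabla_J G x u v) w = - G x v (nabla_J G x u w)"
proof -
  note m = hermitian_onD(1)[OF h]
  note ip = metric_onD(2)[OF m x] and c = christoffel_metric[OF m x]
  note sk = J_skew(1)[OF ip hermitian_onD(2)[OF h x]]
  have "D (\<lambda>y. G y (J v) w) x u + D (\<lambda>y. G y v (J w)) x u = 0"
  proof -
    have "((\<lambda>y. G y (J v) w + G y v (J w)) has_derivative (\<lambda>u. D (\<lambda>y. G y (J v) w) x u + D (\<lambda>y. G y v (J w)) x u)) (at x)"
      using metric_onD(5)[OF m x] by (intro has_derivative_add) (simp_all add: frechet_derivative_works)
    then have "D (\<lambda>y. G y (J v) w + G y v (J w)) x u = D (\<lambda>y. G y (J v) w) x u + D (\<lambda>y. G y v (J w)) x u"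
      by (rule D_eqI)
    moreover have "D (\<lambda>y. G y (J v) w + G y v (J w)) x = D (\<lambda>y. 0) x"
      using J_skew(1)[OF metric_onD(2)[OF m] hermitian_onD(2)[OF h]]
      by (intro D_cong_open[OF metric_onD(1)[OF m] x]) simp
    moreover have "D (\<lambda>y. 0 :: real) x u = 0" by (simp add: D_eqI[OF has_derivative_const])
    ultimately show ?thesis by simp
  qed
  then show ?thesis
    unfolding c nabla_J_christoffel[OF h x] ip_lin[OF ip]
    using sk[of "christoffel G x u v" w] sk[of v "christoffel G x u w"] by linarith
qed

lemma nabla_J_J:
  assumes h: "hermitian_on S G" and x: "x \<in> S"
  shows "nabla_J G x u (J v) = - J (nabla_J G x u v)"
  by (simp add: nabla_J_christoffel[OF h x] J_alg bilinear_rneg[OF christoffel_bilinear[OF hermitian_onD(1)[OF h] x]])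

lemma bilinear_nabla_J:
  assumes h: "hermitian_on S G" and x: "x \<in> S"
  shows "bilinear (nabla_J G x)"
proof -
  note b = christoffel_bilinear[OF hermitian_onD(1)[OF h] x]
  show ?thesis
    unfolding bilinear_def nabla_J_christoffel[OF h x]
    by (intro conjI allI linearI)
      (simp_all add: J_alg bilinear_ladd[OF b] bilinear_radd[OF b] bilinear_lmul[OF b] bilinear_rmul[OF b] algebra_simps)
qed

lemma cov_along_J:
  assumes h: "hermitian_on S G" and y: "f y \<in> S" and W: "W differentiable (at y)"
  shows "cov_along G f a (\<lambda>y. J (W y)) y = J (cov_along G f a W y) + nabla_J G (f y) (D f y a) (W y)"
proof -
  have "D (\<lambda>y. J (W y)) y a = J (D W y a)"
    using W by (intro D_eqI bounded_linear.has_derivative[OF bounded_linear_J]) (simp add: frechet_derivative_works)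
  then show ?thesis by (simp add: cov_along_def nabla_J_christoffel[OF h y] J_alg)
qed

lemma orthogonal_card_le:
  fixes b :: "'a::euclidean_space \<Rightarrow> 'a \<Rightarrow> real"
  assumes b: "inner_product b" and fin: "finite A" and n0: "0 \<notin> A"
    and o: "\<And>u v. u \<in> A \<Longrightarrow> v \<in> A \<Longrightarrow> u \<noteq> v \<Longrightarrow> b u v = 0"
  shows "card A \<le> DIM('a)"
proof -
  have "independent A"
    unfolding dependent_finite[OF fin]
  proof (intro notI, elim exE conjE bexE)
    fix c v assume v: "v \<in> A" "c v \<noteq> 0" and s: "(\<Sum>u\<in>A. c u *\<^sub>R u) = 0"
    have "0 = b (\<Sum>u\<in>A. c u *\<^sub>R u) v" using s by (simp add: ip_lin[OF b])
    also have "\<dots> = (\<Sum>u\<in>A. c u * b u v)"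
      by (simp add: linear_sum[OF inner_productD(5)[OF b]] ip_lin[OF b])
    also have "\<dots> = (\<Sum>u\<in>A. if u = v then c u * b u v else 0)"
      using o v(1) by (intro sum.cong) auto
    also have "\<dots> = c v * b v v" using v(1) fin by simp
    finally show False using v n0 inner_productD(3)[OF b, of v] by auto
  qed
  then show ?thesis by (rule independent_card_le)
qed

text \<open>Otherwise \<open>v\<close>, \<open>J v\<close>, \<open>w\<close>, \<open>J w\<close>, \<open>k\<close> would be five orthogonal nonzero vectors in real dimension four.\<close>

lemma orthogonal_complex_lines:
  assumes b: "inner_product b" and h: "\<And>u v. b (J u) (J v) = b u v"
    and v: "v \<noteq> 0" and w: "w \<noteq> 0" "b w v = 0" "b w (J v) = 0"
    and k: "b k v = 0" "b k (J v) = 0" "b k w = 0" "b k (J w) = 0"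
  shows "k = 0"
proof (rule ccontr)
  assume k0: "k \<noteq> 0"
  note sk = J_skew[OF b h] and sym = inner_productD(2)[OF b]
  have J0: "J v \<noteq> 0" "J w \<noteq> 0" using v w J_alg(5)[of v] J_alg(5)[of w] J_alg(6) by force+
  have orth: "b v w = 0" "b (J v) w = 0" "b v k = 0" "b (J v) k = 0" "b w k = 0" "b (J w) k = 0"
    "b v (J v) = 0" "b (J v) v = 0" "b w (J w) = 0" "b (J w) w = 0" "b v (J w) = 0" "b (J w) v = 0" "b (J v) (J w) = 0" "b (J w) (J v) = 0"
    using w k sk sym h by (metis neg_equal_0_iff_equal)+
  have ne: "x \<noteq> y" if "b x y = 0" "x \<noteq> 0" for x y using that inner_productD(3)[OF b, of x] by auto
  have dist: "v \<noteq> J v" "v \<noteq> w" "v \<noteq> J w" "v \<noteq> k" "J v \<noteq> w" "J v \<noteq> J w" "J v \<noteq> k" "w \<noteq> J w" "w \<noteq> k" "J w \<noteq> k"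
    using ne orth v w(1) k0 J0 by metis+
  have "card {v, J v, w, J w, k} \<le> DIM(complex^2)"
    using v w k k0 J0 orth by (intro orthogonal_card_le[OF b]) auto
  moreover have "card {v, J v, w, J w, k} = 5" using dist by simp
  ultimately show False by simp
qed

text \<open>A skew endomorphism that anticommutes with \<open>J\<close> and kills one vector \<open>X\<close> kills the complex line of \<open>X\<close>; on the
  orthogonal complex line \<open>\<langle>v, J v\<rangle>\<close> it vanishes because \<open>P v\<close> is orthogonal to both \<open>v\<close> and \<open>J v\<close>.\<close>

lemma skew_antilinear_zero:
  assumes b: "inner_product b" and h: "\<And>u v. b (J u) (J v) = b u v"
    and P: "linear P" "\<And>u v. b (P u) v = - b u (P v)" "\<And>v. P (J v) = - J (P v)"
    and X: "X \<noteq> 0" "P X = 0"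
  shows "P v = 0"
proof -
  note sk = J_skew[OF b h] and sym = inner_productD(2)[OF b]
  have PJX: "P (J X) = 0" using X P(3) by (simp add: J_alg)
  define v' where "v' = v - (b v X / b X X) *\<^sub>R X - (b v (J X) / b X X) *\<^sub>R J X"
  have bX: "b X X \<noteq> 0" using inner_productD(3)[OF b X(1)] by simp
  have Pv: "P v' = P v"
    unfolding v'_def linear_diff[OF P(1)] linear_scale[OF P(1)] by (simp add: X PJX)
  have o: "b v' X = 0" "b v' (J X) = 0"
    using bX by (simp_all add: v'_def ip_lin[OF b] sk h J_alg)
  show ?thesis
  proof (cases "v' = 0")
    case True
    then show ?thesis using Pv linear_0[OF P(1)] by simp
  next
    case False
    have "P v' = 0"
    proof (rule orthogonal_complex_lines[OF b h X(1) False o])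
      show "b (P v') X = 0" "b (P v') (J X) = 0" by (simp_all add: P(2)[of v'] X PJX ip_lin[OF b])
      show "b (P v') v' = 0" using P(2)[of v' v'] sym[of v' "P v'"] by simp
      have "b (P v') (J v') = b v' (J (P v'))" using P(2)[of v' "J v'"] P(3)[of v'] by (simp add: ip_lin[OF b])
      also have "\<dots> = - b (P v') (J v')" using sk(1)[of "P v'" v'] sym[of "J (P v')" v'] by simp
      finally show "b (P v') (J v') = 0" by simp
    qed
    then show ?thesis using Pv by simp
  qed
qed

subsection \<open>Tangent planes\<close>

lemma real2_expansion: "(x::real^2) = x $ 1 *\<^sub>R axis 1 1 + x $ 2 *\<^sub>R axis 2 1"
  by (simp add: vec_eq_iff forall_2 axis_def)

lemma alternating_plane:
  fixes \<eta> :: "real^2 \<Rightarrow> real^2 \<Rightarrow> 'c::real_vector"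
  assumes b: "bilinear \<eta>" and alt: "\<And>a. \<eta> a a = 0"
  shows "\<eta> a c = (a $ 1 * c $ 2 - a $ 2 * c $ 1) *\<^sub>R \<eta> (axis 1 1) (axis 2 1)"
proof -
  have "\<eta> (axis 1 1 + axis 2 1) (axis 1 1 + axis 2 1) = \<eta> (axis 1 1) (axis 1 1) + \<eta> (axis 2 1) (axis 1 1)
      + (\<eta> (axis 1 1) (axis 2 1) + \<eta> (axis 2 1) (axis 2 1))"
    by (simp only: bilinear_ladd[OF b] bilinear_radd[OF b])
  then have s: "\<eta> (axis 2 1) (axis 1 1) = - \<eta> (axis 1 1) (axis 2 1)"
    by (simp add: alt eq_neg_iff_add_eq_0)
  have "\<eta> a c = \<eta> (a $ 1 *\<^sub>R axis 1 1 + a $ 2 *\<^sub>R axis 2 1) (c $ 1 *\<^sub>R axis 1 1 + c $ 2 *\<^sub>R axis 2 1)"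
    by (rule arg_cong2[where f=\<eta>, OF real2_expansion real2_expansion])
  also have "\<dots> = (a $ 1 * c $ 2) *\<^sub>R \<eta> (axis 1 1) (axis 2 1) + (a $ 2 * c $ 1) *\<^sub>R \<eta> (axis 2 1) (axis 1 1)"
    by (simp add: bilinear_ladd[OF b] bilinear_radd[OF b] bilinear_lmul[OF b] bilinear_rmul[OF b] alt mult.commute)
  finally show ?thesis unfolding s by (simp add: scaleR_diff_left)
qed

lemma kahler_form_alternating:
  fixes L :: "real^2 \<Rightarrow> complex^2"
  assumes b: "inner_product b" and h: "\<And>u v. b (J u) (J v) = b u v" and L: "linear L"
  shows "b (J (L a)) (L c) = (a $ 1 * c $ 2 - a $ 2 * c $ 1) * b (J (L (axis 1 1))) (L (axis 2 1))"
  using alternating_plane[of "\<lambda>a c. b (J (L a)) (L c)" a c]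
  by (simp add: bilinear_def linear_iff ip_lin[OF b] J_alg linear_add[OF L] linear_scale[OF L] J_skew(2)[OF b h])

lemma induced_inner_product:
  assumes b: "inner_product (G (f x))" and f: "f differentiable (at x)" and i: "inj (D f x)"
  shows "inner_product (induced_metric G f x)"
proof -
  have L: "linear (D f x)" by (rule linear_D[OF f])
  have "D f x u \<noteq> 0" if "u \<noteq> 0" for u using that i L linear_injective_0 by blast
  then show ?thesis
    unfolding inner_product_def bilinear_def induced_metric_def
    using b inner_productD(2,3)[OF b]
    by (auto intro!: linearI simp: linear_add[OF L] linear_scale[OF L] ip_lin[OF b])
qed

lemma tangential_works:
  assumes b: "inner_product (G (f x))" and f: "f differentiable (at x)" and i: "inj (D f x)"
  shows "G (f x) (tangential G f x v) (D f x c) = G (f x) v (D f x c)"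
proof -
  have L: "linear (D f x)" by (rule linear_D[OF f])
  have "linear (\<lambda>c. G (f x) v (D f x c))"
    by (intro linearI) (simp_all add: linear_add[OF L] linear_scale[OF L] ip_lin[OF b])
  from sharp_works[where b="induced_metric G f x", OF induced_inner_product[where G=G and f=f, OF assms] this, of c]
  show ?thesis by (simp add: tangential_def induced_metric_def)
qed

text \<open>Since \<open>P = \<nabla>\<^sub>X J\<close> is skew and anticommutes with \<open>J\<close>, the vector \<open>P X\<close> is orthogonal to \<open>X\<close> and to \<open>J X\<close>; as it is tangent
  to the surface and the Kaehler form does not vanish there, \<open>P X = 0\<close>, and \<open>P = 0\<close> by the previous lemma.\<close>

lemma nabla_J_tangent_eq_0:
  fixes f :: "real^2 \<Rightarrow> complex^2"
  assumes h: "hermitian_on S G" and y: "f y \<in> S" and f: "f differentiable (at y)"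
    and w: "G (f y) (J (D f y (axis 1 1))) (D f y (axis 2 1)) \<noteq> 0"
    and sy: "\<And>a b. normal_part G f y (nabla_J G (f y) (D f y a) (D f y b) + nabla_J G (f y) (D f y b) (D f y a)) = 0"
  shows "nabla_J G (f y) (D f y a) v = 0"
proof -
  let ?b = "G (f y)" and ?P = "nabla_J G (f y) (D f y a)" and ?X = "D f y a"
  note ip = metric_onD(2)[OF hermitian_onD(1)[OF h] y] and hj = hermitian_onD(2)[OF h y]
  note bil = bilinear_nabla_J[OF h y]
  have L: "linear (D f y)" by (rule linear_D[OF f])
  show ?thesis
  proof (cases "?X = 0")
    case True
    then show ?thesis using bilinear_lzero[OF bil] by simp
  next
    case False
    define z where "z = sharp (induced_metric G f y) (\<lambda>b. ?b (?P ?X + ?P ?X) (D f y b))"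
    \<comment> \<open>the hypothesis on the normal part, for \<open>b = a\<close>\<close>
    have "?P ?X + ?P ?X = D f y z"
      using sy[of a a] by (simp add: normal_part_def tangential_def z_def)
    then have "?P ?X = (1/2) *\<^sub>R D f y z" by (metis scaleR_half_double)
    then have Z: "?P ?X = D f y ((1/2) *\<^sub>R z)" by (simp add: linear_scale[OF L])
    define c where "c = (1/2) *\<^sub>R z"
    note Z = Z[folded c_def]
    have sk: "?b (?P u) v = - ?b u (?P v)" for u v by (rule nabla_J_skew[OF h y])
    have orthX: "?b (?P ?X) ?X = 0" using sk[of ?X ?X] inner_productD(2)[OF ip, of ?X "?P ?X"] by simp
    \<comment> \<open>moving \<open>P\<close> and then \<open>J\<close> to the other factor changes the sign three times in total\<close>
    have "?b (J ?X) (?P ?X) = - ?b (J ?X) (?P ?X)"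
    proof -
      have "?b (J ?X) (?P ?X) = - ?b (?P (J ?X)) ?X" using sk[of "J ?X" ?X] by simp
      also have "\<dots> = ?b (J (?P ?X)) ?X" by (simp add: nabla_J_J[OF h y] ip_lin[OF ip])
      also have "\<dots> = - ?b (?P ?X) (J ?X)" by (rule J_skew(1)[OF ip hj])
      finally show ?thesis using inner_productD(2)[OF ip, of "J ?X" "?P ?X"] by simp
    qed
    then have "?b (J ?X) (D f y c) = 0" by (simp add: Z)
    then have det: "a $ 1 * c $ 2 - a $ 2 * c $ 1 = 0"
      using kahler_form_alternating[OF ip hj L, of a c] w by simp
    have "a \<noteq> 0" using False linear_0[OF L] by auto
    \<comment> \<open>an area form of the plane vanishes on parallel vectors only\<close>
    have "\<exists>r. c = r *\<^sub>R a"
    proof (cases "a $ 1 = 0")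
      case True
      then have a2: "a $ 2 \<noteq> 0" using \<open>a \<noteq> 0\<close> by (auto simp: vec_eq_iff forall_2)
      then have "c $ 1 = 0" using det True by simp
      then show ?thesis using a2 True by (intro exI[of _ "c $ 2 / a $ 2"]) (simp add: vec_eq_iff forall_2)
    next
      case False
      then have "c $ 2 = a $ 2 * c $ 1 / a $ 1" using det by (simp add: field_simps)
      then show ?thesis using False by (intro exI[of _ "c $ 1 / a $ 1"]) (simp add: vec_eq_iff forall_2)
    qed
    then obtain r where "c = r *\<^sub>R a" by blast
    then have r: "?P ?X = r *\<^sub>R ?X" using Z linear_scale[OF L] by simp
    then have "r * ?b ?X ?X = 0" using orthX by (simp add: ip_lin[OF ip])
    then have "r = 0" using inner_productD(3)[OF ip False] by simp
    then have PX: "?P ?X = 0" using r by simp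
    have "linear ?P" using bil by (simp add: bilinear_def)
    from skew_antilinear_zero[where b="?b" and P="?P" and X="?X", OF ip hj this sk nabla_J_J[OF h y] False PX]
    show ?thesis .
  qed
qed

text \<open>In the cyclic condition for the normal part of \<open>V\<close>, two of the three terms are derivatives of \<open>J\<close> in tangent directions
  and vanish; the tangential part of \<open>V\<close> does not contribute for the same reason.\<close>

lemma nabla_J_area_component_eq_0:
  fixes f :: "real^2 \<Rightarrow> complex^2"
  assumes h: "hermitian_on S G" and y: "f y \<in> S" and f: "f differentiable (at y)" "inj (D f y)"
    and tan0: "\<And>a v. nabla_J G (f y) (D f y a) v = 0"
    and cyc: "\<And>a b \<xi>. is_normal G f y \<xi> \<Longrightarrow>
      G (f y) (nabla_J G (f y) \<xi> (D f y a)) (D f y b) + G (f y) (nabla_J G (f y) (D f y a) (D f y b)) \<xi>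
      + G (f y) (nabla_J G (f y) (D f y b) \<xi>) (D f y a) = 0"
  shows "G (f y) (nabla_J G (f y) V (D f y a)) (D f y b) = 0"
proof -
  note ip = metric_onD(2)[OF hermitian_onD(1)[OF h] y]
  note bil = bilinear_nabla_J[OF h y]
  let ?\<xi> = "normal_part G f y V"
  have "is_normal G f y ?\<xi>"
    unfolding is_normal_def normal_part_def using tangential_works[where G=G and f=f, OF ip f] by (simp add: ip_lin[OF ip])
  from cyc[OF this, of a b] have "G (f y) (nabla_J G (f y) ?\<xi> (D f y a)) (D f y b) = 0"
    by (simp add: tan0 ip_lin[OF ip])
  moreover have "V = ?\<xi> + D f y (sharp (induced_metric G f y) (\<lambda>b. G (f y) V (D f y b)))"
    by (simp add: normal_part_def tangential_def)
  then have "nabla_J G (f y) V (D f y a) = nabla_J G (f y) ?\<xi> (D f y a)"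
    using bilinear_ladd[OF bil] tan0 by (metis add.right_neutral)
  ultimately show ?thesis by simp
qed

subsection \<open>Rules for derivatives of real functions\<close>

lemma D_arith:
  fixes p q :: "'a::euclidean_space \<Rightarrow> real"
  assumes "smooth_on U p" "smooth_on U q" "y \<in> U"
  shows "D (\<lambda>y. p y + q y) y a = D p y a + D q y a"
    "D (\<lambda>y. p y - q y) y a = D p y a - D q y a"
    "D (\<lambda>y. p y * q y) y a = D p y a * q y + p y * D q y a"
    "D (\<lambda>y. - p y) y a = - D p y a"
proof -
  have d: "(p has_derivative D p y) (at y)" "(q has_derivative D q y) (at y)"
    using assms smooth_on_has_derivative by blast+
  show "D (\<lambda>y. p y + q y) y a = D p y a + D q y a"
    by (rule D_eqI[OF has_derivative_add[OF d]])
  show "D (\<lambda>y. p y - q y) y a = D p y a - D q y a"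
    by (rule D_eqI[OF has_derivative_diff[OF d]])
  show "D (\<lambda>y. p y * q y) y a = D p y a * q y + p y * D q y a"
    using D_eqI[OF has_derivative_mult[OF d]] by simp
  show "D (\<lambda>y. - p y) y a = - D p y a"
    by (rule D_eqI[OF has_derivative_minus[OF d(1)]])
qed

lemma D_const: "D (\<lambda>_. c) y a = 0"
  by (simp add: D_eqI[OF has_derivative_const])

lemma D_powr:
  fixes p :: "'a::euclidean_space \<Rightarrow> real"
  assumes "smooth_on U p" "y \<in> U" "p y > 0"
  shows "D (\<lambda>y. p y powr r) y a = r * p y powr (r - 1) * D p y a"
proof -
  have "((\<lambda>s. s powr r) has_derivative (\<lambda>v. (r * p y powr (r - 1)) * v)) (at (p y))"
    using has_real_derivative_powr[OF assms(3), of r] by (simp add: has_field_derivative_def)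
  from has_derivative_compose[OF smooth_on_has_derivative[OF assms(1,2)] this]
  show ?thesis by (rule D_eqI)
qed

section \<open>Surfaces along which the complex structure is parallel\<close>

lemma scaleR_cov_along:
  assumes b: "bilinear (christoffel G (f y))"
    and "c differentiable (at y)" "W differentiable (at y)"
  shows "cov_along G f a (\<lambda>y. c y *\<^sub>R W y) y = D c y a *\<^sub>R W y + c y *\<^sub>R cov_along G f a W y"
proof -
  have "D (\<lambda>y. c y *\<^sub>R W y) y a = c y *\<^sub>R D W y a + D c y a *\<^sub>R W y"
    using assms by (intro D_eqI[OF has_derivative_scaleR]) (simp_all add: frechet_derivative_works)
  then show ?thesis by (simp add: cov_along_def bilinear_rmul[OF b] scaleR_add_right)
qed

lemma add_cov_along:
  assumes b: "bilinear (christoffel G (f y))"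
    and "V differentiable (at y)" "W differentiable (at y)"
  shows "cov_along G f a (\<lambda>y. V y + W y) y = cov_along G f a V y + cov_along G f a W y"
proof -
  have "D (\<lambda>y. V y + W y) y a = D V y a + D W y a"
    using assms by (intro D_eqI[OF has_derivative_add]) (simp_all add: frechet_derivative_works)
  then show ?thesis by (simp add: cov_along_def bilinear_radd[OF b])
qed

text \<open>A surface in one chart along which \<open>J\<close> is parallel, together with two constant coordinate directions \<open>a1\<close>, \<open>a2\<close>. They stay
  arbitrary because they are used twice: as the coordinate axes, for the first variation, and as the directions of an
  adapted frame at a point, for the Laplacian.\<close>

locale parallel_surface =
  fixes S :: "(complex^2) set" and G :: "(complex^2) metric" and U :: "(real^2) set"
    and f :: "real^2 \<Rightarrow> complex^2" and a1 a2 :: "real^2"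
  assumes herm: "hermitian_on S G" and open_U: "open U" and smooth_f: "smooth_on U f"
    and f_in: "\<And>y. y \<in> U \<Longrightarrow> f y \<in> S"
    and parallel: "\<And>y a v. y \<in> U \<Longrightarrow> nabla_J G (f y) (D f y a) v = 0"
    and ndg: "\<And>y. y \<in> U \<Longrightarrow> G (f y) (D f y a1) (D f y a1) * G (f y) (D f y a2) (D f y a2)
        - (G (f y) (D f y a1) (D f y a2))\<^sup>2 > 0"
begin

abbreviation "X1 \<equiv> \<lambda>y. D f y a1"
abbreviation "X2 \<equiv> \<lambda>y. D f y a2"
abbreviation "N1 \<equiv> cov_along G f a1"
abbreviation "N2 \<equiv> cov_along G f a2"

definition "g11 y = G (f y) (X1 y) (X1 y)"
definition "g12 y = G (f y) (X1 y) (X2 y)"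
definition "g22 y = G (f y) (X2 y) (X2 y)"
definition "gdet y = g11 y * g22 y - g12 y * g12 y"

\<comment> \<open>the Gram-Schmidt frame of the tangent plane and the coefficients of \<open>X1\<close>, \<open>X2\<close> in it; \<open>u\<close> will be \<open>cos \<alpha>\<close>\<close>
definition "E1 y = (1 / sqrt (g11 y)) *\<^sub>R X1 y"
definition "c21 y = G (f y) (X2 y) (E1 y)"
definition "E2 y = (sqrt (g11 y) / sqrt (gdet y)) *\<^sub>R (X2 y - c21 y *\<^sub>R E1 y)"
definition "c11 y = sqrt (g11 y)"
definition "c22 y = sqrt (gdet y) / sqrt (g11 y)"
definition "u y = G (f y) (J (E1 y)) (E2 y)"

lemma metric: "metric_on S G" using hermitian_onD(1)[OF herm] .
lemma ip: "y \<in> U \<Longrightarrow> inner_product (G (f y))" using metric_onD(2)[OF metric f_in] .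
lemma hj: "y \<in> U \<Longrightarrow> G (f y) (J v) (J w) = G (f y) v w" using hermitian_onD(2)[OF herm f_in] .
lemma bilG: "y \<in> U \<Longrightarrow> bilinear (christoffel G (f y))" using christoffel_bilinear[OF metric f_in] .

lemma smooth_ip: "smooth_on U V \<Longrightarrow> smooth_on U W \<Longrightarrow> smooth_on U (\<lambda>y. G (f y) (V y) (W y))"
  by (rule smooth_on_bilinear_family[where S=S and h=G and f=f and V=V and W=W, OF metric_onD(4)[OF metric] metric_onD(3)[OF metric] open_U smooth_f f_in])

lemma smooth_N: "smooth_on U W \<Longrightarrow> smooth_on U (cov_along G f a W)"
  by (rule smooth_on_cov_along[OF metric open_U f_in smooth_f])

lemma D_ip:
  assumes "smooth_on U V" "smooth_on U W" "y \<in> U"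
  shows "D (\<lambda>y. G (f y) (V y) (W y)) y a = G (f y) (cov_along G f a V y) (W y) + G (f y) (V y) (cov_along G f a W y)"
  by (rule D_eqI[OF cov_along_metric[where V=V and W=W, OF metric f_in[OF assms(3)] smooth_on_imp_differentiable[OF smooth_f assms(3)]
          smooth_on_imp_differentiable[OF assms(1,3)] smooth_on_imp_differentiable[OF assms(2,3)]]])

lemma N_J:
  assumes "smooth_on U W" "y \<in> U"
  shows "cov_along G f a (\<lambda>y. J (W y)) y = J (cov_along G f a W y)"
  using cov_along_J[where W=W and f=f, OF herm f_in[OF assms(2)] smooth_on_imp_differentiable[OF assms], of a] parallel[OF assms(2)] by simp

lemma N_scaleR:
  assumes "smooth_on U c" "smooth_on U W" "y \<in> U"
  shows "cov_along G f a (\<lambda>y. c y *\<^sub>R W y) y = D c y a *\<^sub>R W y + c y *\<^sub>R cov_along G f a W y"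
  by (rule scaleR_cov_along[where f=f and G=G and y=y, OF bilG[OF assms(3)] smooth_on_imp_differentiable[OF assms(1,3)]
      smooth_on_imp_differentiable[OF assms(2,3)]])

lemma N_add:
  assumes "smooth_on U V" "smooth_on U W" "y \<in> U"
  shows "cov_along G f a (\<lambda>y. V y + W y) y = cov_along G f a V y + cov_along G f a W y"
  by (rule add_cov_along[where f=f and G=G and y=y, OF bilG[OF assms(3)] smooth_on_imp_differentiable[OF assms(1,3)]
      smooth_on_imp_differentiable[OF assms(2,3)]])

lemma gdet_pos: "y \<in> U \<Longrightarrow> gdet y > 0"
  using ndg[of y] by (simp add: gdet_def g11_def g12_def g22_def power2_eq_square)

lemma g11_pos: assumes "y \<in> U" shows "g11 y > 0"
proof -
  have "g11 y \<noteq> 0"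
  proof
    assume "g11 y = 0"
    then have "gdet y = - (g12 y)\<^sup>2" by (simp add: gdet_def power2_eq_square)
    then show False using gdet_pos[OF assms] zero_le_power2[of "g12 y"] by linarith
  qed
  moreover have "g11 y \<ge> 0" unfolding g11_def by (rule inner_productD(17)[OF ip[OF assms]])
  ultimately show ?thesis by simp
qed

lemma c_pos:
  assumes "y \<in> U"
  shows "c11 y > 0" "c22 y > 0" "sqrt (gdet y) = c11 y * c22 y"
  using g11_pos[OF assms] gdet_pos[OF assms] by (simp_all add: c11_def c22_def)

lemma smooth_X: "smooth_on U X1" "smooth_on U X2"
  using smooth_on_D[OF smooth_f] by auto

lemma smooth_g: "smooth_on U g11" "smooth_on U g12" "smooth_on U g22" "smooth_on U gdet"
proof -
  show g: "smooth_on U g11" "smooth_on U g12" "smooth_on U g22"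
    unfolding g11_def[abs_def] g12_def[abs_def] g22_def[abs_def] by (rule smooth_ip; rule smooth_X)+
  show "smooth_on U gdet"
    unfolding gdet_def[abs_def] by (intro smooth_intros g open_U)
qed

lemma smooth_E1: "smooth_on U E1"
  unfolding E1_def[abs_def] using g11_pos
  by (intro smooth_on_scaleR smooth_on_divide smooth_on_sqrt smooth_on_const smooth_g smooth_X open_U) simp_all

lemma smooth_c: "smooth_on U c11" "smooth_on U c21" "smooth_on U c22"
proof -
  show "smooth_on U c11" unfolding c11_def[abs_def] by (intro smooth_on_sqrt smooth_g open_U g11_pos)
  show "smooth_on U c21" unfolding c21_def[abs_def] by (intro smooth_ip smooth_X smooth_E1)
  show "smooth_on U c22" unfolding c22_def[abs_def]
    using g11_pos gdet_pos by (intro smooth_on_divide smooth_on_sqrt smooth_g open_U) simp_all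
qed

lemma smooth_E2: "smooth_on U E2"
  unfolding E2_def[abs_def] using g11_pos gdet_pos
  by (intro smooth_on_scaleR smooth_on_diff smooth_on_divide smooth_on_sqrt smooth_on_const smooth_g smooth_X smooth_E1 smooth_c open_U) simp_all

lemmas smooth_E = smooth_E1 smooth_E2
lemmas smooth_JE = smooth_on_J[OF smooth_E1 open_U] smooth_on_J[OF smooth_E2 open_U]

lemma smooth_u: "smooth_on U u"
  unfolding u_def[abs_def] by (intro smooth_ip smooth_E smooth_JE)

lemma X_E:
  assumes y: "y \<in> U"
  shows "X1 y = c11 y *\<^sub>R E1 y" "X2 y = c21 y *\<^sub>R E1 y + c22 y *\<^sub>R E2 y"
  using g11_pos[OF y] gdet_pos[OF y] by (auto simp: c11_def c22_def E1_def E2_def)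

lemma orthonormal:
  assumes y: "y \<in> U"
  shows "G (f y) (E1 y) (E1 y) = 1" "G (f y) (E1 y) (E2 y) = 0" "G (f y) (E2 y) (E1 y) = 0" "G (f y) (E2 y) (E2 y) = 1"
proof -
  note i = ip[OF y] and p = g11_pos[OF y] gdet_pos[OF y]
  have sq: "sqrt (g11 y) * sqrt (g11 y) = g11 y" "sqrt (gdet y) * sqrt (gdet y) = gdet y"
    using p by simp_all
  show 11: "G (f y) (E1 y) (E1 y) = 1"
    using p sq by (simp add: E1_def ip_lin[OF i] flip: g11_def)
  show 21: "G (f y) (E2 y) (E1 y) = 0"
    by (simp add: E2_def ip_lin[OF i] 11 flip: c21_def)
  then show "G (f y) (E1 y) (E2 y) = 0" using inner_productD(2)[OF i, of "E1 y" "E2 y"] by simp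
  have "G (f y) (X2 y) (X1 y) = g12 y" unfolding g12_def by (rule inner_productD(2)[OF i])
  then have c21: "c21 y = g12 y / sqrt (g11 y)"
    by (simp add: c21_def E1_def ip_lin[OF i])
  have "G (f y) (X2 y - c21 y *\<^sub>R E1 y) (X2 y - c21 y *\<^sub>R E1 y) = g22 y - c21 y * c21 y"
    using inner_productD(2)[OF i, of "X2 y" "E1 y"]
    by (simp add: ip_lin[OF i] 11 flip: g22_def) (simp add: c21_def algebra_simps)
  also have "c21 y * c21 y = g12 y * g12 y / g11 y" unfolding c21 using sq by simp
  also have "g22 y - g12 y * g12 y / g11 y = gdet y / g11 y" using p by (simp add: gdet_def field_simps)
  finally have n: "G (f y) (X2 y - c21 y *\<^sub>R E1 y) (X2 y - c21 y *\<^sub>R E1 y) = gdet y / g11 y" .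
  have "G (f y) (E2 y) (E2 y) = (sqrt (g11 y) / sqrt (gdet y)) * ((sqrt (g11 y) / sqrt (gdet y)) * (gdet y / g11 y))"
    unfolding n[symmetric] E2_def by (simp only: inner_productD(8,13)[OF i])
  then show "G (f y) (E2 y) (E2 y) = 1" using p sq by (simp add: field_simps)
qed

lemma g_c:
  assumes y: "y \<in> U"
  shows "g11 y = c11 y * c11 y" "g12 y = c11 y * c21 y" "g22 y = c21 y * c21 y + c22 y * c22 y"
  unfolding g11_def g12_def g22_def X_E[OF y]
  by (simp_all add: ip_lin[OF ip[OF y]] orthonormal[OF y])

lemma u_eq:
  assumes y: "y \<in> U"
  shows "u y = G (f y) (J (X1 y)) (X2 y) / sqrt (gdet y)"
proof -
  note i = ip[OF y]
  have "G (f y) (J (X1 y)) (X2 y) = c11 y * c22 y * u y"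
    unfolding X_E[OF y] u_def by (simp add: J_alg ip_lin[OF i] J_skew(2)[OF i hj[OF y]])
  then show ?thesis using c_pos[OF y] by simp
qed

text \<open>The one-form \<open>\<theta>\<close> does not appear in the Euler-Lagrange equation. It is chosen so that it pairs the second fundamental form
  with the normal parts \<open>\<eta>1\<close>, \<open>\<eta>2\<close> of \<open>J E1\<close>, \<open>J E2\<close>, while its expression by the connection and the parallel \<open>J\<close>
  makes its exterior derivative computable.\<close>

definition "\<theta> k y = G (f y) (cov_along G f k E1 y) (J (E1 y)) + G (f y) (cov_along G f k E2 y) (J (E2 y))
   - 2 * (u y * G (f y) (cov_along G f k E1 y) (E2 y))"

definition "\<eta>1 y = J (E1 y) - u y *\<^sub>R E2 y"
definition "\<eta>2 y = J (E2 y) + u y *\<^sub>R E1 y"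

lemma smooth_theta: "smooth_on U (\<theta> k)"
  unfolding \<theta>_def[abs_def]
  by (intro smooth_on_add smooth_on_diff smooth_on_mult smooth_on_const smooth_u smooth_ip smooth_N smooth_E smooth_JE open_U)

lemma cov_along_E:
  assumes y: "y \<in> U"
  shows "G (f y) (cov_along G f k E1 y) (E1 y) = 0" "G (f y) (cov_along G f k E2 y) (E2 y) = 0"
    "G (f y) (cov_along G f k E2 y) (E1 y) = - G (f y) (cov_along G f k E1 y) (E2 y)"
proof -
  note i = ip[OF y] and s = inner_productD(2)[OF ip[OF y]]
  have z: "G (f y) (cov_along G f k V y) (W y) + G (f y) (V y) (cov_along G f k W y) = 0"
    if "smooth_on U V" "smooth_on U W" "\<And>z. z \<in> U \<Longrightarrow> G (f z) (V z) (W z) = c" for V W c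
  proof -
    have "D (\<lambda>y. G (f y) (V y) (W y)) y = D (\<lambda>y. c) y"
      by (rule D_cong_open[OF open_U y]) (rule that(3))
    then show ?thesis using D_ip[OF that(1,2) y, of k] D_const[of c y k] by simp
  qed
  show "G (f y) (cov_along G f k E1 y) (E1 y) = 0"
    using z[OF smooth_E1 smooth_E1 orthonormal(1)] s[of "E1 y" "cov_along G f k E1 y"] by simp
  show "G (f y) (cov_along G f k E2 y) (E2 y) = 0"
    using z[OF smooth_E2 smooth_E2 orthonormal(4)] s[of "E2 y" "cov_along G f k E2 y"] by simp
  show "G (f y) (cov_along G f k E2 y) (E1 y) = - G (f y) (cov_along G f k E1 y) (E2 y)"
    using z[OF smooth_E2 smooth_E1 orthonormal(3)] s[of "E2 y" "cov_along G f k E1 y"] by simp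
qed

lemma eta_normal:
  assumes y: "y \<in> U"
  shows "G (f y) (\<eta>1 y) (E1 y) = 0" "G (f y) (\<eta>1 y) (E2 y) = 0" "G (f y) (\<eta>2 y) (E1 y) = 0" "G (f y) (\<eta>2 y) (E2 y) = 0"
    "G (f y) (\<eta>1 y) (J (E1 y)) = 1 - (u y)\<^sup>2" "G (f y) (\<eta>1 y) (J (E2 y)) = 0"
    "G (f y) (\<eta>2 y) (J (E1 y)) = 0" "G (f y) (\<eta>2 y) (J (E2 y)) = 1 - (u y)\<^sup>2"
proof -
  note i = ip[OF y] and s = inner_productD(2)[OF ip[OF y]]
  have J2: "G (f y) (J (E2 y)) (E1 y) = - u y" "G (f y) (E2 y) (J (E1 y)) = u y" "G (f y) (E1 y) (J (E2 y)) = - u y"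
    using J_skew(1)[OF i hj[OF y], of "E2 y" "E1 y"] J_skew(1)[OF i hj[OF y], of "E1 y" "E2 y"] s[of "E2 y" "J (E1 y)"]
    by (simp_all add: u_def)
  note t = ip_lin[OF i] orthonormal[OF y] J2 J_skew(2,3)[OF i hj[OF y]] hj[OF y] power2_eq_square
  show "G (f y) (\<eta>1 y) (E1 y) = 0" "G (f y) (\<eta>1 y) (E2 y) = 0" "G (f y) (\<eta>2 y) (E1 y) = 0" "G (f y) (\<eta>2 y) (E2 y) = 0"
    "G (f y) (\<eta>1 y) (J (E1 y)) = 1 - (u y)\<^sup>2" "G (f y) (\<eta>1 y) (J (E2 y)) = 0"
    "G (f y) (\<eta>2 y) (J (E1 y)) = 0" "G (f y) (\<eta>2 y) (J (E2 y)) = 1 - (u y)\<^sup>2"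
    unfolding \<eta>1_def \<eta>2_def by (simp_all add: t flip: u_def)
qed

lemma theta_eta:
  assumes y: "y \<in> U"
  shows "\<theta> k y = G (f y) (cov_along G f k E1 y) (\<eta>1 y) + G (f y) (cov_along G f k E2 y) (\<eta>2 y)"
  unfolding \<theta>_def \<eta>1_def \<eta>2_def by (simp add: ip_lin[OF ip[OF y]] cov_along_E[OF y])

lemma D_u:
  assumes y: "y \<in> U"
  shows "D u y k = G (f y) (cov_along G f k E2 y) (\<eta>1 y) - G (f y) (cov_along G f k E1 y) (\<eta>2 y)"
proof -
  note i = ip[OF y] and s = inner_productD(2)[OF ip[OF y]]
  have "D u y k = G (f y) (J (cov_along G f k E1 y)) (E2 y) + G (f y) (J (E1 y)) (cov_along G f k E2 y)"
    unfolding u_def[abs_def] D_ip[OF smooth_JE(1) smooth_E2 y] N_J[OF smooth_E1 y] ..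
  then show ?thesis
    unfolding \<eta>1_def \<eta>2_def
    using J_skew(1)[OF i hj[OF y], of "cov_along G f k E1 y" "E2 y"] s[of "J (E1 y)" "cov_along G f k E2 y"]
    by (simp add: ip_lin[OF i] cov_along_E[OF y])
qed

text \<open>Paired with a normal vector, the covariant derivative is linear over functions, because the derivatives of the coefficients
  come with tangent vectors. The third equation is the symmetry of the second fundamental form.\<close>

lemma second_fundamental:
  assumes y: "y \<in> U" and n: "G (f y) V (E1 y) = 0" "G (f y) V (E2 y) = 0"
  shows "G (f y) V (cov_along G f k X1 y) = c11 y * G (f y) V (cov_along G f k E1 y)"
    "G (f y) V (cov_along G f k X2 y) = c21 y * G (f y) V (cov_along G f k E1 y) + c22 y * G (f y) V (cov_along G f k E2 y)"
    "c11 y * G (f y) V (N2 E1 y) = c21 y * G (f y) V (N1 E1 y) + c22 y * G (f y) V (N1 E2 y)"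
proof -
  note i = ip[OF y]
  have cong: "cov_along G f k V y = cov_along G f k W y" if "\<And>z. z \<in> U \<Longrightarrow> V z = W z" for V W k
    unfolding cov_along_def using D_cong_open[OF open_U y, of V W] that[OF y] that by simp
  have 1: "cov_along G f k X1 y = D c11 y k *\<^sub>R E1 y + c11 y *\<^sub>R cov_along G f k E1 y" for k
    using cong[OF X_E(1)] N_scaleR[OF smooth_c(1) smooth_E1 y] by simp
  have "cov_along G f k X2 y = cov_along G f k (\<lambda>y. c21 y *\<^sub>R E1 y + c22 y *\<^sub>R E2 y) y" for k
    by (rule cong[OF X_E(2)])
  then have 2: "cov_along G f k X2 y = (D c21 y k *\<^sub>R E1 y + c21 y *\<^sub>R cov_along G f k E1 y) + (D c22 y k *\<^sub>R E2 y + c22 y *\<^sub>R cov_along G f k E2 y)" for k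
    using N_add[OF smooth_on_scaleR[OF smooth_c(2) smooth_E1 open_U] smooth_on_scaleR[OF smooth_c(3) smooth_E2 open_U] y]
      N_scaleR[OF smooth_c(2) smooth_E1 y] N_scaleR[OF smooth_c(3) smooth_E2 y] by simp
  show e1: "G (f y) V (cov_along G f k X1 y) = c11 y * G (f y) V (cov_along G f k E1 y)" for k
    unfolding 1 by (simp add: ip_lin[OF i] n)
  show e2: "G (f y) V (cov_along G f k X2 y) = c21 y * G (f y) V (cov_along G f k E1 y) + c22 y * G (f y) V (cov_along G f k E2 y)" for k
    unfolding 2 by (simp add: ip_lin[OF i] n)
  have "N1 X2 y = N2 X1 y" by (rule cov_along_torsion_free[OF metric open_U y f_in[OF y] smooth_f])
  then show "c11 y * G (f y) V (N2 E1 y) = c21 y * G (f y) V (N1 E1 y) + c22 y * G (f y) V (N1 E2 y)"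
    using e1[of a2] e2[of a1] by simp
qed

text \<open>Since \<open>J\<close> commutes with \<open>N1\<close> and \<open>N2\<close>, second derivatives of the frame occur in the commutator of \<open>N1\<close> and \<open>N2\<close> only,
  which is curvature; all the other terms are of first order.\<close>

lemma curl_theta:
  assumes y: "y \<in> U"
  shows "D (\<theta> a2) y a1 - D (\<theta> a1) y a2 =
    (G (f y) (curvature G (f y) (X1 y) (X2 y) (E1 y)) (J (E1 y)) + G (f y) (curvature G (f y) (X1 y) (X2 y) (E2 y)) (J (E2 y))
      - 2 * u y * G (f y) (curvature G (f y) (X1 y) (X2 y) (E1 y)) (E2 y))
    + 2 * G (f y) (N2 E1 y) (J (N1 E1 y)) + 2 * G (f y) (N2 E2 y) (J (N1 E2 y))
    - 2 * (D u y a1 * G (f y) (N2 E1 y) (E2 y) - D u y a2 * G (f y) (N1 E1 y) (E2 y))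
    - 2 * u y * (G (f y) (N2 E1 y) (N1 E2 y) - G (f y) (N1 E1 y) (N2 E2 y))"
proof -
  note i = ip[OF y] and s = inner_productD(2)[OF ip[OF y]]
  let ?R = "\<lambda>W. curvature G (f y) (X1 y) (X2 y) (W y)"
  have R: "N1 (N2 W) y = N2 (N1 W) y + ?R W" if "smooth_on U W" for W
    using cov_along_commutator[OF metric open_U y f_in smooth_f that, of a1 a2] by (simp add: algebra_simps)
  have q: "D (\<lambda>y. G (f y) (N2 W y) (J (W y))) y a1 = D (\<lambda>y. G (f y) (N1 W y) (J (W y))) y a2
    + G (f y) (?R W) (J (W y)) + 2 * G (f y) (N2 W y) (J (N1 W y))" if W: "smooth_on U W" for W
    using J_skew(1)[OF i hj[OF y], of "N1 W y" "N2 W y"] s[of "J (N1 W y)" "N2 W y"]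
    by (simp add: D_ip[OF smooth_N[OF W] smooth_on_J[OF W open_U] y] N_J[OF W y] R[OF W] ip_lin[OF i])
  have p: "D (\<lambda>y. G (f y) (N2 E1 y) (E2 y)) y a1 = D (\<lambda>y. G (f y) (N1 E1 y) (E2 y)) y a2
    + G (f y) (?R E1) (E2 y) + G (f y) (N2 E1 y) (N1 E2 y) - G (f y) (N1 E1 y) (N2 E2 y)"
    by (simp add: D_ip[OF smooth_N[OF smooth_E1] smooth_E2 y] R[OF smooth_E1] ip_lin[OF i])
  have th: "D (\<theta> k) y l = D (\<lambda>y. G (f y) (cov_along G f k E1 y) (J (E1 y))) y l + D (\<lambda>y. G (f y) (cov_along G f k E2 y) (J (E2 y))) y l
    - 2 * (D u y l * G (f y) (cov_along G f k E1 y) (E2 y) + u y * D (\<lambda>y. G (f y) (cov_along G f k E1 y) (E2 y)) y l)" for k l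
  proof -
    note sm = smooth_ip[OF smooth_N[OF smooth_E1] smooth_JE(1)] smooth_ip[OF smooth_N[OF smooth_E2] smooth_JE(2)]
      smooth_ip[OF smooth_N[OF smooth_E1] smooth_E2]
    have "D (\<lambda>y. 2 * (u y * G (f y) (cov_along G f k E1 y) (E2 y))) y l = 2 * (D u y l * G (f y) (cov_along G f k E1 y) (E2 y) + u y * D (\<lambda>y. G (f y) (cov_along G f k E1 y) (E2 y)) y l)"
      by (simp add: D_arith(3)[OF smooth_on_const smooth_on_mult[OF smooth_u sm(3) open_U] y] D_arith(3)[OF smooth_u sm(3) y] D_const)
    then show ?thesis unfolding \<theta>_def[abs_def]
      by (simp add: D_arith(2)[OF smooth_on_add[OF sm(1,2) open_U] smooth_on_mult[OF smooth_on_const smooth_on_mult[OF smooth_u sm(3) open_U] open_U] y]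
          D_arith(1)[OF sm(1,2) y])
  qed
  show ?thesis unfolding th q[OF smooth_E1] q[OF smooth_E2] p by (simp add: algebra_simps)
qed

\<comment> \<open>\<open>\<surd>g\<close> times the gradient of \<open>u\<close>, so that the divergence of the flux is \<open>\<surd>g\<close> times the Laplacian\<close>
definition "flux1 y = (g22 y * D u y a1 - g12 y * D u y a2) / sqrt (gdet y)"
definition "flux2 y = (g11 y * D u y a2 - g12 y * D u y a1) / sqrt (gdet y)"

text \<open>The Euler-Lagrange equation is tested with \<open>\<eta>1\<close> and \<open>\<eta>2\<close>. By \<open>D_u\<close> and \<open>theta_eta\<close>, both \<open>du\<close> and \<open>\<theta>\<close> are linear in the
  components of the second fundamental form in the directions \<open>\<eta>1\<close>, \<open>\<eta>2\<close>; eliminating the components with the two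
  equations and with the symmetry of the form leaves a relation between \<open>du\<close> and \<open>\<theta>\<close>. The factor is
  \<open>1 + \<beta> tan\<^sup>2 \<alpha>\<close>.\<close>

lemma euler_lagrange_frame:
  assumes y: "y \<in> U"
    and EL: "\<And>V. G (f y) V (X1 y) = 0 \<Longrightarrow> G (f y) V (X2 y) = 0 \<Longrightarrow>
      (g22 y * G (f y) V (N1 X1 y) - 2 * g12 y * G (f y) V (N1 X2 y) + g11 y * G (f y) V (N2 X2 y)) / sqrt (gdet y)
      + \<beta> / (u y)\<^sup>2 * (D u y a1 * G (f y) (J V) (X2 y) + D u y a2 * G (f y) (J (X1 y)) V) = 0"
  shows "(1 + \<beta> * (1 - (u y)\<^sup>2) / (u y)\<^sup>2) * flux1 y = \<theta> a2 y"
    "(1 + \<beta> * (1 - (u y)\<^sup>2) / (u y)\<^sup>2) * flux2 y = - \<theta> a1 y"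
proof -
  note i = ip[OF y] and s = inner_productD(2)[OF ip[OF y]]
  define c d e where "c = c11 y" and "d = c22 y" and "e = c21 y"
  have cd: "c > 0" "d > 0" "sqrt (gdet y) = c * d" using c_pos[OF y] by (simp_all add: c_def d_def)
  define k where "k = \<beta> * (1 - (u y)\<^sup>2) / (u y)\<^sup>2"
  define q w where "q = \<beta> / (u y)\<^sup>2" and "w = 1 - (u y)\<^sup>2"
  have k: "k = q * w" by (simp add: k_def q_def w_def)
  note g = g_c[OF y, folded c_def d_def e_def]
  have JX: "G (f y) (J V) (X2 y) = - (e * G (f y) V (J (E1 y)) + d * G (f y) V (J (E2 y)))"
    "G (f y) (J (X1 y)) V = c * G (f y) V (J (E1 y))" for V
    using J_skew(1)[OF i hj[OF y], of V "X2 y"] s[of "J (X1 y)" V] unfolding X_E[OF y]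
    by (simp_all add: J_alg ip_lin[OF i] c_def d_def e_def)
  \<comment> \<open>the Euler-Lagrange equation and the symmetry of the second fundamental form, in the frame\<close>
  have main: "d * G (f y) V (N1 E1 y) - e * G (f y) V (N1 E2 y) + c * G (f y) V (N2 E2 y)
     + \<beta> / (u y)\<^sup>2 * (D u y a1 * (- (e * G (f y) V (J (E1 y)) + d * G (f y) V (J (E2 y)))) + D u y a2 * (c * G (f y) V (J (E1 y)))) = 0"
    and tors: "c * G (f y) V (N2 E1 y) = e * G (f y) V (N1 E1 y) + d * G (f y) V (N1 E2 y)"
    if n: "G (f y) V (E1 y) = 0" "G (f y) V (E2 y) = 0" for V
  proof -
    note sf = second_fundamental[OF y n, folded c_def d_def e_def]
    show t: "c * G (f y) V (N2 E1 y) = e * G (f y) V (N1 E1 y) + d * G (f y) V (N1 E2 y)" by (rule sf(3))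
    have V: "G (f y) V (X1 y) = 0" "G (f y) V (X2 y) = 0"
      unfolding X_E[OF y] by (simp_all add: ip_lin[OF i] n)
    have "g22 y * G (f y) V (N1 X1 y) - 2 * g12 y * G (f y) V (N1 X2 y) + g11 y * G (f y) V (N2 X2 y)
      = (e * e + d * d) * (c * G (f y) V (N1 E1 y)) - 2 * (c * e) * (e * G (f y) V (N1 E1 y) + d * G (f y) V (N1 E2 y))
        + c * e * (c * G (f y) V (N2 E1 y)) + c * c * (d * G (f y) V (N2 E2 y))"
      unfolding g sf(1,2) by (simp add: algebra_simps)
    also have "\<dots> = (c * d) * (d * G (f y) V (N1 E1 y) - e * G (f y) V (N1 E2 y) + c * G (f y) V (N2 E2 y))"
      unfolding t by (simp add: algebra_simps)
    finally have "(g22 y * G (f y) V (N1 X1 y) - 2 * g12 y * G (f y) V (N1 X2 y) + g11 y * G (f y) V (N2 X2 y)) / sqrt (gdet y)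
      = d * G (f y) V (N1 E1 y) - e * G (f y) V (N1 E2 y) + c * G (f y) V (N2 E2 y)"
      using cd by simp
    then show "d * G (f y) V (N1 E1 y) - e * G (f y) V (N1 E2 y) + c * G (f y) V (N2 E2 y)
     + \<beta> / (u y)\<^sup>2 * (D u y a1 * (- (e * G (f y) V (J (E1 y)) + d * G (f y) V (J (E2 y)))) + D u y a2 * (c * G (f y) V (J (E1 y)))) = 0"
      using EL[OF V] unfolding JX by simp
  qed
  note et = eta_normal[OF y]
  \<comment> \<open>components \<open>\<langle>\<eta>, \<nabla>\<^sub>k E\<^sub>i\<rangle>\<close> of the second fundamental form, \<open>h\<close> for \<open>\<eta>1\<close> and \<open>k\<close> for \<open>\<eta>2\<close>\<close>
  define h11 h12 h21 h22 where "h11 = G (f y) (\<eta>1 y) (N1 E1 y)" and "h12 = G (f y) (\<eta>1 y) (N1 E2 y)"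
    and "h21 = G (f y) (\<eta>1 y) (N2 E1 y)" and "h22 = G (f y) (\<eta>1 y) (N2 E2 y)"
  define k11 k12 k21 k22 where "k11 = G (f y) (\<eta>2 y) (N1 E1 y)" and "k12 = G (f y) (\<eta>2 y) (N1 E2 y)"
    and "k21 = G (f y) (\<eta>2 y) (N2 E1 y)" and "k22 = G (f y) (\<eta>2 y) (N2 E2 y)"
  note hk = h11_def[symmetric] h12_def[symmetric] h21_def[symmetric] h22_def[symmetric]
    k11_def[symmetric] k12_def[symmetric] k21_def[symmetric] k22_def[symmetric]
  have u12: "D u y a1 = h12 - k11" "D u y a2 = h22 - k21"
    unfolding D_u[OF y] s[of _ "\<eta>1 y"] s[of _ "\<eta>2 y"] hk by simp_all
  have th: "\<theta> a1 y = h11 + k12" "\<theta> a2 y = h21 + k22"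
    unfolding theta_eta[OF y] s[of _ "\<eta>1 y"] s[of _ "\<eta>2 y"] hk by simp_all
  have t1: "c * h21 = e * h11 + d * h12" using tors[OF et(1,2)] unfolding hk .
  have t2: "c * k21 = e * k11 + d * k12" using tors[OF et(3,4)] unfolding hk .
  have e1: "d * h11 - e * h12 + c * h22 + k * (c * D u y a2 - e * D u y a1) = 0"
    using main[OF et(1,2)] unfolding et hk k q_def[symmetric] w_def[symmetric] by (simp add: algebra_simps)
  have e2: "d * k11 - e * k12 + c * k22 - k * (d * D u y a1) = 0"
    using main[OF et(3,4)] unfolding et hk k q_def[symmetric] w_def[symmetric] by (simp add: algebra_simps)
  have f2: "flux2 y = (c * D u y a2 - e * D u y a1) / d"
    unfolding flux2_def g cd(3) using cd(1,2) by (simp add: field_simps)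
  have f1: "flux1 y = (e * (e * D u y a1 - c * D u y a2) + d * d * D u y a1) / (c * d)"
    unfolding flux1_def g cd(3) using cd(1,2) by (simp add: field_simps)
  have w2: "c * D u y a2 - e * D u y a1 = c * h22 - d * k12 - e * h12"
    unfolding u12 using t2 by (simp add: algebra_simps)
  have r2: "(1 + k) * (c * D u y a2 - e * D u y a1) = - (d * (h11 + k12))"
  proof -
    have "(1 + k) * (c * D u y a2 - e * D u y a1) = (c * D u y a2 - e * D u y a1) + k * (c * D u y a2 - e * D u y a1)"
      by (simp only: distrib_right mult_1)
    also have "\<dots> = (c * h22 - d * k12 - e * h12) - (d * h11 - e * h12 + c * h22)"
      using e1 w2 by linarith
    finally show ?thesis by (simp add: algebra_simps)
  qed
  then show "(1 + \<beta> * (1 - (u y)\<^sup>2) / (u y)\<^sup>2) * flux2 y = - \<theta> a1 y"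
    unfolding f2 th k_def[symmetric] using cd by (simp add: field_simps)
  have "(1 + k) * (d * D u y a1) = d * (h12 - k11) + (d * k11 - e * k12 + c * k22)"
  proof -
    have "(1 + k) * (d * D u y a1) = d * D u y a1 + k * (d * D u y a1)" by (simp only: distrib_right mult_1)
    also have "\<dots> = d * D u y a1 + (d * k11 - e * k12 + c * k22)" using e2 by linarith
    finally show ?thesis unfolding u12 .
  qed
  also have "\<dots> = d * h12 - e * k12 + c * k22" by (simp add: algebra_simps)
  finally have r1: "(1 + k) * (d * D u y a1) = d * h12 - e * k12 + c * k22" .
  have "(1 + k) * (e * (e * D u y a1 - c * D u y a2) + d * d * D u y a1)
     = - e * ((1 + k) * (c * D u y a2 - e * D u y a1)) + d * ((1 + k) * (d * D u y a1))" by (simp add: algebra_simps)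
  also have "\<dots> = d * (e * h11 + d * h12) + d * c * k22" unfolding r1 r2 by (simp add: algebra_simps)
  also have "\<dots> = c * d * (h21 + k22)" unfolding t1[symmetric] by (simp add: algebra_simps)
  finally show "(1 + \<beta> * (1 - (u y)\<^sup>2) / (u y)\<^sup>2) * flux1 y = \<theta> a2 y"
    unfolding f1 th k_def[symmetric] using cd by (simp add: field_simps)
qed

lemma metric_on_induced: "metric_on U (induced_metric G f)" if inj: "\<And>y. y \<in> U \<Longrightarrow> inj (D f y)"
  unfolding metric_on_def
proof (intro conjI ballI allI)
  show "open U" by (rule open_U)
  show "inner_product (induced_metric G f y)" if "y \<in> U" for y
    by (rule induced_inner_product[where G=G and f=f, OF ip[OF that] smooth_on_imp_differentiable[OF smooth_f that] inj[OF that]])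
  show "smooth_on U (\<lambda>y. induced_metric G f y v w)" for v w
    unfolding induced_metric_def by (intro smooth_ip smooth_on_D smooth_f)
qed

end

section \<open>The Laplacian in an orthonormal basis\<close>

lemma orthonormal_plane:
  fixes b :: "real^2 \<Rightarrow> real^2 \<Rightarrow> real"
  assumes b: "inner_product b" and o: "b a1 a1 = 1" "b a1 a2 = 0" "b a2 a2 = 1"
  shows "z = b z a1 *\<^sub>R a1 + b z a2 *\<^sub>R a2"
proof -
  define w where "w = z - (b z a1 *\<^sub>R a1 + b z a2 *\<^sub>R a2)"
  have o': "b a2 a1 = 0" using o(2) inner_productD(2)[OF b] by simp
  have w: "b w a1 = 0" "b w a2 = 0" by (simp_all add: w_def ip_lin[OF b] o o')
  have w': "b a1 w = 0" "b a2 w = 0" using w inner_productD(2)[OF b] by simp_all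
  have "w = 0"
  proof (rule ccontr)
    assume "w \<noteq> 0"
    moreover have n: "a1 \<noteq> 0" "a2 \<noteq> 0" using o inner_productD(15)[OF b] by auto
    moreover have ne: "a1 \<noteq> a2" "a1 \<noteq> w" "a2 \<noteq> w" using o o' w by auto
    ultimately have "card {a1, a2, w} \<le> DIM(real^2)"
      using o o' w w' by (intro orthogonal_card_le[OF b]) auto
    then show False using ne by simp
  qed
  then show ?thesis by (simp add: w_def)
qed

lemma hessian_bilinear:
  assumes m: "metric_on U g" and x: "x \<in> U" and p: "smooth_on U p"
  shows "bilinear (hessian g p x)"
proof -
  note bc = christoffel_bilinear[OF m x]
  have Lp: "linear (D p y)" if "y \<in> U" for y by (rule linear_D[OF smooth_on_imp_differentiable[OF p that]])
  have dp: "((\<lambda>y. D p y b) has_derivative D (\<lambda>y. D p y b) x) (at x)" for b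
    by (rule smooth_on_has_derivative[OF smooth_on_D[OF p] x])
  have l1: "linear (\<lambda>b. D (\<lambda>y. D p y b) x a)" for a
  proof (rule linearI)
    fix b c r
    show "D (\<lambda>y. D p y (b + c)) x a = D (\<lambda>y. D p y b) x a + D (\<lambda>y. D p y c) x a"
    proof (rule D_eqI)
      show "((\<lambda>y. D p y (b + c)) has_derivative (\<lambda>a. D (\<lambda>y. D p y b) x a + D (\<lambda>y. D p y c) x a)) (at x)"
        by (rule has_derivative_transform_within_open[OF has_derivative_add[OF dp dp] metric_onD(1)[OF m] x])
          (simp add: linear_add[OF Lp])
    qed
    show "D (\<lambda>y. D p y (r *\<^sub>R b)) x a = r *\<^sub>R D (\<lambda>y. D p y b) x a"
    proof (rule D_eqI)
      show "((\<lambda>y. D p y (r *\<^sub>R b)) has_derivative (\<lambda>a. r *\<^sub>R D (\<lambda>y. D p y b) x a)) (at x)"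
        by (rule has_derivative_transform_within_open[OF has_derivative_scaleR_right[OF dp] metric_onD(1)[OF m] x])
          (simp add: linear_scale[OF Lp])
    qed
  qed
  have l2: "linear (D (\<lambda>y. D p y b) x)" for b
    using dp has_derivative_linear by blast
  show ?thesis
    unfolding bilinear_def hessian_def
    by (auto intro!: linearI simp: linear_add[OF Lp[OF x]] linear_scale[OF Lp[OF x]] linear_add[OF l1] linear_scale[OF l1]
        linear_add[OF l2] linear_scale[OF l2] bilinear_ladd[OF bc] bilinear_radd[OF bc]
        bilinear_lmul[OF bc] bilinear_rmul[OF bc] algebra_simps)
qed

lemma laplacian_orthonormal:
  fixes g :: "(real^2) metric"
  assumes b: "inner_product (g x)" and o: "g x a1 a1 = 1" "g x a1 a2 = 0" "g x a2 a2 = 1"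
    and H: "bilinear (hessian g p x)"
  shows "laplacian g p x = hessian g p x a1 a1 + hessian g p x a2 a2"
proof -
  have l: "linear (\<lambda>w::real^2. w \<bullet> i)" for i by (rule linearI) (simp_all add: inner_add_left)
  have sh: "sharp (g x) (\<lambda>w. w \<bullet> i) = (a1 \<bullet> i) *\<^sub>R a1 + (a2 \<bullet> i) *\<^sub>R a2" for i
    using orthonormal_plane[OF b o, of "sharp (g x) (\<lambda>w. w \<bullet> i)"] by (simp add: sharp_works[OF b l])
  have e: "(\<Sum>i\<in>Basis. (a \<bullet> i) * hessian g p x a i) = hessian g p x a a" for a
  proof -
    have la: "linear (hessian g p x a)" using H by (simp add: bilinear_def)
    have "hessian g p x a (\<Sum>i\<in>Basis. (a \<bullet> i) *\<^sub>R i) = (\<Sum>i\<in>Basis. (a \<bullet> i) * hessian g p x a i)"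
      by (simp only: linear_sum[OF la] linear_scale[OF la] real_scaleR_def)
    then show ?thesis by (simp add: euclidean_representation)
  qed
  show ?thesis
    unfolding laplacian_def sh bilinear_ladd[OF H] bilinear_lmul[OF H] real_scaleR_def sum.distrib e ..
qed

text \<open>The Christoffel terms of the Hessian are expanded by the Koszul formula, with the basis orthonormal at the point only.\<close>

lemma hessian_trace:
  fixes g :: "(real^2) metric"
  assumes m: "metric_on U g" and x: "x \<in> U" and o: "g x a1 a1 = 1" "g x a1 a2 = 0" "g x a2 a2 = 1" and p: "smooth_on U p"
  shows "laplacian g p x = D (\<lambda>y. D p y a1) x a1 + D (\<lambda>y. D p y a2) x a2
    - D p x a1 * (D (\<lambda>y. g y a1 a1) x a1 / 2 + D (\<lambda>y. g y a1 a2) x a2 - D (\<lambda>y. g y a2 a2) x a1 / 2)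
    - D p x a2 * (D (\<lambda>y. g y a1 a2) x a1 + D (\<lambda>y. g y a2 a2) x a2 / 2 - D (\<lambda>y. g y a1 a1) x a2 / 2)"
proof -
  have Lp: "linear (D p x)" by (rule linear_D[OF smooth_on_imp_differentiable[OF p x]])
  note b = metric_onD(2)[OF m x]
  have "D p x z = g x z a1 * D p x a1 + g x z a2 * D p x a2" for z
  proof -
    have "D p x z = D p x (g x z a1 *\<^sub>R a1 + g x z a2 *\<^sub>R a2)"
      using orthonormal_plane[OF b o] by (rule arg_cong)
    then show ?thesis by (simp add: linear_add[OF Lp] linear_scale[OF Lp])
  qed
  note e = this[of "christoffel g x a1 a1"] this[of "christoffel g x a2 a2"]
  show ?thesis
    unfolding laplacian_orthonormal[OF b o hessian_bilinear[OF m x p]] hessian_def e christoffel_koszul[OF m x]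
    using trilinear_D_metric(4)[OF m x, of a2 a1]
    by (simp add: field_simps)
qed

lemma orthonormal_tetrad:
  fixes b :: "complex^2 \<Rightarrow> complex^2 \<Rightarrow> real"
  assumes b: "inner_product b" and o: "\<And>i j. i \<in> {1..4::nat} \<Longrightarrow> j \<in> {1..4} \<Longrightarrow> b (e i) (e j) = (if i = j then 1 else 0)"
  shows "b v w = b v (e 1) * b w (e 1) + b v (e 2) * b w (e 2) + b v (e 3) * b w (e 3) + b v (e 4) * b w (e 4)"
proof -
  define z where "z = v - (\<Sum>i\<in>{1..4}. b v (e i) *\<^sub>R e i)"
  have ze: "b z (e j) = 0" if j: "j \<in> {1..4}" for j
  proof -
    have "b z (e j) = b v (e j) - (\<Sum>i\<in>{1..4}. b v (e i) * b (e i) (e j))"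
      by (simp add: z_def ip_lin[OF b] linear_sum[OF inner_productD(5)[OF b]])
    also have "(\<Sum>i\<in>{1..4}. b v (e i) * b (e i) (e j)) = (\<Sum>i\<in>{1..4}. if i = j then b v (e i) else 0)"
      using o j by (intro sum.cong) auto
    finally show ?thesis using j by simp
  qed
  have "z = 0"
  proof (rule ccontr)
    assume z: "z \<noteq> 0"
    have inj: "inj_on e {1..4}"
    proof (rule inj_onI)
      fix i j assume ij: "i \<in> {1..4::nat}" "j \<in> {1..4}" "e i = e j"
      then show "i = j" using o[OF ij(1,2)] o[OF ij(1,1)] by (auto split: if_splits)
    qed
    have n: "e i \<noteq> 0" if "i \<in> {1..4}" for i using o[OF that that] inner_productD(15)[OF b] by auto
    have zn: "z \<notin> e ` {1..4}" using ze o by force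
    have "card (insert z (e ` {1..4})) \<le> DIM(complex^2)"
    proof (rule orthogonal_card_le[OF b])
      show "0 \<notin> insert z (e ` {1..4})" using z n by force
      fix p q assume "p \<in> insert z (e ` {1..4})" "q \<in> insert z (e ` {1..4})" "p \<noteq> q"
      then show "b p q = 0" using ze o inner_productD(2)[OF b, of z] by auto
    qed simp
    moreover have "card (insert z (e ` {1..4})) = 5" using zn card_image[OF inj] by simp
    ultimately show False by simp
  qed
  then have "v = (\<Sum>i\<in>{1..4}. b v (e i) *\<^sub>R e i)" by (simp add: z_def)
  then have "b v w = b (\<Sum>i\<in>{1..4}. b v (e i) *\<^sub>R e i) w" by simp
  also have "\<dots> = (\<Sum>i\<in>{1..4}. b v (e i) * b w (e i))"
    using inner_productD(2)[OF b, of w] by (simp add: linear_sum[OF inner_productD(5)[OF b]] ip_lin[OF b])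
  also have "{1..4::nat} = {1, 2, 3, 4}" by auto
  finally show ?thesis by simp
qed

context parallel_surface
begin

text \<open>The function \<open>\<langle>v, w\<rangle>\<close> has symmetric second derivatives; expanding them by the metric property of the connection
  gives \<open>\<langle>R v, w\<rangle> + \<langle>v, R w\<rangle> = 0\<close>.\<close>

lemma curvature_skew:
  assumes y: "y \<in> U"
  shows "G (f y) (curvature G (f y) (X1 y) (X2 y) v) w = - G (f y) (curvature G (f y) (X1 y) (X2 y) w) v"
proof -
  note i = ip[OF y] and s = inner_productD(2)[OF ip[OF y]]
  let ?R = "\<lambda>w. curvature G (f y) (X1 y) (X2 y) w"
  have c: "smooth_on U (\<lambda>_. v)" "smooth_on U (\<lambda>_. w)" by (rule smooth_on_const)+
  have R: "N1 (N2 (\<lambda>_. w)) y = N2 (N1 (\<lambda>_. w)) y + ?R w" for w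
    using cov_along_commutator[OF metric open_U y f_in smooth_f smooth_on_const, of a1 a2 w] by (simp add: algebra_simps)
  let ?p = "\<lambda>y. G (f y) v w"
  have 2: "D (\<lambda>y. D ?p y k) y l = G (f y) (cov_along G f l (cov_along G f k (\<lambda>_. v)) y) w + G (f y) (cov_along G f k (\<lambda>_. v) y) (cov_along G f l (\<lambda>_. w) y)
     + (G (f y) (cov_along G f l (\<lambda>_. v) y) (cov_along G f k (\<lambda>_. w) y) + G (f y) v (cov_along G f l (cov_along G f k (\<lambda>_. w)) y))" for k l
  proof -
    have "D (\<lambda>y. D ?p y k) y = D (\<lambda>y. G (f y) (cov_along G f k (\<lambda>_. v) y) w + G (f y) v (cov_along G f k (\<lambda>_. w) y)) y"
      by (rule D_cong_open[OF open_U y]) (rule D_ip[OF c])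
    then show ?thesis
      using D_arith(1)[OF smooth_ip[OF smooth_N[OF c(1)] c(2)] smooth_ip[OF c(1) smooth_N[OF c(2)]] y, of k k l]
        D_ip[OF smooth_N[OF c(1)] c(2) y, of k l] D_ip[OF c(1) smooth_N[OF c(2)] y, of k l] by simp
  qed
  have "D (\<lambda>y. D ?p y a2) y a1 = D (\<lambda>y. D ?p y a1) y a2"
    by (rule D2_commute[OF open_U y smooth_ip[OF c]])
  then have "G (f y) (?R v) w + G (f y) v (?R w) = 0"
    unfolding 2 R ip_lin[OF i] by simp
  then show ?thesis using s[of v "?R w"] by simp
qed

text \<open>The exterior derivative of the relation between \<open>du\<close> and \<open>\<theta>\<close>, evaluated at a point where the two directions are
  orthonormal and part of an adapted frame. There \<open>\<eta>1 = s e\<^sub>3\<close> and \<open>\<eta>2 = - s e\<^sub>4\<close>, and all the first-order terms are polynomials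
  in the components \<open>h\<close> of the covariant derivatives of \<open>E1\<close>, \<open>E2\<close>.\<close>

lemma laplacian_formula:
  fixes e :: "nat \<Rightarrow> complex^2"
  assumes x: "x \<in> U" and inj: "\<And>y. y \<in> U \<Longrightarrow> inj (D f y)" and upos: "\<And>y. y \<in> U \<Longrightarrow> u y > 0"
    and EL: "\<And>y V. y \<in> U \<Longrightarrow> G (f y) V (X1 y) = 0 \<Longrightarrow> G (f y) V (X2 y) = 0 \<Longrightarrow>
      (g22 y * G (f y) V (N1 X1 y) - 2 * g12 y * G (f y) V (N1 X2 y) + g11 y * G (f y) V (N2 X2 y)) / sqrt (gdet y)
      + \<beta> / (u y)\<^sup>2 * (D u y a1 * G (f y) (J V) (X2 y) + D u y a2 * G (f y) (J (X1 y)) V) = 0"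
    and on: "\<And>i j. i \<in> {1..4::nat} \<Longrightarrow> j \<in> {1..4} \<Longrightarrow> G (f x) (e i) (e j) = (if i = j then 1 else 0)"
    and e12: "e 1 = X1 x" "e 2 = X2 x"
    and Je: "J (e 1) = C *\<^sub>R e 2 + s *\<^sub>R e 3" "J (e 2) = - C *\<^sub>R e 1 - s *\<^sub>R e 4"
      "J (e 3) = - s *\<^sub>R e 1 + C *\<^sub>R e 4" "J (e 4) = s *\<^sub>R e 2 - C *\<^sub>R e 3"
    and s: "s \<noteq> 0" and Cs: "C\<^sup>2 + s\<^sup>2 = 1" and Q: "C\<^sup>2 + \<beta> * s\<^sup>2 \<noteq> 0"
  shows "laplacian (induced_metric G f) u x =
    2 * \<beta> * s\<^sup>2 / (C * (C\<^sup>2 + \<beta> * s\<^sup>2)) * (((D u x a1)\<^sup>2 + (D u x a2)\<^sup>2) / s\<^sup>2)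
    - 2 * C * (((D u x a1)\<^sup>2 + (D u x a2)\<^sup>2) / s\<^sup>2)
    - s * C\<^sup>2 / (C\<^sup>2 + \<beta> * s\<^sup>2) * (G (f x) (curvature G (f x) (e 1) (e 2) (e 3)) (e 1) - G (f x) (curvature G (f x) (e 1) (e 2) (e 4)) (e 2))"
proof -
  \<comment> \<open>keeps the index \<open>1\<close> of a frame from being rewritten to a successor\<close>
  note [simp del] = One_nat_def
  note i = ip[OF x] and sy = inner_productD(2)[OF ip[OF x]]
  have oe: "G (f x) (e 1) (e 1) = 1" "G (f x) (e 1) (e 2) = 0" "G (f x) (e 2) (e 1) = 0" "G (f x) (e 2) (e 2) = 1"
    "G (f x) (e 3) (e 1) = 0" "G (f x) (e 3) (e 2) = 0" "G (f x) (e 4) (e 1) = 0" "G (f x) (e 4) (e 2) = 0"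
    using on by simp_all
  have gx: "g11 x = 1" "g12 x = 0" "g22 x = 1" "gdet x = 1"
    using oe by (simp_all add: g11_def g12_def g22_def gdet_def flip: e12)
  have Ex: "E1 x = e 1" "E2 x = e 2"
  proof -
    show 1: "E1 x = e 1" by (simp add: E1_def gx e12)
    have "c21 x = 0" using oe by (simp add: c21_def 1 flip: e12)
    then show "E2 x = e 2" by (simp add: E2_def gx e12)
  qed
  have ux: "u x = C" by (simp add: u_def Ex Je ip_lin[OF i] oe)
  have Cpos: "C > 0" using upos[OF x] ux by simp
  have eta: "\<eta>1 x = s *\<^sub>R e 3" "\<eta>2 x = - s *\<^sub>R e 4"
    by (simp_all add: \<eta>1_def \<eta>2_def Ex Je ux)
  define u1 u2 where "u1 = D u x a1" and "u2 = D u x a2"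
  \<comment> \<open>\<open>1 + \<beta> tan\<^sup>2 \<alpha>\<close>, written as a smooth function of \<open>u\<close>\<close>
  define \<psi> where "\<psi> y = (1 - \<beta>) + \<beta> * u y powr (-2)" for y
  have pw2: "u y powr (-2) = 1 / (u y)\<^sup>2" if "y \<in> U" for y
    using upos[OF that] by (simp add: powr_minus divide_inverse)
  have psi: "\<psi> y = 1 + \<beta> * (1 - (u y)\<^sup>2) / (u y)\<^sup>2" if "y \<in> U" for y
    using upos[OF that] by (simp add: \<psi>_def pw2[OF that] field_simps)
  have smp: "smooth_on U (\<lambda>y. u y powr (-2))" by (intro smooth_on_powr smooth_u open_U upos)
  have smpsi: "smooth_on U \<psi>" unfolding \<psi>_def[abs_def] by (intro smooth_intros smp open_U)
  have Dpsi: "D \<psi> x k = - 2 * \<beta> / C ^ 3 * D u x k" for k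
  proof -
    have "D \<psi> x k = \<beta> * D (\<lambda>y. u y powr (-2)) x k"
      unfolding \<psi>_def[abs_def]
      by (simp add: D_arith(1)[OF smooth_on_const smooth_on_mult[OF smooth_on_const smp open_U] x] D_arith(3)[OF smooth_on_const smp x] D_const)
    also have "D (\<lambda>y. u y powr (-2)) x k = - 2 * C powr (-3) * D u x k"
      using D_powr[OF smooth_u x upos[OF x], of "-2" k] by (simp add: ux)
    also have "C powr (-3) = 1 / C ^ 3" using Cpos by (simp add: powr_minus divide_inverse)
    finally show ?thesis by simp
  qed
  have psix: "\<psi> x = (C\<^sup>2 + \<beta> * s\<^sup>2) / C\<^sup>2"
  proof -
    have "1 - C\<^sup>2 = s\<^sup>2" using Cs by simp
    then show ?thesis using psi[OF x] Cpos by (simp add: ux add_divide_distrib)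
  qed
  have fl: "\<psi> y * flux1 y = \<theta> a2 y" "\<psi> y * flux2 y = - \<theta> a1 y" if "y \<in> U" for y
  proof -
    show "\<psi> y * flux1 y = \<theta> a2 y" unfolding psi[OF that]
      by (rule euler_lagrange_frame(1)[where \<beta>=\<beta>, OF that]) (rule EL[OF that])
    show "\<psi> y * flux2 y = - \<theta> a1 y" unfolding psi[OF that]
      by (rule euler_lagrange_frame(2)[where \<beta>=\<beta>, OF that]) (rule EL[OF that])
  qed
  have fluxp: "flux1 y = (g22 y * D u y a1 - g12 y * D u y a2) * gdet y powr (-(1/2))"
    "flux2 y = (g11 y * D u y a2 - g12 y * D u y a1) * gdet y powr (-(1/2))" if "y \<in> U" for y
  proof -
    have "gdet y powr (-(1/2)) = inverse (sqrt (gdet y))"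
      unfolding powr_minus using powr_half_sqrt[of "gdet y"] gdet_pos[OF that] by simp
    then show "flux1 y = (g22 y * D u y a1 - g12 y * D u y a2) * gdet y powr (-(1/2))"
      "flux2 y = (g11 y * D u y a2 - g12 y * D u y a1) * gdet y powr (-(1/2))"
      by (simp_all only: flux1_def flux2_def divide_inverse)
  qed
  note smd = smooth_on_D[OF smooth_u]
  have smg: "smooth_on U (\<lambda>y. gdet y powr (-(1/2)))" by (intro smooth_on_powr smooth_g open_U gdet_pos)
  have smflux: "smooth_on U flux1" "smooth_on U flux2"
    by (rule smooth_on_cong[OF smooth_on_mult[OF smooth_on_diff[OF smooth_on_mult[OF smooth_g(3) smd[of a1] open_U] smooth_on_mult[OF smooth_g(2) smd[of a2] open_U] open_U] smg open_U] open_U];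
        use fluxp in simp)
      (rule smooth_on_cong[OF smooth_on_mult[OF smooth_on_diff[OF smooth_on_mult[OF smooth_g(1) smd[of a2] open_U] smooth_on_mult[OF smooth_g(2) smd[of a1] open_U] open_U] smg open_U] open_U];
        use fluxp in simp)
  have Dg: "D gdet x k = D g11 x k + D g22 x k" for k
    unfolding gdet_def[abs_def]
    by (simp add: D_arith(2)[OF smooth_on_mult[OF smooth_g(1,3) open_U] smooth_on_mult[OF smooth_g(2,2) open_U] x]
        D_arith(3)[OF smooth_g(1,3) x] D_arith(3)[OF smooth_g(2,2) x] gx)
  \<comment> \<open>both components of the flux have this form; the determinant is \<open>1\<close> at \<open>x\<close> and its derivative is the trace \<open>Dg\<close>\<close>
  have Dflux: "D (\<lambda>y. (p y * D u y k - q y * D u y l) * gdet y powr (-(1/2))) x n =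
      D p x n * D u x k + p x * D (\<lambda>y. D u y k) x n - D q x n * D u x l - q x * D (\<lambda>y. D u y l) x n
      - (p x * D u x k - q x * D u x l) * (D g11 x n + D g22 x n) / 2"
    if pq: "smooth_on U p" "smooth_on U q" for p q k l n
  proof -
    note m = smooth_on_mult[OF pq(1) smd[of k] open_U] smooth_on_mult[OF pq(2) smd[of l] open_U]
    have dgp: "D (\<lambda>y. gdet y powr (-(1/2))) x n = - ((D g11 x n + D g22 x n) / 2)"
      using D_powr[OF smooth_g(4) x gdet_pos[OF x], of "-(1/2)" n]
      unfolding gx Dg powr_one_eq_one by linarith
    have em: "D (\<lambda>y. (p y * D u y k - q y * D u y l) * gdet y powr (-(1/2))) x n =
      (D p x n * D u x k + p x * D (\<lambda>y. D u y k) x n - (D q x n * D u x l + q x * D (\<lambda>y. D u y l) x n)) * 1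
      + (p x * D u x k - q x * D u x l) * D (\<lambda>y. gdet y powr (-(1/2))) x n"
      unfolding D_arith(3)[OF smooth_on_diff[OF m open_U] smg x] D_arith(2)[OF m x] D_arith(3)[OF pq(1) smd[of k] x]
          D_arith(3)[OF pq(2) smd[of l] x] gx by simp
    show ?thesis unfolding em dgp by simp
  qed
  have D1: "D flux1 x n = D (\<lambda>y. (g22 y * D u y a1 - g12 y * D u y a2) * gdet y powr (-(1/2))) x n"
    and D2: "D flux2 x n = D (\<lambda>y. (g11 y * D u y a2 - g12 y * D u y a1) * gdet y powr (-(1/2))) x n" for n
    using D_cong_open[OF open_U x fluxp(1)] D_cong_open[OF open_U x fluxp(2)] by simp_all
  have gind: "(\<lambda>y. induced_metric G f y a1 a1) = g11" "(\<lambda>y. induced_metric G f y a1 a2) = g12" "(\<lambda>y. induced_metric G f y a2 a2) = g22"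
    by (simp_all add: induced_metric_def g11_def g12_def g22_def fun_eq_iff)
  have lap: "laplacian (induced_metric G f) u x = D flux1 x a1 + D flux2 x a2"
  proof -
    have o: "induced_metric G f x a1 a1 = 1" "induced_metric G f x a1 a2 = 0" "induced_metric G f x a2 a2 = 1"
      using gx fun_cong[OF gind(1), of x] fun_cong[OF gind(2), of x] fun_cong[OF gind(3), of x] by simp_all
    have m: "metric_on U (induced_metric G f)" by (rule metric_on_induced) (rule inj)
    have e: "D flux1 x a1 + D flux2 x a2 = D (\<lambda>y. D u y a1) x a1 + D (\<lambda>y. D u y a2) x a2
      - D u x a1 * (D g11 x a1 / 2 + D g12 x a2 - D g22 x a1 / 2)
      - D u x a2 * (D g12 x a1 + D g22 x a2 / 2 - D g11 x a2 / 2)"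
      unfolding D1 D2 Dflux[OF smooth_g(3,2)] Dflux[OF smooth_g(1,2)] gx
      by (simp add: algebra_simps add_divide_distrib)
    show ?thesis
      unfolding e using hessian_trace[OF m x o smooth_u] unfolding gind .
  qed
  have flx: "flux1 x = u1" "flux2 x = u2" by (simp_all add: flux1_def flux2_def gx u1_def u2_def)
  have "D (\<lambda>y. \<psi> y * flux1 y) x a1 = D (\<theta> a2) x a1" "D (\<lambda>y. \<psi> y * flux2 y) x a2 = D (\<lambda>y. - \<theta> a1 y) x a2"
    using D_cong_open[OF open_U x, of "\<lambda>y. \<psi> y * flux1 y" "\<theta> a2"] D_cong_open[OF open_U x, of "\<lambda>y. \<psi> y * flux2 y" "\<lambda>y. - \<theta> a1 y"] fl by auto
  then have curl: "D (\<theta> a2) x a1 - D (\<theta> a1) x a2 = \<psi> x * laplacian (induced_metric G f) u x - 2 * \<beta> / C ^ 3 * (u1\<^sup>2 + u2\<^sup>2)"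
    unfolding lap D_arith(3)[OF smpsi smflux(1) x] D_arith(3)[OF smpsi smflux(2) x] D_arith(4)[OF smooth_theta smooth_theta x] Dpsi flx
      u1_def[symmetric] u2_def[symmetric]
    by (simp add: distrib_left power2_eq_square add_divide_distrib)
  define h where "h k a i = G (f x) (cov_along G f k a x) (e i)" for k a i
  have hE: "h k E1 1 = 0" "h k E2 2 = 0" "h k E2 1 = - h k E1 2" for k
    unfolding h_def using cov_along_E[OF x, of k] by (simp_all add: Ex)
  \<comment> \<open>symmetry of the second fundamental form\<close>
  have hs: "h a2 E1 3 = h a1 E2 3" "h a2 E1 4 = h a1 E2 4"
  proof -
    have c: "c11 x = 1" "c21 x = 0" "c22 x = 1"
      using oe by (simp_all add: c11_def c21_def c22_def gx Ex flip: e12)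
    show "h a2 E1 3 = h a1 E2 3" "h a2 E1 4 = h a1 E2 4"
      using second_fundamental(3)[OF x, of "e 3"] second_fundamental(3)[OF x, of "e 4"] oe sy[of "e 3"] sy[of "e 4"]
      unfolding h_def by (simp_all add: Ex c)
  qed
  have u12: "u1 = s * (h a1 E2 3 + h a1 E1 4)" "u2 = s * (h a2 E2 3 + h a1 E2 4)"
    unfolding u1_def u2_def D_u[OF x] eta by (simp_all add: h_def[symmetric] ip_lin[OF i] hs algebra_simps)
  have th: "\<theta> a2 x = s * (h a1 E2 3 - h a2 E2 4)" "\<theta> a1 x = s * (h a1 E1 3 - h a1 E2 4)"
    unfolding theta_eta[OF x] eta by (simp_all add: h_def[symmetric] ip_lin[OF i] hs algebra_simps)
  have psiu: "\<psi> x * u1 = s * (h a1 E2 3 - h a2 E2 4)" "\<psi> x * u2 = - (s * (h a1 E1 3 - h a1 E2 4))"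
    using fl[OF x] th flx by simp_all
  have tet: "G (f x) v w = G (f x) v (e 1) * G (f x) w (e 1) + G (f x) v (e 2) * G (f x) w (e 2)
      + G (f x) v (e 3) * G (f x) w (e 3) + G (f x) v (e 4) * G (f x) w (e 4)" for v w
    by (rule orthonormal_tetrad[OF i]) (rule on)
  have JJ: "G (f x) (J v) (e 1) = - (C * G (f x) v (e 2) + s * G (f x) v (e 3))"
    "G (f x) (J v) (e 2) = C * G (f x) v (e 1) + s * G (f x) v (e 4)"
    "G (f x) (J v) (e 3) = s * G (f x) v (e 1) - C * G (f x) v (e 4)"
    "G (f x) (J v) (e 4) = - (s * G (f x) v (e 2)) + C * G (f x) v (e 3)" for v
    using J_skew(1)[OF i hj[OF x]] by (simp_all add: Je ip_lin[OF i])
  have quad: "2 * G (f x) (N2 E1 x) (J (N1 E1 x)) + 2 * G (f x) (N2 E2 x) (J (N1 E2 x))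
    - 2 * (u1 * G (f x) (N2 E1 x) (E2 x) - u2 * G (f x) (N1 E1 x) (E2 x))
    - 2 * C * (G (f x) (N2 E1 x) (N1 E2 x) - G (f x) (N1 E1 x) (N2 E2 x))
    = 2 * C * ((h a1 E1 4 + h a1 E2 3) * (h a2 E2 4 - h a1 E2 3) + (h a2 E2 3 + h a1 E2 4) * (h a1 E1 3 - h a1 E2 4))"
    unfolding tet[of _ "J _"] tet[of "N2 E1 x" "N1 E2 x"] tet[of "N1 E1 x" "N2 E2 x"] JJ Ex h_def[symmetric]
      hE hs u12
    by (simp add: algebra_simps)
  \<comment> \<open>up to signs and powers of \<open>s\<close>, the first factors of the quadratic terms are \<open>du\<close> and the second ones are \<open>\<theta>\<close>, which is \<open>\<psi>\<close> times \<open>du\<close> again\<close>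
  have quads: "s\<^sup>2 * (2 * C * ((h a1 E1 4 + h a1 E2 3) * (h a2 E2 4 - h a1 E2 3) + (h a2 E2 3 + h a1 E2 4) * (h a1 E1 3 - h a1 E2 4)))
    = - 2 * C * \<psi> x * (u1\<^sup>2 + u2\<^sup>2)"
  proof -
    have "s\<^sup>2 * (2 * C * ((h a1 E1 4 + h a1 E2 3) * (h a2 E2 4 - h a1 E2 3) + (h a2 E2 3 + h a1 E2 4) * (h a1 E1 3 - h a1 E2 4)))
      = 2 * C * (- u1 * (s * (h a1 E2 3 - h a2 E2 4)) + u2 * (s * (h a1 E1 3 - h a1 E2 4)))"
      unfolding u12 by (simp add: algebra_simps power2_eq_square)
    also have "\<dots> = 2 * C * (- u1 * (\<psi> x * u1) + u2 * (- (\<psi> x * u2)))" unfolding psiu by simp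
    finally show ?thesis by (simp add: algebra_simps power2_eq_square)
  qed
  let ?R = "\<lambda>v. curvature G (f x) (e 1) (e 2) v"
  let ?K = "G (f x) (?R (e 3)) (e 1) - G (f x) (?R (e 4)) (e 2)"
  have sk: "G (f x) (?R v) w = - G (f x) (?R w) v" for v w
    using curvature_skew[OF x, of v w] by (simp add: e12)
  \<comment> \<open>the terms with \<open>\<langle>R e\<^sub>1, e\<^sub>2\<rangle>\<close> cancel, because \<open>\<theta>\<close> contains the connection form with the factor \<open>- 2 u\<close>\<close>
  have Kt: "G (f x) (?R (E1 x)) (J (E1 x)) + G (f x) (?R (E2 x)) (J (E2 x)) - 2 * C * G (f x) (?R (E1 x)) (E2 x) = - s * ?K"
    using sk[of "e 2" "e 1"] sk[of "e 1" "e 3"] sk[of "e 2" "e 4"] unfolding Ex Je by (simp add: ip_lin[OF i] algebra_simps)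
  have "\<psi> x * laplacian (induced_metric G f) u x - 2 * \<beta> / C ^ 3 * (u1\<^sup>2 + u2\<^sup>2)
     = - s * ?K + 2 * C * ((h a1 E1 4 + h a1 E2 3) * (h a2 E2 4 - h a1 E2 3) + (h a2 E2 3 + h a1 E2 4) * (h a1 E1 3 - h a1 E2 4))"
    unfolding curl[symmetric] curl_theta[OF x] ux u1_def[symmetric] u2_def[symmetric] e12[symmetric] quad[symmetric] Kt[symmetric] by simp
  moreover have "2 * C * ((h a1 E1 4 + h a1 E2 3) * (h a2 E2 4 - h a1 E2 3) + (h a2 E2 3 + h a1 E2 4) * (h a1 E1 3 - h a1 E2 4))
    = - 2 * C * \<psi> x * (u1\<^sup>2 + u2\<^sup>2) / s\<^sup>2"
    using quads s by (metis nonzero_mult_div_cancel_left power_not_zero)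
  ultimately have e: "\<psi> x * laplacian (induced_metric G f) u x = 2 * \<beta> / C ^ 3 * (u1\<^sup>2 + u2\<^sup>2) - s * ?K - \<psi> x * (2 * C * ((u1\<^sup>2 + u2\<^sup>2) / s\<^sup>2))"
    by (simp add: mult_ac)
  have p0: "\<psi> x \<noteq> 0" using Q Cpos psix by simp
  have "laplacian (induced_metric G f) u x = \<psi> x * laplacian (induced_metric G f) u x / \<psi> x" using p0 by simp
  also have "\<dots> = 2 * \<beta> / C ^ 3 * (u1\<^sup>2 + u2\<^sup>2) / \<psi> x - s * ?K / \<psi> x - 2 * C * ((u1\<^sup>2 + u2\<^sup>2) / s\<^sup>2)"
    unfolding e diff_divide_distrib using p0 by simp
  also have "2 * \<beta> / C ^ 3 * (u1\<^sup>2 + u2\<^sup>2) / \<psi> x = 2 * \<beta> * s\<^sup>2 / (C * (C\<^sup>2 + \<beta> * s\<^sup>2)) * ((u1\<^sup>2 + u2\<^sup>2) / s\<^sup>2)"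
    unfolding psix using Cpos s Q by (simp add: power2_eq_square power3_eq_cube)
  also have "s * ?K / \<psi> x = s * C\<^sup>2 / (C\<^sup>2 + \<beta> * s\<^sup>2) * ?K"
    unfolding psix using Cpos by simp
  finally show ?thesis by (simp add: u1_def u2_def)
qed

end

section \<open>Integration by parts and the fundamental lemma\<close>

text \<open>Integrals are taken over boxes, on which continuous functions are integrable and differentiation under the integral sign
  applies; the supports of the integrands lie in the inscribed balls.\<close>

definition cube :: "'a::euclidean_space \<Rightarrow> real \<Rightarrow> 'a set" where
  "cube z r = cbox (z - r *\<^sub>R One) (z + r *\<^sub>R One)"

lemma mem_cube: "x \<in> cube z r \<longleftrightarrow> (\<forall>b\<in>Basis. \<bar>(x - z) \<bullet> b\<bar> \<le> r)"
proof -
  have "\<bar>(x - z) \<bullet> b\<bar> \<le> r \<longleftrightarrow> z \<bullet> b - r \<le> x \<bullet> b \<and> x \<bullet> b \<le> z \<bullet> b + r" for b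
    by (auto simp: inner_diff_left)
  then show ?thesis by (simp add: cube_def mem_box inner_diff_left inner_add_left)
qed

lemma ball_subset_cube: "ball z r \<subseteq> cube z r"
proof
  fix x assume "x \<in> ball z r"
  then have n: "norm (x - z) < r" by (simp add: dist_norm norm_minus_commute)
  have "\<bar>(x - z) \<bullet> b\<bar> \<le> r" if "b \<in> Basis" for b
    using Basis_le_norm[OF that, of "x - z"] n by simp
  then show "x \<in> cube z r" by (simp add: mem_cube)
qed

lemma cball_subset_cube: "r > 0 \<Longrightarrow> cball z r \<subseteq> cube z r"
  using closure_mono[OF ball_subset_cube[of z r]] by (simp add: cube_def)

lemma compact_cube: "compact (cube z r)" "closed (cube z r)"
  by (simp_all add: cube_def closed_cbox)

lemma cube_subset_cball: "cube z r \<subseteq> cball z (r * DIM('a))" for z :: "'a::euclidean_space"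
proof
  fix x :: 'a assume x: "x \<in> cube z r"
  have "norm (x - z) \<le> (\<Sum>b\<in>Basis. \<bar>(x - z) \<bullet> b\<bar>)" by (rule norm_le_l1)
  also have "\<dots> \<le> (\<Sum>b\<in>(Basis::'a set). r)"
    using x by (intro sum_mono) (simp add: mem_cube)
  finally show "x \<in> cball z (r * DIM('a))" by (simp add: dist_norm norm_minus_commute mult.commute)
qed

lemma small_cube:
  fixes z :: "'a::euclidean_space"
  assumes "open U" "z \<in> U"
  shows "\<exists>r>0. cube z r \<subseteq> U"
proof -
  obtain e where e: "e > 0" "cball z e \<subseteq> U" using assms open_contains_cball by blast
  have "cube z (e / DIM('a)) \<subseteq> cball z e" using cube_subset_cball[of z "e / DIM('a)"] by simp
  then show ?thesis using e by (intro exI[of _ "e / DIM('a)"]) auto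
qed

text \<open>The integral of a compactly supported function is invariant under translation; differentiation under
  the integral sign gives the claim. The enlarged cube contains the support of all translates by \<open>h a\<close>, \<open>\<bar>h\<bar> \<le> 1\<close>.\<close>

lemma integral_D_eq_0:
  fixes \<psi> :: "'a::euclidean_space \<Rightarrow> real"
  assumes sm: "smooth_on UNIV \<psi>" and r: "r > 0" and supp: "\<And>x. x \<notin> ball z r \<Longrightarrow> \<psi> x = 0"
  shows "integral (cube z r) (\<lambda>x. D \<psi> x a) = 0"
proof -
  define N where "N = r + norm a"
  have super: "integral S p = integral UNIV p" if "\<And>x. x \<notin> S \<Longrightarrow> p x = 0" for S and p :: "'a \<Rightarrow> real"
  proof -
    have "p = (\<lambda>x. if x \<in> S then p x else 0)" using that by auto
    then show ?thesis using integral_restrict_UNIV[of S p] by simp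
  qed
  have d: "(\<psi> has_derivative D \<psi> y) (at y)" for y using smooth_on_has_derivative[OF sm] by simp
  have cD: "continuous_on S (\<lambda>x. D \<psi> x a)" for S
    using smooth_on_imp_continuous_on[OF smooth_on_D[OF sm]] continuous_on_subset by blast
  have c\<psi>: "continuous_on S \<psi>" for S
    using smooth_on_imp_continuous_on[OF sm] continuous_on_subset by blast
  let ?I = "\<lambda>h. integral (cube z N) (\<lambda>x. \<psi> (x + h *\<^sub>R a))"
  have "((\<lambda>h. integral (cube z N) (\<lambda>x. \<psi> (x + h *\<^sub>R a))) has_field_derivative integral (cube z N) (\<lambda>x. D \<psi> (x + 0 *\<^sub>R a) a)) (at 0 within {-1..1})"
    unfolding cube_def
  proof (rule leibniz_rule_field_derivative[where fx="\<lambda>h x. D \<psi> (x + h *\<^sub>R a) a" and f="\<lambda>h x. \<psi> (x + h *\<^sub>R a)"])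
    fix h :: real and x
    have "((\<lambda>h. \<psi> (x + h *\<^sub>R a)) has_vector_derivative D \<psi> (x + h *\<^sub>R a) a) (at h)"
      using d by (intro D_line) (auto simp: differentiable_def)
    then show "((\<lambda>h. \<psi> (x + h *\<^sub>R a)) has_real_derivative D \<psi> (x + h *\<^sub>R a) a) (at h within {-1..1})"
      by (simp add: has_real_derivative_iff_has_vector_derivative has_vector_derivative_at_within)
  next
    show "(\<lambda>x. \<psi> (x + h *\<^sub>R a)) integrable_on cbox (z - N *\<^sub>R One) (z + N *\<^sub>R One)" for h
      by (intro integrable_continuous continuous_on_compose2[OF c\<psi>[of UNIV]] continuous_intros) auto
    show "continuous_on ({-1..1} \<times> cbox (z - N *\<^sub>R One) (z + N *\<^sub>R One)) (\<lambda>(h, x). D \<psi> (x + h *\<^sub>R a) a)"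
      unfolding split_beta by (intro continuous_on_compose2[OF cD[of UNIV]] continuous_intros) auto
  qed auto
  moreover have "?I h = integral UNIV \<psi>" if h: "\<bar>h\<bar> \<le> 1" for h
  proof -
    have "?I h = integral (cube (z + h *\<^sub>R a) N) \<psi>"
      using integral_shift_cbox_plus[of "z - N *\<^sub>R One" "z + N *\<^sub>R One" \<psi> "h *\<^sub>R a"]
      by (simp add: cube_def o_def algebra_simps)
    also have "\<dots> = integral UNIV \<psi>"
    proof (rule super)
      fix x assume x: "x \<notin> cube (z + h *\<^sub>R a) N"
      have "x \<notin> ball z r"
      proof
        assume "x \<in> ball z r"
        then have "dist (z + h *\<^sub>R a) x < N"
          using norm_triangle_ineq[of "z - x" "h *\<^sub>R a"] h mult_right_mono[OF h norm_ge_zero[of a]]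
          by (simp add: dist_norm N_def algebra_simps)
        then show False using x ball_subset_cube[of "z + h *\<^sub>R a" N] by auto
      qed
      then show "\<psi> x = 0" by (rule supp)
    qed
    finally show ?thesis .
  qed
  then have "(?I has_field_derivative 0) (at 0 within {-1..1})"
    by (intro has_field_derivative_transform_within[OF DERIV_const[of "integral UNIV \<psi>"], of 1]) (auto simp: dist_real_def)
  ultimately have "integral (cube z N) (\<lambda>x. D \<psi> x a) = 0"
  proof -
    assume 1: "(?I has_field_derivative integral (cube z N) (\<lambda>x. D \<psi> (x + 0 *\<^sub>R a) a)) (at 0 within {-1..1})"
      and 2: "(?I has_field_derivative 0) (at 0 within {-1..1})"
    have "at (0::real) within {-1..1} = at 0" by (rule at_within_interior) simp
    then show "integral (cube z N) (\<lambda>x. D \<psi> x a) = 0" using DERIV_unique 1 2 by fastforce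
  qed
  moreover have out: "D \<psi> x a = 0" if "x \<notin> cball z r" for x
  proof -
    have "D \<psi> x = D (\<lambda>_. 0 :: real) x"
      by (rule D_cong_open[of "- cball z r"]) (use that supp in auto)
    then show ?thesis using D_const[of "0::real" x a] by simp
  qed
  moreover have "cball z r \<subseteq> cube z r" "cball z r \<subseteq> cube z N"
    using cball_subset_cube[OF r, of z] ball_subset_cube subset_cball[of r N z] cball_subset_cube[of N z] r by (auto simp: N_def add_pos_nonneg)
  moreover from this out have "integral (cube z r) (\<lambda>x. D \<psi> x a) = integral UNIV (\<lambda>x. D \<psi> x a)"
    "integral (cube z N) (\<lambda>x. D \<psi> x a) = integral UNIV (\<lambda>x. D \<psi> x a)"
    by (blast intro!: super)+
  ultimately show ?thesis by simp
qed

lemma smooth_on_extend_by_0: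
  fixes \<phi> P :: "'a::euclidean_space \<Rightarrow> real"
  assumes "smooth_on UNIV \<phi>" "smooth_on U P" "open U" "cball z r \<subseteq> U" "\<And>x. x \<notin> ball z r \<Longrightarrow> \<phi> x = 0"
  shows "smooth_on UNIV (\<lambda>x. if x \<in> U then \<phi> x * P x else 0)"
proof (rule smooth_on_local)
  fix x
  have "smooth_on U (\<lambda>x. if x \<in> U then \<phi> x * P x else 0)"
    by (rule smooth_on_cong[OF smooth_on_mult[OF smooth_on_subset[OF assms(1)] assms(2,3)] assms(3)]) auto
  moreover have "smooth_on (- cball z r) (\<lambda>x. if x \<in> U then \<phi> x * P x else 0)"
    by (rule smooth_on_cong[OF smooth_on_const[of _ 0]]) (use assms(5) in auto)
  moreover have "x \<in> U \<or> x \<in> - cball z r" using assms(4) by auto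
  ultimately show "\<exists>T. open T \<and> x \<in> T \<and> smooth_on T (\<lambda>x. if x \<in> U then \<phi> x * P x else 0)"
    using assms(3) open_Compl[OF closed_cball] by blast
qed

text \<open>Test with a bump function supported where \<open>H\<close> keeps its sign.\<close>

lemma fundamental_lemma:
  fixes H :: "'a::euclidean_space \<Rightarrow> real"
  assumes U: "open U" "z \<in> U" and H: "continuous_on U H"
    and int: "\<And>r \<phi>. r > 0 \<Longrightarrow> cube z r \<subseteq> U \<Longrightarrow> smooth_on UNIV \<phi> \<Longrightarrow> (\<And>x. x \<notin> ball z r \<Longrightarrow> \<phi> x = 0) \<Longrightarrow>
      integral (cube z r) (\<lambda>x. \<phi> x * H x) = 0"
  shows "H z = 0"
proof (rule ccontr)
  assume n: "H z \<noteq> 0"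
  define s where "s = sgn (H z)"
  have cs: "continuous_on U (\<lambda>x. s * H x)" by (intro continuous_intros H)
  have A: "open {x \<in> U. s * H x > 0}"
  proof -
    have "{x \<in> U. s * H x > 0} = U \<inter> (\<lambda>x. s * H x) -` {0<..}" by auto
    then show ?thesis using continuous_open_preimage[OF cs U(1) open_greaterThan] by simp
  qed
  have B: "z \<in> {x \<in> U. s * H x > 0}" using n U(2) by (simp add: s_def sgn_if)
  obtain r where r: "r > 0" "cube z r \<subseteq> {x \<in> U. s * H x > 0}" using small_cube[OF A B] by blast
  obtain \<phi> :: "'a \<Rightarrow> real" where \<phi>: "smooth_on UNIV \<phi>" "\<And>x. \<phi> x \<ge> 0" "\<phi> z > 0" "\<And>x. x \<notin> ball z r \<Longrightarrow> \<phi> x = 0"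
    using exists_bump[OF r(1), of z] by metis
  have cont: "continuous_on (cube z r) (\<lambda>x. \<phi> x * (s * H x))"
  proof (rule continuous_on_mult)
    show "continuous_on (cube z r) \<phi>"
      by (rule continuous_on_subset[OF smooth_on_imp_continuous_on[OF \<phi>(1)]]) simp
    show "continuous_on (cube z r) (\<lambda>x. s * H x)"
      by (rule continuous_on_subset[OF cs]) (use r(2) in auto)
  qed
  have "integral (cube z r) (\<lambda>x. \<phi> x * (s * H x)) = integral (cube z r) (\<lambda>x. s * (\<phi> x * H x))"
    by (simp only: mult.left_commute)
  also have "\<dots> = s * integral (cube z r) (\<lambda>x. \<phi> x * H x)" by (rule integral_mult_right)
  also have "integral (cube z r) (\<lambda>x. \<phi> x * H x) = 0"
    by (rule int[OF r(1) _ \<phi>(1,4)]) (use r(2) in auto)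
  also have "s * 0 = 0" by simp
  finally have i0: "((\<lambda>x. \<phi> x * (s * H x)) has_integral 0) (cube z r)"
    using integrable_integral[OF integrable_continuous[OF cont[unfolded cube_def]]] by (simp add: cube_def)
  have zb: "z \<in> box (z - r *\<^sub>R One) (z + r *\<^sub>R One)" using r(1) by (auto simp: mem_box inner_diff_left inner_add_left)
  have "\<phi> z * (s * H z) = 0"
  proof (rule has_integral_0_cbox_imp_0[OF cont[unfolded cube_def] _ i0[unfolded cube_def]])
    show "0 \<le> \<phi> x * (s * H x)" if "x \<in> box (z - r *\<^sub>R One) (z + r *\<^sub>R One)" for x
    proof -
      have "x \<in> cube z r" using that box_subset_cbox[of "z - r *\<^sub>R One" "z + r *\<^sub>R One"] by (auto simp: cube_def)
      then have "s * H x > 0" using r(2) by auto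
      then show ?thesis using \<phi>(2)[of x] by simp
    qed
    show "z \<in> cbox (z - r *\<^sub>R One) (z + r *\<^sub>R One)" using zb box_subset_cbox by blast
  qed (use zb in auto)
  then show False using \<phi>(3) n by (simp add: s_def sgn_zero_iff)
qed

section \<open>The first variation\<close>

lemma inner_product_Cauchy_Schwarz:
  assumes b: "inner_product b"
  shows "(b u v)\<^sup>2 \<le> b u u * b v v"
proof (cases "v = 0")
  case True
  then show ?thesis by (simp add: ip_lin[OF b])
next
  case False
  then have p: "b v v > 0" by (rule inner_productD(3)[OF b])
  define r where "r = b u v / b v v"
  have rv: "r * b v v = b u v" using p by (simp add: r_def)
  have "b (u - r *\<^sub>R v) (u - r *\<^sub>R v) = b u u - 2 * (r * b u v) + r * (r * b v v)"
    using inner_productD(2)[OF b, of v u] by (simp add: ip_lin[OF b] algebra_simps)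
  then have "b (u - r *\<^sub>R v) (u - r *\<^sub>R v) = b u u - r * b u v" unfolding rv by simp
  then have "0 \<le> b u u - r * b u v" using inner_productD(17)[OF b, of "u - r *\<^sub>R v"] by simp
  then have "0 \<le> (b u u - r * b u v) * b v v" using p by simp
  also have "\<dots> = b u u * b v v - (r * b v v) * b u v" by (simp add: algebra_simps)
  finally show ?thesis unfolding rv by (simp add: power2_eq_square)
qed

text \<open>Wirtinger's inequality: Cauchy-Schwarz for \<open>J X\<close> and the component of \<open>Y\<close> orthogonal to \<open>X\<close>.\<close>

lemma wirtinger:
  assumes b: "inner_product b" and h: "\<And>u v. b (J u) (J v) = b u v"
  shows "(b (J X) Y)\<^sup>2 \<le> b X X * b Y Y - (b X Y)\<^sup>2"
proof (cases "X = 0")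
  case True
  then show ?thesis by (simp add: ip_lin[OF b] J_alg)
next
  case False
  then have p: "b X X > 0" by (rule inner_productD(3)[OF b])
  define r where "r = b X Y / b X X"
  have r: "r * b X X = b X Y" using p by (simp add: r_def)
  have 1: "b (J X) (Y - r *\<^sub>R X) = b (J X) Y" by (simp add: ip_lin[OF b] J_skew[OF b h])
  have "b (Y - r *\<^sub>R X) (Y - r *\<^sub>R X) = b Y Y - 2 * (r * b X Y) + r * (r * b X X)"
    using inner_productD(2)[OF b, of Y X] by (simp add: ip_lin[OF b] algebra_simps)
  then have 2: "b (Y - r *\<^sub>R X) (Y - r *\<^sub>R X) = b Y Y - r * b X Y" unfolding r by simp
  have "(b (J X) Y)\<^sup>2 \<le> b X X * (b Y Y - r * b X Y)"
    using inner_product_Cauchy_Schwarz[OF b, of "J X" "Y - r *\<^sub>R X"] unfolding 1 2 h .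
  also have "\<dots> = b X X * b Y Y - (r * b X X) * b X Y" by (simp add: algebra_simps)
  finally show ?thesis unfolding r by (simp add: power2_eq_square)
qed

text \<open>The integrand \<open>cos powr (-\<beta>) d\<mu>\<close> as a function of the point and of the two coordinate vectors.\<close>

definition lagrangian :: "real \<Rightarrow> (complex^2) metric \<Rightarrow> complex^2 \<Rightarrow> complex^2 \<Rightarrow> complex^2 \<Rightarrow> real" where
  "lagrangian \<beta> G p A B = (G p (J A) B / sqrt (G p A A * G p B B - (G p A B)\<^sup>2)) powr (-\<beta>)
     * sqrt (G p A A * G p B B - (G p A B)\<^sup>2)"

lemma lagrangian_derivative:
  fixes w m :: "real \<Rightarrow> real"
  assumes w: "(w has_real_derivative w') (at 0)" and m: "(m has_real_derivative m') (at 0)"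
    and pos: "w 0 > 0" "m 0 > 0" and u: "u = w 0 / sqrt (m 0)"
  shows "((\<lambda>t. (w t / sqrt (m t)) powr (-\<beta>) * sqrt (m t)) has_real_derivative
    - \<beta> * u powr (-\<beta> - 1) * w' + (\<beta> + 1) * u powr (-\<beta>) / sqrt (m 0) * (m' / 2)) (at 0)"
proof -
  let ?s = "sqrt (m 0)"
  have s: "?s > 0" "?s * ?s = m 0" using pos by simp_all
  have upos: "u > 0" using pos s u by simp
  have ds: "((\<lambda>t. sqrt (m t)) has_real_derivative m' * (inverse ?s / 2)) (at 0)"
    using DERIV_chain2[OF DERIV_real_sqrt[OF pos(2)] m] by (simp add: mult.commute)
  have dr: "((\<lambda>t. w t / sqrt (m t)) has_real_derivative (w' * ?s - w 0 * (m' * (inverse ?s / 2))) / (?s * ?s)) (at 0)"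
    using s(1) by (intro DERIV_divide w ds) simp
  have dp: "((\<lambda>t. (w t / sqrt (m t)) powr (-\<beta>)) has_real_derivative
      (-\<beta> * u powr (-\<beta> - 1)) * ((w' * ?s - w 0 * (m' * (inverse ?s / 2))) / (?s * ?s))) (at 0)"
  proof (rule DERIV_chain2[where f="\<lambda>r. r powr (-\<beta>)", OF _ dr])
    show "((\<lambda>r. r powr - \<beta>) has_real_derivative - \<beta> * u powr (- \<beta> - 1)) (at (w 0 / sqrt (m 0)))"
      unfolding u[symmetric] by (rule has_real_derivative_powr[OF upos])
  qed
  have p: "u powr (-\<beta>) = u * u powr (-\<beta> - 1)" using upos powr_mult_base[of u "-\<beta> - 1"] by simp
  have w0: "w 0 = u * ?s" using s u by simp
  have alg: "- \<beta> * q * ((w' * s - u * s * (m' * (inverse s / 2))) / (s * s)) * s + m' * (inverse s / 2) * (u * q)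
      = - \<beta> * q * w' + (\<beta> + 1) * (u * q) / s * (m' / 2)" if "s > 0" for s q :: real
    using that by (simp add: field_simps)
  show ?thesis
  proof (rule DERIV_cong[OF DERIV_mult[OF dp ds]])
    show "- \<beta> * u powr (- \<beta> - 1) * ((w' * ?s - w 0 * (m' * (inverse ?s / 2))) / (?s * ?s)) * sqrt (m 0)
        + m' * (inverse ?s / 2) * (w 0 / sqrt (m 0)) powr - \<beta>
      = - \<beta> * u powr (- \<beta> - 1) * w' + (\<beta> + 1) * u powr - \<beta> / sqrt (m 0) * (m' / 2)"
      unfolding u[symmetric] p unfolding w0 by (rule alg[OF s(1)])
  qed
qed

abbreviation ax1 :: "real^2" where "ax1 \<equiv> axis 1 1"
abbreviation ax2 :: "real^2" where "ax2 \<equiv> axis 2 1"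

lemma D_combination:
  fixes q a b :: "'a::euclidean_space \<Rightarrow> real"
  assumes "smooth_on U q" "smooth_on U a" "smooth_on U b" "open U" "y \<in> U"
  shows "D (\<lambda>y. c * q y * a y + d * b y) y k = c * (D q y k * a y + q y * D a y k) + d * D b y k"
  unfolding D_arith(1)[OF smooth_on_mult[OF smooth_on_mult[OF smooth_on_const assms(1,4)] assms(2,4)] smooth_on_mult[OF smooth_on_const assms(3,4)] assms(5)]
    D_arith(3)[OF smooth_on_mult[OF smooth_on_const assms(1,4)] assms(2,5)]
    D_arith(3)[OF smooth_on_const assms(1,5)] D_arith(3)[OF smooth_on_const assms(3,5)] D_const
  by (simp add: algebra_simps)

text \<open>The hypotheses under which the first variation is computed. Unlike \<open>parallel\<close>, the condition \<open>area_component\<close> concerns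
  derivatives of \<open>J\<close> in all directions: the surface moves off itself.\<close>

locale variational_surface = parallel_surface S G U f ax1 ax2
  for S G U f +
  fixes \<beta> :: real
  assumes area_component: "\<And>y V. y \<in> U \<Longrightarrow> G (f y) (nabla_J G (f y) V (D f y ax1)) (D f y ax2) = 0"
    and kahler_pos: "\<And>y. y \<in> U \<Longrightarrow> G (f y) (J (D f y ax1)) (D f y ax2) > 0"
begin

lemma u_pos: "y \<in> U \<Longrightarrow> u y > 0"
  using u_eq kahler_pos gdet_pos by simp

text \<open>The derivative of the area part of the integrand with respect to the coordinate vectors:
  \<open>Y\<^sub>i = u powr (-\<beta>) \<surd>g g\<^sup>i\<^sup>j X\<^sub>j\<close>.\<close>

definition "Y1 y = (u y powr (-\<beta>) * gdet y powr (-(1/2))) *\<^sub>R (g22 y *\<^sub>R X1 y - g12 y *\<^sub>R X2 y)"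
definition "Y2 y = (u y powr (-\<beta>) * gdet y powr (-(1/2))) *\<^sub>R (g11 y *\<^sub>R X2 y - g12 y *\<^sub>R X1 y)"

lemma smooth_upow: "smooth_on U (\<lambda>y. u y powr r)" "smooth_on U (\<lambda>y. gdet y powr r)"
  by (intro smooth_on_powr smooth_u smooth_g open_U u_pos gdet_pos; assumption)+

lemma smooth_Y: "smooth_on U Y1" "smooth_on U Y2"
  unfolding Y1_def[abs_def] Y2_def[abs_def]
  by (intro smooth_on_scaleR smooth_on_mult smooth_on_diff smooth_upow smooth_g smooth_X open_U)+

lemma gdet_powr: assumes "y \<in> U" shows "gdet y powr (-(1/2)) = 1 / sqrt (gdet y)"
proof -
  have "gdet y powr (1/2) = sqrt (gdet y)" using gdet_pos[OF assms] by (intro powr_half_sqrt) simp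
  then show ?thesis unfolding powr_minus by (simp only: inverse_eq_divide)
qed

text \<open>The map \<open>f + t \<phi> V\<close> and its derivative in the direction \<open>a\<close>, at the pair \<open>(t, y)\<close>. Taking \<open>V\<close> constant
  keeps the variation smooth without a choice of normal fields.\<close>

definition varied :: "(real^2 \<Rightarrow> real) \<Rightarrow> complex^2 \<Rightarrow> real \<times> (real^2) \<Rightarrow> complex^2" where
  "varied \<phi> V p = f (snd p) + (fst p * \<phi> (snd p)) *\<^sub>R V"
definition varied_d :: "real^2 \<Rightarrow> (real^2 \<Rightarrow> real) \<Rightarrow> complex^2 \<Rightarrow> real \<times> (real^2) \<Rightarrow> complex^2" where
  "varied_d a \<phi> V p = D f (snd p) a + (fst p * D \<phi> (snd p) a) *\<^sub>R V"

abbreviation "Lvar \<phi> V p \<equiv> lagrangian \<beta> G (varied \<phi> V p) (varied_d ax1 \<phi> V p) (varied_d ax2 \<phi> V p)"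

text \<open>The value of the first variation of the integrand: \<open>W1\<close> and \<open>W2\<close> are the covariant derivatives of the variation field
  \<open>\<phi> V\<close>.\<close>

definition lagrangian_dot :: "(real^2 \<Rightarrow> real) \<Rightarrow> complex^2 \<Rightarrow> real^2 \<Rightarrow> real" where
  "lagrangian_dot \<phi> V y = (let W1 = D \<phi> y ax1 *\<^sub>R V + \<phi> y *\<^sub>R N1 (\<lambda>_. V) y; W2 = D \<phi> y ax2 *\<^sub>R V + \<phi> y *\<^sub>R N2 (\<lambda>_. V) y in
     - \<beta> * u y powr (-\<beta> - 1) * (G (f y) (J W1) (X2 y) + G (f y) (J (X1 y)) W2)
     + (\<beta> + 1) * (G (f y) W1 (Y1 y) + G (f y) W2 (Y2 y)))"

text \<open>The curves of positions and of coordinate vectors at a fixed parameter point are differentiated covariantly along the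
  curve \<open>c\<close> of positions. The derivative of \<open>J\<close> in the direction \<open>V\<close> drops out by \<open>area_component\<close>.\<close>

lemma derivative_along_variation:
  assumes y: "y \<in> U" and \<phi>: "smooth_on UNIV \<phi>"
  shows "((\<lambda>t. Lvar \<phi> V (t, y)) has_real_derivative lagrangian_dot \<phi> V y) (at 0)"
proof -
  note i = ip[OF y] and s = inner_productD(2)[OF ip[OF y]]
  define c where "c t = f y + (t * \<phi> y) *\<^sub>R V" for t :: real
  define A where "A t = X1 y + (t * D \<phi> y ax1) *\<^sub>R V" for t :: real
  define B where "B t = X2 y + (t * D \<phi> y ax2) *\<^sub>R V" for t :: real
  have z: "c 0 = f y" "A 0 = X1 y" "B 0 = X2 y" by (simp_all add: c_def A_def B_def)
  have dc: "(c has_derivative (\<lambda>t. (t * \<phi> y) *\<^sub>R V)) (at t)"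
    and dA: "(A has_derivative (\<lambda>t. (t * D \<phi> y ax1) *\<^sub>R V)) (at t)"
    and dB: "(B has_derivative (\<lambda>t. (t * D \<phi> y ax2) *\<^sub>R V)) (at t)" for t
    unfolding c_def[abs_def] A_def[abs_def] B_def[abs_def] by (auto intro!: derivative_eq_intros)
  have df: "c differentiable at 0" "A differentiable at 0" "B differentiable at 0"
    using dc dA dB unfolding differentiable_def by blast+
  have dJA: "(\<lambda>t. J (A t)) differentiable at 0"
    using bounded_linear.has_derivative[OF bounded_linear_J dA] unfolding differentiable_def by blast
  have c0: "c 0 \<in> S" using f_in[OF y] z by simp
  define W1 where "W1 = D \<phi> y ax1 *\<^sub>R V + \<phi> y *\<^sub>R N1 (\<lambda>_. V) y"
  define W2 where "W2 = D \<phi> y ax2 *\<^sub>R V + \<phi> y *\<^sub>R N2 (\<lambda>_. V) y"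
  have N: "cov_along G c 1 A 0 = W1" "cov_along G c 1 B 0 = W2"
    using christoffel_sym[OF metric f_in[OF y], of V "X1 y"] christoffel_sym[OF metric f_in[OF y], of V "X2 y"]
    by (simp_all add: cov_along_def W1_def W2_def D_eqI[OF dc] D_eqI[OF dA] D_eqI[OF dB] z D_eqI[OF has_derivative_const]
        bilinear_lmul[OF bilG[OF y]] bilinear_rmul[OF bilG[OF y]])
  have NJA: "G (f y) (cov_along G c 1 (\<lambda>t. J (A t)) 0) (X2 y) = G (f y) (J W1) (X2 y)"
  proof -
    have "cov_along G c 1 (\<lambda>t. J (A t)) 0 = J W1 + nabla_J G (f y) (\<phi> y *\<^sub>R V) (X1 y)"
      using cov_along_J[where f=c and W=A and y=0 and a=1, OF herm c0 df(2)] by (simp add: N z D_eqI[OF dc])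
    then show ?thesis using area_component[OF y] by (simp add: ip_lin[OF i])
  qed
  have r: "((\<lambda>t. G (c t) (P t) (Q t)) has_real_derivative (G (f y) (cov_along G c 1 P 0) (Q 0) + G (f y) (P 0) (cov_along G c 1 Q 0))) (at 0)"
    if "P differentiable at 0" "Q differentiable at 0" for P Q
  proof -
    have d: "((\<lambda>t. G (c t) (P t) (Q t)) has_derivative (\<lambda>a. G (f y) (cov_along G c a P 0) (Q 0) + G (f y) (P 0) (cov_along G c a Q 0))) (at 0)"
      using cov_along_metric[where f=c and V=P and W=Q, OF metric c0 df(1) that] unfolding z .
    have l: "linear (\<lambda>a. G (f y) (cov_along G c a P 0) (Q 0) + G (f y) (P 0) (cov_along G c a Q 0))" by (rule has_derivative_linear[OF d])
    have "(\<lambda>a. G (f y) (cov_along G c a P 0) (Q 0) + G (f y) (P 0) (cov_along G c a Q 0)) = (*) (G (f y) (cov_along G c 1 P 0) (Q 0) + G (f y) (P 0) (cov_along G c 1 Q 0))"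
    proof
      fix a :: real
      show "G (f y) (cov_along G c a P 0) (Q 0) + G (f y) (P 0) (cov_along G c a Q 0) = (G (f y) (cov_along G c 1 P 0) (Q 0) + G (f y) (P 0) (cov_along G c 1 Q 0)) * a"
        using linear_scale[OF l, of a 1] by (simp add: mult.commute)
    qed
    then show ?thesis using d by (simp add: has_field_derivative_def)
  qed
  define w where "w t = G (c t) (J (A t)) (B t)" for t
  define m where "m t = G (c t) (A t) (A t) * G (c t) (B t) (B t) - (G (c t) (A t) (B t))\<^sup>2" for t
  have w: "(w has_real_derivative (G (f y) (J W1) (X2 y) + G (f y) (J (X1 y)) W2)) (at 0)"
    using r[OF dJA df(3)] by (simp add: w_def[abs_def] NJA N z)
  have m: "(m has_real_derivative 2 * (g22 y * G (f y) W1 (X1 y) + g11 y * G (f y) W2 (X2 y)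
      - g12 y * (G (f y) W1 (X2 y) + G (f y) W2 (X1 y)))) (at 0)"
  proof -
    show ?thesis
      unfolding m_def[abs_def]
      by (rule DERIV_cong[OF DERIV_diff[OF DERIV_mult[OF r[OF df(2,2)] r[OF df(3,3)]] DERIV_power[OF r[OF df(2,3)], where n=2]]])
        (simp add: N z g11_def g12_def g22_def s[of "X1 y" W1] s[of "X1 y" W2] s[of "X2 y" W2] algebra_simps)
  qed
  have m0: "m 0 = gdet y" by (simp add: m_def z gdet_def g11_def g12_def g22_def power2_eq_square)
  have w0: "w 0 > 0" using kahler_pos[OF y] by (simp add: w_def z)
  have u0: "u y = w 0 / sqrt (m 0)" unfolding m0 u_eq[OF y] by (simp add: w_def z)
  have e: "(\<lambda>t. Lvar \<phi> V (t, y)) = (\<lambda>t. (w t / sqrt (m t)) powr (-\<beta>) * sqrt (m t))"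
    by (simp add: lagrangian_def varied_def varied_d_def w_def m_def c_def A_def B_def)
  have Yd: "(\<beta> + 1) * (G (f y) W1 (Y1 y) + G (f y) W2 (Y2 y)) = (\<beta> + 1) * u y powr (-\<beta>) / sqrt (m 0) *
     ((2 * (g22 y * G (f y) W1 (X1 y) + g11 y * G (f y) W2 (X2 y) - g12 y * (G (f y) W1 (X2 y) + G (f y) W2 (X1 y)))) / 2)"
    unfolding Y1_def Y2_def gdet_powr[OF y] m0 by (simp add: ip_lin[OF i] algebra_simps add_divide_distrib diff_divide_distrib)
  show ?thesis
    unfolding e lagrangian_dot_def Let_def W1_def[symmetric] W2_def[symmetric] Yd
    by (rule lagrangian_derivative[OF w m w0 _ u0]) (simp add: m0 gdet_pos[OF y])
qed

text \<open>The coefficient of \<open>- (\<beta> + 1) \<phi>\<close> in the first variation, up to a divergence; \<open>pot1\<close> and \<open>pot2\<close> are the potentials of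
  that divergence.\<close>

definition el_density :: "complex^2 \<Rightarrow> real^2 \<Rightarrow> real" where
  "el_density V y = \<beta> * u y powr (-\<beta> - 2) * (D u y ax1 * G (f y) (J V) (X2 y) + D u y ax2 * G (f y) (J (X1 y)) V)
     + G (f y) V (N1 Y1 y + N2 Y2 y)"

definition "pot1 V y = - \<beta> * u y powr (-\<beta> - 1) * G (f y) (J V) (X2 y) + (\<beta> + 1) * G (f y) V (Y1 y)"
definition "pot2 V y = - \<beta> * u y powr (-\<beta> - 1) * G (f y) (J (X1 y)) V + (\<beta> + 1) * G (f y) V (Y2 y)"

lemma smooth_pot: "smooth_on U (pot1 V)" "smooth_on U (pot2 V)"
  unfolding pot1_def[abs_def] pot2_def[abs_def]
  by (intro smooth_on_add smooth_on_mult smooth_on_const smooth_upow smooth_ip smooth_on_J smooth_X smooth_Y open_U)+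

lemma smooth_el_density: "smooth_on U (el_density V)"
  unfolding el_density_def[abs_def]
  by (intro smooth_on_add smooth_on_mult smooth_on_const smooth_upow smooth_ip smooth_on_J smooth_X smooth_N smooth_Y smooth_on_D smooth_u open_U)

text \<open>Integration by parts. The area part contributes the divergence of \<open>\<phi> \<langle>V, Y\<^sub>i\<rangle>\<close>. In the Kaehler part, derivatives fall on \<open>\<phi>\<close>,
  on \<open>V\<close>, on the power of \<open>u\<close> and on the coordinate vectors; the last ones cancel, since the mixed covariant derivatives of \<open>f\<close>
  agree and \<open>J\<close> is skew and parallel. Differentiating the power of \<open>u\<close> produces the factor \<open>\<beta> + 1\<close>.\<close>

lemma lagrangian_dot_divergence:
  assumes y: "y \<in> U" and \<phi>: "smooth_on UNIV \<phi>"
  shows "lagrangian_dot \<phi> V y = D (\<lambda>y. \<phi> y * pot1 V y) y ax1 + D (\<lambda>y. \<phi> y * pot2 V y) y ax2 - (\<beta> + 1) * (\<phi> y * el_density V y)"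
proof -
  note i = ip[OF y] and s = inner_productD(2)[OF ip[OF y]]
  have \<phi>U: "smooth_on U \<phi>" using smooth_on_subset[OF \<phi>] by simp
  let ?V = "\<lambda>_. V :: complex^2"
  have sV: "smooth_on U ?V" by (rule smooth_on_const)
  have tors: "N2 X1 y = N1 X2 y" by (rule cov_along_torsion_free[OF metric open_U y f_in[OF y] smooth_f])
  have Dq: "D (\<lambda>y. u y powr (-\<beta> - 1)) y k = - (\<beta> + 1) * u y powr (-\<beta> - 2) * D u y k" for k
    using D_powr[OF smooth_u y u_pos[OF y], of "-\<beta> - 1" k] by (simp add: algebra_simps)
  note smJV = smooth_ip[OF smooth_on_J[OF sV open_U] smooth_X(2)] smooth_ip[OF smooth_on_J[OF smooth_X(1) open_U] sV]
  have D1: "D (pot1 V) y ax1 = - \<beta> * (- (\<beta> + 1) * u y powr (-\<beta> - 2) * D u y ax1 * G (f y) (J V) (X2 y)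
      + u y powr (-\<beta> - 1) * (G (f y) (J (N1 ?V y)) (X2 y) + G (f y) (J V) (N1 X2 y)))
      + (\<beta> + 1) * (G (f y) (N1 ?V y) (Y1 y) + G (f y) V (N1 Y1 y))"
    unfolding pot1_def[abs_def]
      D_combination[OF smooth_upow(1) smJV(1) smooth_ip[OF sV smooth_Y(1)] open_U y] Dq
      D_ip[OF smooth_on_J[OF sV open_U] smooth_X(2) y] N_J[OF sV y] D_ip[OF sV smooth_Y(1) y] by simp
  have D2: "D (pot2 V) y ax2 = - \<beta> * (- (\<beta> + 1) * u y powr (-\<beta> - 2) * D u y ax2 * G (f y) (J (X1 y)) V
      + u y powr (-\<beta> - 1) * (G (f y) (J (N2 X1 y)) V + G (f y) (J (X1 y)) (N2 ?V y)))
      + (\<beta> + 1) * (G (f y) (N2 ?V y) (Y2 y) + G (f y) V (N2 Y2 y))"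
    unfolding pot2_def[abs_def]
      D_combination[OF smooth_upow(1) smJV(2) smooth_ip[OF sV smooth_Y(2)] open_U y] Dq
      D_ip[OF smooth_on_J[OF smooth_X(1) open_U] sV y] N_J[OF smooth_X(1) y] D_ip[OF sV smooth_Y(2) y] by simp
  have canc: "G (f y) (J (N2 X1 y)) V = - G (f y) (J V) (N1 X2 y)"
    using J_skew(1)[OF i hj[OF y], of "N1 X2 y" V] s[of "N1 X2 y" "J V"] by (simp add: tors)
  show ?thesis
    unfolding D_arith(3)[OF \<phi>U smooth_pot(1) y] D_arith(3)[OF \<phi>U smooth_pot(2) y] D1 D2 canc
    unfolding lagrangian_dot_def Let_def pot1_def pot2_def el_density_def
    by (simp add: ip_lin[OF i] J_alg algebra_simps)
qed

end

lemma sym_bilinear_plane: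
  fixes h :: "real^2 \<Rightarrow> real^2 \<Rightarrow> real"
  assumes b: "bilinear h" and sy: "\<And>a b. h a b = h b a"
  shows "h a c = a $ 1 * c $ 1 * h ax1 ax1 + (a $ 1 * c $ 2 + a $ 2 * c $ 1) * h ax1 ax2 + a $ 2 * c $ 2 * h ax2 ax2"
proof -
  have "h a c = h (a $ 1 *\<^sub>R ax1 + a $ 2 *\<^sub>R ax2) (c $ 1 *\<^sub>R ax1 + c $ 2 *\<^sub>R ax2)"
    by (rule arg_cong2[where f=h, OF real2_expansion real2_expansion])
  also have "\<dots> = a $ 1 * c $ 1 * h ax1 ax1 + (a $ 1 * c $ 2 + a $ 2 * c $ 1) * h ax1 ax2 + a $ 2 * c $ 2 * h ax2 ax2"
    using sy[of ax2 ax1]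
    by (simp add: bilinear_ladd[OF b] bilinear_radd[OF b] bilinear_lmul[OF b] bilinear_rmul[OF b] algebra_simps)
  finally show ?thesis .
qed

text \<open>The numerator of the mean curvature is a quadratic covariant of two binary quadratic forms, of weight two.\<close>

lemma gram_covariant:
  fixes g h :: "real^2 \<Rightarrow> real^2 \<Rightarrow> real"
  assumes g: "bilinear g" "\<And>a b. g a b = g b a" and h: "bilinear h" "\<And>a b. h a b = h b a"
  shows "g c c * h a a - 2 * g a c * h a c + g a a * h c c
    = (a $ 1 * c $ 2 - a $ 2 * c $ 1)\<^sup>2 * (g ax2 ax2 * h ax1 ax1 - 2 * g ax1 ax2 * h ax1 ax2 + g ax1 ax1 * h ax2 ax2)"
  unfolding sym_bilinear_plane[OF g, of c c] sym_bilinear_plane[OF g, of a c] sym_bilinear_plane[OF g, of a a]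
    sym_bilinear_plane[OF h, of c c] sym_bilinear_plane[OF h, of a c] sym_bilinear_plane[OF h, of a a]
  by (simp add: power2_eq_square algebra_simps)

lemma gram_det:
  fixes g :: "real^2 \<Rightarrow> real^2 \<Rightarrow> real"
  assumes g: "bilinear g" "\<And>a b. g a b = g b a"
  shows "g a a * g c c - (g a c)\<^sup>2 = (a $ 1 * c $ 2 - a $ 2 * c $ 1)\<^sup>2 * (g ax1 ax1 * g ax2 ax2 - (g ax1 ax2)\<^sup>2)"
  using gram_covariant[OF g g, of c a] by (simp add: power2_eq_square algebra_simps)

context variational_surface
begin

text \<open>An open set on which the integrand is smooth: the varied map stays in the chart and its Kaehler form stays positive.
  Then the area density is positive by Wirtinger's inequality, so that the varied map is immersed as well.\<close>

definition admissible :: "(real^2 \<Rightarrow> real) \<Rightarrow> complex^2 \<Rightarrow> (real \<times> (real^2)) set" where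
  "admissible \<phi> V = {p. snd p \<in> U \<and> varied \<phi> V p \<in> S \<and> G (varied \<phi> V p) (J (varied_d ax1 \<phi> V p)) (varied_d ax2 \<phi> V p) > 0}"

lemma smooth_varied:
  assumes \<phi>: "smooth_on UNIV \<phi>"
  shows "smooth_on (UNIV \<times> U) (varied \<phi> V)" "smooth_on (UNIV \<times> U) (varied_d a \<phi> V)"
proof -
  have o: "open (UNIV \<times> U :: (real \<times> (real^2)) set)" by (intro open_Times open_U open_UNIV)
  have fs: "smooth_on (UNIV \<times> U) (fst :: real \<times> (real^2) \<Rightarrow> real)" "smooth_on (UNIV \<times> U) (snd :: real \<times> (real^2) \<Rightarrow> real^2)"
    by (intro smooth_on_bounded_linear bounded_linear_fst bounded_linear_snd o)+
  show "smooth_on (UNIV \<times> U) (varied \<phi> V)"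
    unfolding varied_def[abs_def]
    by (intro smooth_on_add smooth_on_scaleR smooth_on_mult smooth_on_const fs o
        smooth_on_compose[OF smooth_f fs(2) o] smooth_on_compose[OF \<phi> fs(2) o]) auto
  show "smooth_on (UNIV \<times> U) (varied_d a \<phi> V)"
    unfolding varied_d_def[abs_def]
    by (intro smooth_on_add smooth_on_scaleR smooth_on_mult smooth_on_const fs o
        smooth_on_compose[OF smooth_on_D[OF smooth_f] fs(2) o] smooth_on_compose[OF smooth_on_D[OF \<phi>] fs(2) o]) auto
qed

lemma open_admissible:
  assumes \<phi>: "smooth_on UNIV \<phi>"
  shows "open (admissible \<phi> V)" "smooth_on (admissible \<phi> V) (\<lambda>p. Lvar \<phi> V p)"
    "p \<in> admissible \<phi> V \<Longrightarrow> G (varied \<phi> V p) (varied_d ax1 \<phi> V p) (varied_d ax1 \<phi> V p) * G (varied \<phi> V p) (varied_d ax2 \<phi> V p) (varied_d ax2 \<phi> V p)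
        - (G (varied \<phi> V p) (varied_d ax1 \<phi> V p) (varied_d ax2 \<phi> V p))\<^sup>2 > 0"
proof -
  have o: "open (UNIV \<times> U :: (real \<times> (real^2)) set)" by (intro open_Times open_U open_UNIV)
  define S' where "S' = (UNIV \<times> U) \<inter> varied \<phi> V -` S"
  have oS: "open S'"
    unfolding S'_def
    by (rule continuous_open_preimage[OF smooth_on_imp_continuous_on[OF smooth_varied(1)[OF \<phi>]] o metric_onD(1)[OF metric]])
  have sv: "smooth_on S' (varied \<phi> V)" and sd: "\<And>a. smooth_on S' (varied_d a \<phi> V)"
    using smooth_varied[OF \<phi>] smooth_on_subset[of "UNIV \<times> U" _ S'] by (auto simp: S'_def)
  have sG: "smooth_on S' (\<lambda>p. G (varied \<phi> V p) (P p) (Q p))" if "smooth_on S' P" "smooth_on S' Q" for P Q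
    by (rule smooth_on_bilinear_family[where S=S and h=G and f="varied \<phi> V" and V=P and W=Q,
          OF metric_onD(4)[OF metric] metric_onD(3)[OF metric] oS sv _ that]) (auto simp: S'_def)
  have sw: "smooth_on S' (\<lambda>p. G (varied \<phi> V p) (J (varied_d ax1 \<phi> V p)) (varied_d ax2 \<phi> V p))"
    by (intro sG smooth_on_J sd oS)
  have eq: "admissible \<phi> V = S' \<inter> (\<lambda>p. G (varied \<phi> V p) (J (varied_d ax1 \<phi> V p)) (varied_d ax2 \<phi> V p)) -` {0<..}"
    by (auto simp: admissible_def S'_def)
  show od: "open (admissible \<phi> V)"
    unfolding eq by (rule continuous_open_preimage[OF smooth_on_imp_continuous_on[OF sw] oS open_greaterThan])
  have sub: "admissible \<phi> V \<subseteq> S'" unfolding eq by blast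
  show pos: "G (varied \<phi> V p) (varied_d ax1 \<phi> V p) (varied_d ax1 \<phi> V p) * G (varied \<phi> V p) (varied_d ax2 \<phi> V p) (varied_d ax2 \<phi> V p)
        - (G (varied \<phi> V p) (varied_d ax1 \<phi> V p) (varied_d ax2 \<phi> V p))\<^sup>2 > 0" if p: "p \<in> admissible \<phi> V" for p
  proof -
    have pS: "varied \<phi> V p \<in> S" and w: "G (varied \<phi> V p) (J (varied_d ax1 \<phi> V p)) (varied_d ax2 \<phi> V p) > 0"
      using p by (auto simp: admissible_def)
    have "(G (varied \<phi> V p) (J (varied_d ax1 \<phi> V p)) (varied_d ax2 \<phi> V p))\<^sup>2 > 0" using w by simp
    then show ?thesis
      using wirtinger[OF metric_onD(2)[OF metric pS] hermitian_onD(2)[OF herm pS], of "varied_d ax1 \<phi> V p" "varied_d ax2 \<phi> V p"] by linarith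
  qed
  note ss = smooth_on_subset[OF sG[OF sd sd] sub]
  have posq: "G (varied \<phi> V p) (J (varied_d ax1 \<phi> V p)) (varied_d ax2 \<phi> V p) / sqrt (G (varied \<phi> V p) (varied_d ax1 \<phi> V p) (varied_d ax1 \<phi> V p) * G (varied \<phi> V p) (varied_d ax2 \<phi> V p) (varied_d ax2 \<phi> V p)
        - (G (varied \<phi> V p) (varied_d ax1 \<phi> V p) (varied_d ax2 \<phi> V p))\<^sup>2) > 0" if p: "p \<in> admissible \<phi> V" for p
  proof (rule divide_pos_pos)
    show "G (varied \<phi> V p) (J (varied_d ax1 \<phi> V p)) (varied_d ax2 \<phi> V p) > 0" using p by (simp add: admissible_def)
  qed (rule real_sqrt_gt_zero[OF pos[OF p]])
  show "smooth_on (admissible \<phi> V) (\<lambda>p. Lvar \<phi> V p)"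
    unfolding lagrangian_def
    by (intro smooth_on_mult smooth_on_powr smooth_on_divide smooth_on_sqrt smooth_on_diff smooth_on_power ss smooth_on_subset[OF sw sub] od pos posq real_sqrt_gt_zero)
qed

lemma admissible_0: "y \<in> U \<Longrightarrow> (0, y) \<in> admissible \<phi> V"
  using f_in kahler_pos by (simp add: admissible_def varied_def varied_d_def)

lemma admissible_tube:
  assumes \<phi>: "smooth_on UNIV \<phi>" and K: "compact K" "K \<subseteq> U"
  shows "\<exists>\<delta>>0. \<forall>t x. \<bar>t\<bar> < \<delta> \<longrightarrow> x \<in> K \<longrightarrow> (t, x) \<in> admissible \<phi> V"
proof -
  have "{0} \<times> K \<subseteq> admissible \<phi> V" using admissible_0 K(2) by auto
  from Elementary_Topology.tube_lemma[OF K(1) open_admissible(1)[OF \<phi>] this] obtain T where T: "0 \<in> T" "open T" "T \<times> K \<subseteq> admissible \<phi> V" by blast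
  then obtain \<delta> where "\<delta> > 0" "ball 0 \<delta> \<subseteq> T" using openE by blast
  then show ?thesis using T(3) by (intro exI[of _ \<delta>]) auto
qed

lemma first_variation:
  assumes \<phi>: "smooth_on UNIV \<phi>" and K: "cbox p q \<subseteq> U"
  shows "((\<lambda>t. integral (cbox p q) (\<lambda>x. Lvar \<phi> V (t, x))) has_real_derivative integral (cbox p q) (lagrangian_dot \<phi> V)) (at 0)"
    "continuous_on (cbox p q) (lagrangian_dot \<phi> V)"
proof -
  obtain \<delta> where \<delta>: "\<delta> > 0" "\<And>t x. \<bar>t\<bar> < \<delta> \<Longrightarrow> x \<in> cbox p q \<Longrightarrow> (t, x) \<in> admissible \<phi> V"
    using admissible_tube[OF \<phi> compact_cbox K, of V] by blast
  define T where "T = {-\<delta>/2..\<delta>/2}"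
  have in_dom: "(t, x) \<in> admissible \<phi> V" if "t \<in> T" "x \<in> cbox p q" for t x
    using that \<delta>(1) by (intro \<delta>(2)) (auto simp: T_def)
  have T0: "0 \<in> interior T" using \<delta>(1) by (simp add: T_def)
  note sm = open_admissible(2)[OF \<phi>, of V]
  have d: "((\<lambda>t. Lvar \<phi> V (t, x)) has_real_derivative D (\<lambda>p. Lvar \<phi> V p) (t, x) (1, 0)) (at t)"
    if "(t, x) \<in> admissible \<phi> V" for t x
  proof -
    have "((\<lambda>s. Lvar \<phi> V ((0, x) + s *\<^sub>R (1, 0))) has_vector_derivative D (\<lambda>p. Lvar \<phi> V p) ((0, x) + t *\<^sub>R (1, 0)) (1, 0)) (at t)"
      by (rule D_line) (use smooth_on_imp_differentiable[OF sm that] in simp)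
    then show ?thesis by (simp add: has_real_derivative_iff_has_vector_derivative)
  qed
  have cont: "continuous_on (T \<times> cbox p q) (\<lambda>z. D (\<lambda>p. Lvar \<phi> V p) z (1, 0))"
    by (rule continuous_on_subset[OF smooth_on_imp_continuous_on[OF smooth_on_D[OF sm]]]) (use in_dom in auto)
  have cL: "continuous_on (T \<times> cbox p q) (\<lambda>p. Lvar \<phi> V p)"
    by (rule continuous_on_subset[OF smooth_on_imp_continuous_on[OF sm]]) (use in_dom in auto)
  have e: "D (\<lambda>p. Lvar \<phi> V p) (0, x) (1, 0) = lagrangian_dot \<phi> V x" if "x \<in> cbox p q" for x
  proof -
    have x: "x \<in> U" using that K by auto
    show ?thesis by (rule DERIV_unique[OF d[OF admissible_0[OF x]] derivative_along_variation[OF x \<phi>]])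
  qed
  have "((\<lambda>t. integral (cbox p q) (\<lambda>x. Lvar \<phi> V (t, x))) has_field_derivative integral (cbox p q) (\<lambda>x. D (\<lambda>p. Lvar \<phi> V p) (0, x) (1, 0))) (at 0 within T)"
  proof (rule leibniz_rule_field_derivative[where f="\<lambda>t x. Lvar \<phi> V (t, x)" and fx="\<lambda>t x. D (\<lambda>p. Lvar \<phi> V p) (t, x) (1, 0)"])
    show "((\<lambda>t. Lvar \<phi> V (t, x)) has_real_derivative D (\<lambda>p. Lvar \<phi> V p) (t, x) (1, 0)) (at t within T)" if "t \<in> T" "x \<in> cbox p q" for t x
      by (rule has_field_derivative_at_within[OF d[OF in_dom[OF that]]])
    show "(\<lambda>x. Lvar \<phi> V (t, x)) integrable_on cbox p q" if "t \<in> T" for t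
      by (rule integrable_continuous[OF continuous_on_compose2[OF cL]]) (use that in \<open>auto intro!: continuous_intros\<close>)
    show "continuous_on (T \<times> cbox p q) (\<lambda>(t, x). D (\<lambda>p. Lvar \<phi> V p) (t, x) (1, 0))"
      using cont by (simp add: case_prod_unfold)
    show "convex T" "0 \<in> T" using T0 interior_subset by (auto simp: T_def)
  qed
  moreover have "integral (cbox p q) (\<lambda>x. D (\<lambda>p. Lvar \<phi> V p) (0, x) (1, 0)) = integral (cbox p q) (lagrangian_dot \<phi> V)"
    by (rule integral_cong) (rule e)
  ultimately show "((\<lambda>t. integral (cbox p q) (\<lambda>x. Lvar \<phi> V (t, x))) has_real_derivative integral (cbox p q) (lagrangian_dot \<phi> V)) (at 0)"
    using at_within_interior[OF T0] by simp
  have "continuous_on (cbox p q) (\<lambda>x. D (\<lambda>p. Lvar \<phi> V p) (0, x) (1, 0))"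
    by (rule continuous_on_compose2[OF cont]) (use T0 interior_subset in \<open>auto intro!: continuous_intros\<close>)
  then show "continuous_on (cbox p q) (lagrangian_dot \<phi> V)" using e by (metis (no_types, lifting) continuous_on_cong)
qed

text \<open>Critical points satisfy the Euler-Lagrange equation against every constant \<open>V\<close>: the divergence integrates to zero and
  \<open>\<beta> + 1\<close> can be divided out.\<close>

lemma euler_lagrange:
  assumes b1: "\<beta> \<noteq> -1" and y: "y \<in> U"
    and crit: "\<And>\<phi> r. r > 0 \<Longrightarrow> cube y r \<subseteq> U \<Longrightarrow> smooth_on UNIV \<phi> \<Longrightarrow> (\<And>x. x \<notin> ball y r \<Longrightarrow> \<phi> x = 0) \<Longrightarrow>
      ((\<lambda>t. integral (cube y r) (\<lambda>x. Lvar \<phi> V (t, x))) has_real_derivative 0) (at 0)"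
  shows "el_density V y = 0"
proof (rule fundamental_lemma[OF open_U y smooth_on_imp_continuous_on[OF smooth_el_density]])
  fix r :: real and \<phi> :: "real^2 \<Rightarrow> real"
  assume r: "r > 0" "cube y r \<subseteq> U" and \<phi>: "smooth_on UNIV \<phi>" and supp: "\<And>x. x \<notin> ball y r \<Longrightarrow> \<phi> x = 0"
  let ?K = "cube y r"
  have cb: "cball y r \<subseteq> U" using cball_subset_cube[OF r(1)] r(2) by auto
  note fv = first_variation[OF \<phi> r(2)[unfolded cube_def], of V, folded cube_def]
  have "integral ?K (lagrangian_dot \<phi> V) = 0"
    using DERIV_unique[OF fv(1) crit[OF r \<phi> supp]] .
  define P where "P q = (\<lambda>x. if x \<in> U then \<phi> x * q x else 0)" for q
  have DP: "integral ?K (\<lambda>x. D (P q) x a) = 0" and cP: "continuous_on ?K (\<lambda>x. D (P q) x a)" if "smooth_on U q" for q a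
  proof -
    have sP: "smooth_on UNIV (P q)" unfolding P_def by (rule smooth_on_extend_by_0[OF \<phi> that open_U cb supp])
    show "integral ?K (\<lambda>x. D (P q) x a) = 0" by (rule integral_D_eq_0[OF sP r(1)]) (simp add: P_def supp)
    show "continuous_on ?K (\<lambda>x. D (P q) x a)"
      by (rule continuous_on_subset[OF smooth_on_imp_continuous_on[OF smooth_on_D[OF sP]]]) simp
  qed
  have e: "lagrangian_dot \<phi> V x = D (P (pot1 V)) x ax1 + D (P (pot2 V)) x ax2 - (\<beta> + 1) * (\<phi> x * el_density V x)" if "x \<in> ?K" for x
  proof -
    have x: "x \<in> U" using that r(2) by auto
    have "D (P q) x = D (\<lambda>x. \<phi> x * q x) x" for q
      by (rule D_cong_open[OF open_U x]) (simp add: P_def)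
    then show ?thesis using lagrangian_dot_divergence[OF x \<phi>] by simp
  qed
  have cE: "continuous_on ?K (\<lambda>x. \<phi> x * el_density V x)"
    by (intro continuous_on_mult continuous_on_subset[OF smooth_on_imp_continuous_on[OF \<phi>]]
        continuous_on_subset[OF smooth_on_imp_continuous_on[OF smooth_el_density] r(2)]) simp
  have i: "(\<lambda>x. D (P (pot1 V)) x ax1) integrable_on ?K" "(\<lambda>x. D (P (pot2 V)) x ax2) integrable_on ?K" "(\<lambda>x. \<phi> x * el_density V x) integrable_on ?K"
    using cP[OF smooth_pot(1)] cP[OF smooth_pot(2)] cE unfolding cube_def by (auto intro: integrable_continuous)
  have "0 = integral ?K (\<lambda>x. D (P (pot1 V)) x ax1 + D (P (pot2 V)) x ax2 - (\<beta> + 1) * (\<phi> x * el_density V x))"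
    unfolding \<open>integral ?K (lagrangian_dot \<phi> V) = 0\<close>[symmetric] by (rule integral_cong) (rule e)
  also have "\<dots> = integral ?K (\<lambda>x. D (P (pot1 V)) x ax1 + D (P (pot2 V)) x ax2) - integral ?K (\<lambda>x. (\<beta> + 1) * (\<phi> x * el_density V x))"
    by (rule integral_diff[OF integrable_add[OF i(1,2)] integrable_on_mult_right[OF i(3)]])
  also have "integral ?K (\<lambda>x. D (P (pot1 V)) x ax1 + D (P (pot2 V)) x ax2) = 0"
    using integral_add[OF i(1,2)] DP[OF smooth_pot(1)] DP[OF smooth_pot(2)] by simp
  also have "integral ?K (\<lambda>x. (\<beta> + 1) * (\<phi> x * el_density V x)) = (\<beta> + 1) * integral ?K (\<lambda>x. \<phi> x * el_density V x)"
    by (rule integral_mult_right)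
  finally show "integral ?K (\<lambda>x. \<phi> x * el_density V x) = 0" using b1 by simp
qed

text \<open>For normal \<open>V\<close>, the derivatives of the coefficients of \<open>Y1\<close> and \<open>Y2\<close> drop out, as they multiply tangent vectors; \<open>N1 Y1 + N2 Y2\<close>
  becomes the mean curvature.\<close>

lemma euler_lagrange_normal:
  assumes y: "y \<in> U" and el: "el_density V y = 0" and n: "G (f y) V (X1 y) = 0" "G (f y) V (X2 y) = 0"
  shows "(g22 y * G (f y) V (N1 X1 y) - 2 * g12 y * G (f y) V (N1 X2 y) + g11 y * G (f y) V (N2 X2 y)) / sqrt (gdet y)
      + \<beta> / (u y)\<^sup>2 * (D u y ax1 * G (f y) (J V) (X2 y) + D u y ax2 * G (f y) (J (X1 y)) V) = 0"
proof -
  note i = ip[OF y]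
  have tors: "N2 X1 y = N1 X2 y" by (rule cov_along_torsion_free[OF metric open_U y f_in[OF y] smooth_f])
  define k where "k = (\<lambda>y. u y powr (-\<beta>) * gdet y powr (-(1/2)))"
  have sk: "smooth_on U k" unfolding k_def by (intro smooth_on_mult smooth_upow open_U)
  have comb: "G (f y) V (cov_along G f a (\<lambda>y. k y *\<^sub>R (p y *\<^sub>R P y - q y *\<^sub>R Q y)) y) = k y * (p y * G (f y) V (cov_along G f a P y) - q y * G (f y) V (cov_along G f a Q y))"
    if s: "smooth_on U p" "smooth_on U q" "smooth_on U P" "smooth_on U Q" and PQ: "G (f y) V (P y) = 0" "G (f y) V (Q y) = 0" for a p q P Q
  proof -
    note sq = smooth_on_minus[OF s(2) open_U]
    have "cov_along G f a (\<lambda>y. k y *\<^sub>R (p y *\<^sub>R P y + (- q y) *\<^sub>R Q y)) y = D k y a *\<^sub>R (p y *\<^sub>R P y + (- q y) *\<^sub>R Q y)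
        + k y *\<^sub>R ((D p y a *\<^sub>R P y + p y *\<^sub>R cov_along G f a P y) + (D (\<lambda>y. - q y) y a *\<^sub>R Q y + (- q y) *\<^sub>R cov_along G f a Q y))"
      unfolding N_scaleR[OF sk smooth_on_add[OF smooth_on_scaleR[OF s(1,3) open_U] smooth_on_scaleR[OF sq s(4) open_U] open_U] y]
        N_add[OF smooth_on_scaleR[OF s(1,3) open_U] smooth_on_scaleR[OF sq s(4) open_U] y] N_scaleR[OF s(1,3) y] N_scaleR[OF sq s(4) y] ..
    then show ?thesis by (simp add: ip_lin[OF i] PQ)
  qed
  have "G (f y) V (N1 Y1 y) = k y * (g22 y * G (f y) V (N1 X1 y) - g12 y * G (f y) V (N1 X2 y))"
    unfolding Y1_def[abs_def] using comb[OF smooth_g(3,2) smooth_X n] by (simp add: k_def)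
  moreover have "G (f y) V (N2 Y2 y) = k y * (g11 y * G (f y) V (N2 X2 y) - g12 y * G (f y) V (N2 X1 y))"
    unfolding Y2_def[abs_def] using comb[OF smooth_g(1,2) smooth_X(2,1) n(2,1)] by (simp add: k_def)
  ultimately have NY: "G (f y) V (N1 Y1 y + N2 Y2 y) = u y powr (-\<beta>) * ((g22 y * G (f y) V (N1 X1 y) - 2 * g12 y * G (f y) V (N1 X2 y) + g11 y * G (f y) V (N2 X2 y)) / sqrt (gdet y))"
    by (simp add: ip_lin[OF i] tors k_def gdet_powr[OF y] algebra_simps add_divide_distrib diff_divide_distrib)
  have up: "u y powr (-\<beta> - 2) = u y powr (-\<beta>) / (u y)\<^sup>2"
    using u_pos[OF y] by (simp add: powr_diff)
  have "u y powr (-\<beta>) * ((g22 y * G (f y) V (N1 X1 y) - 2 * g12 y * G (f y) V (N1 X2 y) + g11 y * G (f y) V (N2 X2 y)) / sqrt (gdet y)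
      + \<beta> / (u y)\<^sup>2 * (D u y ax1 * G (f y) (J V) (X2 y) + D u y ax2 * G (f y) (J (X1 y)) V)) = 0"
    using el unfolding el_density_def NY up by (simp add: algebra_simps)
  then show ?thesis using u_pos[OF y] by simp
qed

text \<open>With the determinant \<open>d\<close> of the new basis, the numerator of the mean curvature is multiplied by \<open>d\<^sup>2\<close>, the area by \<open>d > 0\<close>, and the
  second term, alternating in the directions, by \<open>d\<close>. Thus the equation is multiplied by \<open>d\<close>.\<close>

lemma euler_lagrange_basis:
  assumes y: "y \<in> U" and det: "a $ 1 * c $ 2 - a $ 2 * c $ 1 > 0"
    and EL: "(g22 y * G (f y) V (N1 X1 y) - 2 * g12 y * G (f y) V (N1 X2 y) + g11 y * G (f y) V (N2 X2 y)) / sqrt (gdet y)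
      + \<beta> / (u y)\<^sup>2 * (D u y ax1 * G (f y) (J V) (X2 y) + D u y ax2 * G (f y) (J (X1 y)) V) = 0"
  shows "(G (f y) (D f y c) (D f y c) * G (f y) V (cov_along G f a (\<lambda>y. D f y a) y)
        - 2 * G (f y) (D f y a) (D f y c) * G (f y) V (cov_along G f a (\<lambda>y. D f y c) y)
        + G (f y) (D f y a) (D f y a) * G (f y) V (cov_along G f c (\<lambda>y. D f y c) y))
      / sqrt (G (f y) (D f y a) (D f y a) * G (f y) (D f y c) (D f y c) - (G (f y) (D f y a) (D f y c))\<^sup>2)
      + \<beta> / (u y)\<^sup>2 * (D u y a * G (f y) (J V) (D f y c) + D u y c * G (f y) (J (D f y a)) V) = 0"
proof -
  note i = ip[OF y] and s = inner_productD(2)[OF ip[OF y]]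
  define d where "d = a $ 1 * c $ 2 - a $ 2 * c $ 1"
  have d: "d > 0" using det by (simp add: d_def)
  have Lf: "linear (D f y)" and Lu: "linear (D u y)"
    using linear_D smooth_on_imp_differentiable[OF _ y] smooth_f smooth_u by blast+
  let ?g = "\<lambda>a b. G (f y) (D f y a) (D f y b)"
  let ?h = "\<lambda>a b. G (f y) V (cov_along G f a (\<lambda>y. D f y b) y)"
  have g: "bilinear ?g" "\<And>a b. ?g a b = ?g b a"
    by (auto simp: bilinear_def linear_iff ip_lin[OF i] linear_add[OF Lf] linear_scale[OF Lf] s)
  have tors: "cov_along G f a (\<lambda>y. D f y b) y = cov_along G f b (\<lambda>y. D f y a) y" for a b
    by (rule cov_along_torsion_free[OF metric open_U y f_in[OF y] smooth_f])
  have lc: "linear (\<lambda>a. cov_along G f a W y)" if "smooth_on U W" for W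
    using linear_D[OF smooth_on_imp_differentiable[OF that y]] Lf
    by (auto simp: cov_along_def linear_iff bilinear_ladd[OF bilG[OF y]] bilinear_lmul[OF bilG[OF y]] algebra_simps)
  have hl: "linear (\<lambda>a. ?h a b)" for b
    using lc[OF smooth_on_D[OF smooth_f, of b]] by (auto simp: linear_iff ip_lin[OF i])
  have hs: "?h a b = ?h b a" for a b by (rule arg_cong[OF tors])
  have h: "bilinear ?h"
  proof -
    have "(\<lambda>b. ?h a b) = (\<lambda>b. ?h b a)" for a by (rule ext) (rule hs)
    then show ?thesis unfolding bilinear_def using hl by simp
  qed
  have gd: "sqrt (?g a a * ?g c c - (?g a c)\<^sup>2) = d * sqrt (gdet y)"
    unfolding gram_det[OF g, of a c] using d
    by (simp add: d_def[symmetric] real_sqrt_mult gdet_def g11_def g12_def g22_def power2_eq_square)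
  have num: "?g c c * ?h a a - 2 * ?g a c * ?h a c + ?g a a * ?h c c = d\<^sup>2 * (g22 y * G (f y) V (N1 X1 y) - 2 * g12 y * G (f y) V (N1 X2 y) + g11 y * G (f y) V (N2 X2 y))"
    unfolding gram_covariant[OF g h hs, of c a] by (simp add: d_def g11_def g12_def g22_def)
  have JX: "G (f y) (J (D f y b)) V = - G (f y) (J V) (D f y b)" for b
    using J_skew(1)[OF i hj[OF y], of "D f y b" V] s[of "D f y b" "J V"] by simp
  let ?\<eta> = "\<lambda>a c. D u y a * G (f y) (J V) (D f y c) - D u y c * G (f y) (J V) (D f y a)"
  have "bilinear ?\<eta>"
    by (auto simp: bilinear_def linear_iff ip_lin[OF i] linear_add[OF Lf] linear_scale[OF Lf] linear_add[OF Lu] linear_scale[OF Lu] algebra_simps)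
  then have eta: "?\<eta> a c = d * ?\<eta> ax1 ax2"
    using alternating_plane[of ?\<eta> a c] by (simp add: d_def)
  have g0: "sqrt (gdet y) > 0" using gdet_pos[OF y] by simp
  define n where "n = g22 y * G (f y) V (N1 X1 y) - 2 * g12 y * G (f y) V (N1 X2 y) + g11 y * G (f y) V (N2 X2 y)"
  define e where "e = ?\<eta> ax1 ax2"
  have EL': "n / sqrt (gdet y) + \<beta> / (u y)\<^sup>2 * e = 0"
    using EL unfolding JX n_def e_def by simp
  have "(d\<^sup>2 * n) / (d * sqrt (gdet y)) = d * (n / sqrt (gdet y))"
    using d g0 by (simp add: power2_eq_square)
  moreover have "D u y a * G (f y) (J V) (D f y c) + D u y c * - G (f y) (J V) (D f y a) = d * e"
    using eta by (simp add: e_def)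
  ultimately have "(d\<^sup>2 * n) / (d * sqrt (gdet y)) + \<beta> / (u y)\<^sup>2 * (D u y a * G (f y) (J V) (D f y c) + D u y c * - G (f y) (J V) (D f y a))
      = d * (n / sqrt (gdet y) + \<beta> / (u y)\<^sup>2 * e)" by (simp only: distrib_left mult.left_commute)
  then show ?thesis
    unfolding gd num JX n_def[symmetric] EL' by simp
qed

end

section \<open>Charts\<close>

lemma is_chartD:
  assumes "is_chart c"
  shows "open (cdom c)" "open (cmap c ` cdom c)" "continuous_on (cdom c) (cmap c)" "continuous_on (cmap c ` cdom c) (cinv c)"
    "p \<in> cdom c \<Longrightarrow> cinv c (cmap c p) = p" "x \<in> cmap c ` cdom c \<Longrightarrow> cinv c x \<in> cdom c"
    "x \<in> cmap c ` cdom c \<Longrightarrow> cmap c (cinv c x) = x" "inj_on (cmap c) (cdom c)"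
proof -
  have h: "homeomorphism (cdom c) (cmap c ` cdom c) (cmap c) (cinv c)" and o: "open (cdom c)" "open (cmap c ` cdom c)"
    using assms by (auto simp: is_chart_def)
  show "open (cdom c)" "open (cmap c ` cdom c)" by (fact o)+
  show "continuous_on (cdom c) (cmap c)" "continuous_on (cmap c ` cdom c) (cinv c)"
    using h by (auto simp: homeomorphism_def)
  show i: "p \<in> cdom c \<Longrightarrow> cinv c (cmap c p) = p" for p using h by (auto simp: homeomorphism_def)
  show "x \<in> cmap c ` cdom c \<Longrightarrow> cinv c x \<in> cdom c" "x \<in> cmap c ` cdom c \<Longrightarrow> cmap c (cinv c x) = x"
    using h by (auto simp: homeomorphism_def)
  show "inj_on (cmap c) (cdom c)" by (rule inj_on_inverseI[of _ "cinv c"]) (rule i)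
qed

lemma cmap_image_eq:
  assumes c: "is_chart c" and V: "V \<subseteq> cdom c"
  shows "cmap c ` V = cmap c ` cdom c \<inter> cinv c -` V"
proof (intro equalityI subsetI)
  fix x assume "x \<in> cmap c ` V"
  then show "x \<in> cmap c ` cdom c \<inter> cinv c -` V" using V is_chartD(5)[OF c] by auto
next
  fix x assume "x \<in> cmap c ` cdom c \<inter> cinv c -` V"
  then show "x \<in> cmap c ` V" using is_chartD(7)[OF c, of x] by (metis IntE imageI vimageE)
qed

lemma cinv_image_eq:
  assumes c: "is_chart c" and V: "V \<subseteq> cmap c ` cdom c"
  shows "cinv c ` V = cdom c \<inter> cmap c -` V"
proof (intro equalityI subsetI)
  fix x assume "x \<in> cinv c ` V"
  then show "x \<in> cdom c \<inter> cmap c -` V" using V is_chartD(6,7)[OF c] by auto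
next
  fix x assume "x \<in> cdom c \<inter> cmap c -` V"
  then show "x \<in> cinv c ` V" using is_chartD(5)[OF c, of x] by (metis IntE imageI vimageE)
qed

lemma open_cmap_image:
  assumes "is_chart c" "V \<subseteq> cdom c" "open V"
  shows "open (cmap c ` V)"
  unfolding cmap_image_eq[OF assms(1,2)]
  by (rule continuous_open_preimage[OF is_chartD(4,2)[OF assms(1)] assms(3)])

lemma open_cinv_image:
  assumes "is_chart c" "V \<subseteq> cmap c ` cdom c" "open V"
  shows "open (cinv c ` V)"
  unfolding cinv_image_eq[OF assms(1,2)]
  by (rule continuous_open_preimage[OF is_chartD(3,1)[OF assms(1)] assms(3)])

text \<open>The manifolds with their atlases; the map of the surface stays a variable of the lemmas, because variations replace it.\<close>

locale surface_setting =
  fixes A :: "('m::{t2_space,second_countable_topology}, complex^2) chart set"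
    and h :: "('m, complex^2) chart \<Rightarrow> (complex^2) metric"
    and B :: "('s::{t2_space,second_countable_topology}, real^2) chart set"
  assumes hermite: "hermite_surface A h" and surface: "closed_oriented_surface B"
begin

lemma chartA: "d \<in> A \<Longrightarrow> is_chart d" and chartB: "c \<in> B \<Longrightarrow> is_chart c"
  using hermite surface by (auto simp: hermite_surface_def complex_surface_def closed_oriented_surface_def smooth_atlas_def)

lemma coverA: "\<exists>d\<in>A. q \<in> cdom d" and coverB: "\<exists>c\<in>B. p \<in> cdom c"
proof -
  have "(\<Union>c\<in>A. cdom c) = UNIV" "(\<Union>c\<in>B. cdom c) = UNIV"
    using hermite surface by (auto simp: hermite_surface_def complex_surface_def closed_oriented_surface_def smooth_atlas_def)
  then show "\<exists>d\<in>A. q \<in> cdom d" "\<exists>c\<in>B. p \<in> cdom c" by blast+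
qed

lemma hermitian_chart: assumes "d \<in> A" shows "hermitian_on (cmap d ` cdom d) (h d)"
proof -
  have "riemannian_metric A h" "\<forall>c\<in>A. \<forall>x\<in>cmap c ` cdom c. \<forall>u v. h c x (J u) (J v) = h c x u v"
    using hermite by (auto simp: hermite_surface_def)
  then show ?thesis
    using assms is_chartD(2)[OF chartA[OF assms]] unfolding hermitian_on_def metric_on_def riemannian_metric_def by blast
qed

lemma metric_transition:
  assumes "d \<in> A" "d' \<in> A" "x \<in> overlap d d'"
  shows "h d' (transition d d' x) (D (transition d d') x u) (D (transition d d') x v) = h d x u v"
    "D (transition d d') x (J v) = J (D (transition d d') x v)"
  using hermite assms by (auto simp: hermite_surface_def riemannian_metric_def complex_surface_def)

lemma open_overlap:
  assumes "is_chart c" "is_chart d" shows "open (overlap c d)"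
  unfolding overlap_def by (rule open_cmap_image[OF assms(1)]) (auto intro: open_Int is_chartD(1)[OF assms(1)] is_chartD(1)[OF assms(2)])

lemma smooth_transition:
  "d \<in> A \<Longrightarrow> d' \<in> A \<Longrightarrow> smooth_on (overlap d d') (transition d d')"
  "c \<in> B \<Longrightarrow> c' \<in> B \<Longrightarrow> smooth_on (overlap c c') (transition c c')"
  using hermite surface by (auto simp: hermite_surface_def complex_surface_def closed_oriented_surface_def smooth_atlas_def)

lemma det_transition:
  "c \<in> B \<Longrightarrow> c' \<in> B \<Longrightarrow> x \<in> overlap c c' \<Longrightarrow> det (matrix (D (transition c c') x)) > 0"
  using surface by (auto simp: closed_oriented_surface_def)

lemma transition_cmap: "is_chart c \<Longrightarrow> p \<in> cdom c \<Longrightarrow> transition c c' (cmap c p) = cmap c' p"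
  by (simp add: transition_def is_chartD(5))

lemma open_local_dom:
  assumes "c \<in> B" "d \<in> A" "continuous_on UNIV F"
  shows "open (cdom c \<inter> F -` cdom d)" "open (local_dom c d F)"
proof -
  show o: "open (cdom c \<inter> F -` cdom d)"
    using is_chartD(1)[OF chartB[OF assms(1)]] is_chartD(1)[OF chartA[OF assms(2)]] assms(3)
    by (intro open_Int open_vimage)
  show "open (local_dom c d F)"
    unfolding local_dom_def by (rule open_cmap_image[OF chartB[OF assms(1)] _ o]) auto
qed

lemma local_domD:
  assumes "c \<in> B" "d \<in> A" "x \<in> local_dom c d F"
  shows "cinv c x \<in> cdom c" "F (cinv c x) \<in> cdom d" "cmap c (cinv c x) = x" "local_rep c d F x \<in> cmap d ` cdom d"
    "cinv d (local_rep c d F x) = F (cinv c x)"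
  using assms is_chartD(5)[OF chartB[OF assms(1)]] is_chartD(5)[OF chartA[OF assms(2)]]
  by (auto simp: local_dom_def local_rep_def)

lemma local_domI:
  assumes "p \<in> cdom c" "F p \<in> cdom d"
  shows "cmap c p \<in> local_dom c d F"
  using assms by (auto simp: local_dom_def)

lemma local_rep_cmap: "c \<in> B \<Longrightarrow> p \<in> cdom c \<Longrightarrow> local_rep c d F (cmap c p) = cmap d (F p)"
  by (simp add: local_rep_def is_chartD(5)[OF chartB])

text \<open>The relation holds on an open set, so that it can be differentiated.\<close>

lemma local_rep_change:
  assumes ch: "c \<in> B" "c' \<in> B" "d \<in> A" "d' \<in> A" and F: "continuous_on UNIV F"
    and p: "p \<in> cdom c" "p \<in> cdom c'" "F p \<in> cdom d" "F p \<in> cdom d'"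
  shows "\<exists>N. open N \<and> cmap c' p \<in> N \<and> N \<subseteq> local_dom c' d' F \<and> N \<subseteq> overlap c' c \<and>
    (\<forall>y\<in>N. transition c' c y \<in> local_dom c d F \<and> local_rep c d F (transition c' c y) \<in> overlap d d' \<and>
      local_rep c' d' F y = transition d d' (local_rep c d F (transition c' c y)))"
proof -
  note C = chartB[OF ch(1)] chartB[OF ch(2)] and E = chartA[OF ch(3)] chartA[OF ch(4)]
  define W where "W = cdom c \<inter> cdom c' \<inter> F -` (cdom d \<inter> cdom d')"
  have oW: "open W"
    unfolding W_def using is_chartD(1)[OF C(1)] is_chartD(1)[OF C(2)] is_chartD(1)[OF E(1)] is_chartD(1)[OF E(2)] F
    by (intro open_Int open_vimage)
  show ?thesis
  proof (intro exI[of _ "cmap c' ` W"] conjI ballI)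
    show "open (cmap c' ` W)" by (rule open_cmap_image[OF C(2) _ oW]) (auto simp: W_def)
    show "cmap c' p \<in> cmap c' ` W" using p by (auto simp: W_def)
    show "cmap c' ` W \<subseteq> local_dom c' d' F" "cmap c' ` W \<subseteq> overlap c' c" by (auto simp: W_def local_dom_def overlap_def)
    fix y assume "y \<in> cmap c' ` W"
    then obtain q where q: "q \<in> W" "y = cmap c' q" by blast
    then have t: "transition c' c y = cmap c q" using transition_cmap[OF C(2), of q c] by (simp add: W_def)
    show "transition c' c y \<in> local_dom c d F" using q unfolding t by (auto simp: W_def local_dom_def)
    show "local_rep c d F (transition c' c y) \<in> overlap d d'"
    proof -
      have "local_rep c d F (cmap c q) = cmap d (F q)" using q by (intro local_rep_cmap[OF ch(1)]) (simp add: W_def)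
      then show ?thesis using q unfolding t overlap_def by (simp add: W_def)
    qed
    show "local_rep c' d' F y = transition d d' (local_rep c d F (transition c' c y))"
      using q local_rep_cmap[OF ch(1), of q d F] local_rep_cmap[OF ch(2), of q d' F] transition_cmap[OF E(1), of "F q" d']
      unfolding t by (auto simp: W_def)
  qed
qed

lemma local_rep_derivative:
  assumes ch: "c \<in> B" "c' \<in> B" "d \<in> A" "d' \<in> A" and F: "continuous_on UNIV F"
    and p: "p \<in> cdom c" "p \<in> cdom c'" "F p \<in> cdom d" "F p \<in> cdom d'"
    and df: "local_rep c d F differentiable (at (cmap c p))"
  shows "(local_rep c' d' F has_derivative (\<lambda>v. D (transition d d') (cmap d (F p)) (D (local_rep c d F) (cmap c p) (D (transition c' c) (cmap c' p) v)))) (at (cmap c' p))"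
proof -
  obtain N where N: "open N" "cmap c' p \<in> N" "N \<subseteq> overlap c' c"
    "\<And>y. y \<in> N \<Longrightarrow> local_rep c' d' F y = transition d d' (local_rep c d F (transition c' c y))"
    using local_rep_change[OF ch F p] by blast
  note C = chartB[OF ch(1)] chartB[OF ch(2)]
  have t: "transition c' c (cmap c' p) = cmap c p" by (rule transition_cmap[OF C(2) p(2)])
  have f: "local_rep c d F (cmap c p) = cmap d (F p)" by (rule local_rep_cmap[OF ch(1) p(1)])
  have ov: "cmap d (F p) \<in> overlap d d'" using p by (auto simp: overlap_def)
  have d1: "(transition c' c has_derivative D (transition c' c) (cmap c' p)) (at (cmap c' p))"
    using N(2,3) by (intro smooth_on_has_derivative[OF smooth_transition(2)[OF ch(2,1)]]) auto
  have d2: "(local_rep c d F has_derivative D (local_rep c d F) (cmap c p)) (at (transition c' c (cmap c' p)))"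
    unfolding t using df by (simp add: frechet_derivative_works)
  have d3: "(transition d d' has_derivative D (transition d d') (cmap d (F p))) (at (local_rep c d F (transition c' c (cmap c' p))))"
    unfolding t f by (rule smooth_on_has_derivative[OF smooth_transition(1)[OF ch(3,4)] ov])
  have "((\<lambda>y. transition d d' (local_rep c d F (transition c' c y))) has_derivative
      (\<lambda>v. D (transition d d') (cmap d (F p)) (D (local_rep c d F) (cmap c p) (D (transition c' c) (cmap c' p) v)))) (at (cmap c' p))"
    by (rule has_derivative_compose[OF has_derivative_compose[OF d1 d2] d3])
  then show ?thesis
    by (rule has_derivative_transform_within_open[OF _ N(1,2)]) (simp add: N(4))
qed

lemma det_matrix_real2:
  fixes L :: "real^2 \<Rightarrow> real^2"
  shows "det (matrix L) = L ax1 $ 1 * L ax2 $ 2 - L ax1 $ 2 * L ax2 $ 1"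
  by (simp add: det_2 matrix_def)

lemma area_density_gram:
  "area_density (induced_metric G f) x = sqrt (G (f x) (D f x ax1) (D f x ax1) * G (f x) (D f x ax2) (D f x ax2) - (G (f x) (D f x ax1) (D f x ax2))\<^sup>2)"
  by (simp add: area_density_def induced_metric_def)

text \<open>The transition map of the ambient surface is a holomorphic isometry and changes nothing. The one of the surface acts linearly on the
  coordinate vectors, and the two quantities are alternating, respectively the square root of a Gram determinant.\<close>

lemma chart_change_quantities:
  assumes ch: "c \<in> B" "c' \<in> B" "d \<in> A" "d' \<in> A" and F: "continuous_on UNIV F"
    and p: "p \<in> cdom c" "p \<in> cdom c'" "F p \<in> cdom d" "F p \<in> cdom d'"
    and df: "local_rep c d F differentiable (at (cmap c p))"
  defines "f \<equiv> local_rep c d F" and "f' \<equiv> local_rep c' d' F" and "x \<equiv> cmap c p" and "x' \<equiv> cmap c' p"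
  shows "kahler_form (h d') (f' x') (D f' x' ax1) (D f' x' ax2) = det (matrix (D (transition c' c) x')) * kahler_form (h d) (f x) (D f x ax1) (D f x ax2)"
    "area_density (induced_metric (h d') f') x' = \<bar>det (matrix (D (transition c' c) x'))\<bar> * area_density (induced_metric (h d) f) x"
proof -
  note E = chartA[OF ch(3)] chartA[OF ch(4)]
  let ?L = "D (transition c' c) x'"
  have Df': "D f' x' v = D (transition d d') (cmap d (F p)) (D f x (?L v))" for v
    unfolding f_def f'_def x_def x'_def by (rule D_eqI[OF local_rep_derivative[OF ch F p df]])
  have fx: "f x = cmap d (F p)" "f' x' = cmap d' (F p)"
    using local_rep_cmap[OF ch(1) p(1)] local_rep_cmap[OF ch(2) p(2)] by (simp_all add: f_def f'_def x_def x'_def)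
  have ov: "cmap d (F p) \<in> overlap d d'" using p by (auto simp: overlap_def)
  have tr: "transition d d' (cmap d (F p)) = cmap d' (F p)" by (rule transition_cmap[OF E(1) p(3)])
  note mt = metric_transition[OF ch(3,4) ov, unfolded tr]
  have xS: "cmap d (F p) \<in> cmap d ` cdom d" using p by auto
  note ip = metric_onD(2)[OF hermitian_onD(1)[OF hermitian_chart[OF ch(3)]] xS] and hj = hermitian_onD(2)[OF hermitian_chart[OF ch(3)] xS]
  have Lf: "linear (D f x)" by (rule linear_D) (use df in \<open>simp add: f_def x_def\<close>)
  have m: "h d' (f' x') (D f' x' v) (D f' x' w) = h d (f x) (D f x (?L v)) (D f x (?L w))" for v w
    unfolding Df' fx by (rule mt(1))
  have "kahler_form (h d') (f' x') (D f' x' ax1) (D f' x' ax2) = h d (f x) (J (D f x (?L ax1))) (D f x (?L ax2))"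
    unfolding kahler_form_def Df' fx mt(2)[symmetric] by (rule mt(1))
  also have "\<dots> = det (matrix ?L) * kahler_form (h d) (f x) (D f x ax1) (D f x ax2)"
    unfolding kahler_form_def det_matrix_real2 fx by (rule kahler_form_alternating[OF ip hj Lf])
  finally show "kahler_form (h d') (f' x') (D f' x' ax1) (D f' x' ax2) = det (matrix ?L) * kahler_form (h d) (f x) (D f x ax1) (D f x ax2)" .
  have g: "bilinear (\<lambda>a b. h d (f x) (D f x a) (D f x b))" "\<And>a b. h d (f x) (D f x a) (D f x b) = h d (f x) (D f x b) (D f x a)"
    unfolding fx using inner_productD(2)[OF ip]
    by (auto simp: bilinear_def linear_iff ip_lin[OF ip] linear_add[OF Lf] linear_scale[OF Lf])
  show "area_density (induced_metric (h d') f') x' = \<bar>det (matrix ?L)\<bar> * area_density (induced_metric (h d) f) x"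
    unfolding area_density_gram m gram_det[OF g, of "?L ax1" "?L ax2"] det_matrix_real2
    by (simp only: real_sqrt_mult real_sqrt_abs)
qed

lemma immersion_rep:
  assumes im: "immersion B A F" and ch: "c \<in> B" "d \<in> A" and x: "x \<in> local_dom c d F"
  shows "smooth_on (local_dom c d F) (local_rep c d F)" "inj (D (local_rep c d F) x)" "local_rep c d F differentiable (at x)"
    "continuous_on UNIV F" "open (local_dom c d F)"
proof -
  show s: "smooth_on (local_dom c d F) (local_rep c d F)" and "inj (D (local_rep c d F) x)" and c: "continuous_on UNIV F"
    using im ch x by (auto simp: immersion_def)
  show "local_rep c d F differentiable (at x)" by (rule smooth_on_imp_differentiable[OF s x])
  show "open (local_dom c d F)" by (rule open_local_dom[OF ch c])
qed

text \<open>The Gram determinant is \<open>\<bar>X\<bar>\<^sup>2\<close> times the squared length of the component of \<open>Y\<close> orthogonal to \<open>X\<close>.\<close>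

lemma gram_pos:
  assumes b: "inner_product b" and L: "linear L" "inj L"
  shows "b (L ax1) (L ax1) * b (L ax2) (L ax2) - (b (L ax1) (L ax2))\<^sup>2 > 0"
proof -
  let ?X = "L ax1" and ?Y = "L ax2"
  have X: "?X \<noteq> 0" using L linear_injective_0[of L] axis_eq_0_iff[of "1::2" "1::real"] by auto
  then have p: "b ?X ?X > 0" by (rule inner_productD(3)[OF b])
  define r where "r = b ?X ?Y / b ?X ?X"
  have r: "r * b ?X ?X = b ?X ?Y" using p by (simp add: r_def)
  have "?Y - r *\<^sub>R ?X = L (ax2 - r *\<^sub>R ax1)" using L(1) by (simp add: linear_diff linear_scale)
  moreover have "ax2 - r *\<^sub>R ax1 \<noteq> 0"
  proof
    assume "ax2 - r *\<^sub>R ax1 = 0"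
    then have "(ax2 - r *\<^sub>R ax1) $ 2 = 0" by simp
    then show False by (simp add: axis_def)
  qed
  ultimately have "?Y - r *\<^sub>R ?X \<noteq> 0" using L linear_injective_0[of L] by auto
  then have "0 < b (?Y - r *\<^sub>R ?X) (?Y - r *\<^sub>R ?X)" by (rule inner_productD(3)[OF b])
  also have "\<dots> = b ?Y ?Y - 2 * (r * b ?X ?Y) + r * (r * b ?X ?X)"
    using inner_productD(2)[OF b, of ?Y ?X] by (simp add: ip_lin[OF b] algebra_simps)
  also have "\<dots> = b ?Y ?Y - r * b ?X ?Y" unfolding r by simp
  finally have "0 < b ?X ?X * (b ?Y ?Y - r * b ?X ?Y)" using p by simp
  also have "\<dots> = b ?X ?X * b ?Y ?Y - (r * b ?X ?X) * b ?X ?Y" by (simp add: algebra_simps)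
  finally show ?thesis unfolding r by (simp add: power2_eq_square)
qed

lemma area_density_pos:
  assumes im: "immersion B A F" and ch: "c \<in> B" "d \<in> A" and x: "x \<in> local_dom c d F"
  shows "area_density (induced_metric (h d) (local_rep c d F)) x > 0"
proof -
  note i = immersion_rep[OF im ch x]
  have "local_rep c d F x \<in> cmap d ` cdom d" by (rule local_domD(4)[OF ch x])
  then have "inner_product (h d (local_rep c d F x))" by (rule metric_onD(2)[OF hermitian_onD(1)[OF hermitian_chart[OF ch(2)]]])
  from gram_pos[OF this linear_D[OF i(3)] i(2)] show ?thesis
    unfolding area_density_gram by simp
qed

text \<open>The quotient does not depend on the charts, because transition maps of the surface preserve the orientation, and it lies between
  \<open>-1\<close> and \<open>1\<close> by Wirtinger's inequality. Hence its arccosine is the angle that the definition describes.\<close>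

lemma cos_kahler_angle:
  assumes im: "immersion B A F" and ch: "c \<in> B" "d \<in> A" and p: "p \<in> cdom c" "F p \<in> cdom d"
  defines "f \<equiv> local_rep c d F" and "x \<equiv> cmap c p"
  shows "cos (kahler_angle A h B F p) = kahler_form (h d) (f x) (D f x ax1) (D f x ax2) / area_density (induced_metric (h d) f) x"
proof -
  define k where "k c d = kahler_form (h d) (local_rep c d F (cmap c p)) (D (local_rep c d F) (cmap c p) ax1) (D (local_rep c d F) (cmap c p) ax2)" for c d
  define a where "a c d = area_density (induced_metric (h d) (local_rep c d F)) (cmap c p)" for c d
  have apos: "a c d > 0" if "c \<in> B" "d \<in> A" "p \<in> cdom c" "F p \<in> cdom d" for c d
    unfolding a_def by (rule area_density_pos[OF im that(1,2) local_domI[where F=F, OF that(3,4)]])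
  have quot: "k c' d' / a c' d' = k c d / a c d" if c': "c' \<in> B" "d' \<in> A" "p \<in> cdom c'" "F p \<in> cdom d'" for c' d'
  proof -
    note i = immersion_rep[OF im ch local_domI[where F=F, OF p]]
    note q = chart_change_quantities[OF ch(1) c'(1) ch(2) c'(2) i(4) p(1) c'(3) p(2) c'(4) i(3)]
    have "cmap c' p \<in> overlap c' c" using p c' by (auto simp: overlap_def)
    then have "det (matrix (D (transition c' c) (cmap c' p))) > 0" by (rule det_transition[OF c'(1) ch(1)])
    then show ?thesis unfolding k_def a_def q by simp
  qed
  define \<alpha> where "\<alpha> = arccos (k c d / a c d)"
  have bound: "\<bar>k c d / a c d\<bar> \<le> 1"
  proof -
    have fS: "local_rep c d F (cmap c p) \<in> cmap d ` cdom d" by (rule local_domD(4)[OF ch local_domI[where F=F, OF p]])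
    have "(k c d)\<^sup>2 \<le> (a c d)\<^sup>2"
      using wirtinger[OF metric_onD(2)[OF hermitian_onD(1)[OF hermitian_chart[OF ch(2)]] fS] hermitian_onD(2)[OF hermitian_chart[OF ch(2)] fS]]
        apos[OF ch p]
      unfolding k_def a_def area_density_gram kahler_form_def by simp
    then have "\<bar>k c d\<bar> \<le> a c d" using apos[OF ch p] by (simp add: abs_le_square_iff[symmetric])
    then show ?thesis using apos[OF ch p] by (simp add: abs_divide)
  qed
  have cos\<alpha>: "cos \<alpha> = k c d / a c d" unfolding \<alpha>_def using bound by (intro cos_arccos_abs) 
  have "kahler_angle A h B F p = \<alpha>"
    unfolding kahler_angle_def Let_def
  proof (rule the_equality)
    have "0 \<le> \<alpha> \<and> \<alpha> \<le> pi" unfolding \<alpha>_def using abs_le_D1[OF bound] abs_le_D2[OF bound] by (intro conjI arccos_lbound arccos_ubound) linarith+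
    moreover have "k c' d' = cos \<alpha> * a c' d'" if "c' \<in> B" "d' \<in> A" "p \<in> cdom c'" "F p \<in> cdom d'" for c' d'
      using quot[OF that] apos[OF that] unfolding cos\<alpha> by (simp add: field_simps)
    ultimately show "0 \<le> \<alpha> \<and> \<alpha> \<le> pi \<and> (\<forall>c\<in>B. \<forall>d\<in>A. p \<in> cdom c \<and> F p \<in> cdom d \<longrightarrow>
        kahler_form (h d) (local_rep c d F (cmap c p)) (D (local_rep c d F) (cmap c p) ax1) (D (local_rep c d F) (cmap c p) ax2)
          = cos \<alpha> * area_density (induced_metric (h d) (local_rep c d F)) (cmap c p))"
      unfolding k_def a_def by blast
  next
    fix \<gamma> assume \<gamma>: "0 \<le> \<gamma> \<and> \<gamma> \<le> pi \<and> (\<forall>c\<in>B. \<forall>d\<in>A. p \<in> cdom c \<and> F p \<in> cdom d \<longrightarrow>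
        kahler_form (h d) (local_rep c d F (cmap c p)) (D (local_rep c d F) (cmap c p) ax1) (D (local_rep c d F) (cmap c p) ax2)
          = cos \<gamma> * area_density (induced_metric (h d) (local_rep c d F)) (cmap c p))"
    then have "k c d = cos \<gamma> * a c d" using ch p unfolding k_def a_def by blast
    then have "cos \<gamma> = k c d / a c d" using apos[OF ch p] by simp
    then show "\<gamma> = \<alpha>" unfolding \<alpha>_def using \<gamma> by (metis arccos_cos)
  qed
  then show ?thesis using cos\<alpha> by (simp add: k_def a_def f_def x_def)
qed

end

section \<open>The area measure\<close>

lemma nn_integral_finite_imp:
  fixes q :: "'a::euclidean_space \<Rightarrow> real"
  assumes m: "(\<lambda>x. q x * indicator S x) \<in> borel_measurable borel" and nn: "\<And>x. x \<in> S \<Longrightarrow> q x \<ge> 0"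
    and fin: "(\<integral>\<^sup>+x\<in>S. ennreal (q x) \<partial>lborel) < \<infinity>"
  shows "q absolutely_integrable_on S"
proof -
  have e: "(\<integral>\<^sup>+x. ennreal (q x * indicator S x) \<partial>lborel) = (\<integral>\<^sup>+x\<in>S. ennreal (q x) \<partial>lborel)"
    by (rule nn_integral_cong) (simp add: indicator_def)
  have "(\<lambda>x. q x * indicator S x) integrable_on UNIV"
    by (rule nn_integral_integrable_on[OF m]) (use nn fin e in \<open>auto simp: indicator_def\<close>)
  also have "(\<lambda>x. q x * indicator S x) = (\<lambda>x. if x \<in> S then q x else 0)" by (auto simp: indicator_def)
  finally have "q integrable_on S" by (simp only: integrable_restrict_UNIV)
  then show ?thesis using nn by (rule nonnegative_absolutely_integrable_1)
qed

text \<open>The change of variables for absolutely integrable functions with values in \<open>real^1\<close>, transferred to nonnegative integrals; if one of the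
  two sides is finite then its integrand is absolutely integrable, and otherwise both are infinite.\<close>

lemma nn_integral_change_of_variables:
  fixes g :: "real^2 \<Rightarrow> real" and \<tau> :: "real^2 \<Rightarrow> real^2"
  assumes S: "S \<in> sets borel"
    and der: "\<And>x. x \<in> S \<Longrightarrow> (\<tau> has_derivative \<tau>' x) (at x within S)" and inj: "inj_on \<tau> S"
    and nn: "\<And>x. x \<in> \<tau> ` S \<Longrightarrow> g x \<ge> 0"
    and m1: "(\<lambda>x. g x * indicator (\<tau> ` S) x) \<in> borel_measurable borel"
    and m2: "(\<lambda>x. (\<bar>det (matrix (\<tau>' x))\<bar> * g (\<tau> x)) * indicator S x) \<in> borel_measurable borel"
  shows "(\<integral>\<^sup>+x\<in>\<tau> ` S. ennreal (g x) \<partial>lborel) = (\<integral>\<^sup>+x\<in>S. ennreal (\<bar>det (matrix (\<tau>' x))\<bar> * g (\<tau> x)) \<partial>lborel)"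
proof -
  let ?p = "\<lambda>x. \<bar>det (matrix (\<tau>' x))\<bar> * g (\<tau> x)"
  have pn: "?p x \<ge> 0" if "x \<in> S" for x using nn that by simp
  have Sl: "S \<in> sets lebesgue" using S by simp
  have bl1: "bounded_linear (\<lambda>r::real. r *\<^sub>R (1::real^1))" by (rule bounded_linear_scaleR_left)
  have bl2: "bounded_linear (\<lambda>v::real^1. v $ 1)" by (rule bounded_linear_vec_nth)
  have conv: "q absolutely_integrable_on T \<and> integral T q = b \<longleftrightarrow>
      (\<lambda>x. q x *\<^sub>R (1::real^1)) absolutely_integrable_on T \<and> integral T (\<lambda>x. q x *\<^sub>R (1::real^1)) = b *\<^sub>R 1"
    for q :: "real^2 \<Rightarrow> real" and T b
  proof
    assume *: "q absolutely_integrable_on T \<and> integral T q = b"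
    then have "q integrable_on T" by (simp add: set_lebesgue_integral_eq_integral(1))
    then have "integral T ((\<lambda>r::real. r *\<^sub>R (1::real^1)) \<circ> q) = b *\<^sub>R 1"
      using integral_linear[OF _ bl1] * by blast
    moreover have "((\<lambda>r::real. r *\<^sub>R (1::real^1)) \<circ> q) absolutely_integrable_on T"
      using absolutely_integrable_linear[OF _ bl1] * by blast
    ultimately show "(\<lambda>x. q x *\<^sub>R (1::real^1)) absolutely_integrable_on T \<and> integral T (\<lambda>x. q x *\<^sub>R (1::real^1)) = b *\<^sub>R 1"
      by (simp add: o_def)
  next
    assume *: "(\<lambda>x. q x *\<^sub>R (1::real^1)) absolutely_integrable_on T \<and> integral T (\<lambda>x. q x *\<^sub>R (1::real^1)) = b *\<^sub>R 1"
    then have "(\<lambda>x. q x *\<^sub>R (1::real^1)) integrable_on T" by (simp add: set_lebesgue_integral_eq_integral(1))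
    then have "integral T ((\<lambda>v::real^1. v $ 1) \<circ> (\<lambda>x. q x *\<^sub>R (1::real^1))) = (b *\<^sub>R (1::real^1)) $ 1"
      using integral_linear[OF _ bl2] * by metis
    moreover have "((\<lambda>v::real^1. v $ 1) \<circ> (\<lambda>x. q x *\<^sub>R (1::real^1))) absolutely_integrable_on T"
      using absolutely_integrable_linear[OF _ bl2] * by blast
    ultimately show "q absolutely_integrable_on T \<and> integral T q = b"
      by (simp add: o_def)
  qed
  have cov: "?p absolutely_integrable_on S \<and> integral S ?p = b \<longleftrightarrow> g absolutely_integrable_on \<tau> ` S \<and> integral (\<tau> ` S) g = b" for b
    unfolding conv using has_absolute_integral_change_of_variables[OF Sl der inj, of "\<lambda>x. g x *\<^sub>R (1::real^1)" "b *\<^sub>R 1"]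
    by (simp add: scaleR_scaleR)
  have val: "(\<integral>\<^sup>+x\<in>T. ennreal (q x) \<partial>lborel) = ennreal (integral T q)" if "q absolutely_integrable_on T" "\<And>x. x \<in> T \<Longrightarrow> q x \<ge> 0"
    for q :: "real^2 \<Rightarrow> real" and T
    using nn_integral_has_integral_lebesgue'[OF that(2) integrable_integral[OF set_lebesgue_integral_eq_integral(1)[OF that(1)]]] .
  have both: "(\<integral>\<^sup>+x\<in>\<tau> ` S. ennreal (g x) \<partial>lborel) = (\<integral>\<^sup>+x\<in>S. ennreal (?p x) \<partial>lborel)"
    if "?p absolutely_integrable_on S \<or> g absolutely_integrable_on \<tau> ` S"
  proof -
    have "?p absolutely_integrable_on S \<and> g absolutely_integrable_on \<tau> ` S \<and> integral S ?p = integral (\<tau> ` S) g"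
      using that cov by blast
    then show ?thesis using val[where q=g and T="\<tau> ` S"] val[where q="?p" and T=S] nn pn by simp
  qed
  show ?thesis
  proof (cases "(\<integral>\<^sup>+x\<in>\<tau> ` S. ennreal (g x) \<partial>lborel) < \<infinity> \<or> (\<integral>\<^sup>+x\<in>S. ennreal (?p x) \<partial>lborel) < \<infinity>")
    case True
    then show ?thesis
      using nn_integral_finite_imp[OF m1 nn] nn_integral_finite_imp[OF m2 pn] both by blast
  next
    case False
    then show ?thesis by (simp add: not_less top_unique)
  qed
qed

lemma disjoint_family_on_image:
  assumes "inj_on f Q" "\<And>i. i \<in> I \<Longrightarrow> X i \<subseteq> Q" "disjoint_family_on X I"
  shows "disjoint_family_on (\<lambda>i. f ` X i) I"
  unfolding disjoint_family_on_def
proof (intro ballI impI)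
  fix i j assume ij: "i \<in> I" "j \<in> I" "i \<noteq> j"
  have "f ` X i \<inter> f ` X j = f ` (X i \<inter> X j)"
    by (rule inj_on_image_Int[OF assms(1) assms(2)[OF ij(1)] assms(2)[OF ij(2)], symmetric])
  also have "X i \<inter> X j = {}" using assms(3) ij by (auto simp: disjoint_family_on_def)
  finally show "f ` X i \<inter> f ` X j = {}" by simp
qed

context surface_setting
begin

abbreviation "dens c d F x \<equiv> area_density (induced_metric (h d) (local_rep c d F)) x"
abbreviation "patch c d F \<equiv> cdom c \<inter> F -` cdom d"

text \<open>The area measure of a patch, transported to the coordinate plane.\<close>

definition "patch_measure c d F = density lborel (\<lambda>x. ennreal (dens c d F x * indicator (local_dom c d F) x))"

lemma sets_patch_measure: "sets (patch_measure c d F) = sets borel" by (simp add: patch_measure_def)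

lemma cmap_borel:
  assumes c: "is_chart c" and X: "X \<in> sets borel" "X \<subseteq> cdom c"
  shows "cmap c ` X \<in> sets borel"
proof -
  have o: "open (cmap c ` cdom c)" by (rule is_chartD(2)[OF c])
  have "cinv c \<in> borel_measurable (restrict_space borel (cmap c ` cdom c))"
    by (rule borel_measurable_continuous_on_restrict[OF is_chartD(4)[OF c]])
  from measurable_sets[OF this X(1)] have "cinv c -` X \<inter> cmap c ` cdom c \<in> sets borel"
    using o by (simp add: space_restrict_space sets_restrict_space_iff)
  then show ?thesis unfolding cmap_image_eq[OF c X(2)] by (simp add: Int_commute)
qed

lemma smooth_gram:
  assumes im: "immersion B A F" and ch: "c \<in> B" "d \<in> A"
  shows "smooth_on (local_dom c d F) (\<lambda>x. h d (local_rep c d F x) (D (local_rep c d F) x a) (D (local_rep c d F) x b))"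
    "smooth_on (local_dom c d F) (\<lambda>x. kahler_form (h d) (local_rep c d F x) (D (local_rep c d F) x a) (D (local_rep c d F) x b))"
    "smooth_on (local_dom c d F) (dens c d F)"
    "open (local_dom c d F)" "smooth_on (local_dom c d F) (local_rep c d F)" "open (patch c d F)"
proof -
  have F: "continuous_on UNIV F" using im by (simp add: immersion_def)
  show s: "smooth_on (local_dom c d F) (local_rep c d F)" using im ch by (simp add: immersion_def)
  show o: "open (local_dom c d F)" "open (patch c d F)" by (rule open_local_dom[OF ch F])+
  note m = hermitian_onD(1)[OF hermitian_chart[OF ch(2)]]
  have G: "smooth_on (local_dom c d F) (\<lambda>x. h d (local_rep c d F x) (V x) (W x))"
    if "smooth_on (local_dom c d F) V" "smooth_on (local_dom c d F) W" for V W
    by (rule smooth_on_bilinear_family[where h="h d" and f="local_rep c d F" and V=V and W=W,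
          OF metric_onD(4)[OF m] metric_onD(3)[OF m] o(1) s local_domD(4)[OF ch] that])
  show g: "smooth_on (local_dom c d F) (\<lambda>x. h d (local_rep c d F x) (D (local_rep c d F) x a) (D (local_rep c d F) x b))" for a b
    by (intro G smooth_on_D s)
  show "smooth_on (local_dom c d F) (\<lambda>x. kahler_form (h d) (local_rep c d F x) (D (local_rep c d F) x a) (D (local_rep c d F) x b))"
    unfolding kahler_form_def by (intro G smooth_on_J smooth_on_D s o)
  show "smooth_on (local_dom c d F) (dens c d F)"
    unfolding area_density_gram
  proof (intro smooth_on_sqrt smooth_on_diff smooth_on_mult smooth_on_power g o)
    fix x assume x: "x \<in> local_dom c d F"
    then have "dens c d F x > 0" by (rule area_density_pos[OF im ch])
    then show "0 < h d (local_rep c d F x) (D (local_rep c d F) x ax1) (D (local_rep c d F) x ax1) * h d (local_rep c d F x) (D (local_rep c d F) x ax2) (D (local_rep c d F) x ax2)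
      - (h d (local_rep c d F x) (D (local_rep c d F) x ax1) (D (local_rep c d F) x ax2))\<^sup>2"
      unfolding area_density_gram by simp
  qed
qed

lemma dens_measurable:
  assumes im: "immersion B A F" and ch: "c \<in> B" "d \<in> A" and Y: "Y \<in> sets borel" "Y \<subseteq> local_dom c d F"
  shows "(\<lambda>x. dens c d F x * indicator Y x) \<in> borel_measurable borel"
proof -
  have "(\<lambda>x. indicator Y x *\<^sub>R dens c d F x) \<in> borel_measurable borel"
    by (rule borel_measurable_continuous_on_indicator[OF Y(1)
          continuous_on_subset[OF smooth_on_imp_continuous_on[OF smooth_gram(3)[OF im ch]] Y(2)]])
  then show ?thesis by (simp add: mult.commute)
qed

lemma emeasure_patch_measure:
  assumes im: "immersion B A F" and ch: "c \<in> B" "d \<in> A" and X: "X \<in> sets borel" "X \<subseteq> patch c d F"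
  shows "emeasure (patch_measure c d F) (cmap c ` X) = (\<integral>\<^sup>+x\<in>cmap c ` X. ennreal (dens c d F x) \<partial>lborel)"
proof -
  have Y: "cmap c ` X \<in> sets borel" by (rule cmap_borel[OF chartB[OF ch(1)] X(1)]) (use X in auto)
  have sub: "cmap c ` X \<subseteq> local_dom c d F" using X(2) by (auto simp: local_dom_def)
  have "(\<lambda>x. ennreal (dens c d F x * indicator (local_dom c d F) x)) \<in> borel_measurable lborel"
    using dens_measurable[OF im ch _ subset_refl] smooth_gram(4)[OF im ch] by simp
  then have "emeasure (patch_measure c d F) (cmap c ` X) = (\<integral>\<^sup>+x\<in>cmap c ` X. ennreal (dens c d F x * indicator (local_dom c d F) x) \<partial>lborel)"
    unfolding patch_measure_def using Y by (intro emeasure_density) simp_all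
  also have "\<dots> = (\<integral>\<^sup>+x\<in>cmap c ` X. ennreal (dens c d F x) \<partial>lborel)"
    using sub by (intro nn_integral_cong) (auto simp: indicator_def)
  finally show ?thesis .
qed

lemma patch_measure_change:
  assumes im: "immersion B A F" and ch: "c \<in> B" "d \<in> A" "c' \<in> B" "d' \<in> A"
    and X: "X \<in> sets borel" "X \<subseteq> patch c d F" "X \<subseteq> patch c' d' F"
  shows "emeasure (patch_measure c d F) (cmap c ` X) = emeasure (patch_measure c' d' F) (cmap c' ` X)"
proof -
  define S where "S = cmap c' ` X"
  define \<tau> where "\<tau> = transition c' c"
  note C = chartB[OF ch(1)] chartB[OF ch(3)]
  have S: "S \<in> sets borel" unfolding S_def by (rule cmap_borel[OF C(2) X(1)]) (use X in auto)
  have t: "\<tau> (cmap c' p) = cmap c p" if "p \<in> X" for p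
    unfolding \<tau>_def using that X(3) by (intro transition_cmap[OF C(2)]) auto
  have im\<tau>: "\<tau> ` S = cmap c ` X" unfolding S_def image_image using t by (auto intro!: image_cong)
  have ov: "S \<subseteq> overlap c' c" unfolding S_def overlap_def using X by auto
  have Sl: "S \<subseteq> local_dom c' d' F" unfolding S_def local_dom_def using X by auto
  have Tl: "\<tau> ` S \<subseteq> local_dom c d F" unfolding im\<tau> local_dom_def using X by auto
  have inj: "inj_on \<tau> S"
  proof (rule inj_onI)
    fix x y assume "x \<in> S" "y \<in> S" and e: "\<tau> x = \<tau> y"
    then obtain p q where p: "p \<in> X" "q \<in> X" "x = cmap c' p" "y = cmap c' q" by (auto simp: S_def)
    then have "cmap c p = cmap c q" using e t by simp
    then have "p = q" using inj_onD[OF is_chartD(8)[OF C(1)]] p X(2) by blast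
    then show "x = y" using p by simp
  qed
  have der: "(\<tau> has_derivative D \<tau> x) (at x within S)" if "x \<in> S" for x
    unfolding \<tau>_def using smooth_on_has_derivative[OF smooth_transition(2)[OF ch(3,1)]] that ov
    by (blast intro: has_derivative_at_withinI)
  have dq: "dens c' d' F x = \<bar>det (matrix (D \<tau> x))\<bar> * dens c d F (\<tau> x)" if x: "x \<in> S" for x
  proof -
    obtain p where p: "p \<in> X" "x = cmap c' p" using x by (auto simp: S_def)
    then have pp: "p \<in> cdom c" "F p \<in> cdom d" "p \<in> cdom c'" "F p \<in> cdom d'" using X by auto
    note i = immersion_rep[OF im ch(1,2) local_domI[where F=F, OF pp(1,2)]]
    show ?thesis
      using chart_change_quantities(2)[OF ch(1,3,2,4) i(4) pp(1,3,2,4) i(3)] t[OF p(1)] p(2) by (simp add: \<tau>_def)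
  qed
  have nn: "dens c d F x \<ge> 0" if "x \<in> \<tau> ` S" for x
    using area_density_pos[OF im ch(1,2)] that Tl by (auto intro: less_imp_le)
  have m1: "(\<lambda>x. dens c d F x * indicator (\<tau> ` S) x) \<in> borel_measurable borel"
    by (rule dens_measurable[OF im ch(1,2) _ Tl]) (use im\<tau> cmap_borel[OF C(1) X(1)] X(2) in auto)
  have m2: "(\<lambda>x. (\<bar>det (matrix (D \<tau> x))\<bar> * dens c d F (\<tau> x)) * indicator S x) \<in> borel_measurable borel"
  proof -
    have "(\<lambda>x. (\<bar>det (matrix (D \<tau> x))\<bar> * dens c d F (\<tau> x)) * indicator S x) = (\<lambda>x. dens c' d' F x * indicator S x)"
      using dq by (auto simp: indicator_def)
    then show ?thesis using dens_measurable[OF im ch(3,4) S Sl] by simp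
  qed
  have "emeasure (patch_measure c d F) (cmap c ` X) = (\<integral>\<^sup>+x\<in>\<tau> ` S. ennreal (dens c d F x) \<partial>lborel)"
    unfolding im\<tau> by (rule emeasure_patch_measure[OF im ch(1,2) X(1,2)])
  also have "\<dots> = (\<integral>\<^sup>+x\<in>S. ennreal (\<bar>det (matrix (D \<tau> x))\<bar> * dens c d F (\<tau> x)) \<partial>lborel)"
    by (rule nn_integral_change_of_variables[OF S der inj nn m1 m2])
  also have "\<dots> = (\<integral>\<^sup>+x\<in>S. ennreal (dens c' d' F x) \<partial>lborel)"
    using dq by (intro nn_integral_cong) (auto simp: indicator_def)
  also have "\<dots> = emeasure (patch_measure c' d' F) (cmap c' ` X)"
    unfolding S_def by (rule emeasure_patch_measure[OF im ch(3,4) X(1,3), symmetric])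
  finally show ?thesis .
qed

text \<open>Finitely many patches cover the compact surface; subtracting from each the previous ones makes them disjoint Borel sets.\<close>

lemma finite_chart_partition:
  assumes F: "continuous_on UNIV F"
  shows "\<exists>(n::nat) cc dd P. (\<forall>i<n. cc i \<in> B \<and> dd i \<in> A \<and> P i \<in> sets borel \<and> P i \<subseteq> patch (cc i) (dd i) F) \<and>
    disjoint_family_on P {..<n} \<and> (\<Union>i<n. P i) = UNIV"
proof -
  let ?\<C> = "{patch c d F |c d. c \<in> B \<and> d \<in> A}"
  have cov: "UNIV \<subseteq> \<Union>?\<C>"
  proof
    fix p :: 's
    obtain c d where "c \<in> B" "p \<in> cdom c" "d \<in> A" "F p \<in> cdom d" using coverA coverB by metis
    then show "p \<in> \<Union>?\<C>" by blast
  qed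
  have op: "\<And>S. S \<in> ?\<C> \<Longrightarrow> open S" using open_local_dom(1)[OF _ _ F] by blast
  have cpt: "compact (UNIV :: 's set)" using surface by (simp add: closed_oriented_surface_def)
  obtain \<D> where \<D>: "\<D> \<subseteq> ?\<C>" "finite \<D>" "UNIV \<subseteq> \<Union>\<D>" by (rule compactE[OF cpt cov op])
  obtain n and e :: "nat \<Rightarrow> 's set" where e: "\<D> = e ` {i. i < n}" using finite_imp_nat_seg_image_inj_on[OF \<D>(2)] by metis
  have "\<forall>i\<in>{..<n}. \<exists>c d. c \<in> B \<and> d \<in> A \<and> e i = patch c d F" using \<D>(1) e by blast
  then obtain cc dd where cd: "\<And>i. i < n \<Longrightarrow> cc i \<in> B \<and> dd i \<in> A \<and> e i = patch (cc i) (dd i) F"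
    by (metis lessThan_iff)
  define e' where "e' i = (if i < n then e i else {})" for i
  define P where "P = disjointed e'"
  have "open (e' i)" for i using cd[of i] open_local_dom(1)[OF _ _ F, of "cc i" "dd i"] by (auto simp: e'_def)
  then have "range e' \<subseteq> sets borel" by auto
  then have mP: "P i \<in> sets borel" for i unfolding P_def using sets.range_disjointed_sets[of e' borel] by auto
  have sub: "P i \<subseteq> e' i" for i unfolding P_def by (rule disjointed_subset)
  have "(\<Union>i. P i) = (\<Union>i. e' i)" unfolding P_def by (rule UN_disjointed_eq)
  moreover have "(\<Union>i. e' i) = UNIV"
  proof -
    have "p \<in> (\<Union>i. e' i)" for p
    proof -
      obtain i where "i < n" "p \<in> e i" using \<D>(3) unfolding e by blast
      then show ?thesis by (auto simp: e'_def intro!: exI[of _ i])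
    qed
    then show ?thesis by blast
  qed
  moreover have "(\<Union>i. P i) = (\<Union>i<n. P i)"
  proof -
    have "P i = {}" if "\<not> i < n" for i using sub[of i] that by (simp add: e'_def)
    then show ?thesis by blast
  qed
  ultimately have U: "(\<Union>i<n. P i) = UNIV" by simp
  have "disjoint_family P" unfolding P_def by (rule disjoint_family_disjointed)
  then have dj: "disjoint_family_on P {..<n}" by (auto simp: disjoint_family_on_def)
  show ?thesis
  proof (intro exI conjI allI impI)
    fix i assume i: "i < n"
    show "cc i \<in> B" "dd i \<in> A" using cd[OF i] by auto
    show "P i \<subseteq> patch (cc i) (dd i) F" using sub[of i] cd[OF i] i by (simp add: e'_def)
  qed (rule mP dj U)+
qed

text \<open>The property that the definition of the area measure by a definite description asks for.\<close>

definition "is_area_measure F \<mu> \<longleftrightarrow> sets \<mu> = sets borel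
     \<and> (\<forall>c\<in>B. \<forall>d\<in>A. \<forall>X\<in>sets borel. X \<subseteq> patch c d F \<longrightarrow>
          emeasure \<mu> X = (\<integral>\<^sup>+ x \<in> cmap c ` X. ennreal (dens c d F x) \<partial>lborel))"

lemma area_measure_eq_by_parts:
  assumes \<mu>: "sets \<mu> = sets borel" and F: "disjoint_family_on P {..<n::nat}" "(\<Union>i<n. P i) = UNIV" "\<And>i. i < n \<Longrightarrow> P i \<in> sets borel"
    and Y: "Y \<in> sets borel"
  shows "emeasure \<mu> Y = (\<Sum>i<n. emeasure \<mu> (Y \<inter> P i))"
proof (rule sum_emeasure_cover)
  show "Y \<in> sets \<mu>" using \<mu> Y by simp
  show "P ` {..<n} \<subseteq> sets \<mu>" using \<mu> F(3) by auto
  show "Y \<subseteq> (\<Union>i<n. P i)" using F(2) by simp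
qed (use F(1) in simp_all)

text \<open>A Borel set is a finite disjoint union of Borel sets in patches, on which the measure is prescribed.\<close>

lemma area_measure_unique:
  assumes F: "continuous_on UNIV F" and m: "is_area_measure F \<mu>" "is_area_measure F \<nu>"
  shows "\<mu> = \<nu>"
proof (rule measure_eqI)
  show "sets \<mu> = sets \<nu>" using m by (simp add: is_area_measure_def)
  fix Y assume "Y \<in> sets \<mu>"
  then have Y: "Y \<in> sets borel" using m by (simp add: is_area_measure_def)
  obtain n :: nat and cc dd P where P: "\<And>i. i < n \<Longrightarrow> cc i \<in> B \<and> dd i \<in> A \<and> P i \<in> sets borel \<and> P i \<subseteq> patch (cc i) (dd i) F"
    "disjoint_family_on P {..<n}" "(\<Union>i<n. P i) = UNIV" using finite_chart_partition[OF F] by blast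
  have "emeasure \<mu> (Y \<inter> P i) = emeasure \<nu> (Y \<inter> P i)" if i: "i < n" for i
  proof -
    have "Y \<inter> P i \<in> sets borel" "Y \<inter> P i \<subseteq> patch (cc i) (dd i) F" using P(1)[OF i] Y by auto
    then have "emeasure \<rho> (Y \<inter> P i) = (\<integral>\<^sup>+ x \<in> cmap (cc i) ` (Y \<inter> P i). ennreal (dens (cc i) (dd i) F x) \<partial>lborel)"
      if "is_area_measure F \<rho>" for \<rho>
      using that P(1)[OF i] unfolding is_area_measure_def by blast
    then show ?thesis using m by simp
  qed
  then show "emeasure \<mu> Y = emeasure \<nu> Y"
    using area_measure_eq_by_parts[OF _ P(2,3) _ Y, of \<mu>] area_measure_eq_by_parts[OF _ P(2,3) _ Y, of \<nu>] P(1) m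
    by (simp add: is_area_measure_def)
qed

text \<open>The measures of the parts of a finite partition are added up. The result has the required value on a Borel set in an arbitrary patch,
  because different charts measure the same set alike.\<close>

lemma area_measure_exists:
  assumes im: "immersion B A F"
  shows "\<exists>\<mu>. is_area_measure F \<mu>"
proof -
  have F: "continuous_on UNIV F" using im by (simp add: immersion_def)
  obtain n :: nat and cc dd P where P: "\<And>i. i < n \<Longrightarrow> cc i \<in> B \<and> dd i \<in> A \<and> P i \<in> sets borel \<and> P i \<subseteq> patch (cc i) (dd i) F"
    "disjoint_family_on P {..<n}" "(\<Union>i<n. P i) = UNIV" using finite_chart_partition[OF F] by blast
  define \<mu>0 where "\<mu>0 X = (\<Sum>i<n. emeasure (patch_measure (cc i) (dd i) F) (cmap (cc i) ` (X \<inter> P i)))" for X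
  have add: "(\<Sum>j. emeasure (patch_measure c d F) (cmap c ` (X j \<inter> Q))) = emeasure (patch_measure c d F) (cmap c ` ((\<Union>j. X j) \<inter> Q))"
    if "c \<in> B" "d \<in> A" "Q \<in> sets borel" "Q \<subseteq> patch c d F" "range X \<subseteq> sets borel" "disjoint_family X" for X :: "nat \<Rightarrow> 's set" and Q c d
  proof -
    have inj: "inj_on (cmap c) Q" by (rule inj_on_subset[OF is_chartD(8)[OF chartB[OF that(1)]]]) (use that in auto)
    have "range (\<lambda>j. cmap c ` (X j \<inter> Q)) \<subseteq> sets (patch_measure c d F)"
      unfolding sets_patch_measure using that by (auto intro!: cmap_borel chartB)
    moreover have "disjoint_family (\<lambda>j. cmap c ` (X j \<inter> Q))"
      by (rule disjoint_family_on_image[OF inj]) (use that(6) in \<open>auto simp: disjoint_family_on_def\<close>)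
    moreover have "(\<Union>j. cmap c ` (X j \<inter> Q)) = cmap c ` ((\<Union>j. X j) \<inter> Q)" by auto
    ultimately show ?thesis using suminf_emeasure[of "\<lambda>j. cmap c ` (X j \<inter> Q)" "patch_measure c d F"] by simp
  qed
  have ca: "countably_additive (sets borel) \<mu>0"
    unfolding countably_additive_def
  proof (intro allI impI)
    fix X :: "nat \<Rightarrow> 's set" assume X: "range X \<subseteq> sets borel" "disjoint_family X"
    have "(\<Sum>j. \<mu>0 (X j)) = (\<Sum>i<n. \<Sum>j. emeasure (patch_measure (cc i) (dd i) F) (cmap (cc i) ` (X j \<inter> P i)))"
      unfolding \<mu>0_def by (rule suminf_sum) (rule summableI)
    also have "\<dots> = \<mu>0 (\<Union>j. X j)" unfolding \<mu>0_def using P(1) by (intro sum.cong refl add[OF _ _ _ _ X]) auto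
    finally show "(\<Sum>j. \<mu>0 (X j)) = \<mu>0 (\<Union>j. X j)" .
  qed
  have pos: "positive (sets borel) \<mu>0" by (simp add: positive_def \<mu>0_def)
  define \<mu> where "\<mu> = measure_of UNIV (sets borel) \<mu>0"
  have sa: "sigma_algebra UNIV (sets (borel :: 's measure))" using sets.sigma_algebra_axioms[of "borel :: 's measure"] by simp
  have em: "emeasure \<mu> X = \<mu>0 X" if "X \<in> sets borel" for X
    unfolding \<mu>_def by (rule emeasure_measure_of_sigma[OF sa pos ca that])
  have "is_area_measure F \<mu>"
    unfolding is_area_measure_def
  proof (intro conjI ballI impI)
    show "sets \<mu> = sets borel" unfolding \<mu>_def using sigma_algebra.sets_measure_of_eq[OF sa] by simp
    fix c d X assume cd: "c \<in> B" "d \<in> A" and X: "X \<in> sets borel" "X \<subseteq> patch c d F"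
    have inj: "inj_on (cmap c) X" by (rule inj_on_subset[OF is_chartD(8)[OF chartB[OF cd(1)]]]) (use X in auto)
    have "emeasure \<mu> X = (\<Sum>i<n. emeasure (patch_measure c d F) (cmap c ` (X \<inter> P i)))"
      unfolding em[OF X(1)] \<mu>0_def
    proof (rule sum.cong[OF refl])
      fix i assume "i \<in> {..<n}"
      then have i: "cc i \<in> B" "dd i \<in> A" "P i \<in> sets borel" "P i \<subseteq> patch (cc i) (dd i) F" using P(1) by auto
      show "emeasure (patch_measure (cc i) (dd i) F) (cmap (cc i) ` (X \<inter> P i)) = emeasure (patch_measure c d F) (cmap c ` (X \<inter> P i))"
        by (rule patch_measure_change[OF im i(1,2) cd]) (use i X in auto)
    qed
    also have "\<dots> = emeasure (patch_measure c d F) (\<Union>i<n. cmap c ` (X \<inter> P i))"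
    proof (rule sum_emeasure)
      show "(\<lambda>i. cmap c ` (X \<inter> P i)) ` {..<n} \<subseteq> sets (patch_measure c d F)"
        unfolding sets_patch_measure using P(1) X by (auto intro!: cmap_borel chartB cd)
      show "disjoint_family_on (\<lambda>i. cmap c ` (X \<inter> P i)) {..<n}"
        by (rule disjoint_family_on_image[OF inj]) (use P(2) in \<open>auto simp: disjoint_family_on_def\<close>)
    qed simp
    also have "(\<Union>i<n. cmap c ` (X \<inter> P i)) = cmap c ` X" using P(3) by blast
    finally show "emeasure \<mu> X = (\<integral>\<^sup>+ x \<in> cmap c ` X. ennreal (dens c d F x) \<partial>lborel)"
      unfolding emeasure_patch_measure[OF im cd X] .
  qed
  then show ?thesis by blast
qed

lemma area_measure_works:
  assumes im: "immersion B A F"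
  shows "is_area_measure F (area_measure A h B F)"
proof -
  have F: "continuous_on UNIV F" using im by (simp add: immersion_def)
  have e: "area_measure A h B F = (THE \<mu>. is_area_measure F \<mu>)"
    unfolding area_measure_def is_area_measure_def ..
  show ?thesis
    unfolding e by (rule theI') (use area_measure_exists[OF im] area_measure_unique[OF F] in blast)
qed

end

section \<open>Localising the functional\<close>

context surface_setting
begin

lemma sets_area_measure: "immersion B A F \<Longrightarrow> sets (area_measure A h B F) = sets borel"
  using area_measure_works by (simp add: is_area_measure_def)

lemma space_area_measure: "immersion B A F \<Longrightarrow> space (area_measure A h B F) = UNIV"
  using sets_eq_imp_space_eq[OF sets_area_measure] by simp

lemma emeasure_area:
  assumes "immersion B A F" "c \<in> B" "d \<in> A" "X \<in> sets borel" "X \<subseteq> patch c d F"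
  shows "emeasure (area_measure A h B F) X = (\<integral>\<^sup>+ x \<in> cmap c ` X. ennreal (dens c d F x) \<partial>lborel)"
  using area_measure_works[OF assms(1)] assms(2-5) unfolding is_area_measure_def by blast

lemma continuous_cos_kahler_angle:
  assumes im: "immersion B A F"
  shows "continuous_on UNIV (\<lambda>p. cos (kahler_angle A h B F p))"
proof -
  have "isCont (\<lambda>p. cos (kahler_angle A h B F p)) p" for p
  proof -
    obtain c d where cd: "c \<in> B" "p \<in> cdom c" "d \<in> A" "F p \<in> cdom d" using coverA coverB by metis
    note s = smooth_gram[OF im cd(1,3)]
    let ?q = "\<lambda>x. kahler_form (h d) (local_rep c d F x) (D (local_rep c d F) x ax1) (D (local_rep c d F) x ax2) / dens c d F x"
    have q: "continuous_on (local_dom c d F) ?q"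
      using area_density_pos[OF im cd(1,3)]
      by (intro continuous_on_divide smooth_on_imp_continuous_on[OF s(2)] smooth_on_imp_continuous_on[OF s(3)]) force
    have "continuous_on (patch c d F) (\<lambda>p. ?q (cmap c p))"
      by (rule continuous_on_compose2[OF q continuous_on_subset[OF is_chartD(3)[OF chartB[OF cd(1)]]]]) (auto simp: local_dom_def)
    moreover have "?q (cmap c p) = cos (kahler_angle A h B F p)" if "p \<in> patch c d F" for p
      using cos_kahler_angle[OF im cd(1,3), of p] that by simp
    ultimately have "continuous_on (patch c d F) (\<lambda>p. cos (kahler_angle A h B F p))"
      by (rule continuous_on_eq)
    then show ?thesis using continuous_on_eq_continuous_at[OF s(6)] cd by blast
  qed
  then show ?thesis by (simp add: continuous_on_eq_continuous_at)
qed

lemma locally_finite_area: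
  assumes im: "immersion B A F"
  shows "\<exists>N. open N \<and> p \<in> N \<and> emeasure (area_measure A h B F) N < \<infinity>"
proof -
  obtain c d where cd: "c \<in> B" "p \<in> cdom c" "d \<in> A" "F p \<in> cdom d" using coverA coverB by metis
  note s = smooth_gram[OF im cd(1,3)]
  note C = chartB[OF cd(1)]
  have x: "cmap c p \<in> local_dom c d F" by (rule local_domI[where F=F, OF cd(2,4)])
  obtain e where e: "e > 0" "cball (cmap c p) e \<subseteq> local_dom c d F" using s(4) x open_contains_cball by blast
  let ?b = "ball (cmap c p) e"
  define N where "N = cinv c ` ?b"
  have bl: "?b \<subseteq> local_dom c d F" using e(2) ball_subset_cball by blast
  have lT: "local_dom c d F \<subseteq> cmap c ` cdom c" by (auto simp: local_dom_def)
  have oN: "open N" unfolding N_def by (rule open_cinv_image[OF C]) (use bl lT in auto)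
  have pN: "p \<in> N" unfolding N_def using e(1) is_chartD(5)[OF C cd(2)] by (intro image_eqI[of _ _ "cmap c p"]) auto
  have Np: "N \<subseteq> patch c d F" unfolding N_def using local_domD(1,2)[OF cd(1,3)] bl by blast
  have cN: "cmap c ` N = ?b"
  proof -
    have "cmap c (cinv c y) = y" if "y \<in> ?b" for y using that bl local_domD(3)[OF cd(1,3)] by blast
    then show ?thesis unfolding N_def image_image by auto
  qed
  have "compact (dens c d F ` cball (cmap c p) e)"
    by (rule compact_continuous_image[OF continuous_on_subset[OF smooth_on_imp_continuous_on[OF s(3)] e(2)] compact_cball])
  then obtain M where M: "\<And>x. x \<in> cball (cmap c p) e \<Longrightarrow> norm (dens c d F x) \<le> M"
    using compact_imp_bounded bounded_iff by (metis imageI)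
  have "emeasure (area_measure A h B F) N = (\<integral>\<^sup>+ x \<in> ?b. ennreal (dens c d F x) \<partial>lborel)"
    using emeasure_area[OF im cd(1,3) _ Np] oN unfolding cN by simp
  also have "\<dots> \<le> (\<integral>\<^sup>+ x. ennreal M * indicator ?b x \<partial>lborel)"
  proof (rule nn_integral_mono)
    fix x
    have "dens c d F x \<le> M" if "x \<in> ?b" using M[of x] that by auto
    then show "ennreal (dens c d F x) * indicator ?b x \<le> ennreal M * indicator ?b x"
      by (cases "x \<in> ?b") (simp_all add: ennreal_leI)
  qed
  also have "\<dots> = ennreal M * emeasure lborel ?b" by (rule nn_integral_cmult_indicator) simp
  also have "\<dots> < \<infinity>" using emeasure_lborel_ball_finite[of "cmap c p" e] by (simp add: ennreal_mult_less_top)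
  finally show ?thesis using oN pN by blast
qed

text \<open>By compactness, as the density is bounded near every point.\<close>

lemma finite_area:
  assumes im: "immersion B A F"
  shows "finite_measure (area_measure A h B F)"
proof
  let ?\<mu> = "area_measure A h B F"
  let ?\<C> = "{N. open N \<and> emeasure ?\<mu> N < \<infinity>}"
  have cpt: "compact (UNIV :: 's set)" using surface by (simp add: closed_oriented_surface_def)
  have cov: "UNIV \<subseteq> \<Union>?\<C>" using locally_finite_area[OF im] by blast
  obtain \<D> where \<D>: "\<D> \<subseteq> ?\<C>" "finite \<D>" "UNIV \<subseteq> \<Union>\<D>"
    by (rule compactE[OF cpt cov]) auto
  have "emeasure ?\<mu> (\<Union>N\<in>\<D>. N) \<le> (\<Sum>N\<in>\<D>. emeasure ?\<mu> N)"
    using \<D> by (intro emeasure_subadditive_finite) (auto simp: sets_area_measure[OF im])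
  also have "\<dots> < \<infinity>" using \<D>(1,2) by (auto simp: ennreal_sum_less_top)
  finally show "emeasure ?\<mu> (space ?\<mu>) \<noteq> \<infinity>"
    using \<D>(3) by (simp add: space_area_measure[OF im] top.extremum_unique)
qed

abbreviation "rho \<beta> F p \<equiv> cos (kahler_angle A h B F p) powr (-\<beta>)"

lemma rho_integrable:
  assumes sy: "symplectic_surface A h B F"
  shows "integrable (area_measure A h B F) (rho \<beta> F)" "rho \<beta> F \<in> borel_measurable borel"
proof -
  have im: "immersion B A F" and pos: "\<And>p. cos (kahler_angle A h B F p) > 0" using sy by (auto simp: symplectic_surface_def)
  have c: "continuous_on UNIV (rho \<beta> F)"
    using pos by (intro continuous_on_powr continuous_cos_kahler_angle[OF im] continuous_on_const) (metis less_irrefl)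
  have "compact (rho \<beta> F ` UNIV)"
    using surface by (intro compact_continuous_image[OF c]) (simp add: closed_oriented_surface_def)
  then obtain M where M: "\<And>p. norm (rho \<beta> F p) \<le> M" using compact_imp_bounded bounded_iff by (metis rangeI)
  show m: "rho \<beta> F \<in> borel_measurable borel" by (rule borel_measurable_continuous_onI[OF c])
  have "rho \<beta> F \<in> borel_measurable (area_measure A h B F)"
    using m measurable_cong_sets[OF sets_area_measure[OF im] refl] by blast
  then show "integrable (area_measure A h B F) (rho \<beta> F)"
    using M by (intro finite_measure.integrable_const_bound[OF finite_area[OF im], where B=M]) auto
qed

text \<open>The coordinate expressions depend on the map near the point only.\<close>

lemma rep_agree:
  assumes ch: "c \<in> B" "d \<in> A" and O: "open N" "\<And>p. p \<in> N \<Longrightarrow> F1 p = F0 p" and p: "p \<in> cdom c" "p \<in> N"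
  shows "local_rep c d F1 (cmap c p) = local_rep c d F0 (cmap c p)" "D (local_rep c d F1) (cmap c p) = D (local_rep c d F0) (cmap c p)"
proof -
  define V where "V = cmap c ` (cdom c \<inter> N)"
  have oV: "open V" unfolding V_def using O(1) is_chartD(1)[OF chartB[OF ch(1)]] by (intro open_cmap_image[OF chartB[OF ch(1)]]) auto
  have e: "local_rep c d F1 y = local_rep c d F0 y" if "y \<in> V" for y
  proof -
    obtain q where q: "q \<in> cdom c" "q \<in> N" "y = cmap c q" using \<open>y \<in> V\<close> by (auto simp: V_def)
    show ?thesis
      using local_rep_cmap[OF ch(1) q(1), of d F1] local_rep_cmap[OF ch(1) q(1), of d F0] O(2)[OF q(2)] q(3) by simp
  qed
  have xV: "cmap c p \<in> V" using p by (auto simp: V_def)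
  show "local_rep c d F1 (cmap c p) = local_rep c d F0 (cmap c p)" by (rule e[OF xV])
  show "D (local_rep c d F1) (cmap c p) = D (local_rep c d F0) (cmap c p)" by (rule D_cong_open[OF oV xV e])
qed

lemma area_outside:
  assumes im: "immersion B A F0" "immersion B A F1" and O: "open N" "\<And>p. p \<in> N \<Longrightarrow> F1 p = F0 p"
    and Y: "Y \<in> sets borel" "Y \<subseteq> N"
  shows "emeasure (area_measure A h B F1) Y = emeasure (area_measure A h B F0) Y"
proof -
  have F: "continuous_on UNIV F0" using im by (simp add: immersion_def)
  obtain n :: nat and cc dd P where P: "\<And>i. i < n \<Longrightarrow> cc i \<in> B \<and> dd i \<in> A \<and> P i \<in> sets borel \<and> P i \<subseteq> patch (cc i) (dd i) F0"
    "disjoint_family_on P {..<n}" "(\<Union>i<n. P i) = UNIV" using finite_chart_partition[OF F] by blast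
  have "emeasure (area_measure A h B F1) (Y \<inter> P i) = emeasure (area_measure A h B F0) (Y \<inter> P i)" if i: "i < n" for i
  proof -
    have i': "cc i \<in> B" "dd i \<in> A" "P i \<in> sets borel" "P i \<subseteq> patch (cc i) (dd i) F0" using P(1)[OF i] by auto
    have b: "Y \<inter> P i \<in> sets borel" "Y \<inter> P i \<subseteq> patch (cc i) (dd i) F0" using i' Y by auto
    then have b1: "Y \<inter> P i \<subseteq> patch (cc i) (dd i) F1" using O(2) Y(2) by fastforce
    have "dens (cc i) (dd i) F1 x = dens (cc i) (dd i) F0 x" if x: "x \<in> cmap (cc i) ` (Y \<inter> P i)" for x
    proof -
      obtain p where p: "p \<in> Y \<inter> P i" "x = cmap (cc i) p" using x by blast
      then have "p \<in> cdom (cc i)" "p \<in> N" using b Y(2) by auto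
      from rep_agree[OF i'(1,2) O this] show ?thesis unfolding area_density_gram p(2) by simp
    qed
    then show ?thesis
      unfolding emeasure_area[OF im(1) i'(1,2) b] emeasure_area[OF im(2) i'(1,2) b(1) b1]
      by (intro nn_integral_cong) (auto simp: indicator_def)
  qed
  then show ?thesis
    using area_measure_eq_by_parts[OF sets_area_measure[OF im(1)] P(2,3) _ Y(1)]
      area_measure_eq_by_parts[OF sets_area_measure[OF im(2)] P(2,3) _ Y(1)] P(1) by simp
qed

lemma integral_outside:
  assumes sy: "symplectic_surface A h B F0" "symplectic_surface A h B F1" and O: "open N" "\<And>p. p \<in> N \<Longrightarrow> F1 p = F0 p"
  shows "(\<integral>p. indicator N p *\<^sub>R rho \<beta> F1 p \<partial>(area_measure A h B F1)) = (\<integral>p. indicator N p *\<^sub>R rho \<beta> F0 p \<partial>(area_measure A h B F0))"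
proof -
  have im: "immersion B A F0" "immersion B A F1" using sy by (auto simp: symplectic_surface_def)
  have NS: "N \<inter> space (area_measure A h B F) \<in> sets (area_measure A h B F)" if "immersion B A F" for F
    using O(1) by (simp add: sets_area_measure[OF that] space_area_measure[OF that])
  have "restrict_space (area_measure A h B F1) N = restrict_space (area_measure A h B F0) N"
  proof (rule measure_eqI)
    show s: "sets (restrict_space (area_measure A h B F1) N) = sets (restrict_space (area_measure A h B F0) N)"
      by (rule sets_restrict_space_cong) (simp add: sets_area_measure im)
    fix Y assume "Y \<in> sets (restrict_space (area_measure A h B F1) N)"
    then have Y: "Y \<in> sets borel" "Y \<subseteq> N" using sets_restrict_space_iff[OF NS[OF im(2)]] by (auto simp: sets_area_measure im)
    show "emeasure (restrict_space (area_measure A h B F1) N) Y = emeasure (restrict_space (area_measure A h B F0) N) Y"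
      using emeasure_restrict_space[OF NS[OF im(1)] Y(2)] emeasure_restrict_space[OF NS[OF im(2)] Y(2)]
        area_outside[OF im O Y] by simp
  qed
  then have "(\<integral>p. indicator N p *\<^sub>R rho \<beta> F1 p \<partial>(area_measure A h B F1)) = (\<integral>p. indicator N p *\<^sub>R rho \<beta> F1 p \<partial>(area_measure A h B F0))"
    unfolding integral_restrict_space[OF NS[OF im(1)], symmetric] integral_restrict_space[OF NS[OF im(2)], symmetric] by simp
  also have "\<dots> = (\<integral>p. indicator N p *\<^sub>R rho \<beta> F0 p \<partial>(area_measure A h B F0))"
  proof (rule Bochner_Integration.integral_cong[OF refl])
    fix p
    have "cos (kahler_angle A h B F1 p) = cos (kahler_angle A h B F0 p)" if p: "p \<in> N"
    proof -
      obtain c d where cd: "c \<in> B" "p \<in> cdom c" "d \<in> A" "F0 p \<in> cdom d" using coverA coverB by metis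
      have F1: "F1 p \<in> cdom d" using cd O(2)[OF p] by simp
      note r = rep_agree[OF cd(1,3) O cd(2) p]
      show ?thesis
        unfolding cos_kahler_angle[OF im(1) cd(1,3,2,4)] cos_kahler_angle[OF im(2) cd(1,3,2) F1] area_density_gram by (simp add: r)
    qed
    then show "indicator N p *\<^sub>R rho \<beta> F1 p = indicator N p *\<^sub>R rho \<beta> F0 p" by (simp add: indicator_def)
  qed
  finally show ?thesis .
qed

text \<open>The coordinate map transports the area measure on \<open>X\<close> to the measure with density \<open>dens\<close> on \<open>K\<close>.\<close>

lemma integral_inside:
  assumes sy: "symplectic_surface A h B F" and ch: "c \<in> B" "d \<in> A" and K: "compact K" "K \<subseteq> local_dom c d F"
  defines "f \<equiv> local_rep c d F" and "X \<equiv> cinv c ` K"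
  shows "(\<integral>p. indicator X p *\<^sub>R rho \<beta> F p \<partial>(area_measure A h B F)) = integral K (\<lambda>x. lagrangian \<beta> (h d) (f x) (D f x ax1) (D f x ax2))"
    "closed X"
proof -
  have im: "immersion B A F" and pos: "\<And>p. cos (kahler_angle A h B F p) > 0" using sy by (auto simp: symplectic_surface_def)
  note C = chartB[OF ch(1)]
  note s = smooth_gram[OF im ch]
  let ?\<mu> = "area_measure A h B F"
  let ?T = "cmap c ` cdom c"
  have lT: "local_dom c d F \<subseteq> ?T" by (auto simp: local_dom_def)
  have KT: "K \<subseteq> ?T" using K lT by auto
  have "compact X" unfolding X_def
    by (rule compact_continuous_image[OF continuous_on_subset[OF is_chartD(4)[OF C] KT] K(1)])
  then show cX: "closed X" by (rule compact_imp_closed)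
  have Xp: "X \<subseteq> patch c d F" unfolding X_def using local_domD(1,2)[OF ch] K(2) by blast
  have Kb: "K \<in> sets borel" using compact_imp_closed[OF K(1)] by simp
  obtain p0 :: 's where True by simp
  \<comment> \<open>the inverse chart, made Borel measurable on the whole plane; the value outside the chart does not matter\<close>
  define g where "g y = (if y \<in> ?T then cinv c y else p0)" for y
  have g: "g \<in> borel_measurable borel"
    unfolding g_def[abs_def] using is_chartD(2)[OF C]
    by (intro borel_measurable_continuous_on_if is_chartD(4)[OF C] continuous_on_const) simp
  define w where "w y = dens c d F y * indicator K y" for y
  have w: "w \<in> borel_measurable borel" unfolding w_def[abs_def] by (rule dens_measurable[OF im ch Kb K(2)])
  have wn: "w y \<ge> 0" for y
    using area_density_pos[OF im ch, of y] K(2) by (auto simp: w_def indicator_def less_imp_le)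
  have img: "cmap c ` (X \<inter> Y) = K \<inter> g -` Y" for Y
  proof (intro equalityI subsetI)
    fix y assume "y \<in> cmap c ` (X \<inter> Y)"
    then obtain k where k: "k \<in> K" "cinv c k \<in> Y" "y = cmap c (cinv c k)" by (auto simp: X_def)
    then show "y \<in> K \<inter> g -` Y" using KT is_chartD(7)[OF C, of k] by (auto simp: g_def)
  next
    fix y assume y: "y \<in> K \<inter> g -` Y"
    then have "cinv c y \<in> X \<inter> Y" "cmap c (cinv c y) = y" using KT is_chartD(7)[OF C, of y] by (auto simp: g_def X_def)
    then show "y \<in> cmap c ` (X \<inter> Y)" by (metis imageI)
  qed
  have meq: "density ?\<mu> (\<lambda>p. ennreal (indicator X p)) = distr (density lborel (\<lambda>y. ennreal (w y))) borel g"
  proof (rule measure_eqI)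
    show "sets (density ?\<mu> (\<lambda>p. ennreal (indicator X p))) = sets (distr (density lborel (\<lambda>y. ennreal (w y))) borel g)"
      by (simp add: sets_area_measure[OF im])
    fix Y assume "Y \<in> sets (density ?\<mu> (\<lambda>p. ennreal (indicator X p)))"
    then have Y: "Y \<in> sets borel" by (simp add: sets_area_measure[OF im])
    have XY: "X \<inter> Y \<in> sets borel" "X \<inter> Y \<subseteq> patch c d F" using cX Y Xp by auto
    have "emeasure (density ?\<mu> (\<lambda>p. ennreal (indicator X p))) Y = emeasure ?\<mu> (X \<inter> Y)"
    proof -
      have sX: "X \<in> sets ?\<mu>" "Y \<in> sets ?\<mu>" using cX Y by (simp_all add: sets_area_measure[OF im])
      have "emeasure (density ?\<mu> (\<lambda>p. ennreal (indicator X p))) Y = (\<integral>\<^sup>+p. ennreal (indicator X p) * indicator Y p \<partial>?\<mu>)"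
        using sX by (intro emeasure_density measurable_compose[OF _ measurable_ennreal] borel_measurable_indicator)
      also have "\<dots> = (\<integral>\<^sup>+p. indicator (X \<inter> Y) p \<partial>?\<mu>)"
        by (intro nn_integral_cong) (simp add: indicator_def)
      also have "\<dots> = emeasure ?\<mu> (X \<inter> Y)" using sX by (intro nn_integral_indicator) auto
      finally show ?thesis .
    qed
    also have "\<dots> = (\<integral>\<^sup>+ x \<in> K \<inter> g -` Y. ennreal (dens c d F x) \<partial>lborel)"
      unfolding emeasure_area[OF im ch XY] img ..
    also have "\<dots> = (\<integral>\<^sup>+ x \<in> g -` Y. ennreal (w x) \<partial>lborel)"
      by (intro nn_integral_cong) (auto simp: w_def indicator_def)
    also have "\<dots> = emeasure (density lborel (\<lambda>y. ennreal (w y))) (g -` Y)"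
      using w measurable_sets[OF g Y] by (subst emeasure_density) simp_all
    also have "\<dots> = emeasure (distr (density lborel (\<lambda>y. ennreal (w y))) borel g) Y"
      using g Y by (subst emeasure_distr) simp_all
    finally show "emeasure (density ?\<mu> (\<lambda>p. ennreal (indicator X p))) Y = emeasure (distr (density lborel (\<lambda>y. ennreal (w y))) borel g) Y" .
  qed
  have r: "rho \<beta> F \<in> borel_measurable borel" by (rule rho_integrable(2)[OF sy])
  have r\<mu>: "rho \<beta> F \<in> borel_measurable ?\<mu>" using r measurable_cong_sets[OF sets_area_measure[OF im] refl] by blast
  have iX: "(indicator X :: 's \<Rightarrow> real) \<in> borel_measurable ?\<mu>"
    using cX by (intro borel_measurable_indicator) (simp add: sets_area_measure[OF im])
  have "(\<integral>p. indicator X p *\<^sub>R rho \<beta> F p \<partial>?\<mu>) = integral\<^sup>L (density ?\<mu> (\<lambda>p. ennreal (indicator X p))) (rho \<beta> F)"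
    by (rule integral_density[symmetric, OF r\<mu> iX]) simp
  also have "\<dots> = (\<integral>y. rho \<beta> F (g y) \<partial>(density lborel (\<lambda>y. ennreal (w y))))"
    unfolding meq by (rule integral_distr) (use g r in simp_all)
  also have "\<dots> = (\<integral>y. w y *\<^sub>R rho \<beta> F (g y) \<partial>lborel)"
    using g r w wn by (intro integral_density) (auto intro: measurable_compose)
  also have "\<dots> = (\<integral>y. indicator K y *\<^sub>R lagrangian \<beta> (h d) (f y) (D f y ax1) (D f y ax2) \<partial>lborel)"
  proof (rule Bochner_Integration.integral_cong[OF refl])
    fix y
    show "w y *\<^sub>R rho \<beta> F (g y) = indicator K y *\<^sub>R lagrangian \<beta> (h d) (f y) (D f y ax1) (D f y ax2)"
    proof (cases "y \<in> K")
      case True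
      then have yl: "y \<in> local_dom c d F" using K(2) by auto
      note l = local_domD[OF ch yl]
      have gy: "g y = cinv c y" using True KT by (auto simp: g_def)
      have "cos (kahler_angle A h B F (cinv c y)) = kahler_form (h d) (f y) (D f y ax1) (D f y ax2) / dens c d F y"
        using cos_kahler_angle[OF im ch l(1,2)] unfolding l(3) f_def .
      then show ?thesis
        using True unfolding gy w_def lagrangian_def kahler_form_def area_density_gram f_def by simp
    qed (simp add: w_def)
  qed
  also have "\<dots> = integral K (\<lambda>x. lagrangian \<beta> (h d) (f x) (D f x ax1) (D f x ax2))"
  proof -
    have c: "continuous_on K (\<lambda>x. lagrangian \<beta> (h d) (f x) (D f x ax1) (D f x ax2))"
    proof -
      have "continuous_on K (\<lambda>x. (kahler_form (h d) (f x) (D f x ax1) (D f x ax2) / dens c d F x) powr (-\<beta>) * dens c d F x)"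
      proof (intro continuous_on_mult continuous_on_powr continuous_on_divide continuous_on_const)
        show "continuous_on K (dens c d F)" by (rule continuous_on_subset[OF smooth_on_imp_continuous_on[OF s(3)] K(2)])
        show "continuous_on K (\<lambda>x. kahler_form (h d) (f x) (D f x ax1) (D f x ax2))"
          unfolding f_def by (rule continuous_on_subset[OF smooth_on_imp_continuous_on[OF s(2)] K(2)])
        show "\<forall>x\<in>K. dens c d F x \<noteq> 0" using area_density_pos[OF im ch] K(2) by force
        show "\<forall>x\<in>K. kahler_form (h d) (f x) (D f x ax1) (D f x ax2) / dens c d F x \<noteq> 0"
        proof
          fix y assume "y \<in> K"
          then have yl: "y \<in> local_dom c d F" using K(2) by auto
          note l = local_domD[OF ch yl]
          show "kahler_form (h d) (f y) (D f y ax1) (D f y ax2) / dens c d F y \<noteq> 0"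
            using cos_kahler_angle[OF im ch l(1,2)] pos[of "cinv c y"] unfolding l(3) f_def by (metis less_irrefl)
        qed
      qed (rule continuous_on_subset[OF smooth_on_imp_continuous_on[OF s(3)] K(2)])
      then show ?thesis unfolding lagrangian_def kahler_form_def area_density_gram f_def .
    qed
    have "set_integrable lborel K (\<lambda>x. lagrangian \<beta> (h d) (f x) (D f x ax1) (D f x ax2))"
      unfolding set_integrable_def by (rule borel_integrable_compact[OF K(1) c])
    from set_borel_integral_eq_integral(2)[OF this] show ?thesis by (simp add: set_lebesgue_integral_def)
  qed
  finally show "(\<integral>p. indicator X p *\<^sub>R rho \<beta> F p \<partial>?\<mu>) = integral K (\<lambda>x. lagrangian \<beta> (h d) (f x) (D f x ax1) (D f x ax2))" .
qed

text \<open>Only the second summand depends on the varied map.\<close>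

lemma L_functional_split:
  assumes sy: "symplectic_surface A h B F0" "symplectic_surface A h B F1" and ch: "c \<in> B" "d \<in> A"
    and K: "compact K" "K \<subseteq> local_dom c d F1" and eq: "\<And>p. p \<notin> cinv c ` K \<Longrightarrow> F1 p = F0 p"
  shows "L_functional \<beta> A h B F1 = (\<integral>p. indicator (- (cinv c ` K)) p *\<^sub>R rho \<beta> F0 p \<partial>(area_measure A h B F0))
    + integral K (\<lambda>x. lagrangian \<beta> (h d) (local_rep c d F1 x) (D (local_rep c d F1) x ax1) (D (local_rep c d F1) x ax2))"
proof -
  let ?X = "cinv c ` K" and ?\<mu> = "area_measure A h B F1"
  have im: "immersion B A F1" using sy by (simp add: symplectic_surface_def)
  note ii = integral_inside(1)[OF sy(2) ch K, of \<beta>] integral_inside(2)[OF sy(2) ch K]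
  have o: "open (- ?X)" by (rule open_Compl[OF ii(2)])
  note int = rho_integrable(1)[OF sy(2), of \<beta>]
  have i: "integrable ?\<mu> (\<lambda>p. indicator Y p *\<^sub>R rho \<beta> F1 p)" if "Y \<in> sets borel" for Y
    using that by (intro integrable_mult_indicator int) (simp add: sets_area_measure[OF im])
  have "L_functional \<beta> A h B F1 = (\<integral>p. indicator ?X p *\<^sub>R rho \<beta> F1 p + indicator (- ?X) p *\<^sub>R rho \<beta> F1 p \<partial>?\<mu>)"
    unfolding L_functional_def by (rule Bochner_Integration.integral_cong[OF refl]) (simp add: indicator_def)
  also have "\<dots> = (\<integral>p. indicator ?X p *\<^sub>R rho \<beta> F1 p \<partial>?\<mu>) + (\<integral>p. indicator (- ?X) p *\<^sub>R rho \<beta> F1 p \<partial>?\<mu>)"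
    using ii(2) o by (intro Bochner_Integration.integral_add i) simp_all
  also have "(\<integral>p. indicator (- ?X) p *\<^sub>R rho \<beta> F1 p \<partial>?\<mu>) = (\<integral>p. indicator (- ?X) p *\<^sub>R rho \<beta> F0 p \<partial>(area_measure A h B F0))"
    by (rule integral_outside[OF sy o]) (use eq in simp)
  finally show ?thesis unfolding ii(1) by simp
qed

end

section \<open>Local variations\<close>

text \<open>For \<open>c\<close> obtained from \<open>a\<close> by a quarter turn, \<open>\<omega>(L a, L c)\<close> is \<open>\<bar>a\<bar>\<^sup>2\<close> times the value on the axes.\<close>

lemma inj_if_kahler_nonzero:
  fixes L :: "real^2 \<Rightarrow> complex^2"
  assumes b: "inner_product b" and h: "\<And>u v. b (J u) (J v) = b u v" and L: "linear L"
    and w: "b (J (L ax1)) (L ax2) \<noteq> 0"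
  shows "inj L"
proof (rule linear_injective_0[OF L, THEN iffD2], intro allI impI)
  fix a assume a: "L a = 0"
  define c :: "real^2" where "c = (\<chi> i. if i = 1 then - a $ 2 else a $ 1)"
  have c: "c $ 1 = - a $ 2" "c $ 2 = a $ 1" by (simp_all add: c_def)
  have "b (J (L a)) (L c) = 0" unfolding a by (simp add: J_alg ip_lin[OF b])
  then have "(a $ 1 * a $ 1 + a $ 2 * a $ 2) * b (J (L ax1)) (L ax2) = 0"
    unfolding kahler_form_alternating[OF b h L, of a c] c by simp
  then have "a $ 1 * a $ 1 + a $ 2 * a $ 2 = 0" using w by (simp only: mult_eq_0_iff simp_thms)
  then have "a $ 1 = 0 \<and> a $ 2 = 0" by (simp only: sum_squares_eq_zero_iff)
  then show "a = 0" unfolding vec_eq_iff forall_2 by (simp only: zero_index simp_thms)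
qed

lemma inj_D_if_left_inverse:
  assumes d: "\<sigma> differentiable (at x)" "\<rho> differentiable (at (\<sigma> x))" and N: "open N" "x \<in> N" "\<And>y. y \<in> N \<Longrightarrow> \<rho> (\<sigma> y) = y"
  shows "inj (D \<sigma> x)"
proof -
  have "((\<lambda>y. \<rho> (\<sigma> y)) has_derivative (\<lambda>v. D \<rho> (\<sigma> x) (D \<sigma> x v))) (at x)"
    by (rule has_derivative_compose[OF d[unfolded frechet_derivative_works]])
  then have "((\<lambda>y. y) has_derivative (\<lambda>v. D \<rho> (\<sigma> x) (D \<sigma> x v))) (at x)"
    by (rule has_derivative_transform_within_open[OF _ N])
  then have "(\<lambda>v. D \<rho> (\<sigma> x) (D \<sigma> x v)) = (\<lambda>v. v)"
    by (rule has_derivative_unique[OF _ has_derivative_ident])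
  then have "D \<rho> (\<sigma> x) (D \<sigma> x v) = v" for v by (rule fun_cong)
  then show ?thesis by (rule inj_on_inverseI)
qed

context surface_setting
begin

lemma transition_inverse:
  assumes "is_chart c" "is_chart c'" "y \<in> overlap c c'"
  shows "transition c c' y \<in> overlap c' c" "transition c' c (transition c c' y) = y"
proof -
  obtain p where p: "p \<in> cdom c" "p \<in> cdom c'" "y = cmap c p" using assms(3) by (auto simp: overlap_def)
  show "transition c c' y \<in> overlap c' c" using p transition_cmap[OF assms(1) p(1), of c'] by (auto simp: overlap_def)
  show "transition c' c (transition c c' y) = y"
    using p transition_cmap[OF assms(1) p(1), of c'] transition_cmap[OF assms(2) p(2), of c] by simp
qed

lemma transition_inj:
  "d \<in> A \<Longrightarrow> d' \<in> A \<Longrightarrow> x \<in> overlap d d' \<Longrightarrow> inj (D (transition d d') x)"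
  "c \<in> B \<Longrightarrow> c' \<in> B \<Longrightarrow> y \<in> overlap c c' \<Longrightarrow> inj (D (transition c c') y)"
proof -
  show "inj (D (transition d d') x)" if "d \<in> A" "d' \<in> A" "x \<in> overlap d d'"
    by (rule inj_D_if_left_inverse[OF smooth_on_imp_differentiable[OF smooth_transition(1)[OF that(1,2)] that(3)]
          smooth_on_imp_differentiable[OF smooth_transition(1)[OF that(2,1)] transition_inverse(1)[OF chartA[OF that(1)] chartA[OF that(2)] that(3)]]
          open_overlap[OF chartA[OF that(1)] chartA[OF that(2)]] that(3) transition_inverse(2)[OF chartA[OF that(1)] chartA[OF that(2)]]])
  show "inj (D (transition c c') y)" if "c \<in> B" "c' \<in> B" "y \<in> overlap c c'"
    by (rule inj_D_if_left_inverse[OF smooth_on_imp_differentiable[OF smooth_transition(2)[OF that(1,2)] that(3)]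
          smooth_on_imp_differentiable[OF smooth_transition(2)[OF that(2,1)] transition_inverse(1)[OF chartB[OF that(1)] chartB[OF that(2)] that(3)]]
          open_overlap[OF chartB[OF that(1)] chartB[OF that(2)]] that(3) transition_inverse(2)[OF chartB[OF that(1)] chartB[OF that(2)]]])
qed

text \<open>Moving the coordinates of the surface by \<open>t \<phi> V\<close> inside the patch and leaving the map unchanged outside of the compact set \<open>X\<close>
  that carries \<open>\<phi>\<close> gives, for small \<open>t\<close>, a variation in the class of symplectic surfaces. Each point has a neighbourhood in the patch or
  off \<open>X\<close>; all the properties of a variation are local and are checked in these two cases.\<close>

lemma critical_local_variation:
  assumes crit: "symplectic_critical_surface \<beta> A h B F" and ch: "c \<in> B" "d \<in> A"
    and vs: "variational_surface (cmap d ` cdom d) (h d) (local_dom c d F) (local_rep c d F)"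
    and z: "r > 0" "cube z r \<subseteq> local_dom c d F" and \<phi>: "smooth_on UNIV \<phi>" and supp: "\<And>x. x \<notin> ball z r \<Longrightarrow> \<phi> x = 0"
  shows "((\<lambda>t. integral (cube z r) (\<lambda>x. lagrangian \<beta> (h d) (variational_surface.varied (local_rep c d F) \<phi> V (t, x))
      (variational_surface.varied_d (local_rep c d F) ax1 \<phi> V (t, x)) (variational_surface.varied_d (local_rep c d F) ax2 \<phi> V (t, x)))) has_real_derivative 0) (at 0)"
proof -
  interpret v: variational_surface "cmap d ` cdom d" "h d" "local_dom c d F" "local_rep c d F" \<beta> by (rule vs)
  have sy: "symplectic_surface A h B F" using crit by (simp add: symplectic_critical_surface_def)
  have im: "immersion B A F" and Fpos: "\<And>p. cos (kahler_angle A h B F p) > 0" using sy by (auto simp: symplectic_surface_def)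
  have F: "continuous_on UNIV F" using im by (simp add: immersion_def)
  define U f K W X where "U = local_dom c d F" and "f = local_rep c d F" and "K = cube z r" and "W = patch c d F" and "X = cinv c ` K"
  note C = chartB[OF ch(1)] and E = chartA[OF ch(2)]
  have oU: "open U" and oW: "open W" unfolding U_def W_def using open_local_dom[OF ch F] by auto
  have KU: "K \<subseteq> U" using z(2) by (simp add: K_def U_def)
  have cK: "compact K" "closed K" unfolding K_def by (rule compact_cube)+
  have X: "closed X" unfolding X_def by (rule integral_inside(2)[OF sy ch cK(1) KU[unfolded U_def]])
  have oX: "open (- X)" by (rule open_Compl[OF X])
  have \<phi>0: "\<phi> x = 0" if "x \<notin> K" for x using supp[of x] ball_subset_cube[of z r] that unfolding K_def by blast
  have D\<phi>0: "D \<phi> x a = 0" if "x \<notin> K" for x a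
  proof -
    have "D \<phi> x = D (\<lambda>_. 0 :: real) x"
      by (rule D_cong_open[of "- K"]) (use \<phi>0 that cK(2) in auto)
    then show ?thesis using D_const[of "0::real" x a] by simp
  qed
  \<comment> \<open>for such \<open>t\<close> the varied coordinates stay in the chart and the Kaehler form stays positive\<close>
  obtain \<epsilon> where \<epsilon>: "\<epsilon> > 0" "\<And>t x. \<bar>t\<bar> < \<epsilon> \<Longrightarrow> x \<in> K \<Longrightarrow> (t, x) \<in> v.admissible \<phi> V"
    using v.admissible_tube[OF \<phi> cK(1) KU[unfolded U_def], of V] by blast
  have dom: "(t, x) \<in> v.admissible \<phi> V" if t: "\<bar>t\<bar> < \<epsilon>" and x: "x \<in> U" for t x
  proof (cases "x \<in> K")
    case True
    then show ?thesis using \<epsilon>(2) t by blast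
  next
    case False
    have "(0, x) \<in> v.admissible \<phi> V" by (rule v.admissible_0) (use x in \<open>simp add: U_def\<close>)
    then show ?thesis by (simp add: v.admissible_def v.varied_def v.varied_d_def \<phi>0[OF False] D\<phi>0[OF False])
  qed
  define ft where "ft t y = v.varied \<phi> V (t, y)" for t y
  have ft: "ft t y = f y + (t * \<phi> y) *\<^sub>R V" for t y by (simp add: ft_def v.varied_def f_def)
  define \<Phi> where "\<Phi> t q = (if q \<in> W then cinv d (ft t (cmap c q)) else F q)" for t q
  have WU: "cmap c q \<in> U" if "q \<in> W" for q using that by (auto simp: W_def U_def local_dom_def)
  have WU': "q \<in> W" if "q \<in> cdom c" "cmap c q \<in> U" for q
    using that local_domD[OF ch, of "cmap c q" F] is_chartD(5)[OF C, of q] by (simp add: U_def W_def)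
  have ftT: "ft t y \<in> cmap d ` cdom d" if "\<bar>t\<bar> < \<epsilon>" "y \<in> U" for t y
    using dom[OF that] by (simp add: v.admissible_def ft_def)
  have \<Phi>W: "\<Phi> t q \<in> cdom d" "cmap d (\<Phi> t q) = ft t (cmap c q)" if "\<bar>t\<bar> < \<epsilon>" "q \<in> W" for t q
    using is_chartD(6,7)[OF E ftT[OF that(1) WU[OF that(2)]]] that(2) by (simp_all add: \<Phi>_def)
  have f_cmap: "cinv d (f (cmap c q)) = F q" if "q \<in> W" for q
    using that local_rep_cmap[OF ch(1), of q d F] is_chartD(5)[OF E, of "F q"] by (simp add: W_def f_def)
  have \<Phi>X: "\<Phi> t q = F q" if "q \<notin> X" for t q
  proof (cases "q \<in> W")
    case True
    have "cmap c q \<notin> K"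
    proof
      assume "cmap c q \<in> K"
      then have "cinv c (cmap c q) \<in> X" by (simp add: X_def)
      then show False using that True is_chartD(5)[OF C, of q] by (simp add: W_def)
    qed
    then show ?thesis using True f_cmap by (simp add: \<Phi>_def ft \<phi>0)
  qed (simp add: \<Phi>_def)
  have \<Phi>0: "\<Phi> 0 = F" using f_cmap by (auto simp: \<Phi>_def ft)
  have XW: "X \<subseteq> W" unfolding X_def W_def using local_domD(1,2)[OF ch] KU by (auto simp: U_def)
  define I where "I = {-\<epsilon><..<\<epsilon>}"
  have I: "t \<in> I \<longleftrightarrow> \<bar>t\<bar> < \<epsilon>" for t by (auto simp: I_def)
  have oI: "open I" by (simp add: I_def)
  have smv: "smooth_on (UNIV \<times> U) (v.varied \<phi> V)" unfolding U_def by (rule v.smooth_varied(1)[OF \<phi>])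
  have cont: "continuous_on (I \<times> UNIV) (\<lambda>(t, q). \<Phi> t q)"
  proof -
    have 1: "continuous_on (I \<times> W) (\<lambda>(t, q). \<Phi> t q)"
    proof -
      have "continuous_on (I \<times> W) (\<lambda>p. (fst p, cmap c (snd p)))"
        by (intro continuous_on_Pair continuous_on_fst continuous_on_id continuous_on_compose2[OF is_chartD(3)[OF C] continuous_on_snd[OF continuous_on_id]])
          (auto simp: W_def)
      then have "continuous_on (I \<times> W) (\<lambda>p. v.varied \<phi> V (fst p, cmap c (snd p)))"
        by (rule continuous_on_compose2[OF smooth_on_imp_continuous_on[OF smv]]) (use WU in auto)
      then have "continuous_on (I \<times> W) (\<lambda>p. cinv d (v.varied \<phi> V (fst p, cmap c (snd p))))"
      proof (rule continuous_on_compose2[OF is_chartD(4)[OF E]])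
        show "(\<lambda>p. v.varied \<phi> V (fst p, cmap c (snd p))) ` (I \<times> W) \<subseteq> cmap d ` cdom d"
          using ftT WU I unfolding ft_def by auto
      qed
      then show ?thesis by (rule continuous_on_eq) (auto simp: \<Phi>_def ft_def)
    qed
    have 2: "continuous_on (I \<times> - X) (\<lambda>(t, q). \<Phi> t q)"
      by (rule continuous_on_eq[OF continuous_on_compose2[OF F continuous_on_snd[OF continuous_on_id]]]) (auto simp: \<Phi>X)
    have "continuous_on ((I \<times> W) \<union> (I \<times> - X)) (\<lambda>(t, q). \<Phi> t q)"
      by (rule continuous_on_open_Un[OF open_Times[OF oI oW] open_Times[OF oI oX] 1 2])
    moreover have "(I \<times> W) \<union> (I \<times> - X) = I \<times> UNIV" using XW by auto
    ultimately show ?thesis by simp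
  qed
  have cont_t: "continuous_on UNIV (\<Phi> t)" if "t \<in> I" for t
  proof -
    have "continuous_on UNIV (\<lambda>q. (\<lambda>(t, q). \<Phi> t q) (t, q))"
      by (rule continuous_on_compose2[OF cont continuous_on_Pair[OF continuous_on_const continuous_on_id]]) (use that in auto)
    then show ?thesis by simp
  qed
  \<comment> \<open>smoothness in arbitrary charts: near a point of the patch through the transition maps, elsewhere from the immersion \<open>F\<close>\<close>
  have joint: "smooth_on {(t, y). t \<in> I \<and> y \<in> local_dom c' d' (\<Phi> t)} (\<lambda>(t, y). local_rep c' d' (\<Phi> t) y)"
    if ch': "c' \<in> B" "d' \<in> A" for c' d'
  proof (rule smooth_on_local)
    fix p assume "p \<in> {(t, y). t \<in> I \<and> y \<in> local_dom c' d' (\<Phi> t)}"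
    then obtain t0 y0 where p: "p = (t0, y0)" "t0 \<in> I" "y0 \<in> local_dom c' d' (\<Phi> t0)" by blast
    note C' = chartB[OF ch'(1)] and E' = chartA[OF ch'(2)]
    note l = local_domD[OF ch' p(3)]
    define q0 where "q0 = cinv c' y0"
    show "\<exists>T. open T \<and> p \<in> T \<and> smooth_on T (\<lambda>(t, y). local_rep c' d' (\<Phi> t) y)"
    proof (cases "q0 \<in> W")
      case True
      define \<tau> where "\<tau> = transition c' c"
      define O1 where "O1 = overlap c' c \<inter> \<tau> -` U"
      have sm\<tau>: "smooth_on (overlap c' c) \<tau>" unfolding \<tau>_def by (rule smooth_transition(2)[OF ch'(1) ch(1)])
      have oO1: "open O1" unfolding O1_def
        by (rule continuous_open_preimage[OF smooth_on_imp_continuous_on[OF sm\<tau>] open_overlap[OF C' C] oU])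
      have oIO: "open (I \<times> O1)" by (rule open_Times[OF oI oO1])
      define m where "m p = v.varied \<phi> V (fst p, \<tau> (snd p))" for p :: "real \<times> (real^2)"
      have sf: "smooth_on (I \<times> O1) (fst :: real \<times> (real^2) \<Rightarrow> real)" "smooth_on (I \<times> O1) (snd :: real \<times> (real^2) \<Rightarrow> real^2)"
        by (intro smooth_on_bounded_linear bounded_linear_fst bounded_linear_snd oIO)+
      have smm: "smooth_on (I \<times> O1) m"
        unfolding m_def[abs_def]
        by (rule smooth_on_compose[OF smv smooth_on_Pair[OF sf(1) smooth_on_compose[OF sm\<tau> sf(2) oIO] oIO] oIO]) (auto simp: O1_def)
      define T where "T = (I \<times> O1) \<inter> m -` overlap d d'"
      have oT: "open T" unfolding T_def
        by (rule continuous_open_preimage[OF smooth_on_imp_continuous_on[OF smm] oIO open_overlap[OF E E']])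
      have q0: "q0 \<in> cdom c'" "q0 \<in> cdom c" "cmap c' q0 = y0" using l True by (simp_all add: q0_def W_def)
      have \<tau>0: "\<tau> y0 = cmap c q0" using transition_cmap[OF C' q0(1), of c] q0(3) by (simp add: \<tau>_def)
      have "y0 \<in> O1" unfolding O1_def using q0 \<tau>0 WU[OF True] by (auto simp: overlap_def)
      moreover have "m (t0, y0) = cmap d (\<Phi> t0 q0)"
        using \<Phi>W(2)[of t0 q0] True p(2) by (simp add: m_def \<tau>0 ft_def I)
      then have "m (t0, y0) \<in> overlap d d'"
        using \<Phi>W(1)[of t0 q0] True p(2) l(2) by (auto simp: overlap_def I q0_def)
      ultimately have pT: "p \<in> T" using p by (simp add: T_def)
      have "smooth_on T (\<lambda>p. transition d d' (m p))"
        by (rule smooth_on_compose[OF smooth_transition(1)[OF ch(2) ch'(2)] smooth_on_subset[OF smm] oT]) (auto simp: T_def)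
      then have "smooth_on T (\<lambda>(t, y). local_rep c' d' (\<Phi> t) y)"
      proof (rule smooth_on_cong[OF _ oT])
        fix p assume "p \<in> T"
        then obtain t y where ty: "p = (t, y)" "t \<in> I" "y \<in> O1" by (auto simp: T_def)
        then obtain q where q: "q \<in> cdom c'" "q \<in> cdom c" "y = cmap c' q" by (auto simp: O1_def overlap_def)
        have t: "\<tau> y = cmap c q" using transition_cmap[OF C' q(1), of c] q(3) by (simp add: \<tau>_def)
        have qW: "q \<in> W" by (rule WU'[OF q(2)]) (use ty(3) t in \<open>simp add: O1_def\<close>)
        have "local_rep c' d' (\<Phi> t) y = cmap d' (\<Phi> t q)" unfolding q(3) by (rule local_rep_cmap[OF ch'(1) q(1)])
        also have "\<dots> = transition d d' (cmap d (\<Phi> t q))"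
          using transition_cmap[OF E \<Phi>W(1)[OF _ qW], of t d'] ty(2) by (simp add: I)
        also have "cmap d (\<Phi> t q) = m p" using \<Phi>W(2)[OF _ qW, of t] ty by (simp add: m_def t ft_def I)
        finally show "transition d d' (m p) = (case p of (t, y) \<Rightarrow> local_rep c' d' (\<Phi> t) y)" using ty(1) by simp
      qed
      then show ?thesis using oT pT by blast
    next
      case False
      then have q0X: "q0 \<notin> X" using XW by blast
      define O2 where "O2 = cmap c' ` (patch c' d' F \<inter> - X)"
      have oO2: "open O2" unfolding O2_def
        by (rule open_cmap_image[OF C' _ open_Int[OF open_local_dom(1)[OF ch' F] oX]]) auto
      have y0: "y0 \<in> O2" unfolding O2_def using l q0X \<Phi>X[OF q0X, of t0] by (intro image_eqI[of _ _ q0]) (auto simp: q0_def)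
      have O2l: "O2 \<subseteq> local_dom c' d' F" by (auto simp: O2_def local_dom_def)
      have oT: "open (I \<times> O2)" by (rule open_Times[OF oI oO2])
      have "smooth_on (I \<times> O2) (\<lambda>p. local_rep c' d' F (snd p))"
        by (rule smooth_on_compose[OF smooth_gram(5)[OF im ch'] smooth_on_bounded_linear[OF bounded_linear_snd oT] oT]) (use O2l in auto)
      then have "smooth_on (I \<times> O2) (\<lambda>(t, y). local_rep c' d' (\<Phi> t) y)"
      proof (rule smooth_on_cong[OF _ oT])
        fix p assume "p \<in> I \<times> O2"
        then obtain t q where q: "p = (t, cmap c' q)" "q \<in> cdom c'" "q \<notin> X" by (auto simp: O2_def)
        show "local_rep c' d' F (snd p) = (case p of (t, y) \<Rightarrow> local_rep c' d' (\<Phi> t) y)"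
          using local_rep_cmap[OF ch'(1) q(2), of d' F] local_rep_cmap[OF ch'(1) q(2), of d' "\<Phi> t"] \<Phi>X[OF q(3), of t] q(1) by simp
      qed
      then show ?thesis using oT y0 p by blast
    qed
  qed
  have rep_c: "local_rep c d (\<Phi> t) y = ft t y" if "t \<in> I" "y \<in> U" for t y
  proof -
    obtain q where q: "q \<in> W" "y = cmap c q" using \<open>y \<in> U\<close> by (auto simp: U_def W_def local_dom_def)
    then show ?thesis
      using local_rep_cmap[OF ch(1), of q d "\<Phi> t"] \<Phi>W(2)[of t q] that(1) by (simp add: W_def I)
  qed
  have Dft: "((\<lambda>y. local_rep c d (\<Phi> t) y) has_derivative (\<lambda>a. v.varied_d a \<phi> V (t, y))) (at y)" if t: "t \<in> I" and y: "y \<in> U" for t y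
  proof -
    have df: "(f has_derivative D f y) (at y)"
      using smooth_on_has_derivative[OF smooth_gram(5)[OF im ch]] y unfolding f_def U_def by blast
    have d\<phi>: "(\<phi> has_derivative D \<phi> y) (at y)" by (rule smooth_on_has_derivative[OF \<phi>]) simp
    have "((\<lambda>y. f y + (t * \<phi> y) *\<^sub>R V) has_derivative (\<lambda>a. D f y a + (t * D \<phi> y a) *\<^sub>R V)) (at y)"
      by (intro has_derivative_add df has_derivative_scaleR_left has_derivative_mult_right d\<phi>)
    then have "((\<lambda>y. f y + (t * \<phi> y) *\<^sub>R V) has_derivative (\<lambda>a. v.varied_d a \<phi> V (t, y))) (at y)"
      by (simp add: v.varied_d_def f_def)
    then show ?thesis
      by (rule has_derivative_transform_within_open[OF _ oU y]) (simp add: rep_c[OF t] ft)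
  qed
  have DftE: "D (local_rep c d (\<Phi> t)) y a = v.varied_d a \<phi> V (t, y)" if "t \<in> I" "y \<in> U" for t y a
    by (rule D_eqI[OF Dft[OF that]])
  have kpos: "h d (local_rep c d (\<Phi> t) y) (J (D (local_rep c d (\<Phi> t)) y ax1)) (D (local_rep c d (\<Phi> t)) y ax2) > 0"
    "local_rep c d (\<Phi> t) y \<in> cmap d ` cdom d" if t: "t \<in> I" and y: "y \<in> U" for t y
    using dom[of t y] t y ftT[of t y] unfolding DftE[OF t y] rep_c[OF t y] by (simp_all add: I v.admissible_def ft_def)
  have inj_c: "inj (D (local_rep c d (\<Phi> t)) y)" if t: "t \<in> I" and y: "y \<in> U" for t y
  proof (rule inj_if_kahler_nonzero)
    note hc = hermitian_chart[OF ch(2)]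
    show "inner_product (h d (local_rep c d (\<Phi> t) y))" by (rule metric_onD(2)[OF hermitian_onD(1)[OF hc] kpos(2)[OF t y]])
    show "h d (local_rep c d (\<Phi> t) y) (J u) (J w) = h d (local_rep c d (\<Phi> t) y) u w" for u w by (rule hermitian_onD(2)[OF hc kpos(2)[OF t y]])
    show "linear (D (local_rep c d (\<Phi> t)) y)" using Dft[OF t y] by (intro linear_D) (auto simp: differentiable_def)
    show "h d (local_rep c d (\<Phi> t) y) (J (D (local_rep c d (\<Phi> t)) y ax1)) (D (local_rep c d (\<Phi> t)) y ax2) \<noteq> 0"
      using kpos(1)[OF t y] by simp
  qed
  \<comment> \<open>immersion: in the patch because the Kaehler form does not vanish, off \<open>X\<close> because \<open>F\<close> is one\<close>
  have imt: "immersion B A (\<Phi> t)" if t: "t \<in> I" for t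
    unfolding immersion_def
  proof (intro conjI ballI)
    show "continuous_on UNIV (\<Phi> t)" by (rule cont_t[OF t])
    fix c' d' assume ch': "c' \<in> B" "d' \<in> A"
    have o': "open (local_dom c' d' (\<Phi> t))" by (rule open_local_dom(2)[OF ch' cont_t[OF t]])
    have "smooth_on (local_dom c' d' (\<Phi> t)) (\<lambda>y. (\<lambda>(t, y). local_rep c' d' (\<Phi> t) y) (t, y))"
      by (rule smooth_on_compose[OF joint[OF ch'] smooth_on_Pair[OF smooth_on_const smooth_on_ident o'] o']) (use t in auto)
    then show "smooth_on (local_dom c' d' (\<Phi> t)) (local_rep c' d' (\<Phi> t))" by simp
    fix y assume y: "y \<in> local_dom c' d' (\<Phi> t)"
    note l = local_domD[OF ch' y]
    define q where "q = cinv c' y"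
    have q: "q \<in> cdom c'" "\<Phi> t q \<in> cdom d'" "cmap c' q = y" using l by (simp_all add: q_def)
    show "inj (D (local_rep c' d' (\<Phi> t)) y)"
    proof (cases "q \<in> W")
      case True
      have t': "\<bar>t\<bar> < \<epsilon>" using t by (simp add: I)
      have qc: "q \<in> cdom c" using True by (simp add: W_def)
      have ld: "local_rep c d (\<Phi> t) differentiable at (cmap c q)"
        using Dft[OF t WU[OF True]] by (auto simp: differentiable_def)
      have "D (local_rep c' d' (\<Phi> t)) (cmap c' q) a = D (transition d d') (cmap d (\<Phi> t q)) (D (local_rep c d (\<Phi> t)) (cmap c q) (D (transition c' c) (cmap c' q) a))" for a
        by (rule D_eqI[OF local_rep_derivative[OF ch(1) ch'(1) ch(2) ch'(2) cont_t[OF t] qc q(1) \<Phi>W(1)[OF t' True] q(2) ld]])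
      then have e: "D (local_rep c' d' (\<Phi> t)) y = D (transition d d') (cmap d (\<Phi> t q)) \<circ> (D (local_rep c d (\<Phi> t)) (cmap c q) \<circ> D (transition c' c) y)"
        unfolding q(3) by (auto simp: o_def)
      have "y \<in> overlap c' c" "cmap d (\<Phi> t q) \<in> overlap d d'"
        using q qc \<Phi>W(1)[OF t' True] by (auto simp: overlap_def)
      then show ?thesis
        unfolding e by (intro inj_compose transition_inj inj_c[OF t WU[OF True]] ch ch')
    next
      case False
      then have qX: "q \<in> - X" using XW by blast
      have "D (local_rep c' d' (\<Phi> t)) (cmap c' q) = D (local_rep c' d' F) (cmap c' q)"
        by (rule rep_agree(2)[OF ch' oX _ q(1) qX]) (simp add: \<Phi>X)
      moreover have "y \<in> local_dom c' d' F" using local_domI[where F=F, OF q(1), of d'] q \<Phi>X[of q t] qX by simp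
      then have "inj (D (local_rep c' d' F) y)" by (rule immersion_rep(2)[OF im ch'])
      ultimately show ?thesis using q(3) by simp
    qed
  qed
  have syt: "symplectic_surface A h B (\<Phi> t)" if t: "t \<in> I" for t
    unfolding symplectic_surface_def
  proof (intro conjI allI)
    show "immersion B A (\<Phi> t)" by (rule imt[OF t])
    fix q
    show "cos (kahler_angle A h B (\<Phi> t) q) > 0"
    proof (cases "q \<in> W")
      case True
      have t': "\<bar>t\<bar> < \<epsilon>" using t by (simp add: I)
      have qc: "q \<in> cdom c" using True by (simp add: W_def)
      have "cmap c q \<in> local_dom c d (\<Phi> t)" by (rule local_domI[where F="\<Phi> t", OF qc \<Phi>W(1)[OF t' True]])
      from area_density_pos[OF imt[OF t] ch this] show ?thesis
        unfolding cos_kahler_angle[OF imt[OF t] ch qc \<Phi>W(1)[OF t' True]] kahler_form_def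
        by (rule divide_pos_pos[OF kpos(1)[OF t WU[OF True]]])
    next
      case False
      then have qX: "q \<in> - X" using XW by blast
      obtain c' d' where cd: "c' \<in> B" "q \<in> cdom c'" "d' \<in> A" "F q \<in> cdom d'" using coverA coverB by metis
      have \<Phi>q: "\<Phi> t q \<in> cdom d'" using \<Phi>X[of q t] qX cd by simp
      have r1: "local_rep c' d' (\<Phi> t) (cmap c' q) = local_rep c' d' F (cmap c' q)"
        by (rule rep_agree(1)[OF cd(1,3) oX _ cd(2) qX]) (simp add: \<Phi>X)
      have r2: "D (local_rep c' d' (\<Phi> t)) (cmap c' q) = D (local_rep c' d' F) (cmap c' q)"
        by (rule rep_agree(2)[OF cd(1,3) oX _ cd(2) qX]) (simp add: \<Phi>X)
      have "cos (kahler_angle A h B (\<Phi> t) q) = cos (kahler_angle A h B F q)"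
        unfolding cos_kahler_angle[OF im cd(1,3,2,4)] cos_kahler_angle[OF imt[OF t] cd(1,3,2) \<Phi>q] area_density_gram r1 r2 ..
      then show ?thesis using Fpos by simp
    qed
  qed
  have sv: "symplectic_variation A h B F \<epsilon> \<Phi>"
    unfolding symplectic_variation_def I_def[symmetric]
    using \<epsilon>(1) \<Phi>0 syt cont joint by blast
  have dL: "((\<lambda>t. L_functional \<beta> A h B (\<Phi> t)) has_real_derivative 0) (at 0)"
    using crit sv unfolding symplectic_critical_surface_def by blast
  \<comment> \<open>the contribution from outside \<open>X\<close> to the functional\<close>
  define R where "R = (\<integral>p. indicator (- (cinv c ` K)) p *\<^sub>R rho \<beta> F p \<partial>(area_measure A h B F))"
  let ?L = "\<lambda>t x. lagrangian \<beta> (h d) (v.varied \<phi> V (t, x)) (v.varied_d ax1 \<phi> V (t, x)) (v.varied_d ax2 \<phi> V (t, x))"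
  have split: "L_functional \<beta> A h B (\<Phi> t) = R + integral K (?L t)" if t: "t \<in> I" for t
  proof -
    have KU': "K \<subseteq> local_dom c d (\<Phi> t)"
    proof
      fix y assume "y \<in> K"
      then obtain q where q: "q \<in> W" "y = cmap c q" using KU by (auto simp: U_def W_def local_dom_def)
      have "\<Phi> t q \<in> cdom d" using \<Phi>W(1)[OF _ q(1), of t] t by (simp add: I)
      then show "y \<in> local_dom c d (\<Phi> t)" unfolding q(2) using q(1) by (intro local_domI[where F="\<Phi> t"]) (simp_all add: W_def)
    qed
    have "L_functional \<beta> A h B (\<Phi> t) = R + integral K (\<lambda>x. lagrangian \<beta> (h d) (local_rep c d (\<Phi> t) x) (D (local_rep c d (\<Phi> t)) x ax1) (D (local_rep c d (\<Phi> t)) x ax2))"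
      unfolding R_def by (rule L_functional_split[OF sy syt[OF t] ch cK(1) KU']) (rule \<Phi>X[unfolded X_def])
    also have "integral K (\<lambda>x. lagrangian \<beta> (h d) (local_rep c d (\<Phi> t) x) (D (local_rep c d (\<Phi> t)) x ax1) (D (local_rep c d (\<Phi> t)) x ax2)) = integral K (?L t)"
    proof (rule integral_cong)
      fix x assume "x \<in> K"
      then have x: "x \<in> U" using KU by auto
      show "lagrangian \<beta> (h d) (local_rep c d (\<Phi> t) x) (D (local_rep c d (\<Phi> t)) x ax1) (D (local_rep c d (\<Phi> t)) x ax2) = ?L t x"
        unfolding rep_c[OF t x] DftE[OF t x] ft_def ..
    qed
    finally show ?thesis .
  qed
  have "((\<lambda>t. L_functional \<beta> A h B (\<Phi> t) - R) has_real_derivative 0 - 0) (at 0)"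
    by (rule DERIV_diff[OF dL DERIV_const])
  then have "((\<lambda>t. integral K (?L t)) has_real_derivative 0 - 0) (at 0)"
    by (rule has_field_derivative_transform_within_open[OF _ oI]) (use \<epsilon>(1) split in \<open>simp_all add: I\<close>)
  then show ?thesis by (simp add: K_def)
qed

end

section \<open>The Laplacian of the cosine of the Kaehler angle\<close>

lemma laplacian_cong:
  assumes "open U" "x \<in> U" "\<And>y. y \<in> U \<Longrightarrow> p y = q y"
  shows "laplacian g p x = laplacian g q x"
proof -
  have D: "D p y = D q y" if "y \<in> U" for y by (rule D_cong_open[OF assms(1) that assms(3)])
  have "D (\<lambda>y. D p y b) x = D (\<lambda>y. D q y b) x" for b
    by (rule D_cong_open[OF assms(1,2)]) (simp add: D)
  then show ?thesis by (simp add: laplacian_def hessian_def D[OF assms(2)])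
qed

lemma grad_norm_orthonormal:
  fixes g :: "(real^2) metric"
  assumes b: "inner_product (g x)" and o: "g x a1 a1 = 1" "g x a1 a2 = 0" "g x a2 a2 = 1" and L: "linear (D p x)"
  shows "g x (grad g p x) (grad g p x) = (D p x a1)\<^sup>2 + (D p x a2)\<^sup>2"
proof -
  let ?z = "grad g p x"
  have z: "g x ?z w = D p x w" for w unfolding grad_def by (rule sharp_works[OF b L])
  have "g x ?z ?z = g x ?z (g x ?z a1 *\<^sub>R a1 + g x ?z a2 *\<^sub>R a2)"
    by (rule arg_cong[OF orthonormal_plane[OF b o]])
  also have "\<dots> = g x ?z a1 * g x ?z a1 + g x ?z a2 * g x ?z a2" by (simp only: ip_lin[OF b])
  finally show ?thesis by (simp only: z power2_eq_square)
qed

text \<open>Iterated covariant derivatives of \<open>J\<close> along the surface vanish together with the first ones.\<close>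

lemma cov_end_along_eq_0:
  assumes m: "metric_on S G" and fx: "f x \<in> S" and U: "open U" "x \<in> U" and T: "\<And>y v. y \<in> U \<Longrightarrow> T y v = 0"
  shows "cov_end_along G f T x a v = 0"
proof -
  have "D (\<lambda>y. T y v) x = D (\<lambda>_. 0) x" by (rule D_cong_open[OF U]) (simp add: T)
  then have "D (\<lambda>y. T y v) x a = 0" by (simp only: D_const)
  then show ?thesis
    by (simp only: cov_end_along_def T[OF U(2)] bilinear_rzero[OF christoffel_bilinear[OF m fx]] add_0_left diff_self)
qed

text \<open>The Laplacian is computed in the directions \<open>a 1\<close>, \<open>a 2\<close> of the frame, while the Euler-Lagrange equation is known in the directions
  of the coordinate axes. The function \<open>u\<close> is the same for both pairs of directions, as they have the same orientation.\<close>

lemma (in variational_surface) laplacian_in_adapted_frame: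
  fixes e :: "nat \<Rightarrow> complex^2" and a :: "nat \<Rightarrow> real^2"
  assumes x: "x \<in> U" and inj: "\<And>y. y \<in> U \<Longrightarrow> inj (D f y)" and EL: "\<And>y V. y \<in> U \<Longrightarrow> el_density V y = 0"
    and fr: "adapted_frame G f \<alpha> x a e" and s: "sin \<alpha> \<noteq> 0" and Q: "(cos \<alpha>)\<^sup>2 + \<beta> * (sin \<alpha>)\<^sup>2 \<noteq> 0"
  shows "laplacian (induced_metric G f) u x =
    2 * \<beta> * (sin \<alpha>)\<^sup>2 / (cos \<alpha> * ((cos \<alpha>)\<^sup>2 + \<beta> * (sin \<alpha>)\<^sup>2)) * (((D u x (a 1))\<^sup>2 + (D u x (a 2))\<^sup>2) / (sin \<alpha>)\<^sup>2)
    - 2 * cos \<alpha> * (((D u x (a 1))\<^sup>2 + (D u x (a 2))\<^sup>2) / (sin \<alpha>)\<^sup>2)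
    - sin \<alpha> * (cos \<alpha>)\<^sup>2 / ((cos \<alpha>)\<^sup>2 + \<beta> * (sin \<alpha>)\<^sup>2)
      * (G (f x) (curvature G (f x) (e 1) (e 2) (e 3)) (e 1) - G (f x) (curvature G (f x) (e 1) (e 2) (e 4)) (e 2))"
proof -
  \<comment> \<open>keeps the index \<open>1\<close> of a frame from being rewritten to a successor\<close>
  note [simp del] = One_nat_def
  let ?a = "a 1" and ?c = "a 2"
  have e12: "e 1 = D f x ?a" "e 2 = D f x ?c" and det: "?a $ 1 * ?c $ 2 - ?a $ 2 * ?c $ 1 > 0"
    and on: "\<And>i j. i \<in> {1..4} \<Longrightarrow> j \<in> {1..4} \<Longrightarrow> G (f x) (e i) (e j) = (if i = j then 1 else 0)"
    and Je: "J (e 1) = cos \<alpha> *\<^sub>R e 2 + sin \<alpha> *\<^sub>R e 3" "J (e 2) = - cos \<alpha> *\<^sub>R e 1 - sin \<alpha> *\<^sub>R e 4"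
      "J (e 3) = - sin \<alpha> *\<^sub>R e 1 + cos \<alpha> *\<^sub>R e 4" "J (e 4) = sin \<alpha> *\<^sub>R e 2 - cos \<alpha> *\<^sub>R e 3"
    using fr unfolding adapted_frame_def by blast+
  have Lf: "linear (D f y)" if "y \<in> U" for y using linear_D smooth_on_imp_differentiable[OF smooth_f that] by blast
  have gram: "G (f y) (D f y ?a) (D f y ?a) * G (f y) (D f y ?c) (D f y ?c) - (G (f y) (D f y ?a) (D f y ?c))\<^sup>2
      = (?a $ 1 * ?c $ 2 - ?a $ 2 * ?c $ 1)\<^sup>2 * gdet y" if y: "y \<in> U" for y
  proof -
    have b: "inner_product (induced_metric G f y)"
      by (rule induced_inner_product[where G=G and f=f, OF ip[OF y] smooth_on_imp_differentiable[OF smooth_f y] inj[OF y]])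
    show ?thesis
      using gram_det[OF inner_productD(1)[OF b] inner_productD(2)[OF b], of ?a ?c]
      unfolding induced_metric_def gdet_def g11_def g12_def g22_def by (simp only: power2_eq_square)
  qed
  interpret p: parallel_surface S G U f ?a ?c
  proof
    show "G (f y) (D f y ?a) (D f y ?a) * G (f y) (D f y ?c) (D f y ?c) - (G (f y) (D f y ?a) (D f y ?c))\<^sup>2 > 0" if y: "y \<in> U" for y
      unfolding gram[OF y] using det gdet_pos[OF y] by simp
  qed (fact herm open_U smooth_f f_in parallel)+
  have pu: "p.u y = u y" if y: "y \<in> U" for y
  proof -
    have "p.gdet y = (?a $ 1 * ?c $ 2 - ?a $ 2 * ?c $ 1)\<^sup>2 * gdet y"
      using gram[OF y] unfolding p.gdet_def p.g11_def p.g12_def p.g22_def by (simp only: power2_eq_square)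
    then have "sqrt (p.gdet y) = (?a $ 1 * ?c $ 2 - ?a $ 2 * ?c $ 1) * sqrt (gdet y)"
      using det by (simp add: real_sqrt_mult)
    then show ?thesis
      unfolding p.u_eq[OF y] u_eq[OF y] kahler_form_alternating[OF ip[OF y] hj[OF y] Lf[OF y], of ?a ?c] using det by simp
  qed
  have Du: "D p.u y = D u y" if "y \<in> U" for y by (rule D_cong_open[OF open_U that pu])
  have pEL: "(p.g22 y * G (f y) V (p.N1 p.X1 y) - 2 * p.g12 y * G (f y) V (p.N1 p.X2 y) + p.g11 y * G (f y) V (p.N2 p.X2 y)) / sqrt (p.gdet y)
      + \<beta> / (p.u y)\<^sup>2 * (D p.u y ?a * G (f y) (J V) (p.X2 y) + D p.u y ?c * G (f y) (J (p.X1 y)) V) = 0"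
    if y: "y \<in> U" and n: "G (f y) V (p.X1 y) = 0" "G (f y) V (p.X2 y) = 0" for y V
  proof -
    have lin: "linear (\<lambda>b. G (f y) V (D f y b))"
      by (intro linearI) (simp_all add: linear_add[OF Lf[OF y]] linear_scale[OF Lf[OF y]] ip_lin[OF ip[OF y]])
    have v: "?a $ 1 * G (f y) V (X1 y) + ?a $ 2 * G (f y) V (X2 y) = 0" "?c $ 1 * G (f y) V (X1 y) + ?c $ 2 * G (f y) V (X2 y) = 0"
    proof -
      have e: "G (f y) V (D f y b) = b $ 1 * G (f y) V (X1 y) + b $ 2 * G (f y) V (X2 y)" for b
      proof -
        have "G (f y) V (D f y b) = G (f y) V (D f y (b $ 1 *\<^sub>R ax1 + b $ 2 *\<^sub>R ax2))"
          by (rule arg_cong[OF real2_expansion])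
        also have "\<dots> = b $ 1 * G (f y) V (X1 y) + b $ 2 * G (f y) V (X2 y)"
          unfolding linear_add[OF lin] linear_scale[OF lin] real_scaleR_def ..
        finally show ?thesis .
      qed
      show "?a $ 1 * G (f y) V (X1 y) + ?a $ 2 * G (f y) V (X2 y) = 0" "?c $ 1 * G (f y) V (X1 y) + ?c $ 2 * G (f y) V (X2 y) = 0"
        unfolding e[of ?a, symmetric] e[of ?c, symmetric] by (rule n)+
    qed
    \<comment> \<open>normality to \<open>a 1\<close> and \<open>a 2\<close> is normality to the axes, by Cramer's rule\<close>
    have cramer: "k * r + l * t = 0 \<Longrightarrow> m * r + o' * t = 0 \<Longrightarrow> k * o' - l * m > 0 \<Longrightarrow> r = 0 \<and> t = 0" for k l m o' r t :: real
    proof -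
      assume h: "k * r + l * t = 0" "m * r + o' * t = 0" "k * o' - l * m > 0"
      have "(k * o' - l * m) * r = o' * (k * r + l * t) - l * (m * r + o' * t)"
        "(k * o' - l * m) * t = k * (m * r + o' * t) - m * (k * r + l * t)" by (simp_all add: algebra_simps)
      then have "(k * o' - l * m) * r = 0" "(k * o' - l * m) * t = 0" unfolding h(1,2) by simp_all
      then show "r = 0 \<and> t = 0" using h(3) by simp
    qed
    from cramer[OF v det] have n': "G (f y) V (X1 y) = 0" "G (f y) V (X2 y) = 0" by auto
    show ?thesis
      using euler_lagrange_basis[OF y det euler_lagrange_normal[OF y EL[OF y] n']]
      unfolding pu[OF y] Du[OF y] p.gdet_def p.g11_def p.g12_def p.g22_def by (simp only: power2_eq_square)
  qed
  have upos: "p.u y > 0" if "y \<in> U" for y using u_pos[OF that] pu[OF that] by simp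
  have "laplacian (induced_metric G f) u x = laplacian (induced_metric G f) p.u x"
    by (rule laplacian_cong[OF open_U x]) (rule pu[symmetric])
  also note p.laplacian_formula[OF x inj upos pEL on e12 Je s sin_cos_squared_add2 Q]
  finally show ?thesis unfolding Du[OF x] .
qed

context surface_setting
begin

text \<open>The two conditions on \<open>J\<close> provide the assumptions of the local theory, and \<open>u\<close> is the cosine of the Kaehler angle.\<close>

lemma variational_patch:
  assumes sy: "symplectic_surface A h B F" and ch: "c \<in> B" "d \<in> A"
    and cyc: "J_condition_cyclic A h B F" and sym: "J_condition_symmetric A h B F"
  shows "variational_surface (cmap d ` cdom d) (h d) (local_dom c d F) (local_rep c d F)"
    "y \<in> local_dom c d F \<Longrightarrow> cos (kahler_angle A h B F (cinv c y)) = parallel_surface.u (h d) (local_rep c d F) ax1 ax2 y"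
proof -
  define f U where "f = local_rep c d F" and "U = local_dom c d F"
  have im: "immersion B A F" and Fpos: "\<And>p. cos (kahler_angle A h B F p) > 0" using sy by (auto simp: symplectic_surface_def)
  note herm = hermitian_chart[OF ch(2)]
  have f: "smooth_on U f" "open U" and F: "continuous_on UNIV F"
  proof -
    show F: "continuous_on UNIV F" using im by (simp add: immersion_def)
    show "open U" unfolding U_def by (rule open_local_dom(2)[OF ch F])
    show "smooth_on U f" unfolding f_def U_def by (rule smooth_gram(5)[OF im ch])
  qed
  have fS: "f y \<in> cmap d ` cdom d" and inj: "inj (D f y)" and df: "f differentiable (at y)" if "y \<in> U" for y
    using local_domD(4)[OF ch] immersion_rep(2,3)[OF im ch] that unfolding f_def U_def by blast+
  have ang: "cos (kahler_angle A h B F (cinv c y)) = h d (f y) (J (D f y ax1)) (D f y ax2) / area_density (induced_metric (h d) f) y"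
    if y: "y \<in> U" for y
  proof -
    note l = local_domD[OF ch y[unfolded U_def]]
    show ?thesis using cos_kahler_angle[OF im ch l(1,2)] unfolding l(3) kahler_form_def f_def .
  qed
  have ad: "area_density (induced_metric (h d) f) y > 0" if "y \<in> U" for y
    using area_density_pos[OF im ch] that unfolding f_def U_def by blast
  have kp: "h d (f y) (J (D f y ax1)) (D f y ax2) > 0" if y: "y \<in> U" for y
    using Fpos[of "cinv c y"] ad[OF y] unfolding ang[OF y] by (simp add: zero_less_divide_iff)
  have par: "nabla_J (h d) (f y) (D f y a) v = 0" if y: "y \<in> U" for y a v
  proof (rule nabla_J_tangent_eq_0[where f=f and y=y, OF herm fS[OF y] df[OF y]])
    show "h d (f y) (J (D f y ax1)) (D f y ax2) \<noteq> 0" using kp[OF y] by simp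
    show "normal_part (h d) f y (nabla_J (h d) (f y) (D f y a) (D f y b) + nabla_J (h d) (f y) (D f y b) (D f y a)) = 0" for a b
      using sym ch y unfolding J_condition_symmetric_def Let_def f_def U_def by blast
  qed
  have area: "h d (f y) (nabla_J (h d) (f y) V (D f y ax1)) (D f y ax2) = 0" if y: "y \<in> U" for y V
  proof (rule nabla_J_area_component_eq_0[where f=f and y=y, OF herm fS[OF y] df[OF y] inj[OF y]])
    show "nabla_J (h d) (f y) (D f y a) v = 0" for a v by (rule par[OF y])
    show "h d (f y) (nabla_J (h d) (f y) \<xi> (D f y a)) (D f y b) + h d (f y) (nabla_J (h d) (f y) (D f y a) (D f y b)) \<xi>
      + h d (f y) (nabla_J (h d) (f y) (D f y b) \<xi>) (D f y a) = 0" if "is_normal (h d) f y \<xi>" for a b \<xi>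
      using cyc ch y that unfolding J_condition_cyclic_def Let_def f_def U_def by blast
  qed
  have vs: "variational_surface (cmap d ` cdom d) (h d) U f"
  proof
    show "h d (f y) (D f y ax1) (D f y ax1) * h d (f y) (D f y ax2) (D f y ax2) - (h d (f y) (D f y ax1) (D f y ax2))\<^sup>2 > 0" if "y \<in> U" for y
      by (rule gram_pos[OF metric_onD(2)[OF hermitian_onD(1)[OF herm] fS[OF that]] linear_D[OF df[OF that]] inj[OF that]])
  qed (fact herm f fS par area kp)+
  then show "variational_surface (cmap d ` cdom d) (h d) (local_dom c d F) (local_rep c d F)" by (simp only: f_def U_def)
  interpret v: variational_surface "cmap d ` cdom d" "h d" U f by (rule vs)
  show "cos (kahler_angle A h B F (cinv c y)) = parallel_surface.u (h d) (local_rep c d F) ax1 ax2 y" if "y \<in> local_dom c d F"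
  proof -
    have y: "y \<in> U" using that by (simp only: U_def)
    show ?thesis
      unfolding ang[OF y] v.u_eq[OF y, unfolded f_def, folded f_def] area_density_gram f_def[symmetric]
        v.u_eq[OF y] v.gdet_def v.g11_def v.g12_def v.g22_def
      by (simp only: power2_eq_square)
  qed
qed

end

theorem theorem1p2:
  fixes A :: "('m::{t2_space,second_countable_topology}, complex^2) chart set"
    and h :: "('m, complex^2) chart \<Rightarrow> (complex^2) metric"
    and B :: "('s::{t2_space,second_countable_topology}, real^2) chart set"
    and F :: "'s \<Rightarrow> 'm" and \<beta> :: real
    and p :: 's and c :: "('s, real^2) chart" and d :: "('m, complex^2) chart"
    and a :: "nat \<Rightarrow> real^2" and e :: "nat \<Rightarrow> complex^2"
    and E :: "nat \<Rightarrow> real^2 \<Rightarrow> real^2" and N :: "(real^2) set"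
  defines "\<alpha> \<equiv> kahler_angle A h B F"
    and "f \<equiv> local_rep c d F"
    and "x \<equiv> cmap c p"
    and "G \<equiv> h d"
  defines "g \<equiv> induced_metric G f"
    and "cos\<alpha> \<equiv> (\<lambda>y. cos (\<alpha> (cinv c y)))"
  defines "dcos\<alpha> \<equiv> (\<lambda>i. D cos\<alpha> x (a i))"
    and "J' \<equiv> (\<lambda>i j k. G (f x) (nabla_J G (f x) (e k) (e i)) (e j))"
    and "J12kk \<equiv> (\<Sum>k\<in>{1,2}. G (f x)
           (cov_end_along G f (\<lambda>y. nabla_J G (f y) (D f y (E k y))) x (a k) (e 1)) (e 2))"
    and "K \<equiv> (\<lambda>i j k l. G (f x) (curvature G (f x) (e i) (e j) (e l)) (e k))"
    and "C \<equiv> cos (\<alpha> p)"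
    and "S \<equiv> sin (\<alpha> p)"
  defines "grad\<alpha>2 \<equiv> g x (grad g cos\<alpha> x) (grad g cos\<alpha> x) / S\<^sup>2"
    and "Q \<equiv> C\<^sup>2 + \<beta> * S\<^sup>2"
  defines "\<Theta> \<equiv> 2 * C / S\<^sup>2 * (1 + C\<^sup>2 / Q) * (dcos\<alpha> 1 * J' 1 2 1 + dcos\<alpha> 2 * J' 1 2 2)
        + C\<^sup>2 / Q * J12kk
        - 2 * C ^ 3 / (S\<^sup>2 * Q) * ((J' 1 2 1)\<^sup>2 + (J' 1 2 2)\<^sup>2)"
  assumes hermite: "hermite_surface A h"
    and "\<beta> \<noteq> -1"
    and critical: "symplectic_critical_surface \<beta> A h B F"
    and cyclic: "J_condition_cyclic A h B F"
    and symmetric: "J_condition_symmetric A h B F"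
    and charts: "c \<in> B" "p \<in> cdom c" "d \<in> A" "F p \<in> cdom d"
    and "S \<noteq> 0" "Q \<noteq> 0"
    and frame: "adapted_frame G f (\<alpha> p) x a e"
    and extension: "normal_extension g N x a E"
  shows "laplacian g cos\<alpha> x =
      2 * \<beta> * S\<^sup>2 / (C * Q) * grad\<alpha>2 - 2 * C * grad\<alpha>2
      - S * C\<^sup>2 / Q * (K 1 2 1 3 - K 1 2 2 4) + \<Theta>
      - \<beta> * S / Q * (dcos\<alpha> 1 * J' 1 4 2 + 3 * dcos\<alpha> 2 * J' 1 3 2)"
proof -
  \<comment> \<open>keeps the index \<open>1\<close> of a frame from being rewritten to a successor\<close>
  note [simp del] = One_nat_def
  interpret surface_setting A h B
    using hermite critical by unfold_locales (simp_all add: symplectic_critical_surface_def)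
  define U where "U = local_dom c d F"
  have sy: "symplectic_surface A h B F" using critical by (simp add: symplectic_critical_surface_def)
  have im: "immersion B A F" using sy by (simp add: symplectic_surface_def)
  note ch = charts(1,3)
  have vs: "variational_surface (cmap d ` cdom d) G U f" unfolding G_def U_def f_def
    by (rule variational_patch(1)[OF sy ch cyclic symmetric])
  interpret v: variational_surface "cmap d ` cdom d" G U f \<beta> by (rule vs)
  have cosu: "cos\<alpha> y = v.u y" if "y \<in> U" for y
    using variational_patch(2)[OF sy ch cyclic symmetric, of y] that unfolding cos\<alpha>_def \<alpha>_def U_def G_def f_def by simp
  have xU: "x \<in> U" unfolding x_def U_def by (rule local_domI[where F=F, OF charts(2,4)])
  have inj: "inj (D f y)" if "y \<in> U" for y
    using immersion_rep(2)[OF im ch] that unfolding f_def U_def by blast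
  have EL: "v.el_density V y = 0" if y: "y \<in> U" for y V
  proof (rule v.euler_lagrange[OF \<open>\<beta> \<noteq> -1\<close> y])
    fix \<phi> :: "real^2 \<Rightarrow> real" and r :: real
    assume r: "r > 0" "cube y r \<subseteq> U" "smooth_on UNIV \<phi>" "\<And>x. x \<notin> ball y r \<Longrightarrow> \<phi> x = 0"
    show "((\<lambda>t. integral (cube y r) (\<lambda>x. lagrangian \<beta> G (v.varied \<phi> V (t, x)) (v.varied_d ax1 \<phi> V (t, x)) (v.varied_d ax2 \<phi> V (t, x)))) has_real_derivative 0) (at 0)"
      unfolding G_def f_def
      by (rule critical_local_variation[OF critical ch vs[unfolded G_def U_def f_def] r(1) r(2)[unfolded U_def] r(3,4)])
  qed
  have fx: "f x \<in> cmap d ` cdom d" by (rule v.f_in[OF xU])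
  have Dcos: "D cos\<alpha> x = D v.u x" by (rule D_cong_open[OF v.open_U xU cosu])
  have lap: "laplacian g cos\<alpha> x = laplacian g v.u x" by (rule laplacian_cong[OF v.open_U xU cosu])
  have e12: "e k = D f x (a k)" if "k \<in> {1, 2}" for k using frame that unfolding adapted_frame_def by blast
  have on: "G (f x) (e i) (e j) = (if i = j then 1 else 0)" if "i \<in> {1..4}" "j \<in> {1..4}" for i j
    using frame that unfolding adapted_frame_def by blast
  have gx: "g x (a 1) (a 1) = 1" "g x (a 1) (a 2) = 0" "g x (a 2) (a 2) = 1"
    using on[of 1 1] on[of 1 2] on[of 2 2] e12[of 1] e12[of 2] unfolding g_def induced_metric_def by simp_all
  have ipg: "inner_product (g x)"
    unfolding g_def by (rule induced_inner_product[where G=G and f=f, OF v.ip[OF xU] smooth_on_imp_differentiable[OF v.smooth_f xU] inj[OF xU]])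
  have "linear (D cos\<alpha> x)" unfolding Dcos by (rule linear_D[OF smooth_on_imp_differentiable[OF v.smooth_u xU]])
  from grad_norm_orthonormal[where g=g and x=x and p=cos\<alpha>, OF ipg gx this]
  have gr: "grad\<alpha>2 = ((D v.u x (a 1))\<^sup>2 + (D v.u x (a 2))\<^sup>2) / S\<^sup>2" unfolding grad\<alpha>2_def Dcos by simp
  \<comment> \<open>the components of \<open>\<nabla>J\<close> in tangent directions are zero, and so is \<open>\<Theta>\<close>\<close>
  have J'0: "J' i j k = 0" if "k \<in> {1, 2}" for i j k
    unfolding J'_def e12[OF that] v.parallel[OF xU] by (rule ip_lin(5)[OF v.ip[OF xU]])
  have "cov_end_along G f (\<lambda>y. nabla_J G (f y) (D f y (E k y))) x (a k) (e 1) = 0" for k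
    by (rule cov_end_along_eq_0[where f=f and x=x, OF v.metric fx v.open_U xU]) (rule v.parallel)
  then have J12: "J12kk = 0" unfolding J12kk_def by (simp add: ip_lin(5)[OF v.ip[OF xU]])
  have "\<Theta> = 0" unfolding \<Theta>_def J12 by (simp add: J'0)
  moreover have "J' 1 4 2 = 0" "J' 1 3 2 = 0" by (simp_all add: J'0)
  moreover note v.laplacian_in_adapted_frame[OF xU inj EL frame \<open>S \<noteq> 0\<close>[unfolded S_def] \<open>Q \<noteq> 0\<close>[unfolded Q_def C_def S_def],
      folded g_def C_def S_def, folded Q_def, folded gr]
  ultimately show ?thesis unfolding lap K_def by simp
qed

end
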